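(* Let $\mathcal{B}$ be a rigid braided category, let $H\in\mathcal{B}$ be a Hopf algebra (with invertible antipode), and let $\mathcal{C}=H_{\mathcal{B}}\text{-mod}$ be the rigid monoidal category of left $H$-modules in $\mathcal{B}$. Regard $HH(\mathcal{B})$ as a stable braided $\mathcal{B}$-module. Then there is an isomorphism of categories $$aYD^H_{HH(\mathcal{B})}\simeq HH(\mathcal{C}),$$ and this isomorphism identifies the natural automorphism $\varsigma^H$ of the identity functor of the left hand side with the natural automorphism $\varsigma$ of the identity functor of the right hand side.
   Context: $k$ is an algebraically closed field of characteristic $0$; all categories are $k$-linear; associators and identity tensor factors are suppressed. **Duals, braiding.** In a rigid category, $X^*$ denotes the left dual ($X^*\otimes X\to 1$, $1\to X\otimes X^*$) and ${}^*X$ the right dual ($ev: X\otimes{}^*X\to 1$, $coev: 1\to{}^*X\otimes X$); $X^\#=X^{**}$ and ${}^\#X={}^{*}({}^{*}X)$. In a braided category with braiding $\tau_{X,Y}:X\otimes Y\to Y\otimes X$ put $\tau^{-1}_{X,Y}:=(\tau_{Y,X})^{-1}:X\otimes Y\to Y\otimes X$. For a (left) $\mathcal{B}$-module category $\mathcal{M}$, the functor $X\cdot -$ has right adjoint ${}^*X\cdot -$. **Monoidal structure on $\mathcal{C}$.** For $V,W\in H_{\mathcal{B}}\text{-mod}$, $H$ acts on $V\otimes W$ by $(\rho_V\otimes\rho_W)(Id_H\otimes\tau_{H,V}\otimes Id_W)(\Delta\otimes Id)$. **$HH$ of a rigid category $\mathcal{D}$.** Objects: $M\in\mathcal{D}$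 with natural isomorphisms $\tau^\bullet_{M,X}:M\otimes X\to{}^\#X\otimes M$ such that $\tau^\bullet_{M,1}=Id$ and $\tau^\bullet_{M,X\otimes Y}=(Id\otimes\tau^\bullet_{M,Y})(\tau^\bullet_{M,X}\otimes Id)$; morphisms are those of $\mathcal{D}$ compatible with $\tau^\bullet$. Put $\tau^\bullet_{X,M}:=(\tau^\bullet_{M,X^\#})^{-1}:X\otimes M\to M\otimes X^\#$. The automorphism $\varsigma$ of $Id_{HH(\mathcal{D})}$ is $$\varsigma_M:\ M\xrightarrow{Id\otimes coev}M\otimes M\otimes M^*\xrightarrow{\tau^\bullet_{M,M}\otimes Id}M\otimes M^\#\otimes M^*\xrightarrow{Id\otimes ev}M,$$ where in the middle arrow $\tau^\bullet_{X,M}$ is used with $X=M$. **Stable braided modules.** A $\mathcal{B}$-module category $\mathcal{M}$ is braided if equipped with a natural automorphism $E_{X,M}:X\cdot M\to X\cdot M$ of the action functor with $E_{Y,X\cdot M}=\tau^{-1}_{X,Y}E_{Y,M}\tau^{-1}_{Y,X}$ and $E_{Y\otimes X,M}=E_{Y,X\cdot M}E_{X,M}$. It is stable if equipped with an automorphism $\varsigma$ of $Id_{\mathcal{M}}$ with $E_{X,M}=\varsigma_{X\cdot M}(Id_X\cdot\varsigma_M)^{-1}$. **$HH(\mathcal{B})$ as a stable braided $\mathcal{B}$-module.** $X\cdot M=X\otimes M$ with structure $Y\otimes X\otimes M\xrightarrow{\tau^{-1}_{Y,X}}X\otimes Y\otimes M\xrightarrow{\tau^\bullet_{Y,M}}X\otimes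 M\otimes Y^\#$; the stable structure is the automorphism $\varsigma$ of $Id_{HH(\mathcal{B})}$ whose component at $M\in HH(\mathcal{B})$ is the composite $$\varsigma_M:\ M\xrightarrow{Id\otimes coev}M\otimes M\otimes M^*\xrightarrow{\tau^\bullet_{X,M}|_{X=M}\otimes Id}M\otimes M^\#\otimes M^*\xrightarrow{Id\otimes ev}M,$$ and $E_{X,M}=\varsigma_{X\cdot M}(Id_X\otimes\varsigma_M)^{-1}$. **$aYD^H_{\mathcal{M}}$, for $\mathcal{M}$ a braided $\mathcal{B}$-module.** ${}^*H$ is an algebra in $\mathcal{B}$ with unit ${}^*\epsilon$ and multiplication ${}^*H\otimes{}^*H\to{}^*H$ the map whose adjoint $H\otimes{}^*H\otimes{}^*H\to 1$ is $ev\circ(Id_H\otimes ev\otimes Id_{{}^*H})\circ(\tau^{-1}_{H,H}\Delta\otimes Id)$. For an $H$-module $M$ in $\mathcal{M}$ define $r_0,r_1:H\cdot{}^*H\cdot M\to{}^*H\cdot M$ as the maps whose adjoints $H\otimes H\cdot{}^*H\cdot M\to M$ are: for $r_1$, $ev\circ(m_H\otimes Id)$; for $r_0$, $\rho_{H,M}\circ(Id_H\otimes ev)\circ(Id_H\otimes m_H\otimes Id)\circ(Id_H\otimes S\otimes Id_H\otimes Id)\circ(\Delta\otimes Id_H\otimes Id)\circ(\tau_{H,H}\otimes Id)$. Put $$act_M=r_1\circ E_{H,{}^*H\cdot M}\circ(Id_H\otimes r_0)\circ(\Delta\otimes Id):H\cdot{}^*H\cdot M\to{}^*H\cdot M .$$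 (For vector spaces this is $a\cdot(\chi\otimes m)=\chi(S(a^3)-a^1)\otimes a^2m$.) Objects of $aYD^H_{\mathcal{M}}$ are $M\in\mathcal{M}$ that are both an $H$-module and an ${}^*H$-module in $\mathcal{M}$ (actions $\rho_{H,M},\rho_{{}^*H,M}$ being morphisms of $\mathcal{M}$) such that $$\rho_{H,M}\circ(Id_H\otimes\rho_{{}^*H,M})=\rho_{{}^*H,M}\circ act_M;$$ morphisms are compatible with both actions. If $\mathcal{M}$ is stable, $\varsigma^H_M=\rho_{{}^*H,M}\circ(Id_{{}^*H}\otimes\rho_{H,M})\circ(coev\otimes Id_M)\circ\varsigma_M:M\to M$. *)

theory Defs
  imports "HOL-Computational_Algebra.Polynomial" "HOL-Library.FuncSet"
begin

section \<open>Linear categories\<close>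

text \<open>
  Hom-sets are indexed by source and target and are not required to be disjoint.  Hence a category
  of objects with extra structure has as its morphisms literally those morphisms of the underlying
  category that are compatible with the structure.
\<close>

record ('o, 'a, 'k) category =
  Ob :: "'o set"
  Hom :: "'o \<Rightarrow> 'o \<Rightarrow> 'a set"
  Ide :: "'o \<Rightarrow> 'a"
  Cmp :: "'a \<Rightarrow> 'a \<Rightarrow> 'a"  (infixr \<open>\<cdot>\<index>\<close> 55)
  Zer :: "'o \<Rightarrow> 'o \<Rightarrow> 'a"
  Add :: "'a \<Rightarrow> 'a \<Rightarrow> 'a"  (infixl \<open>\<oplus>\<index>\<close> 52)
  Smul :: "'k \<Rightarrow> 'a \<Rightarrow> 'a"

locale linear_category =
  fixes C :: "('o, 'a, 'k::field, 'z) category_scheme" (structure)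
  assumes ide_hom: "X \<in> Ob C \<Longrightarrow> Ide C X \<in> Hom C X X"
    and cmp_hom: "\<lbrakk>X \<in> Ob C; Y \<in> Ob C; Z \<in> Ob C; f \<in> Hom C X Y; g \<in> Hom C Y Z\<rbrakk>
      \<Longrightarrow> g \<cdot> f \<in> Hom C X Z"
    and ide_left: "\<lbrakk>X \<in> Ob C; Y \<in> Ob C; f \<in> Hom C X Y\<rbrakk> \<Longrightarrow> Ide C Y \<cdot> f = f"
    and ide_right: "\<lbrakk>X \<in> Ob C; Y \<in> Ob C; f \<in> Hom C X Y\<rbrakk> \<Longrightarrow> f \<cdot> Ide C X = f"
    and cmp_assoc: "\<lbrakk>W \<in> Ob C; X \<in> Ob C; Y \<in> Ob C; Z \<in> Ob C;
        f \<in> Hom C W X; g \<in> Hom C X Y; h \<in> Hom C Y Z\<rbrakk> \<Longrightarrow> (h \<cdot> g) \<cdot> f = h \<cdot> (g \<cdot> f)"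
    and zer_hom: "\<lbrakk>X \<in> Ob C; Y \<in> Ob C\<rbrakk> \<Longrightarrow> Zer C X Y \<in> Hom C X Y"
    and add_hom: "\<lbrakk>X \<in> Ob C; Y \<in> Ob C; f \<in> Hom C X Y; g \<in> Hom C X Y\<rbrakk> \<Longrightarrow> f \<oplus> g \<in> Hom C X Y"
    and smul_hom: "\<lbrakk>X \<in> Ob C; Y \<in> Ob C; f \<in> Hom C X Y\<rbrakk> \<Longrightarrow> Smul C c f \<in> Hom C X Y"
    and add_assoc: "\<lbrakk>X \<in> Ob C; Y \<in> Ob C; f \<in> Hom C X Y; g \<in> Hom C X Y; h \<in> Hom C X Y\<rbrakk>
      \<Longrightarrow> (f \<oplus> g) \<oplus> h = f \<oplus> (g \<oplus> h)"
    and add_commute: "\<lbrakk>X \<in> Ob C; Y \<in> Ob C; f \<in> Hom C X Y; g \<in> Hom C X Y\<rbrakk> \<Longrightarrow> f \<oplus> g = g \<oplus> f"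
    and add_zer: "\<lbrakk>X \<in> Ob C; Y \<in> Ob C; f \<in> Hom C X Y\<rbrakk> \<Longrightarrow> f \<oplus> Zer C X Y = f"
    and add_neg: "\<lbrakk>X \<in> Ob C; Y \<in> Ob C; f \<in> Hom C X Y\<rbrakk> \<Longrightarrow> f \<oplus> Smul C (-1) f = Zer C X Y"
    and smul_add: "\<lbrakk>X \<in> Ob C; Y \<in> Ob C; f \<in> Hom C X Y; g \<in> Hom C X Y\<rbrakk>
      \<Longrightarrow> Smul C c (f \<oplus> g) = Smul C c f \<oplus> Smul C c g"
    and add_smul: "\<lbrakk>X \<in> Ob C; Y \<in> Ob C; f \<in> Hom C X Y\<rbrakk>
      \<Longrightarrow> Smul C (c + d) f = Smul C c f \<oplus> Smul C d f"
    and mult_smul: "\<lbrakk>X \<in> Ob C; Y \<in> Ob C; f \<in> Hom C X Y\<rbrakk>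
      \<Longrightarrow> Smul C (c * d) f = Smul C c (Smul C d f)"
    and one_smul: "\<lbrakk>X \<in> Ob C; Y \<in> Ob C; f \<in> Hom C X Y\<rbrakk> \<Longrightarrow> Smul C 1 f = f"
    and cmp_add_left: "\<lbrakk>X \<in> Ob C; Y \<in> Ob C; Z \<in> Ob C; f \<in> Hom C X Y; g \<in> Hom C Y Z; h \<in> Hom C Y Z\<rbrakk>
      \<Longrightarrow> (g \<oplus> h) \<cdot> f = (g \<cdot> f) \<oplus> (h \<cdot> f)"
    and cmp_add_right: "\<lbrakk>X \<in> Ob C; Y \<in> Ob C; Z \<in> Ob C; f \<in> Hom C X Y; g \<in> Hom C X Y; h \<in> Hom C Y Z\<rbrakk>
      \<Longrightarrow> h \<cdot> (f \<oplus> g) = (h \<cdot> f) \<oplus> (h \<cdot> g)"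
    and cmp_smul_left: "\<lbrakk>X \<in> Ob C; Y \<in> Ob C; Z \<in> Ob C; f \<in> Hom C X Y; g \<in> Hom C Y Z\<rbrakk>
      \<Longrightarrow> Smul C c g \<cdot> f = Smul C c (g \<cdot> f)"
    and cmp_smul_right: "\<lbrakk>X \<in> Ob C; Y \<in> Ob C; Z \<in> Ob C; f \<in> Hom C X Y; g \<in> Hom C Y Z\<rbrakk>
      \<Longrightarrow> g \<cdot> Smul C c f = Smul C c (g \<cdot> f)"

context
  fixes C :: "('o, 'a, 'k, 'z) category_scheme" (structure)
begin

definition inverse_pair :: "'o \<Rightarrow> 'o \<Rightarrow> 'a \<Rightarrow> 'a \<Rightarrow> bool" where
  "inverse_pair X Y f g \<longleftrightarrow>
    f \<in> Hom C X Y \<and> g \<in> Hom C Y X \<and> g \<cdot> f = Ide C X \<and> f \<cdot> g = Ide C Y"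

definition is_iso :: "'o \<Rightarrow> 'o \<Rightarrow> 'a \<Rightarrow> bool" where
  "is_iso X Y f \<longleftrightarrow> (\<exists>g. inverse_pair X Y f g)"

definition Inv :: "'o \<Rightarrow> 'o \<Rightarrow> 'a \<Rightarrow> 'a" where
  "Inv X Y f = (THE g. inverse_pair X Y f g)"

definition identity_automorphism :: "('o \<Rightarrow> 'a) \<Rightarrow> bool" where
  "identity_automorphism s \<longleftrightarrow>
    (\<forall>X \<in> Ob C. is_iso X X (s X)) \<and>
    (\<forall>X \<in> Ob C. \<forall>Y \<in> Ob C. \<forall>f \<in> Hom C X Y. s Y \<cdot> f = f \<cdot> s X)"

end

text \<open>
  As hom-sets may overlap, the action of a functor on morphisms also depends on source and target.
\<close>

definition linear_functor ::
  "('o, 'a, 'k, 'y) category_scheme \<Rightarrow> ('p, 'b, 'k, 'z) category_scheme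
    \<Rightarrow> ('o \<Rightarrow> 'p) \<Rightarrow> ('o \<Rightarrow> 'o \<Rightarrow> 'a \<Rightarrow> 'b) \<Rightarrow> bool" where
  "linear_functor C D Fo Fa \<longleftrightarrow>
    (\<forall>X \<in> Ob C. Fo X \<in> Ob D) \<and>
    (\<forall>X \<in> Ob C. \<forall>Y \<in> Ob C. \<forall>f \<in> Hom C X Y. Fa X Y f \<in> Hom D (Fo X) (Fo Y)) \<and>
    (\<forall>X \<in> Ob C. Fa X X (Ide C X) = Ide D (Fo X)) \<and>
    (\<forall>X \<in> Ob C. \<forall>Y \<in> Ob C. \<forall>Z \<in> Ob C. \<forall>f \<in> Hom C X Y. \<forall>g \<in> Hom C Y Z.
      Fa X Z (g \<cdot>\<^bsub>C\<^esub> f) = Fa Y Z g \<cdot>\<^bsub>D\<^esub> Fa X Y f) \<and>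
    (\<forall>X \<in> Ob C. \<forall>Y \<in> Ob C. \<forall>f \<in> Hom C X Y. \<forall>g \<in> Hom C X Y.
      Fa X Y (f \<oplus>\<^bsub>C\<^esub> g) = Fa X Y f \<oplus>\<^bsub>D\<^esub> Fa X Y g) \<and>
    (\<forall>X \<in> Ob C. \<forall>Y \<in> Ob C. \<forall>f \<in> Hom C X Y. \<forall>c.
      Fa X Y (Smul C c f) = Smul D c (Fa X Y f))"

definition category_isomorphism ::
  "('o, 'a, 'k::field, 'y) category_scheme \<Rightarrow> ('p, 'b, 'k, 'z) category_scheme
    \<Rightarrow> ('o \<Rightarrow> 'p) \<Rightarrow> ('o \<Rightarrow> 'o \<Rightarrow> 'a \<Rightarrow> 'b) \<Rightarrow> bool" where
  "category_isomorphism C D Fo Fa \<longleftrightarrow>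
    linear_category C \<and> linear_category D \<and> linear_functor C D Fo Fa \<and>
    (\<exists>Go Ga. linear_functor D C Go Ga \<and>
      (\<forall>X \<in> Ob C. Go (Fo X) = X) \<and>
      (\<forall>X \<in> Ob C. \<forall>Y \<in> Ob C. \<forall>f \<in> Hom C X Y. Ga (Fo X) (Fo Y) (Fa X Y f) = f) \<and>
      (\<forall>U \<in> Ob D. Fo (Go U) = U) \<and>
      (\<forall>U \<in> Ob D. \<forall>V \<in> Ob D. \<forall>g \<in> Hom D U V. Fa (Go U) (Go V) (Ga U V g) = g))"


section \<open>Rigid monoidal and braided categories\<close>

text \<open>
  Associators and unitors are part of the data; no strictness is assumed.  A rigid category
  comes with a choice of a left and of a right dual of every object.
\<close>

record ('o, 'a, 'k) monoidal = "('o, 'a, 'k) category" +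
  Ten :: "'o \<Rightarrow> 'o \<Rightarrow> 'o"  (infixr \<open>\<otimes>\<index>\<close> 70)
  Tar :: "'a \<Rightarrow> 'a \<Rightarrow> 'a"  (infixr \<open>\<star>\<index>\<close> 70)
  Uni :: "'o"  (\<open>\<one>\<index>\<close>)
  Asc :: "'o \<Rightarrow> 'o \<Rightarrow> 'o \<Rightarrow> 'a"
  Lun :: "'o \<Rightarrow> 'a"
  Run :: "'o \<Rightarrow> 'a"

record ('o, 'a, 'k) rigid = "('o, 'a, 'k) monoidal" +
  ldual :: "'o \<Rightarrow> 'o"
  ev_left :: "'o \<Rightarrow> 'a"
  coev_left :: "'o \<Rightarrow> 'a"
  rdual :: "'o \<Rightarrow> 'o"
  ev_right :: "'o \<Rightarrow> 'a"
  coev_right :: "'o \<Rightarrow> 'a"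

record ('o, 'a, 'k) braided = "('o, 'a, 'k) rigid" +
  Braid :: "'o \<Rightarrow> 'o \<Rightarrow> 'a"

context
  fixes D :: "('o, 'a, 'k, 'z) monoidal_scheme" (structure)
begin

definition AscInv :: "'o \<Rightarrow> 'o \<Rightarrow> 'o \<Rightarrow> 'a" where
  "AscInv X Y Z = Inv D ((X \<otimes> Y) \<otimes> Z) (X \<otimes> (Y \<otimes> Z)) (Asc D X Y Z)"

definition LunInv :: "'o \<Rightarrow> 'a" where
  "LunInv X = Inv D (\<one> \<otimes> X) X (Lun D X)"

definition RunInv :: "'o \<Rightarrow> 'a" where
  "RunInv X = Inv D (X \<otimes> \<one>) X (Run D X)"

end

locale linear_monoidal_category = linear_category D
  for D :: "('o, 'a, 'k::field, 'z) monoidal_scheme" (structure) +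
  assumes ten_ob: "\<lbrakk>X \<in> Ob D; Y \<in> Ob D\<rbrakk> \<Longrightarrow> X \<otimes> Y \<in> Ob D"
    and uni_ob: "\<one> \<in> Ob D"
    and tar_hom: "\<lbrakk>X \<in> Ob D; Y \<in> Ob D; X' \<in> Ob D; Y' \<in> Ob D; f \<in> Hom D X Y; g \<in> Hom D X' Y'\<rbrakk>
      \<Longrightarrow> f \<star> g \<in> Hom D (X \<otimes> X') (Y \<otimes> Y')"
    and tar_ide: "\<lbrakk>X \<in> Ob D; Y \<in> Ob D\<rbrakk> \<Longrightarrow> Ide D X \<star> Ide D Y = Ide D (X \<otimes> Y)"
    and tar_cmp: "\<lbrakk>X \<in> Ob D; Y \<in> Ob D; Z \<in> Ob D; X' \<in> Ob D; Y' \<in> Ob D; Z' \<in> Ob D;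
        f \<in> Hom D X Y; g \<in> Hom D Y Z; f' \<in> Hom D X' Y'; g' \<in> Hom D Y' Z'\<rbrakk>
      \<Longrightarrow> (g \<cdot> f) \<star> (g' \<cdot> f') = (g \<star> g') \<cdot> (f \<star> f')"
    and tar_add_left: "\<lbrakk>X \<in> Ob D; Y \<in> Ob D; X' \<in> Ob D; Y' \<in> Ob D;
        f \<in> Hom D X Y; g \<in> Hom D X Y; h \<in> Hom D X' Y'\<rbrakk>
      \<Longrightarrow> (f \<oplus> g) \<star> h = (f \<star> h) \<oplus> (g \<star> h)"
    and tar_add_right: "\<lbrakk>X \<in> Ob D; Y \<in> Ob D; X' \<in> Ob D; Y' \<in> Ob D;
        f \<in> Hom D X Y; g \<in> Hom D X' Y'; h \<in> Hom D X' Y'\<rbrakk>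
      \<Longrightarrow> f \<star> (g \<oplus> h) = (f \<star> g) \<oplus> (f \<star> h)"
    and tar_smul_left: "\<lbrakk>X \<in> Ob D; Y \<in> Ob D; X' \<in> Ob D; Y' \<in> Ob D; f \<in> Hom D X Y; g \<in> Hom D X' Y'\<rbrakk>
      \<Longrightarrow> Smul D c f \<star> g = Smul D c (f \<star> g)"
    and tar_smul_right: "\<lbrakk>X \<in> Ob D; Y \<in> Ob D; X' \<in> Ob D; Y' \<in> Ob D; f \<in> Hom D X Y; g \<in> Hom D X' Y'\<rbrakk>
      \<Longrightarrow> f \<star> Smul D c g = Smul D c (f \<star> g)"
    and asc_iso: "\<lbrakk>X \<in> Ob D; Y \<in> Ob D; Z \<in> Ob D\<rbrakk>
      \<Longrightarrow> is_iso D ((X \<otimes> Y) \<otimes> Z) (X \<otimes> (Y \<otimes> Z)) (Asc D X Y Z)"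
    and asc_nat: "\<lbrakk>X \<in> Ob D; Y \<in> Ob D; Z \<in> Ob D; X' \<in> Ob D; Y' \<in> Ob D; Z' \<in> Ob D;
        f \<in> Hom D X X'; g \<in> Hom D Y Y'; h \<in> Hom D Z Z'\<rbrakk>
      \<Longrightarrow> Asc D X' Y' Z' \<cdot> ((f \<star> g) \<star> h) = (f \<star> (g \<star> h)) \<cdot> Asc D X Y Z"
    and lun_iso: "X \<in> Ob D \<Longrightarrow> is_iso D (\<one> \<otimes> X) X (Lun D X)"
    and lun_nat: "\<lbrakk>X \<in> Ob D; Y \<in> Ob D; f \<in> Hom D X Y\<rbrakk>
      \<Longrightarrow> Lun D Y \<cdot> (Ide D \<one> \<star> f) = f \<cdot> Lun D X"
    and run_iso: "X \<in> Ob D \<Longrightarrow> is_iso D (X \<otimes> \<one>) X (Run D X)"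
    and run_nat: "\<lbrakk>X \<in> Ob D; Y \<in> Ob D; f \<in> Hom D X Y\<rbrakk>
      \<Longrightarrow> Run D Y \<cdot> (f \<star> Ide D \<one>) = f \<cdot> Run D X"
    and pentagon: "\<lbrakk>W \<in> Ob D; X \<in> Ob D; Y \<in> Ob D; Z \<in> Ob D\<rbrakk>
      \<Longrightarrow> Asc D W X (Y \<otimes> Z) \<cdot> Asc D (W \<otimes> X) Y Z
        = (Ide D W \<star> Asc D X Y Z) \<cdot> Asc D W (X \<otimes> Y) Z \<cdot> (Asc D W X Y \<star> Ide D Z)"
    and triangle: "\<lbrakk>X \<in> Ob D; Y \<in> Ob D\<rbrakk>
      \<Longrightarrow> (Ide D X \<star> Lun D Y) \<cdot> Asc D X \<one> Y = Run D X \<star> Ide D Y"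

locale rigid_monoidal_category = linear_monoidal_category D
  for D :: "('o, 'a, 'k::field, 'z) rigid_scheme" (structure) +
  assumes ldual_ob: "X \<in> Ob D \<Longrightarrow> ldual D X \<in> Ob D"
    and lev_hom: "X \<in> Ob D \<Longrightarrow> ev_left D X \<in> Hom D (ldual D X \<otimes> X) \<one>"
    and lcoev_hom: "X \<in> Ob D \<Longrightarrow> coev_left D X \<in> Hom D \<one> (X \<otimes> ldual D X)"
    and ldual_zigzag: "X \<in> Ob D \<Longrightarrow>
      Run D X \<cdot> (Ide D X \<star> ev_left D X) \<cdot> Asc D X (ldual D X) X \<cdot> (coev_left D X \<star> Ide D X) \<cdot> LunInv D X
        = Ide D X"
    and ldual_zagzig: "X \<in> Ob D \<Longrightarrow>
      Lun D (ldual D X) \<cdot> (ev_left D X \<star> Ide D (ldual D X)) \<cdot> AscInv D (ldual D X) X (ldual D X)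
          \<cdot> (Ide D (ldual D X) \<star> coev_left D X) \<cdot> RunInv D (ldual D X)
        = Ide D (ldual D X)"
    and rdual_ob: "X \<in> Ob D \<Longrightarrow> rdual D X \<in> Ob D"
    and rev_hom: "X \<in> Ob D \<Longrightarrow> ev_right D X \<in> Hom D (X \<otimes> rdual D X) \<one>"
    and rcoev_hom: "X \<in> Ob D \<Longrightarrow> coev_right D X \<in> Hom D \<one> (rdual D X \<otimes> X)"
    and rdual_zigzag: "X \<in> Ob D \<Longrightarrow>
      Lun D X \<cdot> (ev_right D X \<star> Ide D X) \<cdot> AscInv D X (rdual D X) X \<cdot> (Ide D X \<star> coev_right D X) \<cdot> RunInv D X
        = Ide D X"
    and rdual_zagzig: "X \<in> Ob D \<Longrightarrow>
      Run D (rdual D X) \<cdot> (Ide D (rdual D X) \<star> ev_right D X) \<cdot> Asc D (rdual D X) X (rdual D X)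
          \<cdot> (coev_right D X \<star> Ide D (rdual D X)) \<cdot> LunInv D (rdual D X)
        = Ide D (rdual D X)"

locale rigid_braided_category = rigid_monoidal_category B
  for B :: "('o, 'a, 'k::field, 'z) braided_scheme" (structure) +
  assumes braid_iso: "\<lbrakk>X \<in> Ob B; Y \<in> Ob B\<rbrakk> \<Longrightarrow> is_iso B (X \<otimes> Y) (Y \<otimes> X) (Braid B X Y)"
    and braid_nat: "\<lbrakk>X \<in> Ob B; Y \<in> Ob B; X' \<in> Ob B; Y' \<in> Ob B; f \<in> Hom B X X'; g \<in> Hom B Y Y'\<rbrakk>
      \<Longrightarrow> Braid B X' Y' \<cdot> (f \<star> g) = (g \<star> f) \<cdot> Braid B X Y"
    and hexagon1: "\<lbrakk>X \<in> Ob B; Y \<in> Ob B; Z \<in> Ob B\<rbrakk>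
      \<Longrightarrow> Asc B Y Z X \<cdot> Braid B X (Y \<otimes> Z) \<cdot> Asc B X Y Z
        = (Ide B Y \<star> Braid B X Z) \<cdot> Asc B Y X Z \<cdot> (Braid B X Y \<star> Ide B Z)"
    and hexagon2: "\<lbrakk>X \<in> Ob B; Y \<in> Ob B; Z \<in> Ob B\<rbrakk>
      \<Longrightarrow> AscInv B Z X Y \<cdot> Braid B (X \<otimes> Y) Z \<cdot> AscInv B X Y Z
        = (Braid B X Z \<star> Ide B Y) \<cdot> AscInv B X Z Y \<cdot> (Ide B X \<star> Braid B Y Z)"


subsection \<open>Currying and the canonical isomorphisms between duals\<close>

context
  fixes D :: "('o, 'a, 'k, 'z) rigid_scheme" (structure)
begin

text \<open>
  The morphism \<open>A \<rightarrow> \<^sup>*X\<close> with adjoint \<open>e : X \<otimes> A \<rightarrow> 1\<close>, and the morphism \<open>A \<rightarrow> X\<^sup>*\<close> with adjoint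
  \<open>e : A \<otimes> X \<rightarrow> 1\<close>.
\<close>

definition rcurry :: "'o \<Rightarrow> 'o \<Rightarrow> 'a \<Rightarrow> 'a" where
  "rcurry X A e = Run D (rdual D X) \<cdot> (Ide D (rdual D X) \<star> e) \<cdot> Asc D (rdual D X) X A
    \<cdot> (coev_right D X \<star> Ide D A) \<cdot> LunInv D A"

definition lcurry :: "'o \<Rightarrow> 'o \<Rightarrow> 'a \<Rightarrow> 'a" where
  "lcurry X A e = Lun D (ldual D X) \<cdot> (e \<star> Ide D (ldual D X)) \<cdot> AscInv D A X (ldual D X)
    \<cdot> (Ide D A \<star> coev_left D X) \<cdot> RunInv D A"

text \<open>\<open>\<^sup>*f : \<^sup>*Y \<rightarrow> \<^sup>*X\<close> for \<open>f : X \<rightarrow> Y\<close>.\<close>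

definition rdual_ar :: "'o \<Rightarrow> 'o \<Rightarrow> 'a \<Rightarrow> 'a" where
  "rdual_ar X Y f = rcurry X (rdual D Y) (ev_right D Y \<cdot> (f \<star> Ide D (rdual D Y)))"

text \<open>The nested evaluation \<open>(X \<otimes> Y) \<otimes> (\<^sup>*Y \<otimes> \<^sup>*X) \<rightarrow> 1\<close>.\<close>

definition ev_right2 :: "'o \<Rightarrow> 'o \<Rightarrow> 'a" where
  "ev_right2 X Y = ev_right D X
    \<cdot> (Ide D X \<star> (Lun D (rdual D X) \<cdot> (ev_right D Y \<star> Ide D (rdual D X))
        \<cdot> AscInv D Y (rdual D Y) (rdual D X)))
    \<cdot> Asc D X Y (rdual D Y \<otimes> rdual D X)"

text \<open>The canonical isomorphisms \<open>1 \<rightarrow> \<^sup>*1\<close> and \<open>\<^sup>*Y \<otimes> \<^sup>*X \<rightarrow> \<^sup>*(X \<otimes> Y)\<close>.\<close>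

definition rdual_uni :: "'a" where
  "rdual_uni = rcurry \<one> \<one> (Lun D \<one>)"

definition rdual_ten :: "'o \<Rightarrow> 'o \<Rightarrow> 'a" where
  "rdual_ten X Y = rcurry (X \<otimes> Y) (rdual D Y \<otimes> rdual D X) (ev_right2 X Y)"

text \<open>
  The functor \<open>\<^sup>#X = \<^sup>*(\<^sup>*X)\<close>, with its monoidal structure \<open>1 \<rightarrow> \<^sup>#1\<close> and
  \<open>\<^sup>#X \<otimes> \<^sup>#Y \<rightarrow> \<^sup>#(X \<otimes> Y)\<close>.
\<close>

definition sharp :: "'o \<Rightarrow> 'o" where
  "sharp X = rdual D (rdual D X)"

definition sharp_ar :: "'o \<Rightarrow> 'o \<Rightarrow> 'a \<Rightarrow> 'a" where
  "sharp_ar X Y f = rdual_ar (rdual D Y) (rdual D X) (rdual_ar X Y f)"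

definition sharp_uni :: "'a" where
  "sharp_uni = rdual_ar (rdual D \<one>) \<one> (Inv D \<one> (rdual D \<one>) rdual_uni) \<cdot> rdual_uni"

definition sharp_ten :: "'o \<Rightarrow> 'o \<Rightarrow> 'a" where
  "sharp_ten X Y =
    rdual_ar (rdual D (X \<otimes> Y)) (rdual D Y \<otimes> rdual D X)
        (Inv D (rdual D Y \<otimes> rdual D X) (rdual D (X \<otimes> Y)) (rdual_ten X Y))
      \<cdot> rdual_ten (rdual D Y) (rdual D X)"

text \<open>\<open>X\<^sup># = X\<^sup>*\<^sup>*\<close>, and the canonical isomorphisms \<open>X \<rightarrow> \<^sup>*(X\<^sup>*)\<close> and \<open>X \<rightarrow> \<^sup>#(X\<^sup>#)\<close>.\<close>

definition lsharp :: "'o \<Rightarrow> 'o" where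
  "lsharp X = ldual D (ldual D X)"

definition dual_unit :: "'o \<Rightarrow> 'a" where
  "dual_unit X = rcurry (ldual D X) X (ev_left D X)"

definition sharp_lsharp :: "'o \<Rightarrow> 'a" where
  "sharp_lsharp X =
    rdual_ar (rdual D (lsharp X)) (ldual D X)
        (Inv D (ldual D X) (rdual D (lsharp X)) (dual_unit (ldual D X)))
      \<cdot> dual_unit X"


section \<open>The category \<open>HH(D)\<close>\<close>

text \<open>
  Objects are pairs \<open>(M, t)\<close> with \<open>t X : M \<otimes> X \<rightarrow> \<^sup>#X \<otimes> M\<close>.  The family \<open>t\<close> is extensional, so that
  equality of objects is equality of the components over the objects of \<open>D\<close>.
\<close>

definition half_braiding :: "'o \<Rightarrow> ('o \<Rightarrow> 'a) \<Rightarrow> bool" where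
  "half_braiding M t \<longleftrightarrow>
    M \<in> Ob D \<and> t \<in> extensional (Ob D) \<and>
    (\<forall>X \<in> Ob D. is_iso D (M \<otimes> X) (sharp X \<otimes> M) (t X)) \<and>
    (\<forall>X \<in> Ob D. \<forall>Y \<in> Ob D. \<forall>f \<in> Hom D X Y.
      t Y \<cdot> (Ide D M \<star> f) = (sharp_ar X Y f \<star> Ide D M) \<cdot> t X) \<and>
    t \<one> = (sharp_uni \<star> Ide D M) \<cdot> LunInv D M \<cdot> Run D M \<and>
    (\<forall>X \<in> Ob D. \<forall>Y \<in> Ob D.
      t (X \<otimes> Y) = (sharp_ten X Y \<star> Ide D M) \<cdot> AscInv D (sharp X) (sharp Y) M
        \<cdot> (Ide D (sharp X) \<star> t Y) \<cdot> Asc D (sharp X) M Y \<cdot> (t X \<star> Ide D Y) \<cdot> AscInv D M X Y)"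

definition HH :: "('o \<times> ('o \<Rightarrow> 'a), 'a, 'k) category" where
  "HH = \<lparr>
    Ob = {(M, t). half_braiding M t},
    Hom = \<lambda>(M, t) (N, s). {f \<in> Hom D M N.
      \<forall>X \<in> Ob D. s X \<cdot> (f \<star> Ide D X) = (Ide D (sharp X) \<star> f) \<cdot> t X},
    Ide = \<lambda>(M, t). Ide D M,
    Cmp = Cmp D,
    Zer = \<lambda>(M, t) (N, s). Zer D M N,
    Add = Add D,
    Smul = Smul D \<rparr>"

text \<open>\<open>\<tau>\<^bold>\<bullet>\<^sub>X\<^sub>,\<^sub>M : X \<otimes> M \<rightarrow> M \<otimes> X\<^sup>#\<close>, the inverse of \<open>t (X\<^sup>#) : M \<otimes> X\<^sup># \<rightarrow> \<^sup>#(X\<^sup>#) \<otimes> M\<close>.\<close>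

definition left_half :: "'o \<times> ('o \<Rightarrow> 'a) \<Rightarrow> 'o \<Rightarrow> 'a" where
  "left_half = (\<lambda>(M, t) X.
    Inv D (M \<otimes> lsharp X) (sharp (lsharp X) \<otimes> M) (t (lsharp X)) \<cdot> (sharp_lsharp X \<star> Ide D M))"

definition HH_twist :: "'o \<times> ('o \<Rightarrow> 'a) \<Rightarrow> 'a" where
  "HH_twist = (\<lambda>(M, t).
    Run D M \<cdot> (Ide D M \<star> ev_left D (ldual D M)) \<cdot> Asc D M (lsharp M) (ldual D M)
      \<cdot> (left_half (M, t) M \<star> Ide D (ldual D M)) \<cdot> AscInv D M M (ldual D M)
      \<cdot> (Ide D M \<star> coev_left D M) \<cdot> RunInv D M)"

end


section \<open>Hopf algebras and their modules\<close>

record ('o, 'a) hopf =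
  carr :: "'o"
  mul :: "'a"
  unt :: "'a"
  comul :: "'a"
  counit :: "'a"
  antipode :: "'a"

context
  fixes B :: "('o, 'a, 'k, 'z) braided_scheme" (structure)
begin

text \<open>The convention is \<open>\<tau>\<^sup>-\<^sup>1\<^sub>X\<^sub>,\<^sub>Y = (\<tau>\<^sub>Y\<^sub>,\<^sub>X)\<^sup>-\<^sup>1 : X \<otimes> Y \<rightarrow> Y \<otimes> X\<close>.\<close>

definition BraidInv :: "'o \<Rightarrow> 'o \<Rightarrow> 'a" where
  "BraidInv X Y = Inv B (Y \<otimes> X) (X \<otimes> Y) (Braid B Y X)"

text \<open>\<open>Id \<otimes> \<tau>\<^sub>X\<^sub>,\<^sub>Y \<otimes> Id : (W \<otimes> X) \<otimes> (Y \<otimes> Z) \<rightarrow> (W \<otimes> Y) \<otimes> (X \<otimes> Z)\<close>.\<close>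

definition middle_swap :: "'o \<Rightarrow> 'o \<Rightarrow> 'o \<Rightarrow> 'o \<Rightarrow> 'a" where
  "middle_swap W X Y Z = AscInv B W Y (X \<otimes> Z)
    \<cdot> (Ide B W \<star> (Asc B Y X Z \<cdot> (Braid B X Y \<star> Ide B Z) \<cdot> AscInv B X Y Z))
    \<cdot> Asc B W X (Y \<otimes> Z)"

end

locale hopf_algebra = rigid_braided_category B
  for B :: "('o, 'a, 'k::field, 'z) braided_scheme" (structure) +
  fixes H :: "('o, 'a) hopf"
  assumes carr_ob: "carr H \<in> Ob B"
    and mul_hom: "mul H \<in> Hom B (carr H \<otimes> carr H) (carr H)"
    and unt_hom: "unt H \<in> Hom B \<one> (carr H)"
    and comul_hom: "comul H \<in> Hom B (carr H) (carr H \<otimes> carr H)"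
    and counit_hom: "counit H \<in> Hom B (carr H) \<one>"
    and mul_assoc: "mul H \<cdot> (mul H \<star> Ide B (carr H))
      = mul H \<cdot> (Ide B (carr H) \<star> mul H) \<cdot> Asc B (carr H) (carr H) (carr H)"
    and mul_unt_left: "mul H \<cdot> (unt H \<star> Ide B (carr H)) = Lun B (carr H)"
    and mul_unt_right: "mul H \<cdot> (Ide B (carr H) \<star> unt H) = Run B (carr H)"
    and comul_coassoc: "Asc B (carr H) (carr H) (carr H) \<cdot> (comul H \<star> Ide B (carr H)) \<cdot> comul H
      = (Ide B (carr H) \<star> comul H) \<cdot> comul H"
    and counit_left: "Lun B (carr H) \<cdot> (counit H \<star> Ide B (carr H)) \<cdot> comul H = Ide B (carr H)"
    and counit_right: "Run B (carr H) \<cdot> (Ide B (carr H) \<star> counit H) \<cdot> comul H = Ide B (carr H)"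
    and comul_mul: "comul H \<cdot> mul H
      = (mul H \<star> mul H) \<cdot> middle_swap B (carr H) (carr H) (carr H) (carr H) \<cdot> (comul H \<star> comul H)"
    and comul_unt: "comul H \<cdot> unt H = (unt H \<star> unt H) \<cdot> LunInv B \<one>"
    and counit_mul: "counit H \<cdot> mul H = Lun B \<one> \<cdot> (counit H \<star> counit H)"
    and counit_unt: "counit H \<cdot> unt H = Ide B \<one>"
    and antipode_iso: "is_iso B (carr H) (carr H) (antipode H)"
    and antipode_left: "mul H \<cdot> (antipode H \<star> Ide B (carr H)) \<cdot> comul H = unt H \<cdot> counit H"
    and antipode_right: "mul H \<cdot> (Ide B (carr H) \<star> antipode H) \<cdot> comul H = unt H \<cdot> counit H"

context
  fixes B :: "('o, 'a, 'k, 'z) braided_scheme" (structure) and H :: "('o, 'a) hopf"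
begin

definition is_hopf_module :: "'o \<Rightarrow> 'a \<Rightarrow> bool" where
  "is_hopf_module V r \<longleftrightarrow>
    V \<in> Ob B \<and> r \<in> Hom B (carr H \<otimes> V) V \<and>
    r \<cdot> (mul H \<star> Ide B V) = r \<cdot> (Ide B (carr H) \<star> r) \<cdot> Asc B (carr H) (carr H) V \<and>
    r \<cdot> (unt H \<star> Ide B V) = Lun B V"

definition tensor_action :: "'o \<Rightarrow> 'a \<Rightarrow> 'o \<Rightarrow> 'a \<Rightarrow> 'a" where
  "tensor_action V r W s =
    (r \<star> s) \<cdot> middle_swap B (carr H) (carr H) V W \<cdot> (comul H \<star> Ide B (V \<otimes> W))"

text \<open>
  The actions on \<open>V\<^sup>*\<close> and \<open>\<^sup>*V\<close> for which the evaluations and coevaluations of the underlying objects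
  are morphisms of modules: \<open>(h \<cdot> f)(v) = f(S(h) v)\<close> on \<open>V\<^sup>*\<close>, where \<open>H\<close> passes \<open>V\<^sup>*\<close> along
  \<open>\<tau>\<close>, and \<open>(h \<cdot> f)(v) = f(S\<^sup>-\<^sup>1(h) v)\<close> on \<open>\<^sup>*V\<close>, where \<open>H\<close> passes \<open>V\<close> along \<open>\<tau>\<^sup>-\<^sup>1\<close>.
\<close>

definition ldual_action :: "'o \<Rightarrow> 'a \<Rightarrow> 'a" where
  "ldual_action V r = lcurry B V (carr H \<otimes> ldual B V)
    (ev_left B V \<cdot> (Ide B (ldual B V) \<star> (r \<cdot> (antipode H \<star> Ide B V)))
      \<cdot> Asc B (ldual B V) (carr H) V \<cdot> (Braid B (carr H) (ldual B V) \<star> Ide B V))"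

definition rdual_action :: "'o \<Rightarrow> 'a \<Rightarrow> 'a" where
  "rdual_action V r = rcurry B V (carr H \<otimes> rdual B V)
    (ev_right B V
      \<cdot> ((r \<cdot> (Inv B (carr H) (carr H) (antipode H) \<star> Ide B V) \<cdot> BraidInv B V (carr H))
          \<star> Ide B (rdual B V))
      \<cdot> AscInv B V (carr H) (rdual B V))"

definition Hmod :: "('o \<times> 'a, 'a, 'k) rigid" where
  "Hmod = \<lparr>
    Ob = {(V, r). is_hopf_module V r},
    Hom = \<lambda>(V, r) (W, s). {f \<in> Hom B V W. f \<cdot> r = s \<cdot> (Ide B (carr H) \<star> f)},
    Ide = \<lambda>(V, r). Ide B V,
    Cmp = Cmp B,
    Zer = \<lambda>(V, r) (W, s). Zer B V W,
    Add = Add B,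
    Smul = Smul B,
    Ten = \<lambda>(V, r) (W, s). (V \<otimes> W, tensor_action V r W s),
    Tar = Tar B,
    Uni = (\<one>, Lun B \<one> \<cdot> (counit H \<star> Ide B \<one>)),
    Asc = \<lambda>(U, q) (V, r) (W, s). Asc B U V W,
    Lun = \<lambda>(V, r). Lun B V,
    Run = \<lambda>(V, r). Run B V,
    ldual = \<lambda>(V, r). (ldual B V, ldual_action V r),
    ev_left = \<lambda>(V, r). ev_left B V,
    coev_left = \<lambda>(V, r). coev_left B V,
    rdual = \<lambda>(V, r). (rdual B V, rdual_action V r),
    ev_right = \<lambda>(V, r). ev_right B V,
    coev_right = \<lambda>(V, r). coev_right B V \<rparr>"

text \<open>
  The algebra \<open>\<^sup>*H\<close>: its multiplication has adjoint
  \<open>ev \<circ> (Id \<otimes> ev \<otimes> Id) \<circ> (\<tau>\<^sup>-\<^sup>1\<^sub>H\<^sub>,\<^sub>H \<Delta> \<otimes> Id) : H \<otimes> (\<^sup>*H \<otimes> \<^sup>*H) \<rightarrow> 1\<close>.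
\<close>

definition dual_unt :: "'a" where
  "dual_unt = rdual_ar B (carr H) \<one> (counit H) \<cdot> rdual_uni B"

definition dual_mul :: "'a" where
  "dual_mul = rcurry B (carr H) (rdual B (carr H) \<otimes> rdual B (carr H))
    (ev_right2 B (carr H) (carr H)
      \<cdot> ((BraidInv B (carr H) (carr H) \<cdot> comul H)
          \<star> Ide B (rdual B (carr H) \<otimes> rdual B (carr H))))"

end


section \<open>Stable braided module categories\<close>

record ('o, 'a, 'p, 'b, 'k) module_category = "('p, 'b, 'k) category" +
  Act :: "'o \<Rightarrow> 'p \<Rightarrow> 'p"  (infixr \<open>\<rhd>\<index>\<close> 72)
  Aar :: "'a \<Rightarrow> 'b \<Rightarrow> 'b"  (infixr \<open>\<bullet>\<index>\<close> 72)
  Mas :: "'o \<Rightarrow> 'o \<Rightarrow> 'p \<Rightarrow> 'b"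
  Mun :: "'p \<Rightarrow> 'b"

record ('o, 'a, 'p, 'b, 'k) braided_module = "('o, 'a, 'p, 'b, 'k) module_category" +
  Bra :: "'o \<Rightarrow> 'p \<Rightarrow> 'b"

record ('o, 'a, 'p, 'b, 'k) stable_module = "('o, 'a, 'p, 'b, 'k) braided_module" +
  Twi :: "'p \<Rightarrow> 'b"

context
  fixes \<M> :: "('o, 'a, 'p, 'b, 'k, 'z) module_category_scheme" (structure)
    and B :: "('o, 'a, 'k, 'y) monoidal_scheme"
begin

definition MasInv :: "'o \<Rightarrow> 'o \<Rightarrow> 'p \<Rightarrow> 'b" where
  "MasInv X Y M = Inv \<M> ((X \<otimes>\<^bsub>B\<^esub> Y) \<rhd> M) (X \<rhd> (Y \<rhd> M)) (Mas \<M> X Y M)"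

definition MunInv :: "'p \<Rightarrow> 'b" where
  "MunInv M = Inv \<M> (\<one>\<^bsub>B\<^esub> \<rhd> M) M (Mun \<M> M)"

end

locale linear_module_category = linear_category \<M> + B: linear_monoidal_category B
  for \<M> :: "('o, 'a, 'p, 'b, 'k::field, 'z) module_category_scheme" (structure)
    and B :: "('o, 'a, 'k, 'y) monoidal_scheme" +
  assumes act_ob: "\<lbrakk>X \<in> Ob B; M \<in> Ob \<M>\<rbrakk> \<Longrightarrow> X \<rhd> M \<in> Ob \<M>"
    and aar_hom: "\<lbrakk>X \<in> Ob B; Y \<in> Ob B; M \<in> Ob \<M>; N \<in> Ob \<M>; f \<in> Hom B X Y; u \<in> Hom \<M> M N\<rbrakk>
      \<Longrightarrow> f \<bullet> u \<in> Hom \<M> (X \<rhd> M) (Y \<rhd> N)"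
    and aar_ide: "\<lbrakk>X \<in> Ob B; M \<in> Ob \<M>\<rbrakk> \<Longrightarrow> Ide B X \<bullet> Ide \<M> M = Ide \<M> (X \<rhd> M)"
    and aar_cmp: "\<lbrakk>X \<in> Ob B; Y \<in> Ob B; Z \<in> Ob B; M \<in> Ob \<M>; N \<in> Ob \<M>; P \<in> Ob \<M>;
        f \<in> Hom B X Y; f' \<in> Hom B Y Z; u \<in> Hom \<M> M N; u' \<in> Hom \<M> N P\<rbrakk>
      \<Longrightarrow> (f' \<cdot>\<^bsub>B\<^esub> f) \<bullet> (u' \<cdot> u) = (f' \<bullet> u') \<cdot> (f \<bullet> u)"
    and aar_add_left: "\<lbrakk>X \<in> Ob B; Y \<in> Ob B; M \<in> Ob \<M>; N \<in> Ob \<M>;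
        f \<in> Hom B X Y; f' \<in> Hom B X Y; u \<in> Hom \<M> M N\<rbrakk>
      \<Longrightarrow> (f \<oplus>\<^bsub>B\<^esub> f') \<bullet> u = (f \<bullet> u) \<oplus> (f' \<bullet> u)"
    and aar_add_right: "\<lbrakk>X \<in> Ob B; Y \<in> Ob B; M \<in> Ob \<M>; N \<in> Ob \<M>;
        f \<in> Hom B X Y; u \<in> Hom \<M> M N; u' \<in> Hom \<M> M N\<rbrakk>
      \<Longrightarrow> f \<bullet> (u \<oplus> u') = (f \<bullet> u) \<oplus> (f \<bullet> u')"
    and aar_smul_left: "\<lbrakk>X \<in> Ob B; Y \<in> Ob B; M \<in> Ob \<M>; N \<in> Ob \<M>; f \<in> Hom B X Y; u \<in> Hom \<M> M N\<rbrakk>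
      \<Longrightarrow> Smul B c f \<bullet> u = Smul \<M> c (f \<bullet> u)"
    and aar_smul_right: "\<lbrakk>X \<in> Ob B; Y \<in> Ob B; M \<in> Ob \<M>; N \<in> Ob \<M>; f \<in> Hom B X Y; u \<in> Hom \<M> M N\<rbrakk>
      \<Longrightarrow> f \<bullet> Smul \<M> c u = Smul \<M> c (f \<bullet> u)"
    and mas_iso: "\<lbrakk>X \<in> Ob B; Y \<in> Ob B; M \<in> Ob \<M>\<rbrakk>
      \<Longrightarrow> is_iso \<M> ((X \<otimes>\<^bsub>B\<^esub> Y) \<rhd> M) (X \<rhd> (Y \<rhd> M)) (Mas \<M> X Y M)"
    and mas_nat: "\<lbrakk>X \<in> Ob B; Y \<in> Ob B; X' \<in> Ob B; Y' \<in> Ob B; M \<in> Ob \<M>; N \<in> Ob \<M>;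
        f \<in> Hom B X X'; f' \<in> Hom B Y Y'; u \<in> Hom \<M> M N\<rbrakk>
      \<Longrightarrow> Mas \<M> X' Y' N \<cdot> ((f \<star>\<^bsub>B\<^esub> f') \<bullet> u) = (f \<bullet> (f' \<bullet> u)) \<cdot> Mas \<M> X Y M"
    and mun_iso: "M \<in> Ob \<M> \<Longrightarrow> is_iso \<M> (\<one>\<^bsub>B\<^esub> \<rhd> M) M (Mun \<M> M)"
    and mun_nat: "\<lbrakk>M \<in> Ob \<M>; N \<in> Ob \<M>; u \<in> Hom \<M> M N\<rbrakk>
      \<Longrightarrow> Mun \<M> N \<cdot> (Ide B \<one>\<^bsub>B\<^esub> \<bullet> u) = u \<cdot> Mun \<M> M"
    and mas_pentagon: "\<lbrakk>X \<in> Ob B; Y \<in> Ob B; Z \<in> Ob B; M \<in> Ob \<M>\<rbrakk>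
      \<Longrightarrow> Mas \<M> X Y (Z \<rhd> M) \<cdot> Mas \<M> (X \<otimes>\<^bsub>B\<^esub> Y) Z M
        = (Ide B X \<bullet> Mas \<M> Y Z M) \<cdot> Mas \<M> X (Y \<otimes>\<^bsub>B\<^esub> Z) M \<cdot> (Asc B X Y Z \<bullet> Ide \<M> M)"
    and mun_triangle: "\<lbrakk>X \<in> Ob B; M \<in> Ob \<M>\<rbrakk>
      \<Longrightarrow> (Ide B X \<bullet> Mun \<M> M) \<cdot> Mas \<M> X \<one>\<^bsub>B\<^esub> M = Run B X \<bullet> Ide \<M> M"

locale braided_module_category = linear_module_category \<M> B + B: rigid_braided_category B
  for \<M> :: "('o, 'a, 'p, 'b, 'k::field, 'z) braided_module_scheme" (structure)
    and B :: "('o, 'a, 'k, 'y) braided_scheme" +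
  assumes bra_iso: "\<lbrakk>X \<in> Ob B; M \<in> Ob \<M>\<rbrakk> \<Longrightarrow> is_iso \<M> (X \<rhd> M) (X \<rhd> M) (Bra \<M> X M)"
    and bra_nat: "\<lbrakk>X \<in> Ob B; Y \<in> Ob B; M \<in> Ob \<M>; N \<in> Ob \<M>; f \<in> Hom B X Y; u \<in> Hom \<M> M N\<rbrakk>
      \<Longrightarrow> Bra \<M> Y N \<cdot> (f \<bullet> u) = (f \<bullet> u) \<cdot> Bra \<M> X M"
    and bra_act: "\<lbrakk>X \<in> Ob B; Y \<in> Ob B; M \<in> Ob \<M>\<rbrakk>
      \<Longrightarrow> Bra \<M> Y (X \<rhd> M)
        = Mas \<M> Y X M \<cdot> (BraidInv B X Y \<bullet> Ide \<M> M) \<cdot> MasInv \<M> B X Y M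
          \<cdot> (Ide B X \<bullet> Bra \<M> Y M)
          \<cdot> Mas \<M> X Y M \<cdot> (BraidInv B Y X \<bullet> Ide \<M> M) \<cdot> MasInv \<M> B Y X M"
    and bra_ten: "\<lbrakk>X \<in> Ob B; Y \<in> Ob B; M \<in> Ob \<M>\<rbrakk>
      \<Longrightarrow> Bra \<M> (Y \<otimes>\<^bsub>B\<^esub> X) M
        = MasInv \<M> B Y X M \<cdot> Bra \<M> Y (X \<rhd> M) \<cdot> (Ide B Y \<bullet> Bra \<M> X M) \<cdot> Mas \<M> Y X M"

locale stable_braided_module_category = braided_module_category \<M> B
  for \<M> :: "('o, 'a, 'p, 'b, 'k::field, 'z) stable_module_scheme" (structure)
    and B :: "('o, 'a, 'k, 'y) braided_scheme" +
  assumes twi_auto: "identity_automorphism \<M> (Twi \<M>)"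
    and bra_twi: "\<lbrakk>X \<in> Ob B; M \<in> Ob \<M>\<rbrakk>
      \<Longrightarrow> Bra \<M> X M = Twi \<M> (X \<rhd> M) \<cdot> Inv \<M> (X \<rhd> M) (X \<rhd> M) (Ide B X \<bullet> Twi \<M> M)"


subsection \<open>\<open>HH(B)\<close> as a stable braided module\<close>

context
  fixes B :: "('o, 'a, 'k, 'z) braided_scheme" (structure)
begin

text \<open>
  The half-braiding of \<open>X \<cdot> M\<close> given by
  \<open>\<tau>\<^bold>\<bullet>\<^sub>Y\<^sub>,\<^sub>X\<^sub>\<cdot>\<^sub>M = (Id \<otimes> \<tau>\<^bold>\<bullet>\<^sub>Y\<^sub>,\<^sub>M)(\<tau>\<^sup>-\<^sup>1\<^sub>Y\<^sub>,\<^sub>X \<otimes> Id) : Y \<otimes> X \<otimes> M \<rightarrow> X \<otimes> M \<otimes> Y\<^sup>#\<close>.  Since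
  objects of \<open>HH(B)\<close> carry the maps \<open>\<tau>\<^bold>\<bullet>\<^sub>M\<^sub>,\<^sub>Z : M \<otimes> Z \<rightarrow> \<^sup>#Z \<otimes> M\<close>, what is written down is the
  inverse of this composite for \<open>Y = \<^sup>#Z\<close>.
\<close>

definition HH_act :: "'o \<Rightarrow> 'o \<times> ('o \<Rightarrow> 'a) \<Rightarrow> 'o \<times> ('o \<Rightarrow> 'a)" where
  "HH_act = (\<lambda>X (M, t). (X \<otimes> M, \<lambda>Z \<in> Ob B.
    Asc B (sharp B Z) X M \<cdot> (Braid B X (sharp B Z) \<star> Ide B M) \<cdot> AscInv B X (sharp B Z) M
      \<cdot> (Ide B X \<star> t Z) \<cdot> Asc B X M Z))"

definition HH_module :: "('o, 'a, 'o \<times> ('o \<Rightarrow> 'a), 'a, 'k) stable_module" where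
  "HH_module = \<lparr>
    Ob = Ob (HH B),
    Hom = Hom (HH B),
    Ide = Ide (HH B),
    Cmp = Cmp (HH B),
    Zer = Zer (HH B),
    Add = Add (HH B),
    Smul = Smul (HH B),
    Act = HH_act,
    Aar = Tar B,
    Mas = \<lambda>X Y (M, t). Asc B X Y M,
    Mun = \<lambda>(M, t). Lun B M,
    Bra = \<lambda>X M. Cmp (HH B) (HH_twist B (HH_act X M))
      (Inv (HH B) (HH_act X M) (HH_act X M) (Ide B X \<star> HH_twist B M)),
    Twi = HH_twist B \<rparr>"

end


section \<open>Anti-Yetter-Drinfeld modules\<close>

context
  fixes \<M> :: "('o, 'a, 'p, 'b, 'k, 'z) braided_module_scheme" (structure)
    and B :: "('o, 'a, 'k, 'y) braided_scheme"
begin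

definition is_module_over :: "'o \<Rightarrow> 'a \<Rightarrow> 'a \<Rightarrow> 'p \<Rightarrow> 'b \<Rightarrow> bool" where
  "is_module_over A m u M r \<longleftrightarrow>
    M \<in> Ob \<M> \<and> r \<in> Hom \<M> (A \<rhd> M) M \<and>
    r \<cdot> (m \<bullet> Ide \<M> M) = r \<cdot> (Ide B A \<bullet> r) \<cdot> Mas \<M> A A M \<and>
    r \<cdot> (u \<bullet> Ide \<M> M) = Mun \<M> M"

text \<open>
  The counit \<open>X \<cdot> \<^sup>*X \<cdot> M \<rightarrow> M\<close> and the unit \<open>M \<rightarrow> \<^sup>*X \<cdot> X \<cdot> M\<close> of the adjunction between \<open>X \<cdot> -\<close> and
  \<open>\<^sup>*X \<cdot> -\<close>, and the morphism \<open>N \<rightarrow> \<^sup>*X \<cdot> P\<close> with adjoint \<open>f : X \<cdot> N \<rightarrow> P\<close>.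
\<close>

definition act_ev :: "'o \<Rightarrow> 'p \<Rightarrow> 'b" where
  "act_ev X M = Mun \<M> M \<cdot> (ev_right B X \<bullet> Ide \<M> M) \<cdot> MasInv \<M> B X (rdual B X) M"

definition act_coev :: "'o \<Rightarrow> 'p \<Rightarrow> 'b" where
  "act_coev X M = Mas \<M> (rdual B X) X M \<cdot> (coev_right B X \<bullet> Ide \<M> M) \<cdot> MunInv \<M> B M"

definition act_curry :: "'o \<Rightarrow> 'p \<Rightarrow> 'b \<Rightarrow> 'b" where
  "act_curry X N f = (Ide B (rdual B X) \<bullet> f) \<cdot> act_coev X N"

context
  fixes H :: "('o, 'a) hopf"
begin

abbreviation (input) "Hc \<equiv> carr H"
abbreviation (input) "Hd \<equiv> rdual B (carr H)"

definition r1 :: "'p \<Rightarrow> 'b" where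
  "r1 M = act_curry Hc (Hc \<rhd> Hd \<rhd> M)
    (act_ev Hc M \<cdot> (mul H \<bullet> Ide \<M> (Hd \<rhd> M)) \<cdot> MasInv \<M> B Hc Hc (Hd \<rhd> M))"

definition r0 :: "'p \<Rightarrow> 'b \<Rightarrow> 'b" where
  "r0 M r = act_curry Hc (Hc \<rhd> Hd \<rhd> M)
    (r \<cdot> (Ide B Hc \<bullet> act_ev Hc M) \<cdot> Mas \<M> Hc Hc (Hd \<rhd> M)
      \<cdot> ((Ide B Hc \<star>\<^bsub>B\<^esub> mul H) \<bullet> Ide \<M> (Hd \<rhd> M))
      \<cdot> ((Ide B Hc \<star>\<^bsub>B\<^esub> (antipode H \<star>\<^bsub>B\<^esub> Ide B Hc)) \<bullet> Ide \<M> (Hd \<rhd> M))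
      \<cdot> (Asc B Hc Hc Hc \<bullet> Ide \<M> (Hd \<rhd> M))
      \<cdot> ((comul H \<star>\<^bsub>B\<^esub> Ide B Hc) \<bullet> Ide \<M> (Hd \<rhd> M))
      \<cdot> (Braid B Hc Hc \<bullet> Ide \<M> (Hd \<rhd> M))
      \<cdot> MasInv \<M> B Hc Hc (Hd \<rhd> M))"

definition aYD_act :: "'p \<Rightarrow> 'b \<Rightarrow> 'b" where
  "aYD_act M r = r1 M \<cdot> Bra \<M> Hc (Hd \<rhd> M) \<cdot> (Ide B Hc \<bullet> r0 M r)
    \<cdot> Mas \<M> Hc Hc (Hd \<rhd> M) \<cdot> (comul H \<bullet> Ide \<M> (Hd \<rhd> M))"

text \<open>Objects are triples \<open>(M, r, q)\<close> of an object, its action by \<open>H\<close> and its action by \<open>\<^sup>*H\<close>.\<close>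

definition aYD :: "('p \<times> 'b \<times> 'b, 'b, 'k) category" where
  "aYD = \<lparr>
    Ob = {(M, r, q).
      is_module_over Hc (mul H) (unt H) M r \<and>
      is_module_over Hd (dual_mul B H) (dual_unt B H) M q \<and>
      r \<cdot> (Ide B Hc \<bullet> q) = q \<cdot> aYD_act M r},
    Hom = \<lambda>(M, r, q) (M', r', q'). {f \<in> Hom \<M> M M'.
      f \<cdot> r = r' \<cdot> (Ide B Hc \<bullet> f) \<and> f \<cdot> q = q' \<cdot> (Ide B Hd \<bullet> f)},
    Ide = \<lambda>(M, r, q). Ide \<M> M,
    Cmp = Cmp \<M>,
    Zer = \<lambda>(M, r, q) (M', r', q'). Zer \<M> M M',
    Add = Add \<M>,
    Smul = Smul \<M> \<rparr>"

end

end

definition aYD_twist ::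
  "('o, 'a, 'p, 'b, 'k, 'z) stable_module_scheme \<Rightarrow> ('o, 'a, 'k, 'y) braided_scheme
    \<Rightarrow> ('o, 'a) hopf \<Rightarrow> 'p \<times> 'b \<times> 'b \<Rightarrow> 'b" where
  "aYD_twist \<M> B H = (\<lambda>(M, r, q).
    q \<cdot>\<^bsub>\<M>\<^esub> (Ide B (rdual B (carr H)) \<bullet>\<^bsub>\<M>\<^esub> r) \<cdot>\<^bsub>\<M>\<^esub> act_coev \<M> B (carr H) M \<cdot>\<^bsub>\<M>\<^esub> Twi \<M> M)"

end

(* A half braiding t on M is the same as a family G of maps G e : Y (M X) -> M, one for each pairing
   e : X Y -> 1, natural in X and Y, normalised at the unit and multiplicative for nested pairings; t X is
   the mate of G (ev_right X).  Invertibility of t is automatic, the twist is G (ev_left M) composed with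
   coev_left M, and the iterated duals of the definition of HH disappear.

   For an anti-Yetter-Drinfeld module (M, r, q) over HH(B), the pairing action over H-modules of
   e : V W -> 1 is q o JC e, where JC e : W (M V) -> *H M is obtained from G applied to e(v, h w),
   a pairing of V H with W, by dualising h.  Linearity of q o JC e over H is the anti-Yetter-Drinfeld
   condition, through the identity act_M (H JC e) = JC e h (lemma JC_linear).  Conversely, restricting a
   pairing action over H-modules to trivial modules gives the structure in HH(B), and its value on
   the evaluation of the regular module gives q; because the action H W -> W of a module is H-linear for
   the regular action on H, naturality shows that these two pieces determine the whole action.

   Equations between long composites are checked by reflection: a composite is translated to a list of
   layers of a string diagram, and a recorded list of elementary moves is replayed on it. *)

theory Submission imports Defs begin

section \<open>Typed arrows and strictification\<close>

text \<open>Why pairings. A half braiding over \<open>Hmod\<close> lands in a double dual whose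
  action involves the inverse antipode, whereas a pairing of modules is simply a linear pairing in
  \<open>B\<close>; once duals are gone, the structures over \<open>B\<close> and over
  \<open>Hmod\<close> can be compared directly. Where the condition comes from. If \<open>h\<close>
  acts diagonally on \<open>w m v\<close>, the functional \<open>h' |-> e(v, h' w)\<close> turns
  into \<open>h' |-> e(h_3 v, h' h_1 w)\<close> and \<open>m\<close> into \<open>h_2 m\<close>.
  Linearity of \<open>e\<close> rewrites the former as \<open>e(v, S(h_3) h' h_1 w)\<close>, the
  twisted translate that occurs in \<open>act\<close>. In a braided category the factor
  \<open>h_1\<close> has to travel from the strand of \<open>w\<close> to that of \<open>h'\<close>,
  through \<open>G\<close>; this costs an action of \<open>ev_left H\<close>, and that is the role
  of \<open>E\<close> in the definition of \<open>act\<close>. The obstacle. \<open>Hmod\<close>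
  carries no braiding, so strands of modules cannot be crossed at will. Crossings with trivial
  modules are linear, and these together with the regular module suffice for the
  reconstruction.\<close>

datatype ('o, 'a) ar = Ar (src: 'o) (val: 'a) (trg: 'o)

text \<open>Endpoints travel with the value because hom-sets may overlap. Composability is not
  checked here; it is a side condition of the lemmas.\<close>

definition cm :: "('o, 'a, 'k, 'z) category_scheme \<Rightarrow> ('o, 'a) ar \<Rightarrow> ('o, 'a) ar \<Rightarrow> ('o, 'a) ar"
    (infixr \<open>\<odot>\<index>\<close> 55) where
  "cm D g f = Ar (src f) (Cmp D (val g) (val f)) (trg g)"

context
  fixes D :: "('o, 'a, 'k, 'z) category_scheme" (structure)
begin

definition arr :: "('o, 'a) ar \<Rightarrow> bool" where
  "arr f \<longleftrightarrow> src f \<in> Ob D \<and> trg f \<in> Ob D \<and> val f \<in> Hom D (src f) (trg f)"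

definition idn :: "'o \<Rightarrow> ('o, 'a) ar" where
  "idn X = Ar X (Ide D X) X"

definition inv_ar :: "('o, 'a) ar \<Rightarrow> ('o, 'a) ar" where
  "inv_ar f = Ar (trg f) (Inv D (src f) (trg f) (val f)) (src f)"

definition iso_ar :: "('o, 'a) ar \<Rightarrow> bool" where
  "iso_ar f \<longleftrightarrow> src f \<in> Ob D \<and> trg f \<in> Ob D \<and> is_iso D (src f) (trg f) (val f)"

end

lemma cm_simps [simp]: "src (cm D g f) = src f" "trg (cm D g f) = trg g"
    "val (cm D g f) = Cmp D (val g) (val f)"
  and idn_simps [simp]: "src (idn D X) = X" "trg (idn D X) = X" "val (idn D X) = Ide D X"
  and inv_ar_simps [simp]: "src (inv_ar D f) = trg f" "trg (inv_ar D f) = src f"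
    "val (inv_ar D f) = Inv D (src f) (trg f) (val f)"
  by (simp_all add: cm_def idn_def inv_ar_def)

context linear_category
begin

lemma arr_cm [simp]: "\<lbrakk>arr C f; arr C g; trg f = src g\<rbrakk> \<Longrightarrow> arr C (g \<odot> f)"
  by (auto simp: arr_def intro: cmp_hom)

lemma arr_idn [simp]: "X \<in> Ob C \<Longrightarrow> arr C (idn C X)"
  by (auto simp: arr_def ide_hom)

lemma cm_assoc: "\<lbrakk>arr C f; arr C g; arr C h; trg f = src g; trg g = src h\<rbrakk>
    \<Longrightarrow> (h \<odot> g) \<odot> f = h \<odot> (g \<odot> f)"
  by (auto simp: arr_def cm_def intro: cmp_assoc)

lemma idn_cm: "\<lbrakk>arr C f; trg f = X\<rbrakk> \<Longrightarrow> idn C X \<odot> f = f"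
  by (cases f) (auto simp: arr_def cm_def idn_def ide_left)

lemma cm_idn: "\<lbrakk>arr C f; src f = X\<rbrakk> \<Longrightarrow> f \<odot> idn C X = f"
  by (cases f) (auto simp: arr_def cm_def idn_def ide_right)

lemma inverse_pair_unique:
  assumes "inverse_pair C X Y f g" "inverse_pair C X Y f h" "X \<in> Ob C" "Y \<in> Ob C"
  shows "g = h"
proof -
  have "g = g \<cdot> (f \<cdot> h)" using assms by (simp add: inverse_pair_def ide_right)
  also have "\<dots> = (g \<cdot> f) \<cdot> h"
    using assms cmp_assoc[of Y X Y X h f g] by (simp add: inverse_pair_def)
  also have "\<dots> = h" using assms by (simp add: inverse_pair_def ide_left)
  finally show ?thesis .
qed

lemma Inv_eqI: "\<lbrakk>inverse_pair C X Y f g; X \<in> Ob C; Y \<in> Ob C\<rbrakk> \<Longrightarrow> Inv C X Y f = g"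
  unfolding Inv_def by (blast intro: the_equality inverse_pair_unique)

lemma inverse_pair_Inv: "\<lbrakk>is_iso C X Y f; X \<in> Ob C; Y \<in> Ob C\<rbrakk> \<Longrightarrow> inverse_pair C X Y f (Inv C X Y f)"
  using Inv_eqI unfolding is_iso_def by blast

lemma iso_ar_arr: "iso_ar C f \<Longrightarrow> arr C f" "iso_ar C f \<Longrightarrow> arr C (inv_ar C f)"
  using inverse_pair_Inv by (auto simp: iso_ar_def arr_def inverse_pair_def is_iso_def)

lemma inv_ar_cm: "iso_ar C f \<Longrightarrow> inv_ar C f \<odot> f = idn C (src f)"
  "iso_ar C f \<Longrightarrow> f \<odot> inv_ar C f = idn C (trg f)"
  using inverse_pair_Inv by (auto simp: iso_ar_def inverse_pair_def cm_def idn_def)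

lemma inv_cm2: "\<lbrakk>iso_ar C f; arr C h; trg h = src f\<rbrakk> \<Longrightarrow> inv_ar C f \<odot> f \<odot> h = h"
  by (simp add: cm_assoc[symmetric] iso_ar_arr inv_ar_cm idn_cm)

lemma cm_inv2: "\<lbrakk>iso_ar C f; arr C h; trg h = trg f\<rbrakk> \<Longrightarrow> f \<odot> inv_ar C f \<odot> h = h"
  by (simp add: cm_assoc[symmetric] iso_ar_arr inv_ar_cm idn_cm)

lemma iso_cancel_left: "\<lbrakk>iso_ar C f; arr C g; arr C h; trg g = src f; trg h = src f; f \<odot> g = f \<odot> h\<rbrakk> \<Longrightarrow> g = h"
  by (metis inv_cm2)

lemma iso_cancel_right: "\<lbrakk>iso_ar C f; arr C g; arr C h; src g = trg f; src h = trg f; g \<odot> f = h \<odot> f\<rbrakk> \<Longrightarrow> g = h"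
  by (metis cm_assoc cm_idn inv_ar_cm(2) inv_ar_simps(1) inv_ar_simps(2) iso_ar_arr(1) iso_ar_arr(2))

end

section \<open>Tensor products of typed arrows and the coherence of unitors\<close>

definition tn :: "('o, 'a, 'k, 'z) monoidal_scheme \<Rightarrow> ('o, 'a) ar \<Rightarrow> ('o, 'a) ar \<Rightarrow> ('o, 'a) ar"
    (infixr \<open>\<oslash>\<index>\<close> 70) where
  "tn D f g = Ar (Ten D (src f) (src g)) (Tar D (val f) (val g)) (Ten D (trg f) (trg g))"

context
  fixes D :: "('o, 'a, 'k, 'z) monoidal_scheme" (structure)
begin

definition asc where "asc X Y Z = Ar ((X \<otimes> Y) \<otimes> Z) (Asc D X Y Z) (X \<otimes> (Y \<otimes> Z))"
definition asci where "asci X Y Z = Ar (X \<otimes> (Y \<otimes> Z)) (AscInv D X Y Z) ((X \<otimes> Y) \<otimes> Z)"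
definition lun where "lun X = Ar (\<one> \<otimes> X) (Lun D X) X"
definition luni where "luni X = Ar X (LunInv D X) (\<one> \<otimes> X)"
definition run where "run X = Ar (X \<otimes> \<one>) (Run D X) X"
definition runi where "runi X = Ar X (RunInv D X) (X \<otimes> \<one>)"

end

lemma tn_simps [simp]: "src (tn D f g) = Ten D (src f) (src g)" "trg (tn D f g) = Ten D (trg f) (trg g)"
  "val (tn D f g) = Tar D (val f) (val g)" by (simp_all add: tn_def)

lemma asc_simps [simp]:
  "src (asc D X Y Z) = Ten D (Ten D X Y) Z" "trg (asc D X Y Z) = Ten D X (Ten D Y Z)" "val (asc D X Y Z) = Asc D X Y Z"
  "src (asci D X Y Z) = Ten D X (Ten D Y Z)" "trg (asci D X Y Z) = Ten D (Ten D X Y) Z" "val (asci D X Y Z) = AscInv D X Y Z"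
  "src (lun D X) = Ten D (Uni D) X" "trg (lun D X) = X" "val (lun D X) = Lun D X"
  "src (luni D X) = X" "trg (luni D X) = Ten D (Uni D) X" "val (luni D X) = LunInv D X"
  "src (run D X) = Ten D X (Uni D)" "trg (run D X) = X" "val (run D X) = Run D X"
  "src (runi D X) = X" "trg (runi D X) = Ten D X (Uni D)" "val (runi D X) = RunInv D X"
  by (simp_all add: asc_def asci_def lun_def luni_def run_def runi_def)

context linear_monoidal_category
begin

declare uni_ob [simp] ten_ob [simp]

lemma arr_tn [simp]: "\<lbrakk>arr D f; arr D g\<rbrakk> \<Longrightarrow> arr D (f \<oslash> g)"
  by (auto simp: arr_def intro: tar_hom)

lemma arr_ob [simp]: "arr D f \<Longrightarrow> src f \<in> Ob D" "arr D f \<Longrightarrow> trg f \<in> Ob D"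
  by (auto simp: arr_def)

lemma tn_idn [simp]: "\<lbrakk>X \<in> Ob D; Y \<in> Ob D\<rbrakk> \<Longrightarrow> idn D X \<oslash> idn D Y = idn D (X \<otimes> Y)"
  by (simp add: tn_def idn_def tar_ide)

lemma tn_cm: "\<lbrakk>arr D f; arr D g; arr D f'; arr D g'; trg f = src g; trg f' = src g'\<rbrakk>
    \<Longrightarrow> (g \<oslash> g') \<odot> (f \<oslash> f') = (g \<odot> f) \<oslash> (g' \<odot> f')"
  using tar_cmp[of "src f" "trg f" "trg g" "src f'" "trg f'" "trg g'" "val f" "val g" "val f'" "val g'"]
  by (simp add: tn_def cm_def arr_def del: arr_ob)

lemma tn_cm2: "\<lbrakk>arr D f; arr D g; arr D f'; arr D g'; arr D h; trg f = src g; trg f' = src g'; trg h = src f \<otimes> src f'\<rbrakk>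
    \<Longrightarrow> (g \<oslash> g') \<odot> (f \<oslash> f') \<odot> h = ((g \<odot> f) \<oslash> (g' \<odot> f')) \<odot> h"
  by (simp add: cm_assoc[symmetric] tn_cm)

lemma asci_inv: "asci D X Y Z = inv_ar D (asc D X Y Z)"
  and luni_inv: "luni D X = inv_ar D (lun D X)"
  and runi_inv: "runi D X = inv_ar D (run D X)"
  by (simp_all add: inv_ar_def asci_def luni_def runi_def AscInv_def LunInv_def RunInv_def)

lemma iso_asc [simp]: "\<lbrakk>X \<in> Ob D; Y \<in> Ob D; Z \<in> Ob D\<rbrakk> \<Longrightarrow> iso_ar D (asc D X Y Z)"
  and iso_lun [simp]: "X \<in> Ob D \<Longrightarrow> iso_ar D (lun D X)"
  and iso_run [simp]: "X \<in> Ob D \<Longrightarrow> iso_ar D (run D X)"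
  by (simp_all add: iso_ar_def asc_iso lun_iso run_iso)

lemma arr_asc [simp]: "\<lbrakk>X \<in> Ob D; Y \<in> Ob D; Z \<in> Ob D\<rbrakk> \<Longrightarrow> arr D (asc D X Y Z)"
  "\<lbrakk>X \<in> Ob D; Y \<in> Ob D; Z \<in> Ob D\<rbrakk> \<Longrightarrow> arr D (asci D X Y Z)"
  "X \<in> Ob D \<Longrightarrow> arr D (lun D X)" "X \<in> Ob D \<Longrightarrow> arr D (luni D X)"
  "X \<in> Ob D \<Longrightarrow> arr D (run D X)" "X \<in> Ob D \<Longrightarrow> arr D (runi D X)"
  by (simp_all add: iso_ar_arr asci_inv luni_inv runi_inv)

lemma str_inv [simp]:
  "\<lbrakk>X \<in> Ob D; Y \<in> Ob D; Z \<in> Ob D\<rbrakk> \<Longrightarrow> asc D X Y Z \<odot> asci D X Y Z = idn D (X \<otimes> (Y \<otimes> Z))"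
  "\<lbrakk>X \<in> Ob D; Y \<in> Ob D; Z \<in> Ob D\<rbrakk> \<Longrightarrow> asci D X Y Z \<odot> asc D X Y Z = idn D ((X \<otimes> Y) \<otimes> Z)"
  "X \<in> Ob D \<Longrightarrow> lun D X \<odot> luni D X = idn D X" "X \<in> Ob D \<Longrightarrow> luni D X \<odot> lun D X = idn D (\<one> \<otimes> X)"
  "X \<in> Ob D \<Longrightarrow> run D X \<odot> runi D X = idn D X" "X \<in> Ob D \<Longrightarrow> runi D X \<odot> run D X = idn D (X \<otimes> \<one>)"
  by (simp_all add: inv_ar_cm asci_inv luni_inv runi_inv)

lemma str_inv2 [simp]:
  "\<lbrakk>X \<in> Ob D; Y \<in> Ob D; Z \<in> Ob D; arr D h; trg h = X \<otimes> (Y \<otimes> Z)\<rbrakk> \<Longrightarrow> asc D X Y Z \<odot> asci D X Y Z \<odot> h = h"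
  "\<lbrakk>X \<in> Ob D; Y \<in> Ob D; Z \<in> Ob D; arr D h; trg h = (X \<otimes> Y) \<otimes> Z\<rbrakk> \<Longrightarrow> asci D X Y Z \<odot> asc D X Y Z \<odot> h = h"
  "\<lbrakk>X \<in> Ob D; arr D h; trg h = X\<rbrakk> \<Longrightarrow> lun D X \<odot> luni D X \<odot> h = h"
  "\<lbrakk>X \<in> Ob D; arr D h; trg h = \<one> \<otimes> X\<rbrakk> \<Longrightarrow> luni D X \<odot> lun D X \<odot> h = h"
  "\<lbrakk>X \<in> Ob D; arr D h; trg h = X\<rbrakk> \<Longrightarrow> run D X \<odot> runi D X \<odot> h = h"
  "\<lbrakk>X \<in> Ob D; arr D h; trg h = X \<otimes> \<one>\<rbrakk> \<Longrightarrow> runi D X \<odot> run D X \<odot> h = h"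
  by (simp_all add: cm_assoc[symmetric] idn_cm)

lemma asc_natural: "\<lbrakk>arr D f; arr D g; arr D h\<rbrakk>
    \<Longrightarrow> asc D (trg f) (trg g) (trg h) \<odot> ((f \<oslash> g) \<oslash> h) = (f \<oslash> (g \<oslash> h)) \<odot> asc D (src f) (src g) (src h)"
  using asc_nat[of "src f" "src g" "src h" "trg f" "trg g" "trg h" "val f" "val g" "val h"]
  by (simp add: arr_def asc_def cm_def tn_def del: arr_ob)

lemma lun_natural: "arr D f \<Longrightarrow> lun D (trg f) \<odot> (idn D \<one> \<oslash> f) = f \<odot> lun D (src f)"
  using lun_nat[of "src f" "trg f" "val f"] by (simp add: arr_def lun_def idn_def cm_def tn_def del: arr_ob)

lemma run_natural: "arr D f \<Longrightarrow> run D (trg f) \<odot> (f \<oslash> idn D \<one>) = f \<odot> run D (src f)"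
  using run_nat[of "src f" "trg f" "val f"] by (simp add: arr_def run_def idn_def cm_def tn_def del: arr_ob)

lemma pentagon_ar: "\<lbrakk>W \<in> Ob D; X \<in> Ob D; Y \<in> Ob D; Z \<in> Ob D\<rbrakk>
      \<Longrightarrow> asc D W X (Y \<otimes> Z) \<odot> asc D (W \<otimes> X) Y Z
        = (idn D W \<oslash> asc D X Y Z) \<odot> asc D W (X \<otimes> Y) Z \<odot> (asc D W X Y \<oslash> idn D Z)"
  by (simp add: asc_def idn_def cm_def tn_def pentagon)

lemma triangle_ar: "\<lbrakk>X \<in> Ob D; Y \<in> Ob D\<rbrakk>
      \<Longrightarrow> (idn D X \<oslash> lun D Y) \<odot> asc D X \<one> Y = run D X \<oslash> idn D Y"
  by (simp add: asc_def lun_def run_def idn_def cm_def tn_def triangle)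

text \<open>Kelly's argument: tensoring with the unit object is faithful.\<close>

lemma unit_left_faithful:
  assumes "arr D f" "arr D g" "src f = src g" "trg f = trg g" "idn D \<one> \<oslash> f = idn D \<one> \<oslash> g"
  shows "f = g"
proof -
  have "f \<odot> lun D (src f) = g \<odot> lun D (src f)"
    using assms lun_natural[of f] lun_natural[of g] by simp
  with assms(1-4) show ?thesis
    by (intro iso_cancel_right[of "lun D (src f)" f g]) simp_all
qed

lemma unit_right_faithful:
  assumes "arr D f" "arr D g" "src f = src g" "trg f = trg g" "f \<oslash> idn D \<one> = g \<oslash> idn D \<one>"
  shows "f = g"
proof -
  have "f \<odot> run D (src f) = g \<odot> run D (src f)"
    using assms run_natural[of f] run_natural[of g] by simp
  with assms(1-4) show ?thesis
    by (intro iso_cancel_right[of "run D (src f)" f g]) simp_all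
qed

text \<open>Kelly's derivation from pentagon and triangle. The pentagon at \<open>1, 1, X, Y\<close>
  and two triangles show that both sides agree after tensoring with the unit on the left and
  precomposing with \<open>?a\<close>; both operations can be undone.\<close>

lemma lun_asc:
  assumes [simp]: "X \<in> Ob D" "Y \<in> Ob D"
  shows "lun D (X \<otimes> Y) \<odot> asc D \<one> X Y = lun D X \<oslash> idn D Y"
proof (rule unit_left_faithful)
  let ?a = "asc D \<one> (\<one> \<otimes> X) Y \<odot> (asc D \<one> \<one> X \<oslash> idn D Y)"
  have "(idn D \<one> \<oslash> (lun D (X \<otimes> Y) \<odot> asc D \<one> X Y)) \<odot> ?a
      = (idn D \<one> \<oslash> lun D (X \<otimes> Y)) \<odot> (idn D \<one> \<oslash> asc D \<one> X Y) \<odot> ?a"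
    by (simp add: tn_cm2 idn_cm)
  also have "\<dots> = (idn D \<one> \<oslash> lun D (X \<otimes> Y)) \<odot> asc D \<one> \<one> (X \<otimes> Y) \<odot> asc D (\<one> \<otimes> \<one>) X Y"
    by (simp add: pentagon_ar)
  also have "\<dots> = (run D \<one> \<oslash> (idn D X \<oslash> idn D Y)) \<odot> asc D (\<one> \<otimes> \<one>) X Y"
    by (simp add: cm_assoc[symmetric] triangle_ar)
  also have "\<dots> = asc D \<one> X Y \<odot> ((run D \<one> \<oslash> idn D X) \<oslash> idn D Y)"
    using asc_natural[of "run D \<one>" "idn D X" "idn D Y"] by simp
  also have "\<dots> = asc D \<one> X Y \<odot> (((idn D \<one> \<oslash> lun D X) \<odot> asc D \<one> \<one> X) \<oslash> idn D Y)"
    by (simp add: triangle_ar)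
  also have "\<dots> = asc D \<one> X Y \<odot> ((idn D \<one> \<oslash> lun D X) \<oslash> idn D Y) \<odot> (asc D \<one> \<one> X \<oslash> idn D Y)"
    by (simp add: tn_cm idn_cm)
  also have "\<dots> = (asc D \<one> X Y \<odot> ((idn D \<one> \<oslash> lun D X) \<oslash> idn D Y)) \<odot> (asc D \<one> \<one> X \<oslash> idn D Y)"
    by (simp add: cm_assoc)
  also have "\<dots> = (idn D \<one> \<oslash> (lun D X \<oslash> idn D Y)) \<odot> ?a"
    using asc_natural[of "idn D \<one>" "lun D X" "idn D Y"] by (simp add: cm_assoc)
  finally have e: "(idn D \<one> \<oslash> (lun D (X \<otimes> Y) \<odot> asc D \<one> X Y)) \<odot> ?a = (idn D \<one> \<oslash> (lun D X \<oslash> idn D Y)) \<odot> ?a" .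
  \<comment> \<open>\<open>?a\<close> is cancelled through an explicit right inverse.\<close>
  have i: "?a \<odot> ((asci D \<one> \<one> X \<oslash> idn D Y) \<odot> asci D \<one> (\<one> \<otimes> X) Y) = idn D (\<one> \<otimes> ((\<one> \<otimes> X) \<otimes> Y))"
    by (simp add: cm_assoc tn_cm2 idn_cm)
  have c: "(A \<odot> ?a) \<odot> ((asci D \<one> \<one> X \<oslash> idn D Y) \<odot> asci D \<one> (\<one> \<otimes> X) Y) = A"
    if "arr D A" "src A = \<one> \<otimes> ((\<one> \<otimes> X) \<otimes> Y)" for A
    using that by (subst cm_assoc) (simp_all add: i cm_idn)
  show "idn D \<one> \<oslash> (lun D (X \<otimes> Y) \<odot> asc D \<one> X Y) = idn D \<one> \<oslash> (lun D X \<oslash> idn D Y)"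
    by (subst c[symmetric], simp, simp, subst e, rule c) simp_all
qed simp_all

text \<open>The mirror image: the pentagon at \<open>X, Y, 1, 1\<close>, with the unit tensored on
  the right.\<close>

lemma run_asc:
  assumes [simp]: "X \<in> Ob D" "Y \<in> Ob D"
  shows "(idn D X \<oslash> run D Y) \<odot> asc D X Y \<one> = run D (X \<otimes> Y)"
proof (rule unit_right_faithful)
  have "asc D X Y \<one> \<odot> (((idn D X \<oslash> run D Y) \<odot> asc D X Y \<one>) \<oslash> idn D \<one>)
      = (asc D X Y \<one> \<odot> ((idn D X \<oslash> run D Y) \<oslash> idn D \<one>)) \<odot> (asc D X Y \<one> \<oslash> idn D \<one>)"
    by (simp add: cm_assoc tn_cm idn_cm)
  also have "\<dots> = (idn D X \<oslash> (run D Y \<oslash> idn D \<one>)) \<odot> asc D X (Y \<otimes> \<one>) \<one> \<odot> (asc D X Y \<one> \<oslash> idn D \<one>)"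
    using asc_natural[of "idn D X" "run D Y" "idn D \<one>"] by (simp add: cm_assoc)
  also have "\<dots> = (idn D X \<oslash> ((idn D Y \<oslash> lun D \<one>) \<odot> asc D Y \<one> \<one>)) \<odot> asc D X (Y \<otimes> \<one>) \<one> \<odot> (asc D X Y \<one> \<oslash> idn D \<one>)"
    by (simp add: triangle_ar)
  also have "\<dots> = (idn D X \<oslash> (idn D Y \<oslash> lun D \<one>)) \<odot> (idn D X \<oslash> asc D Y \<one> \<one>) \<odot> asc D X (Y \<otimes> \<one>) \<one> \<odot> (asc D X Y \<one> \<oslash> idn D \<one>)"
    by (simp add: tn_cm2 idn_cm)
  also have "\<dots> = (idn D X \<oslash> (idn D Y \<oslash> lun D \<one>)) \<odot> asc D X Y (\<one> \<otimes> \<one>) \<odot> asc D (X \<otimes> Y) \<one> \<one>"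
    by (simp add: pentagon_ar)
  also have "\<dots> = asc D X Y \<one> \<odot> (idn D (X \<otimes> Y) \<oslash> lun D \<one>) \<odot> asc D (X \<otimes> Y) \<one> \<one>"
    using asc_natural[of "idn D X" "idn D Y" "lun D \<one>"] by (simp add: cm_assoc[symmetric])
  also have "\<dots> = asc D X Y \<one> \<odot> (run D (X \<otimes> Y) \<oslash> idn D \<one>)"
    by (simp add: triangle_ar)
  finally show "((idn D X \<oslash> run D Y) \<odot> asc D X Y \<one>) \<oslash> idn D \<one> = run D (X \<otimes> Y) \<oslash> idn D \<one>"
    using iso_cancel_left[of "asc D X Y \<one>"] by simp
qed simp_all

text \<open>Naturality of \<open>lun\<close> along \<open>lun \<one>\<close> itself, with
  \<open>lun\<close> cancelled on the left, determines \<open>lun\<close> at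
  \<open>\<one> \<otimes> \<one>\<close>; comparing \<open>lun_asc\<close> with the triangle at the
  unit then identifies the two unitors after tensoring with the unit on the right.\<close>

lemma lun_unit: "lun D \<one> = run D \<one>"
proof (rule unit_left_faithful)
  have n: "lun D (\<one> \<otimes> \<one>) = idn D \<one> \<oslash> lun D \<one>"
  proof (rule iso_cancel_left[of "lun D \<one>"])
    show "lun D \<one> \<odot> lun D (\<one> \<otimes> \<one>) = lun D \<one> \<odot> (idn D \<one> \<oslash> lun D \<one>)"
      using lun_natural[of "lun D \<one>"] by simp
  qed simp_all
  have "lun D \<one> \<oslash> idn D \<one> = run D \<one> \<oslash> idn D \<one>"
    using lun_asc[of \<one> \<one>] triangle_ar[of \<one> \<one>] n by simp
  then have "lun D \<one> = run D \<one>" by (rule unit_right_faithful[rotated -1]) simp_all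
  then show "idn D \<one> \<oslash> lun D \<one> = idn D \<one> \<oslash> run D \<one>" by simp
qed simp_all

end

section \<open>Words of objects: a strict model of the tensor product\<close>

context
  fixes D :: "('o, 'a, 'k, 'z) monoidal_scheme" (structure)
begin

text \<open>A word stands for its right-nested tensor product, closed by a unit even for a single
  letter, so that one recursion serves all lengths. Concatenation of words is strictly associative;
  \<open>phi\<close> and \<open>phii\<close> compare it with the tensor product of
  \<open>D\<close>.\<close>

primrec rt :: "'o list \<Rightarrow> 'o" where
  "rt [] = \<one>"
| "rt (x # xs) = x \<otimes> rt xs"

primrec phi :: "'o list \<Rightarrow> 'o list \<Rightarrow> ('o, 'a) ar" where
  "phi [] ys = lun D (rt ys)"
| "phi (x # xs) ys = (idn D x \<oslash> phi xs ys) \<odot> asc D x (rt xs) (rt ys)"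

primrec phii :: "'o list \<Rightarrow> 'o list \<Rightarrow> ('o, 'a) ar" where
  "phii [] ys = luni D (rt ys)"
| "phii (x # xs) ys = asci D x (rt xs) (rt ys) \<odot> (idn D x \<oslash> phii xs ys)"

definition unstr :: "('o list, 'a) ar \<Rightarrow> ('o, 'a) ar" where
  "unstr f = Ar (rt (src f)) (val f) (rt (trg f))"

definition sarr :: "('o list, 'a) ar \<Rightarrow> bool" where
  "sarr f \<longleftrightarrow> set (src f) \<subseteq> Ob D \<and> set (trg f) \<subseteq> Ob D \<and> arr D (unstr f)"

definition sid :: "'o list \<Rightarrow> ('o list, 'a) ar" where
  "sid w = Ar w (Ide D (rt w)) w"

definition scm :: "('o list, 'a) ar \<Rightarrow> ('o list, 'a) ar \<Rightarrow> ('o list, 'a) ar" where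
  "scm g f = Ar (src f) (val (unstr g \<odot> unstr f)) (trg g)"

definition stn :: "('o list, 'a) ar \<Rightarrow> ('o list, 'a) ar \<Rightarrow> ('o list, 'a) ar" where
  "stn f g = Ar (src f @ src g)
    (val (phi (trg f) (trg g) \<odot> (unstr f \<oslash> unstr g) \<odot> phii (src f) (src g))) (trg f @ trg g)"

end

lemma str_simps [simp]:
  "src (unstr D f) = rt D (src f)" "trg (unstr D f) = rt D (trg f)" "val (unstr D f) = val f"
  "src (sid D w) = w" "trg (sid D w) = w" "val (sid D w) = Ide D (rt D w)"
  "src (scm D g h) = src h" "trg (scm D g h) = trg g"
  "src (stn D g h) = src g @ src h" "trg (stn D g h) = trg g @ trg h"
  by (simp_all add: unstr_def sid_def scm_def stn_def)

lemma ar_eqI: "\<lbrakk>src f = src g; val f = val g; trg f = trg g\<rbrakk> \<Longrightarrow> f = g"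
  by (cases f; cases g) simp

lemma unstr_inj: "\<lbrakk>src f = src g; trg f = trg g; unstr D f = unstr D g\<rbrakk> \<Longrightarrow> f = g"
  by (rule ar_eqI) (auto simp: unstr_def)

context linear_monoidal_category
begin

lemma rt_ob [simp]: "set xs \<subseteq> Ob D \<Longrightarrow> rt D xs \<in> Ob D"
  by (induction xs) auto

lemma phi_st [simp]: "src (phi D xs ys) = rt D xs \<otimes> rt D ys" "trg (phi D xs ys) = rt D (xs @ ys)"
  "trg (phii D xs ys) = rt D xs \<otimes> rt D ys" "src (phii D xs ys) = rt D (xs @ ys)"
  by (induction xs) auto

lemma arr_phi [simp]:
  assumes "set xs \<subseteq> Ob D" "set ys \<subseteq> Ob D"
  shows "arr D (phi D xs ys)" "arr D (phii D xs ys)"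
  using assms by (induction xs) auto

lemma phi_phii [simp]:
  assumes "set xs \<subseteq> Ob D" "set ys \<subseteq> Ob D"
  shows "phi D xs ys \<odot> phii D xs ys = idn D (rt D (xs @ ys))"
    "phii D xs ys \<odot> phi D xs ys = idn D (rt D xs \<otimes> rt D ys)"
  using assms by (induction xs) (auto simp: cm_assoc tn_cm tn_cm2 idn_cm)

lemma phi_phii2 [simp]:
  assumes "set xs \<subseteq> Ob D" "set ys \<subseteq> Ob D" "arr D h"
  shows "trg h = rt D (xs @ ys) \<Longrightarrow> phi D xs ys \<odot> phii D xs ys \<odot> h = h"
    "trg h = rt D xs \<otimes> rt D ys \<Longrightarrow> phii D xs ys \<odot> phi D xs ys \<odot> h = h"
  using assms by (simp_all add: cm_assoc[symmetric] idn_cm)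

lemma phi_nil: "set xs \<subseteq> Ob D \<Longrightarrow> phi D xs [] = run D (rt D xs)"
  by (induction xs) (auto simp: lun_unit run_asc)

text \<open>The associativity constraint of the monoidal functor \<open>rt\<close> from words to
  \<open>D\<close>. By induction on the first word: the empty case rests on \<open>lun_asc\<close>,
  the step on the pentagon and on naturality of the associator.\<close>

lemma phi_assoc:
  assumes "set xs \<subseteq> Ob D" and [simp]: "set ys \<subseteq> Ob D" "set zs \<subseteq> Ob D"
  shows "phi D xs (ys @ zs) \<odot> (idn D (rt D xs) \<oslash> phi D ys zs) \<odot> asc D (rt D xs) (rt D ys) (rt D zs)
    = phi D (xs @ ys) zs \<odot> (phi D xs ys \<oslash> idn D (rt D zs))"
  using assms(1)
proof (induction xs)
  case Nil
  have "lun D (rt D (ys @ zs)) \<odot> (idn D \<one> \<oslash> phi D ys zs) \<odot> asc D \<one> (rt D ys) (rt D zs)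
    = (lun D (rt D (ys @ zs)) \<odot> (idn D \<one> \<oslash> phi D ys zs)) \<odot> asc D \<one> (rt D ys) (rt D zs)"
    by (simp add: cm_assoc)
  also have "\<dots> = phi D ys zs \<odot> lun D (rt D ys \<otimes> rt D zs) \<odot> asc D \<one> (rt D ys) (rt D zs)"
    using lun_natural[of "phi D ys zs"] by (simp add: cm_assoc)
  finally show ?case by (simp add: lun_asc)
next
  case (Cons x xs)
  let ?r = "rt D"
  have [simp]: "x \<in> Ob D" "set xs \<subseteq> Ob D" using Cons.prems by auto
  have "phi D (x # xs) (ys @ zs) \<odot> (idn D (?r (x # xs)) \<oslash> phi D ys zs) \<odot> asc D (?r (x # xs)) (?r ys) (?r zs)
    = (idn D x \<oslash> phi D xs (ys @ zs)) \<odot> (asc D x (?r xs) (?r (ys @ zs)) \<odot> ((idn D x \<oslash> idn D (?r xs)) \<oslash> phi D ys zs))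
      \<odot> asc D (x \<otimes> ?r xs) (?r ys) (?r zs)"
    by (simp add: cm_assoc)
  also have "\<dots> = (idn D x \<oslash> phi D xs (ys @ zs)) \<odot> (idn D x \<oslash> (idn D (?r xs) \<oslash> phi D ys zs))
      \<odot> (asc D x (?r xs) (?r ys \<otimes> ?r zs) \<odot> asc D (x \<otimes> ?r xs) (?r ys) (?r zs))"
    using asc_natural[of "idn D x" "idn D (?r xs)" "phi D ys zs"] by (simp add: cm_assoc del: tn_idn)
  also have "\<dots> = (idn D x \<oslash> (phi D xs (ys @ zs) \<odot> (idn D (?r xs) \<oslash> phi D ys zs) \<odot> asc D (?r xs) (?r ys) (?r zs)))
      \<odot> asc D x (?r xs \<otimes> ?r ys) (?r zs) \<odot> (asc D x (?r xs) (?r ys) \<oslash> idn D (?r zs))"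
    by (simp add: pentagon_ar tn_cm2 idn_cm cm_assoc)
  also have "\<dots> = (idn D x \<oslash> (phi D (xs @ ys) zs \<odot> (phi D xs ys \<oslash> idn D (?r zs))))
      \<odot> asc D x (?r xs \<otimes> ?r ys) (?r zs) \<odot> (asc D x (?r xs) (?r ys) \<oslash> idn D (?r zs))"
    by (simp add: Cons.IH)
  also have "\<dots> = (idn D x \<oslash> phi D (xs @ ys) zs) \<odot> ((idn D x \<oslash> (phi D xs ys \<oslash> idn D (?r zs)))
      \<odot> asc D x (?r xs \<otimes> ?r ys) (?r zs)) \<odot> (asc D x (?r xs) (?r ys) \<oslash> idn D (?r zs))"
    by (simp add: tn_cm2 idn_cm cm_assoc)
  also have "\<dots> = (idn D x \<oslash> phi D (xs @ ys) zs) \<odot> (asc D x (?r (xs @ ys)) (?r zs) \<odot> ((idn D x \<oslash> phi D xs ys) \<oslash> idn D (?r zs)))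
      \<odot> (asc D x (?r xs) (?r ys) \<oslash> idn D (?r zs))"
    using asc_natural[of "idn D x" "phi D xs ys" "idn D (?r zs)"] by simp
  also have "\<dots> = phi D ((x # xs) @ ys) zs \<odot> (phi D (x # xs) ys \<oslash> idn D (?r zs))"
    by (simp add: tn_cm tn_cm2 idn_cm cm_assoc)
  finally show ?case .
qed

lemma sarr_unstr [simp]: "sarr D f \<Longrightarrow> arr D (unstr D f)" "sarr D f \<Longrightarrow> set (src f) \<subseteq> Ob D"
  "sarr D f \<Longrightarrow> set (trg f) \<subseteq> Ob D"
  by (simp_all add: sarr_def)

lemma unstr_sid [simp]: "unstr D (sid D w) = idn D (rt D w)"
  by (simp add: unstr_def idn_def sid_def)

lemma unstr_scm [simp]: "\<lbrakk>sarr D f; sarr D g; trg f = src g\<rbrakk> \<Longrightarrow> unstr D (scm D g f) = unstr D g \<odot> unstr D f"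
  by (simp add: unstr_def cm_def scm_def)

lemma unstr_stn [simp]: "unstr D (stn D f g) = phi D (trg f) (trg g) \<odot> (unstr D f \<oslash> unstr D g) \<odot> phii D (src f) (src g)"
  by (rule ar_eqI) (simp_all add: stn_def)

lemma sarr_sid [simp]: "set w \<subseteq> Ob D \<Longrightarrow> sarr D (sid D w)" by (simp add: sarr_def)

lemma sarr_scm [simp]: "\<lbrakk>sarr D f; sarr D g; trg f = src g\<rbrakk> \<Longrightarrow> sarr D (scm D g f)"
  unfolding sarr_def[of _ "scm D g f"] by simp

lemma sarr_stn [simp]: "\<lbrakk>sarr D f; sarr D g\<rbrakk> \<Longrightarrow> sarr D (stn D f g)"
  unfolding sarr_def[of _ "stn D f g"] by simp

lemma scm_assoc: "\<lbrakk>sarr D f; sarr D g; sarr D h; trg f = src g; trg g = src h\<rbrakk>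
    \<Longrightarrow> scm D (scm D h g) f = scm D h (scm D g f)"
  by (rule unstr_inj[where D = D]) (simp_all add: cm_assoc)

lemma sid_scm [simp]: "\<lbrakk>sarr D f; trg f = w\<rbrakk> \<Longrightarrow> scm D (sid D w) f = f"
  by (rule unstr_inj[where D = D]) (auto simp: idn_cm)

lemma scm_sid [simp]: "\<lbrakk>sarr D f; src f = w\<rbrakk> \<Longrightarrow> scm D f (sid D w) = f"
  by (rule unstr_inj[where D = D]) (auto simp: cm_idn)

lemma stn_sid [simp]: "\<lbrakk>set u \<subseteq> Ob D; set v \<subseteq> Ob D\<rbrakk> \<Longrightarrow> stn D (sid D u) (sid D v) = sid D (u @ v)"
  by (rule unstr_inj[where D = D]) (simp_all add: idn_cm)

lemma stn_scm: "\<lbrakk>sarr D f; sarr D g; trg f = src g; sarr D f'; sarr D g'; trg f' = src g'\<rbrakk>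
    \<Longrightarrow> scm D (stn D g g') (stn D f f') = stn D (scm D g f) (scm D g' f')"
  by (rule unstr_inj[where D = D]) (simp_all add: cm_assoc tn_cm2)

lemma stn_nil_left [simp]: "sarr D f \<Longrightarrow> stn D (sid D []) f = f"
  using lun_natural[of "unstr D f"]
  by - (rule unstr_inj[where D = D], simp_all add: cm_assoc[symmetric], simp_all add: cm_assoc cm_idn)

lemma phii_nil: "set xs \<subseteq> Ob D \<Longrightarrow> phii D xs [] = runi D (rt D xs)"
proof -
  assume a: "set xs \<subseteq> Ob D"
  have "run D (rt D xs) \<odot> phii D xs [] = run D (rt D xs) \<odot> runi D (rt D xs)"
    using phi_phii(1)[of xs "[]"] a by (simp add: phi_nil)
  from this show ?thesis by (rule iso_cancel_left[of "run D (rt D xs)", rotated -1]) (use a in simp_all)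
qed

lemma stn_nil_right [simp]: "sarr D f \<Longrightarrow> stn D f (sid D []) = f"
  using run_natural[of "unstr D f"]
  by - (rule unstr_inj[where D = D]; simp add: phi_nil phii_nil cm_assoc[symmetric]; simp add: cm_assoc cm_idn)

text \<open>The inverse of \<open>phi_assoc\<close>: \<open>?q\<close> is a left inverse of
  \<open>?p\<close> and \<open>?s\<close> a right inverse, so they coincide.\<close>

lemma phii_assoc:
  assumes [simp]: "set xs \<subseteq> Ob D" "set ys \<subseteq> Ob D" "set zs \<subseteq> Ob D"
  shows "asci D (rt D xs) (rt D ys) (rt D zs) \<odot> (idn D (rt D xs) \<oslash> phii D ys zs) \<odot> phii D xs (ys @ zs)
    = (phii D xs ys \<oslash> idn D (rt D zs)) \<odot> phii D (xs @ ys) zs"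
proof -
  let ?p = "phi D (xs @ ys) zs \<odot> (phi D xs ys \<oslash> idn D (rt D zs))"
  let ?q = "(phii D xs ys \<oslash> idn D (rt D zs)) \<odot> phii D (xs @ ys) zs"
  let ?s = "asci D (rt D xs) (rt D ys) (rt D zs) \<odot> (idn D (rt D xs) \<oslash> phii D ys zs) \<odot> phii D xs (ys @ zs)"
  have 1: "?q \<odot> ?p = idn D ((rt D xs \<otimes> rt D ys) \<otimes> rt D zs)"
    by (simp add: cm_assoc tn_cm idn_cm)
  have 2: "(phi D xs (ys @ zs) \<odot> (idn D (rt D xs) \<oslash> phi D ys zs) \<odot> asc D (rt D xs) (rt D ys) (rt D zs)) \<odot> ?s
      = idn D (rt D (xs @ ys @ zs))"
    by (simp add: cm_assoc tn_cm2 idn_cm)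
  then have "?p \<odot> ?s = idn D (rt D (xs @ ys @ zs))" unfolding phi_assoc[OF assms] .
  then have "?q \<odot> (?p \<odot> ?s) = ?q" by (simp add: cm_idn)
  moreover have "?q \<odot> (?p \<odot> ?s) = (?q \<odot> ?p) \<odot> ?s" by (rule cm_assoc[symmetric]) simp_all
  ultimately show ?thesis by (simp only: 1) (simp add: idn_cm)
qed

text \<open>The two bracketings are the same tensor product conjugated by different composites of
  \<open>phi\<close>, which \<open>phi_assoc\<close> and \<open>phii_assoc\<close> identify across
  the associator.\<close>

lemma stn_assoc:
  assumes f: "sarr D f" "sarr D g" "sarr D h"
  shows "stn D (stn D f g) h = stn D f (stn D g h)"
proof (rule unstr_inj[where D = D])
  let ?f = "unstr D f" and ?g = "unstr D g" and ?h = "unstr D h"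
  note [simp] = sarr_unstr[OF f(1)] sarr_unstr[OF f(2)] sarr_unstr[OF f(3)]
  let ?a = "asc D (rt D (trg f)) (rt D (trg g)) (rt D (trg h))"
  let ?b = "asci D (rt D (src f)) (rt D (src g)) (rt D (src h))"
  have n: "?a \<odot> ((?f \<oslash> ?g) \<oslash> ?h) = (?f \<oslash> (?g \<oslash> ?h)) \<odot> asc D (rt D (src f)) (rt D (src g)) (rt D (src h))"
    using asc_natural[of ?f ?g ?h] by simp
  have "unstr D (stn D (stn D f g) h) = phi D (trg f @ trg g) (trg h) \<odot> ((phi D (trg f) (trg g) \<oslash> idn D (rt D (trg h)))
      \<odot> ((?f \<oslash> ?g) \<oslash> ?h)) \<odot> ((phii D (src f) (src g) \<oslash> idn D (rt D (src h))) \<odot> phii D (src f @ src g) (src h))"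
    by (simp add: tn_cm tn_cm2 idn_cm cm_idn cm_assoc)
  also have "\<dots> = (phi D (trg f @ trg g) (trg h) \<odot> (phi D (trg f) (trg g) \<oslash> idn D (rt D (trg h))))
      \<odot> ((?f \<oslash> ?g) \<oslash> ?h) \<odot> ((phii D (src f) (src g) \<oslash> idn D (rt D (src h))) \<odot> phii D (src f @ src g) (src h))"
    by (simp add: cm_assoc)
  also have "\<dots> = phi D (trg f) (trg g @ trg h) \<odot> (idn D (rt D (trg f)) \<oslash> phi D (trg g) (trg h)) \<odot> (?a
      \<odot> ((?f \<oslash> ?g) \<oslash> ?h)) \<odot> ?b \<odot> (idn D (rt D (src f)) \<oslash> phii D (src g) (src h)) \<odot> phii D (src f) (src g @ src h)"
    by (simp add: phi_assoc[symmetric] phii_assoc[symmetric] cm_assoc)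
  also have "\<dots> = unstr D (stn D f (stn D g h))"
    unfolding n by (simp add: tn_cm tn_cm2 idn_cm cm_idn cm_assoc)
  finally show "unstr D (stn D (stn D f g) h) = unstr D (stn D f (stn D g h))" .
qed simp_all

end

section \<open>Bracketed products and their flattening to words\<close>

datatype 'w ob = At 'w ("$_" [1000] 1000) | Ue | Tn "'w ob" "'w ob" (infixr "**" 70)

primrec flat :: "'w ob \<Rightarrow> 'w list" where
  "flat (At x) = [x]" | "flat Ue = []" | "flat (Tn a b) = flat a @ flat b"

primrec tree :: "'w list \<Rightarrow> 'w ob" where
  "tree [] = Ue" | "tree (x # xs) = Tn (At x) (tree xs)"

lemma flat_tree [simp]: "flat (tree xs) = xs" by (induction xs) simp_all

context
  fixes D :: "('o, 'a, 'k, 'z) monoidal_scheme" (structure)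
begin

primrec obj :: "'o ob \<Rightarrow> 'o" where
  "obj (At x) = x" | "obj Ue = \<one>" | "obj (Tn a b) = obj a \<otimes> obj b"

text \<open>The canonical isomorphism from a bracketed product to the right-nested product of its
  letters, with inverse \<open>kapi\<close>. A letter receives a unit on the right because
  \<open>rt [x]\<close> is \<open>x \<otimes> \<one>\<close>.\<close>

primrec kap :: "'o ob \<Rightarrow> ('o, 'a) ar" where
  "kap (At x) = runi D x"
| "kap Ue = idn D \<one>"
| "kap (Tn a b) = phi D (flat a) (flat b) \<odot> (kap a \<oslash> kap b)"

primrec kapi :: "'o ob \<Rightarrow> ('o, 'a) ar" where
  "kapi (At x) = run D x"
| "kapi Ue = idn D \<one>"
| "kapi (Tn a b) = (kapi a \<oslash> kapi b) \<odot> phii D (flat a) (flat b)"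

text \<open>Endpoints are passed as bracketings, since an object alone does not determine its
  word.\<close>

definition fl :: "'o ob \<Rightarrow> 'o ob \<Rightarrow> ('o, 'a) ar \<Rightarrow> ('o list, 'a) ar" where
  "fl a b f = Ar (flat a) (val (kap b \<odot> f \<odot> kapi a)) (flat b)"

end

lemma fl_simps [simp]: "src (fl D a b f) = flat a" "trg (fl D a b f) = flat b"
  by (simp_all add: fl_def)

context linear_monoidal_category
begin

lemma obj_ob [simp]: "set (flat a) \<subseteq> Ob D \<Longrightarrow> obj D a \<in> Ob D" by (induction a) auto

lemma kap_st [simp]: "src (kap D a) = obj D a" "trg (kap D a) = rt D (flat a)"
  "src (kapi D a) = rt D (flat a)" "trg (kapi D a) = obj D a"
  by (induction a) simp_all

lemma kap_arr [simp]: "set (flat a) \<subseteq> Ob D \<Longrightarrow> arr D (kap D a)" "set (flat a) \<subseteq> Ob D \<Longrightarrow> arr D (kapi D a)"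
  by (induction a) simp_all

lemma kap_kapi [simp]: "set (flat a) \<subseteq> Ob D \<Longrightarrow> kap D a \<odot> kapi D a = idn D (rt D (flat a))"
    "set (flat a) \<subseteq> Ob D \<Longrightarrow> kapi D a \<odot> kap D a = idn D (obj D a)"
  by (induction a) (auto simp: cm_assoc tn_cm tn_cm2 idn_cm)

lemma kap_kapi2 [simp]:
  "\<lbrakk>set (flat a) \<subseteq> Ob D; arr D h; trg h = rt D (flat a)\<rbrakk> \<Longrightarrow> kap D a \<odot> kapi D a \<odot> h = h"
  "\<lbrakk>set (flat a) \<subseteq> Ob D; arr D h; trg h = obj D a\<rbrakk> \<Longrightarrow> kapi D a \<odot> kap D a \<odot> h = h"
  by (simp_all add: cm_assoc[symmetric] idn_cm)

lemma obj_tree [simp]: "obj D (tree xs) = rt D xs" by (induction xs) auto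

lemma kap_tree [simp]: "set xs \<subseteq> Ob D \<Longrightarrow> kap D (tree xs) = idn D (rt D xs)"
proof (induction xs)
  case (Cons x xs)
  then have [simp]: "x \<in> Ob D" "set xs \<subseteq> Ob D" and IH: "kap D (tree xs) = idn D (rt D xs)" by auto
  have "(idn D x \<oslash> lun D (rt D xs)) \<odot> asc D x \<one> (rt D xs) \<odot> (runi D x \<oslash> idn D (rt D xs))
     = ((idn D x \<oslash> lun D (rt D xs)) \<odot> asc D x \<one> (rt D xs)) \<odot> (runi D x \<oslash> idn D (rt D xs))"
    by (simp add: cm_assoc)
  also have "\<dots> = idn D (x \<otimes> rt D xs)" unfolding triangle_ar[OF \<open>x \<in> Ob D\<close> rt_ob[OF \<open>set xs \<subseteq> Ob D\<close>]]
    by (simp add: tn_cm idn_cm)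
  finally show ?case by (simp add: IH cm_assoc)
qed simp

lemma kapi_tree [simp]: "set xs \<subseteq> Ob D \<Longrightarrow> kapi D (tree xs) = idn D (rt D xs)"
  using kap_kapi(2)[of "tree xs"] kap_tree[of xs] by (simp add: cm_idn)

lemma unstr_fl [simp]: "unstr D (fl D a b f) = kap D b \<odot> f \<odot> kapi D a"
  by (rule ar_eqI) (simp_all add: fl_def)

abbreviation bt :: "('o, 'a) ar \<Rightarrow> 'o ob \<Rightarrow> 'o ob \<Rightarrow> bool" where
  "bt f a b \<equiv> arr D f \<and> src f = obj D a \<and> trg f = obj D b \<and> set (flat a) \<subseteq> Ob D \<and> set (flat b) \<subseteq> Ob D"

lemma sarr_fl [simp]: "bt f a b \<Longrightarrow> sarr D (fl D a b f)"
  by (simp add: sarr_def)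

lemma fl_cm: "\<lbrakk>bt f a b; bt g b c\<rbrakk> \<Longrightarrow> fl D a c (g \<odot> f) = scm D (fl D b c g) (fl D a b f)"
  by (rule unstr_inj[where D = D]) (simp_all add: cm_assoc)

lemma fl_tn: "\<lbrakk>bt f a b; bt g a' b'\<rbrakk> \<Longrightarrow> fl D (Tn a a') (Tn b b') (f \<oslash> g) = stn D (fl D a b f) (fl D a' b' g)"
  by (rule unstr_inj[where D = D]) (simp_all add: cm_assoc tn_cm2 tn_cm)

text \<open>Conjugation by isomorphisms loses nothing, so an equation in \<open>D\<close> may be
  checked on words, where the structure isomorphisms are identities.\<close>

lemma fl_inj: "\<lbrakk>bt f a b; bt g a b; fl D a b f = fl D a b g\<rbrakk> \<Longrightarrow> f = g"
proof -
  assume 1: "bt f a b" "bt g a b" "fl D a b f = fl D a b g"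
  then have "kap D b \<odot> f \<odot> kapi D a = kap D b \<odot> g \<odot> kapi D a" by (metis unstr_fl)
  then have "(kapi D b \<odot> (kap D b \<odot> f \<odot> kapi D a)) \<odot> kap D a = (kapi D b \<odot> (kap D b \<odot> g \<odot> kapi D a)) \<odot> kap D a"
    by simp
  then show ?thesis using 1(1,2) by (simp add: cm_assoc cm_idn)
qed

lemma fl_idn: "set (flat a) \<subseteq> Ob D \<Longrightarrow> fl D a a (idn D (obj D a)) = sid D (flat a)"
  by (rule unstr_inj[where D = D]) (simp_all add: idn_cm)

text \<open>Naturality moves the associator from the bracketed products to the words; there
  \<open>phi_assoc\<close> says exactly that it becomes an identity.\<close>

lemma fl_asc:
  assumes [simp]: "set (flat a) \<subseteq> Ob D" "set (flat b) \<subseteq> Ob D" "set (flat c) \<subseteq> Ob D"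
  shows "fl D (Tn (Tn a b) c) (Tn a (Tn b c)) (asc D (obj D a) (obj D b) (obj D c)) = sid D (flat a @ flat b @ flat c)"
proof (rule unstr_inj[where D = D])
  let ?A = "flat a" and ?B = "flat b" and ?C = "flat c"
  let ?as = "asc D (obj D a) (obj D b) (obj D c)"
  have n: "(kap D a \<oslash> (kap D b \<oslash> kap D c)) \<odot> ?as
      = asc D (rt D ?A) (rt D ?B) (rt D ?C) \<odot> ((kap D a \<oslash> kap D b) \<oslash> kap D c)"
    using asc_natural[of "kap D a" "kap D b" "kap D c"] by simp
  have "unstr D (fl D (Tn (Tn a b) c) (Tn a (Tn b c)) ?as)
     = phi D ?A (?B @ ?C) \<odot> (idn D (rt D ?A) \<oslash> phi D ?B ?C) \<odot> ((kap D a \<oslash> (kap D b \<oslash> kap D c)) \<odot> ?as)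
       \<odot> ((kapi D a \<oslash> kapi D b) \<oslash> kapi D c) \<odot> (phii D ?A ?B \<oslash> idn D (rt D ?C)) \<odot> phii D (?A @ ?B) ?C"
    by (simp add: cm_assoc tn_cm tn_cm2 idn_cm cm_idn)
  also have "\<dots> = (phi D ?A (?B @ ?C) \<odot> (idn D (rt D ?A) \<oslash> phi D ?B ?C) \<odot> asc D (rt D ?A) (rt D ?B) (rt D ?C))
      \<odot> (phii D ?A ?B \<oslash> idn D (rt D ?C)) \<odot> phii D (?A @ ?B) ?C"
    unfolding n by (simp add: cm_assoc tn_cm tn_cm2 idn_cm cm_idn)
  also have "\<dots> = idn D (rt D (?A @ ?B @ ?C))"
    unfolding phi_assoc[OF assms] by (simp add: cm_assoc tn_cm2 idn_cm)
  finally show "unstr D (fl D (Tn (Tn a b) c) (Tn a (Tn b c)) ?as) = unstr D (sid D (?A @ ?B @ ?C))" by simp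
qed simp_all

lemma fl_lun: "set (flat a) \<subseteq> Ob D \<Longrightarrow> fl D (Tn Ue a) a (lun D (obj D a)) = sid D (flat a)"
  using lun_natural[of "kapi D a"]
  by - (rule unstr_inj[where D = D]; simp add: cm_assoc[symmetric]; simp add: cm_assoc idn_cm)

lemma fl_run: "set (flat a) \<subseteq> Ob D \<Longrightarrow> fl D (Tn a Ue) a (run D (obj D a)) = sid D (flat a)"
  using run_natural[of "kapi D a"]
  by - (rule unstr_inj[where D = D]; simp add: phii_nil cm_assoc[symmetric]; simp add: cm_assoc idn_cm)

lemma fl_inverse:
  assumes "fl D a b f = sid D (flat a)" "bt f a b" "bt g b a" "g \<odot> f = idn D (obj D a)" "flat a = flat b"
  shows "fl D b a g = sid D (flat a)"
proof -
  have "scm D (fl D b a g) (fl D a b f) = sid D (flat a)"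
    using assms by (subst fl_cm[symmetric]) (auto simp: fl_idn)
  then show ?thesis using assms by simp
qed

lemma fl_asci: "\<lbrakk>set (flat a) \<subseteq> Ob D; set (flat b) \<subseteq> Ob D; set (flat c) \<subseteq> Ob D\<rbrakk>
  \<Longrightarrow> fl D (Tn a (Tn b c)) (Tn (Tn a b) c) (asci D (obj D a) (obj D b) (obj D c)) = sid D (flat a @ flat b @ flat c)"
  using fl_inverse[of "Tn (Tn a b) c" "Tn a (Tn b c)" "asc D (obj D a) (obj D b) (obj D c)" "asci D (obj D a) (obj D b) (obj D c)"]
  by (simp add: fl_asc)

lemma fl_luni: "set (flat a) \<subseteq> Ob D \<Longrightarrow> fl D a (Tn Ue a) (luni D (obj D a)) = sid D (flat a)"
  using fl_inverse[of "Tn Ue a" a "lun D (obj D a)" "luni D (obj D a)"] by (simp add: fl_lun)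

lemma fl_runi: "set (flat a) \<subseteq> Ob D \<Longrightarrow> fl D a (Tn a Ue) (runi D (obj D a)) = sid D (flat a)"
  using fl_inverse[of "Tn a Ue" a "run D (obj D a)" "runi D (obj D a)"] by (simp add: fl_run)

end

section \<open>Braidings on words\<close>

definition brar :: "('o, 'a, 'k, 'z) monoidal_scheme \<Rightarrow> ('o \<Rightarrow> 'o \<Rightarrow> 'a) \<Rightarrow> 'o \<Rightarrow> 'o \<Rightarrow> ('o, 'a) ar" where
  "brar D \<beta> X Y = Ar (Ten D X Y) (\<beta> X Y) (Ten D Y X)"

lemma brar_simps [simp]: "src (brar D \<beta> X Y) = Ten D X Y" "trg (brar D \<beta> X Y) = Ten D Y X"
  "val (brar D \<beta> X Y) = \<beta> X Y" by (simp_all add: brar_def)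

definition sbr :: "('o, 'a, 'k, 'z) monoidal_scheme \<Rightarrow> ('o \<Rightarrow> 'o \<Rightarrow> 'a) \<Rightarrow> 'o list \<Rightarrow> 'o list \<Rightarrow> ('o list, 'a) ar" where
  "sbr D \<beta> xs ys = Ar (xs @ ys) (val (phi D ys xs \<odot>\<^bsub>D\<^esub> brar D \<beta> (rt D xs) (rt D ys) \<odot>\<^bsub>D\<^esub> phii D xs ys)) (ys @ xs)"

lemma sbr_simps [simp]: "src (sbr D \<beta> xs ys) = xs @ ys" "trg (sbr D \<beta> xs ys) = ys @ xs"
  by (simp_all add: sbr_def)

text \<open>Abstracting from \<open>Braid\<close> makes the inverse braiding an instance of the same
  locale, so that positive and negative crossings share all lemmas.\<close>

locale braiding = linear_monoidal_category D
  for D :: "('o, 'a, 'k::field, 'z) monoidal_scheme" (structure) and \<beta> :: "'o \<Rightarrow> 'o \<Rightarrow> 'a" +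
  assumes br_iso [simp]: "\<lbrakk>X \<in> Ob D; Y \<in> Ob D\<rbrakk> \<Longrightarrow> iso_ar D (brar D \<beta> X Y)"
    and br_natural: "\<lbrakk>arr D f; arr D g\<rbrakk>
      \<Longrightarrow> brar D \<beta> (trg f) (trg g) \<odot> (f \<oslash> g) = (g \<oslash> f) \<odot> brar D \<beta> (src f) (src g)"
    and br_hex1: "\<lbrakk>X \<in> Ob D; Y \<in> Ob D; Z \<in> Ob D\<rbrakk>
      \<Longrightarrow> asc D Y Z X \<odot> brar D \<beta> X (Y \<otimes> Z) \<odot> asc D X Y Z
        = (idn D Y \<oslash> brar D \<beta> X Z) \<odot> asc D Y X Z \<odot> (brar D \<beta> X Y \<oslash> idn D Z)"
    and br_hex2: "\<lbrakk>X \<in> Ob D; Y \<in> Ob D; Z \<in> Ob D\<rbrakk>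
      \<Longrightarrow> asci D Z X Y \<odot> brar D \<beta> (X \<otimes> Y) Z \<odot> asci D X Y Z
        = (brar D \<beta> X Z \<oslash> idn D Y) \<odot> asci D X Z Y \<odot> (idn D X \<oslash> brar D \<beta> Y Z)"
begin

lemma br_arr [simp]: "\<lbrakk>X \<in> Ob D; Y \<in> Ob D\<rbrakk> \<Longrightarrow> arr D (brar D \<beta> X Y)"
  by (simp add: iso_ar_arr)

lemma unstr_sbr [simp]: "unstr D (sbr D \<beta> xs ys) = phi D ys xs \<odot> brar D \<beta> (rt D xs) (rt D ys) \<odot> phii D xs ys"
  by (rule ar_eqI) (simp_all add: sbr_def)

lemma sarr_sbr [simp]: "\<lbrakk>set xs \<subseteq> Ob D; set ys \<subseteq> Ob D\<rbrakk> \<Longrightarrow> sarr D (sbr D \<beta> xs ys)"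
  unfolding sarr_def by simp

lemma fl_brar:
  assumes [simp]: "set (flat a) \<subseteq> Ob D" "set (flat b) \<subseteq> Ob D"
  shows "fl D (Tn a b) (Tn b a) (brar D \<beta> (obj D a) (obj D b)) = sbr D \<beta> (flat a) (flat b)"
proof (rule unstr_inj[where D = D])
  have n: "(kap D b \<oslash> kap D a) \<odot> brar D \<beta> (obj D a) (obj D b)
      = brar D \<beta> (rt D (flat a)) (rt D (flat b)) \<odot> (kap D a \<oslash> kap D b)"
    using br_natural[of "kap D a" "kap D b"] by simp
  have "unstr D (fl D (Tn a b) (Tn b a) (brar D \<beta> (obj D a) (obj D b)))
     = phi D (flat b) (flat a) \<odot> ((kap D b \<oslash> kap D a) \<odot> brar D \<beta> (obj D a) (obj D b)) \<odot> (kapi D a \<oslash> kapi D b) \<odot> phii D (flat a) (flat b)"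
    by (simp add: cm_assoc)
  also have "\<dots> = unstr D (sbr D \<beta> (flat a) (flat b))"
    unfolding n by (simp add: cm_assoc tn_cm2 idn_cm)
  finally show "unstr D (fl D (Tn a b) (Tn b a) (brar D \<beta> (obj D a) (obj D b))) = unstr D (sbr D \<beta> (flat a) (flat b))" .
qed simp_all

lemma sbr_natural:
  assumes f: "sarr D f" and g: "sarr D g"
  shows "scm D (sbr D \<beta> (trg f) (trg g)) (stn D f g) = scm D (stn D g f) (sbr D \<beta> (src f) (src g))"
proof (rule unstr_inj[where D = D])
  note [simp] = sarr_unstr[OF f] sarr_unstr[OF g] f g
  have n: "brar D \<beta> (rt D (trg f)) (rt D (trg g)) \<odot> (unstr D f \<oslash> unstr D g)
      = (unstr D g \<oslash> unstr D f) \<odot> brar D \<beta> (rt D (src f)) (rt D (src g))"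
    using br_natural[of "unstr D f" "unstr D g"] by simp
  have "unstr D (scm D (sbr D \<beta> (trg f) (trg g)) (stn D f g)) = phi D (trg g) (trg f) \<odot>
     (brar D \<beta> (rt D (trg f)) (rt D (trg g)) \<odot> (unstr D f \<oslash> unstr D g)) \<odot> phii D (src f) (src g)"
    by (simp add: cm_assoc)
  also have "\<dots> = unstr D (scm D (stn D g f) (sbr D \<beta> (src f) (src g)))"
    unfolding n by (simp add: cm_assoc)
  finally show "unstr D (scm D (sbr D \<beta> (trg f) (trg g)) (stn D f g)) = unstr D (scm D (stn D g f) (sbr D \<beta> (src f) (src g)))" .
qed (use f g in simp_all)

text \<open>The hexagon: on words its associators are identities and only the crossings
  remain.\<close>

lemma sbr_app_right:
  assumes [simp]: "set xs \<subseteq> Ob D" "set ys \<subseteq> Ob D" "set zs \<subseteq> Ob D"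
  shows "sbr D \<beta> xs (ys @ zs) = scm D (stn D (sid D ys) (sbr D \<beta> xs zs)) (stn D (sbr D \<beta> xs ys) (sid D zs))"
proof -
  let ?x = "tree xs" and ?y = "tree ys" and ?z = "tree zs"
  let ?X = "rt D xs" and ?Y = "rt D ys" and ?Z = "rt D zs"
  have "fl D (Tn (Tn ?x ?y) ?z) (Tn ?y (Tn ?z ?x)) (asc D ?Y ?Z ?X \<odot> brar D \<beta> ?X (?Y \<otimes> ?Z) \<odot> asc D ?X ?Y ?Z)
      = scm D (fl D (Tn (Tn ?y ?z) ?x) (Tn ?y (Tn ?z ?x)) (asc D ?Y ?Z ?X))
         (scm D (fl D (Tn ?x (Tn ?y ?z)) (Tn (Tn ?y ?z) ?x) (brar D \<beta> ?X (?Y \<otimes> ?Z)))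
            (fl D (Tn (Tn ?x ?y) ?z) (Tn ?x (Tn ?y ?z)) (asc D ?X ?Y ?Z)))"
    by (subst fl_cm[where b = "Tn (Tn ?y ?z) ?x"], simp, simp, subst fl_cm[where b = "Tn ?x (Tn ?y ?z)"]) simp_all
  also have "\<dots> = sbr D \<beta> xs (ys @ zs)"
    using fl_asc[of ?y ?z ?x] fl_asc[of ?x ?y ?z] fl_brar[of ?x "Tn ?y ?z"] by simp
  finally have 1: "sbr D \<beta> xs (ys @ zs) = fl D (Tn (Tn ?x ?y) ?z) (Tn ?y (Tn ?z ?x)) (asc D ?Y ?Z ?X \<odot> brar D \<beta> ?X (?Y \<otimes> ?Z) \<odot> asc D ?X ?Y ?Z)" ..
  have "fl D (Tn (Tn ?x ?y) ?z) (Tn ?y (Tn ?z ?x)) ((idn D ?Y \<oslash> brar D \<beta> ?X ?Z) \<odot> asc D ?Y ?X ?Z \<odot> (brar D \<beta> ?X ?Y \<oslash> idn D ?Z))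
      = scm D (fl D (Tn ?y (Tn ?x ?z)) (Tn ?y (Tn ?z ?x)) (idn D ?Y \<oslash> brar D \<beta> ?X ?Z))
         (scm D (fl D (Tn (Tn ?y ?x) ?z) (Tn ?y (Tn ?x ?z)) (asc D ?Y ?X ?Z))
            (fl D (Tn (Tn ?x ?y) ?z) (Tn (Tn ?y ?x) ?z) (brar D \<beta> ?X ?Y \<oslash> idn D ?Z)))"
    by (subst fl_cm[where b = "Tn ?y (Tn ?x ?z)"], simp, simp, subst fl_cm[where b = "Tn (Tn ?y ?x) ?z"]) simp_all
  also have "\<dots> = scm D (stn D (sid D ys) (sbr D \<beta> xs zs)) (stn D (sbr D \<beta> xs ys) (sid D zs))"
    using fl_asc[of ?y ?x ?z] fl_brar[of ?x ?z] fl_brar[of ?x ?y] fl_idn[of ?y] fl_idn[of ?z]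
      fl_tn[of "idn D ?Y" ?y ?y "brar D \<beta> ?X ?Z" "Tn ?x ?z" "Tn ?z ?x"]
      fl_tn[of "brar D \<beta> ?X ?Y" "Tn ?x ?y" "Tn ?y ?x" "idn D ?Z" ?z ?z] by simp
  finally show ?thesis unfolding 1 using br_hex1[of ?X ?Y ?Z] by simp
qed

lemma sbr_app_left:
  assumes [simp]: "set xs \<subseteq> Ob D" "set ys \<subseteq> Ob D" "set zs \<subseteq> Ob D"
  shows "sbr D \<beta> (xs @ ys) zs = scm D (stn D (sbr D \<beta> xs zs) (sid D ys)) (stn D (sid D xs) (sbr D \<beta> ys zs))"
proof -
  let ?x = "tree xs" and ?y = "tree ys" and ?z = "tree zs"
  let ?X = "rt D xs" and ?Y = "rt D ys" and ?Z = "rt D zs"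
  have "fl D (Tn ?x (Tn ?y ?z)) (Tn (Tn ?z ?x) ?y) (asci D ?Z ?X ?Y \<odot> brar D \<beta> (?X \<otimes> ?Y) ?Z \<odot> asci D ?X ?Y ?Z)
      = scm D (fl D (Tn ?z (Tn ?x ?y)) (Tn (Tn ?z ?x) ?y) (asci D ?Z ?X ?Y))
         (scm D (fl D (Tn (Tn ?x ?y) ?z) (Tn ?z (Tn ?x ?y)) (brar D \<beta> (?X \<otimes> ?Y) ?Z))
            (fl D (Tn ?x (Tn ?y ?z)) (Tn (Tn ?x ?y) ?z) (asci D ?X ?Y ?Z)))"
    by (subst fl_cm[where b = "Tn ?z (Tn ?x ?y)"], simp, simp, subst fl_cm[where b = "Tn (Tn ?x ?y) ?z"]) simp_all
  also have "\<dots> = sbr D \<beta> (xs @ ys) zs"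
    using fl_asci[of ?z ?x ?y] fl_asci[of ?x ?y ?z] fl_brar[of "Tn ?x ?y" ?z] by simp
  finally have 1: "sbr D \<beta> (xs @ ys) zs = fl D (Tn ?x (Tn ?y ?z)) (Tn (Tn ?z ?x) ?y) (asci D ?Z ?X ?Y \<odot> brar D \<beta> (?X \<otimes> ?Y) ?Z \<odot> asci D ?X ?Y ?Z)" ..
  have "fl D (Tn ?x (Tn ?y ?z)) (Tn (Tn ?z ?x) ?y) ((brar D \<beta> ?X ?Z \<oslash> idn D ?Y) \<odot> asci D ?X ?Z ?Y \<odot> (idn D ?X \<oslash> brar D \<beta> ?Y ?Z))
      = scm D (fl D (Tn (Tn ?x ?z) ?y) (Tn (Tn ?z ?x) ?y) (brar D \<beta> ?X ?Z \<oslash> idn D ?Y))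
         (scm D (fl D (Tn ?x (Tn ?z ?y)) (Tn (Tn ?x ?z) ?y) (asci D ?X ?Z ?Y))
            (fl D (Tn ?x (Tn ?y ?z)) (Tn ?x (Tn ?z ?y)) (idn D ?X \<oslash> brar D \<beta> ?Y ?Z)))"
    by (subst fl_cm[where b = "Tn (Tn ?x ?z) ?y"], simp, simp, subst fl_cm[where b = "Tn ?x (Tn ?z ?y)"]) simp_all
  also have "\<dots> = scm D (stn D (sbr D \<beta> xs zs) (sid D ys)) (stn D (sid D xs) (sbr D \<beta> ys zs))"
    using fl_asci[of ?x ?z ?y] fl_brar[of ?x ?z] fl_brar[of ?y ?z] fl_idn[of ?x] fl_idn[of ?y]
      fl_tn[of "idn D ?X" ?x ?x "brar D \<beta> ?Y ?Z" "Tn ?y ?z" "Tn ?z ?y"]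
      fl_tn[of "brar D \<beta> ?X ?Z" "Tn ?x ?z" "Tn ?z ?x" "idn D ?Y" ?y ?y] by simp
  finally show ?thesis unfolding 1 using br_hex2[of ?X ?Y ?Z] by simp
qed

lemma sbr_left_cancel:
  assumes "set xs \<subseteq> Ob D" "set ys \<subseteq> Ob D"
  obtains n where "sarr D n" "src n = ys @ xs" "trg n = xs @ ys" "scm D n (sbr D \<beta> xs ys) = sid D (xs @ ys)"
proof
  note [simp] = assms
  let ?b = "brar D \<beta> (rt D xs) (rt D ys)"
  let ?n = "fl D (Tn (tree ys) (tree xs)) (Tn (tree xs) (tree ys)) (inv_ar D ?b)"
  show "sarr D ?n" "src ?n = ys @ xs" "trg ?n = xs @ ys" by (simp_all add: iso_ar_arr)
  have "scm D ?n (fl D (Tn (tree xs) (tree ys)) (Tn (tree ys) (tree xs)) ?b) = sid D (xs @ ys)"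
    by (subst fl_cm[symmetric]) (simp_all add: iso_ar_arr inv_ar_cm fl_idn[of "Tn (tree xs) (tree ys)", simplified])
  then show "scm D ?n (sbr D \<beta> xs ys) = sid D (xs @ ys)" using fl_brar[of "tree xs" "tree ys"] by simp
qed

text \<open>The hexagon with empty words makes these crossings idempotent, and an idempotent with a
  left inverse is the identity.\<close>

lemma sbr_nil [simp]:
  assumes [simp]: "set xs \<subseteq> Ob D"
  shows "sbr D \<beta> xs [] = sid D xs" "sbr D \<beta> [] xs = sid D xs"
proof -
  obtain n where n: "sarr D n" "src n = [] @ xs" "trg n = xs @ []" "scm D n (sbr D \<beta> xs []) = sid D (xs @ [])"
    by (rule sbr_left_cancel[of xs "[]"]) simp_all
  have "scm D n (sbr D \<beta> xs []) = scm D n (scm D (sbr D \<beta> xs []) (sbr D \<beta> xs []))"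
    using sbr_app_right[of xs "[]" "[]"] by simp
  also have "\<dots> = scm D (scm D n (sbr D \<beta> xs [])) (sbr D \<beta> xs [])" by (rule scm_assoc[symmetric]) (use n in simp_all)
  finally show "sbr D \<beta> xs [] = sid D xs" using n by simp
  obtain n where n: "sarr D n" "src n = xs @ []" "trg n = [] @ xs" "scm D n (sbr D \<beta> [] xs) = sid D ([] @ xs)"
    by (rule sbr_left_cancel[of "[]" xs]) simp_all
  have "scm D n (sbr D \<beta> [] xs) = scm D n (scm D (sbr D \<beta> [] xs) (sbr D \<beta> [] xs))"
    using sbr_app_left[of "[]" "[]" xs] by simp
  also have "\<dots> = scm D (scm D n (sbr D \<beta> [] xs)) (sbr D \<beta> [] xs)" by (rule scm_assoc[symmetric]) (use n in simp_all)
  finally show "sbr D \<beta> [] xs = sid D xs" using n by simp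
qed

end

locale braiding_pair = braiding D \<beta>
  for D :: "('o, 'a, 'k::field, 'z) monoidal_scheme" (structure) and \<beta> :: "'o \<Rightarrow> 'o \<Rightarrow> 'a" +
  fixes \<gamma> :: "'o \<Rightarrow> 'o \<Rightarrow> 'a"
  assumes br_inverse: "brar D \<gamma> X Y = inv_ar D (brar D \<beta> Y X)"
begin

lemma arr_inv [simp]: "\<lbrakk>X \<in> Ob D; Y \<in> Ob D\<rbrakk> \<Longrightarrow> arr D (brar D \<gamma> X Y)"
  by (simp add: br_inverse iso_ar_arr)

lemma br_inv [simp]: "\<lbrakk>X \<in> Ob D; Y \<in> Ob D\<rbrakk> \<Longrightarrow> brar D \<beta> X Y \<odot> brar D \<gamma> Y X = idn D (Y \<otimes> X)"
  "\<lbrakk>X \<in> Ob D; Y \<in> Ob D\<rbrakk> \<Longrightarrow> brar D \<gamma> Y X \<odot> brar D \<beta> X Y = idn D (X \<otimes> Y)"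
  by (simp_all add: br_inverse inv_ar_cm)

lemma br_inv2 [simp]: "\<lbrakk>X \<in> Ob D; Y \<in> Ob D; arr D h; trg h = Y \<otimes> X\<rbrakk> \<Longrightarrow> brar D \<beta> X Y \<odot> brar D \<gamma> Y X \<odot> h = h"
  "\<lbrakk>X \<in> Ob D; Y \<in> Ob D; arr D h; trg h = X \<otimes> Y\<rbrakk> \<Longrightarrow> brar D \<gamma> Y X \<odot> brar D \<beta> X Y \<odot> h = h"
  by (simp_all add: br_inverse inv_cm2 cm_inv2)

lemma inverse_unique:
  "\<lbrakk>arr D f; arr D g; arr D h; src g = trg f; src h = trg f; trg g = src f; trg h = src f;
    g \<odot> f = idn D (src f); f \<odot> h = idn D (trg f)\<rbrakk> \<Longrightarrow> g = h"
proof -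
  assume a: "arr D f" "arr D g" "arr D h" "src g = trg f" "src h = trg f" "trg g = src f" "trg h = src f"
    "g \<odot> f = idn D (src f)" "f \<odot> h = idn D (trg f)"
  have "g = g \<odot> (f \<odot> h)" using a by (simp add: cm_idn)
  also have "\<dots> = (g \<odot> f) \<odot> h" by (rule cm_assoc[symmetric]) (use a in simp_all)
  finally show ?thesis using a by (simp add: idn_cm)
qed

lemma br_inv_natural: "\<lbrakk>arr D f; arr D g\<rbrakk>
      \<Longrightarrow> brar D \<gamma> (trg f) (trg g) \<odot> (f \<oslash> g) = (g \<oslash> f) \<odot> brar D \<gamma> (src f) (src g)"
proof -
  assume [simp]: "arr D f" "arr D g"
  have "brar D \<gamma> (trg f) (trg g) \<odot> (f \<oslash> g)
     = brar D \<gamma> (trg f) (trg g) \<odot> ((f \<oslash> g) \<odot> brar D \<beta> (src g) (src f)) \<odot> brar D \<gamma> (src f) (src g)"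
    by (simp add: cm_assoc cm_idn)
  also have "(f \<oslash> g) \<odot> brar D \<beta> (src g) (src f) = brar D \<beta> (trg g) (trg f) \<odot> (g \<oslash> f)"
    using br_natural[of g f] by simp
  finally show ?thesis by (simp add: cm_assoc)
qed

text \<open>Each side of a hexagon for \<open>\<gamma>\<close> inverts a side of the other hexagon
  for \<open>\<beta>\<close>, so uniqueness of inverses gives the equation.\<close>

lemma braiding_inverse: "braiding D \<gamma>"
proof unfold_locales
  fix X Y assume [simp]: "X \<in> Ob D" "Y \<in> Ob D"
  have "inverse_pair D (X \<otimes> Y) (Y \<otimes> X) (val (brar D \<gamma> X Y)) (val (brar D \<beta> Y X))"
    using inverse_pair_Inv[of "Y \<otimes> X" "X \<otimes> Y" "\<beta> Y X"] br_iso[of Y X] unfolding br_inverse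
    by (auto simp: iso_ar_def inverse_pair_def)
  then show "iso_ar D (brar D \<gamma> X Y)" by (auto simp: iso_ar_def is_iso_def)
next
  fix f g assume "arr D f" "arr D g"
  then show "brar D \<gamma> (trg f) (trg g) \<odot> (f \<oslash> g) = (g \<oslash> f) \<odot> brar D \<gamma> (src f) (src g)"
    by (rule br_inv_natural)
next
  fix X Y Z assume [simp]: "X \<in> Ob D" "Y \<in> Ob D" "Z \<in> Ob D"
  let ?f = "asci D X Y Z \<odot> brar D \<beta> (Y \<otimes> Z) X \<odot> asci D Y Z X"
  show "asc D Y Z X \<odot> brar D \<gamma> X (Y \<otimes> Z) \<odot> asc D X Y Z
        = (idn D Y \<oslash> brar D \<gamma> X Z) \<odot> asc D Y X Z \<odot> (brar D \<gamma> X Y \<oslash> idn D Z)"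
  proof (rule inverse_unique[of ?f])
    show "?f \<odot> (idn D Y \<oslash> brar D \<gamma> X Z) \<odot> asc D Y X Z \<odot> (brar D \<gamma> X Y \<oslash> idn D Z) = idn D (trg ?f)"
      unfolding br_hex2[OF \<open>Y \<in> Ob D\<close> \<open>Z \<in> Ob D\<close> \<open>X \<in> Ob D\<close>] by (simp add: cm_assoc tn_cm tn_cm2 idn_cm)
  qed (simp_all add: cm_assoc)
next
  fix X Y Z assume [simp]: "X \<in> Ob D" "Y \<in> Ob D" "Z \<in> Ob D"
  let ?f = "asc D X Y Z \<odot> brar D \<beta> Z (X \<otimes> Y) \<odot> asc D Z X Y"
  show "asci D Z X Y \<odot> brar D \<gamma> (X \<otimes> Y) Z \<odot> asci D X Y Z
        = (brar D \<gamma> X Z \<oslash> idn D Y) \<odot> asci D X Z Y \<odot> (idn D X \<oslash> brar D \<gamma> Y Z)"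
  proof (rule inverse_unique[of ?f])
    show "?f \<odot> (brar D \<gamma> X Z \<oslash> idn D Y) \<odot> asci D X Z Y \<odot> (idn D X \<oslash> brar D \<gamma> Y Z) = idn D (trg ?f)"
      unfolding br_hex1[OF \<open>Z \<in> Ob D\<close> \<open>X \<in> Ob D\<close> \<open>Y \<in> Ob D\<close>] by (simp add: cm_assoc tn_cm tn_cm2 idn_cm)
  qed (simp_all add: cm_assoc)
qed

end

sublocale braiding_pair \<subseteq> inv: braiding D \<gamma> by (rule braiding_inverse)

context braiding_pair
begin

lemma sbr_inverse:
  assumes [simp]: "set xs \<subseteq> Ob D" "set ys \<subseteq> Ob D"
  shows "scm D (sbr D \<gamma> ys xs) (sbr D \<beta> xs ys) = sid D (xs @ ys)"
    "scm D (sbr D \<beta> ys xs) (sbr D \<gamma> xs ys) = sid D (xs @ ys)"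
  by (rule unstr_inj[where D = D]; simp add: cm_assoc)+

end

section \<open>A reflective calculus of string diagrams\<close>

text \<open>Morphism expressions over numbered objects and generators. All of this is executable
  data; the category enters only through the valuation \<open>tv\<close>.\<close>

datatype tm = Gn nat ("$$_" [1000] 1000) | Id "nat ob" | Cm tm tm (infixr ";;" 55) | Tm tm tm (infixr "##" 60)
  | As "nat ob" "nat ob" "nat ob" | Ai "nat ob" "nat ob" "nat ob"
  | Lu "nat ob" | Li "nat ob" | Ru "nat ob" | Ri "nat ob"
  | Br "nat ob" "nat ob" | Bi "nat ob" "nat ob"

datatype el = Ge nat | Cr bool nat nat

type_synonym sign = "(nat ob \<times> nat ob) list"
text \<open>A layer \<open>(k, e)\<close> applies \<open>e\<close> with \<open>k\<close> idle wires
  on its left; the idle wires on its right stay implicit, which makes layers independent of the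
  context. A signature lists domain and codomain of each generator, and a rule consists of an input
  word and two lists of layers.\<close>

type_synonym layer = "nat \<times> el"
type_synonym rule = "nat list \<times> layer list \<times> layer list"

primrec dm :: "sign \<Rightarrow> tm \<Rightarrow> nat ob" where
  "dm S (Gn n) = fst (S ! n)" | "dm S (Id a) = a" | "dm S (Cm g f) = dm S f" | "dm S (Tm f g) = Tn (dm S f) (dm S g)"
| "dm S (As a b c) = Tn (Tn a b) c" | "dm S (Ai a b c) = Tn a (Tn b c)"
| "dm S (Lu a) = Tn Ue a" | "dm S (Li a) = a" | "dm S (Ru a) = Tn a Ue" | "dm S (Ri a) = a"
| "dm S (Br a b) = Tn a b" | "dm S (Bi a b) = Tn a b"

primrec cd :: "sign \<Rightarrow> tm \<Rightarrow> nat ob" where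
  "cd S (Gn n) = snd (S ! n)" | "cd S (Id a) = a" | "cd S (Cm g f) = cd S g" | "cd S (Tm f g) = Tn (cd S f) (cd S g)"
| "cd S (As a b c) = Tn a (Tn b c)" | "cd S (Ai a b c) = Tn (Tn a b) c"
| "cd S (Lu a) = a" | "cd S (Li a) = Tn Ue a" | "cd S (Ru a) = a" | "cd S (Ri a) = Tn a Ue"
| "cd S (Br a b) = Tn b a" | "cd S (Bi a b) = Tn b a"

primrec wt :: "sign \<Rightarrow> bool \<Rightarrow> tm \<Rightarrow> bool" where
  "wt S p (Gn n) = (n < length S)" | "wt S p (Id a) = True"
| "wt S p (Cm g f) = (wt S p g \<and> wt S p f \<and> cd S f = dm S g)"
| "wt S p (Tm f g) = (wt S p f \<and> wt S p g)"
| "wt S p (As a b c) = True" | "wt S p (Ai a b c) = True"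
| "wt S p (Lu a) = True" | "wt S p (Li a) = True" | "wt S p (Ru a) = True" | "wt S p (Ri a) = True"
| "wt S p (Br a b) = p" | "wt S p (Bi a b) = p"

fun shift :: "nat \<Rightarrow> layer list \<Rightarrow> layer list" where
  "shift k [] = []" | "shift k ((i, e) # L) = (k + i, e) # shift k L"

primrec cross1 :: "bool \<Rightarrow> nat \<Rightarrow> nat list \<Rightarrow> layer list" where
  "cross1 s x [] = []" | "cross1 s x (y # ys) = (0, Cr s x y) # shift 1 (cross1 s x ys)"

text \<open>A crossing of words is cut into crossings of single wires. The letters of the left word
  move one after the other, the rightmost first, as \<open>sbr_app_left\<close> prescribes.\<close>

primrec crossw :: "bool \<Rightarrow> nat list \<Rightarrow> nat list \<Rightarrow> layer list" where
  "crossw s [] ys = []" | "crossw s (x # xs) ys = shift 1 (crossw s xs ys) @ cross1 s x ys"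

text \<open>Structure isomorphisms leave no trace. In a tensor product the left factor is placed
  first, so the right one is shifted by the codomain of the left; this fixes one order of
  independent layers, which interchange steps revise.\<close>

primrec tr :: "sign \<Rightarrow> tm \<Rightarrow> layer list" where
  "tr S (Gn n) = [(0, Ge n)]" | "tr S (Id a) = []" | "tr S (Cm g f) = tr S f @ tr S g"
| "tr S (Tm f g) = tr S f @ shift (length (flat (cd S f))) (tr S g)"
| "tr S (As a b c) = []" | "tr S (Ai a b c) = []" | "tr S (Lu a) = []" | "tr S (Li a) = []"
| "tr S (Ru a) = []" | "tr S (Ri a) = []"
| "tr S (Br a b) = crossw True (flat a) (flat b)" | "tr S (Bi a b) = crossw False (flat a) (flat b)"

fun ein :: "sign \<Rightarrow> el \<Rightarrow> nat list" where
  "ein S (Ge n) = flat (fst (S ! n))" | "ein S (Cr s x y) = [x, y]"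
fun eout :: "sign \<Rightarrow> el \<Rightarrow> nat list" where
  "eout S (Ge n) = flat (snd (S ! n))" | "eout S (Cr s x y) = [y, x]"
fun eok :: "sign \<Rightarrow> bool \<Rightarrow> el \<Rightarrow> bool" where
  "eok S p (Ge n) = (n < length S)" | "eok S p (Cr s x y) = p"

fun nxt :: "sign \<Rightarrow> nat list \<Rightarrow> layer \<Rightarrow> nat list" where
  "nxt S w (k, e) = take k w @ eout S e @ drop (k + length (ein S e)) w"
fun okl :: "sign \<Rightarrow> bool \<Rightarrow> nat list \<Rightarrow> layer \<Rightarrow> bool" where
  "okl S p w (k, e) = (k \<le> length w \<and> take (length (ein S e)) (drop k w) = ein S e \<and> eok S p e)"

primrec valid :: "sign \<Rightarrow> bool \<Rightarrow> nat list \<Rightarrow> layer list \<Rightarrow> bool" where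
  "valid S p w [] = True" | "valid S p w (l # L) = (okl S p w l \<and> valid S p (nxt S w l) L)"
primrec fin :: "sign \<Rightarrow> nat list \<Rightarrow> layer list \<Rightarrow> nat list" where
  "fin S w [] = w" | "fin S w (l # L) = fin S (nxt S w l) L"

text \<open>
  Steps on a list of layers: two kinds of interchange at a position; a listed relation, at a position
  and offset, in one of two directions; naturality of a crossing of the wire \<open>w\<close>, coming from the
  left or from the right, with a generator or crossing; cancellation of two inverse crossings.
\<close>

datatype step = SL nat | SR nat | RW nat nat nat bool | NB nat nat bool bool nat el bool | XX nat nat bool nat nat bool

text \<open>The guard places the second layer entirely to the right of the output of the first, so
  the subtraction of natural numbers is exact.\<close>

fun swapl :: "sign \<Rightarrow> nat list \<Rightarrow> layer list \<Rightarrow> layer list option" where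
  "swapl S w ((k, e) # (k', e') # L) = (let n = length (eout S e) in if k + n \<le> k'
      then Some ((k' - n + length (ein S e), e') # (k, e) # L) else None)"
| "swapl S w L = None"
fun swapr :: "sign \<Rightarrow> nat list \<Rightarrow> layer list \<Rightarrow> layer list option" where
  "swapr S w ((k, e) # (k', e') # L) = (let n = length (ein S e') in if k' + n \<le> k
      then Some ((k', e') # (k - n + length (eout S e'), e) # L) else None)"
| "swapr S w L = None"
definition rew :: "nat \<Rightarrow> rule \<Rightarrow> nat list \<Rightarrow> layer list \<Rightarrow> layer list option" where
  "rew k r w L = (case r of (u, l, m) \<Rightarrow>
     if k \<le> length w \<and> take (length u) (drop k w) = u \<and> take (length l) L = shift k l
     then Some (shift k m @ drop (length l) L) else None)"

primrec nth_step :: "sign \<Rightarrow> nat \<Rightarrow> (nat list \<Rightarrow> layer list \<Rightarrow> layer list option) \<Rightarrow> nat list \<Rightarrow> layer list \<Rightarrow> layer list option" where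
  "nth_step S 0 f w L = f w L"
| "nth_step S (Suc i) f w L = (case L of [] \<Rightarrow> None | l # L' \<Rightarrow> map_option (Cons l) (nth_step S i f (nxt S w l) L'))"

definition flip :: "bool \<Rightarrow> rule \<Rightarrow> rule" where
  "flip b r = (if b then r else (fst r, snd (snd r), fst (snd r)))"

definition slide :: "sign \<Rightarrow> bool \<Rightarrow> bool \<Rightarrow> nat \<Rightarrow> el \<Rightarrow> rule" where
  "slide S left s w e = (let x = ein S e; y = eout S e in
     if left then (w # x, crossw s [w] x @ [(0, e)], (1, e) # crossw s [w] y)
     else (x @ [w], crossw s x [w] @ [(1, e)], (0, e) # crossw s y [w]))"

definition cancel :: "bool \<Rightarrow> nat \<Rightarrow> nat \<Rightarrow> rule" where
  "cancel s x y = ([x, y], [(0, Cr s x y), (0, Cr (\<not> s) y x)], [])"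

fun do_step :: "sign \<Rightarrow> bool \<Rightarrow> rule list \<Rightarrow> step \<Rightarrow> nat list \<Rightarrow> layer list \<Rightarrow> layer list option" where
  "do_step S p R (SL i) w L = nth_step S i (swapl S) w L"
| "do_step S p R (SR i) w L = nth_step S i (swapr S) w L"
| "do_step S p R (RW i k n b) w L = (if n < length R then nth_step S i (rew k (flip b (R ! n))) w L else None)"
| "do_step S p R (NB i k left s x e b) w L = (if p \<and> eok S p e then nth_step S i (rew k (flip b (slide S left s x e))) w L else None)"
| "do_step S p R (XX i k s x y b) w L = (if p then nth_step S i (rew k (flip b (cancel s x y))) w L else None)"

primrec steps :: "sign \<Rightarrow> bool \<Rightarrow> rule list \<Rightarrow> nat list \<Rightarrow> step list \<Rightarrow> layer list \<Rightarrow> layer list option" where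
  "steps S p R w [] L = Some L"
| "steps S p R w (s # ss) L = (case do_step S p R s w L of None \<Rightarrow> None | Some L' \<Rightarrow> steps S p R w ss L')"

definition wteq :: "sign \<Rightarrow> bool \<Rightarrow> tm \<times> tm \<Rightarrow> bool" where
  "wteq S p r = (wt S p (fst r) \<and> wt S p (snd r) \<and> dm S (fst r) = dm S (snd r) \<and> cd S (fst r) = cd S (snd r))"

text \<open>One closed boolean, decided by evaluation: everything is well typed and the recorded
  steps turn the layers of \<open>t\<close> literally into those of \<open>u\<close>. Equality of
  lists is syntactic, so every interchange has to be recorded too.\<close>

definition derives :: "sign \<Rightarrow> bool \<Rightarrow> (tm \<times> tm) list \<Rightarrow> tm \<Rightarrow> tm \<Rightarrow> step list \<Rightarrow> bool" where
  "derives S p R t u ss = (wteq S p (t, u) \<and> list_all (wteq S p) R \<and>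
    steps S p (map (\<lambda>r. (flat (dm S (fst r)), tr S (fst r), tr S (snd r))) R) (flat (dm S t)) ss (tr S t) = Some (tr S u))"

context
  fixes D :: "('o, 'a, 'k, 'z) monoidal_scheme" (structure)
    and \<beta> \<gamma> :: "'o \<Rightarrow> 'o \<Rightarrow> 'a" and ov :: "nat \<Rightarrow> 'o" and gv :: "nat \<Rightarrow> 'a"
begin

abbreviation (input) "vo a \<equiv> obj D (map_ob ov a)"

primrec tv :: "tm \<Rightarrow> 'a" where
  "tv (Gn n) = gv n" | "tv (Id a) = Ide D (vo a)" | "tv (Cm g f) = tv g \<cdot> tv f" | "tv (Tm f g) = tv f \<star> tv g"
| "tv (As a b c) = Asc D (vo a) (vo b) (vo c)" | "tv (Ai a b c) = AscInv D (vo a) (vo b) (vo c)"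
| "tv (Lu a) = Lun D (vo a)" | "tv (Li a) = LunInv D (vo a)" | "tv (Ru a) = Run D (vo a)" | "tv (Ri a) = RunInv D (vo a)"
| "tv (Br a b) = \<beta> (vo a) (vo b)" | "tv (Bi a b) = \<gamma> (vo a) (vo b)"

definition ta :: "sign \<Rightarrow> tm \<Rightarrow> ('o, 'a) ar" where
  "ta S t = Ar (vo (dm S t)) (tv t) (vo (cd S t))"

fun es :: "sign \<Rightarrow> el \<Rightarrow> ('o list, 'a) ar" where
  "es S (Ge n) = fl D (map_ob ov (fst (S ! n))) (map_ob ov (snd (S ! n))) (ta S (Gn n))"
| "es S (Cr s x y) = sbr D (if s then \<beta> else \<gamma>) [ov x] [ov y]"

fun lay :: "sign \<Rightarrow> nat list \<Rightarrow> layer \<Rightarrow> ('o list, 'a) ar" where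
  "lay S w (k, e) = stn D (sid D (map ov (take k w))) (stn D (es S e) (sid D (map ov (drop (k + length (ein S e)) w))))"

primrec lsem :: "sign \<Rightarrow> nat list \<Rightarrow> layer list \<Rightarrow> ('o list, 'a) ar" where
  "lsem S w [] = sid D (map ov w)"
| "lsem S w (l # L) = scm D (lsem S (nxt S w l) L) (lay S w l)"

end

lemma flat_map_ob [simp]: "flat (map_ob f a) = map f (flat a)" by (induction a) simp_all

text \<open>The flag \<open>p\<close> tells whether crossings are available. For categories without
  a braiding it is \<open>False\<close>, \<open>\<beta>\<close> and \<open>\<gamma>\<close> are
  arbitrary, and both typing and \<open>do_step\<close> reject crossings.\<close>

locale diagrams = linear_monoidal_category D
  for D :: "('o, 'a, 'k::field, 'z) monoidal_scheme" (structure) +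
  fixes \<beta> \<gamma> :: "'o \<Rightarrow> 'o \<Rightarrow> 'a" and ov :: "nat \<Rightarrow> 'o" and gv :: "nat \<Rightarrow> 'a" and S :: sign and p :: bool
  assumes pair: "p \<Longrightarrow> braiding_pair D \<beta> \<gamma>"
    and ov [simp]: "ov n \<in> Ob D"
    and gv: "n < length S \<Longrightarrow> gv n \<in> Hom D (obj D (map_ob ov (fst (S ! n)))) (obj D (map_ob ov (snd (S ! n))))"
begin

section \<open>Soundness of the calculus\<close>

abbreviation "t_v \<equiv> tv D \<beta> \<gamma> ov gv"
abbreviation "t_a \<equiv> ta D \<beta> \<gamma> ov gv S"
abbreviation "e_s \<equiv> es D \<beta> \<gamma> ov gv S"
abbreviation "l_ay \<equiv> lay D \<beta> \<gamma> ov gv S"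
abbreviation "l_s \<equiv> lsem D \<beta> \<gamma> ov gv S"
abbreviation "bs s \<equiv> (if s then \<beta> else \<gamma>)"

lemma bs: "p \<Longrightarrow> braiding D (bs s)"
  using pair braiding_pair.braiding_inverse braiding_pair.axioms(1) by auto

lemma ov_set [simp]: "ov ` A \<subseteq> Ob D" by auto

lemma ta_simps [simp]: "src (t_a t) = obj D (map_ob ov (dm S t))" "trg (t_a t) = obj D (map_ob ov (cd S t))"
  "val (t_a t) = t_v t" by (simp_all add: ta_def)

lemma obo [simp]: "obj D (map_ob ov a) \<in> Ob D" by simp

lemma ta_eqs:
  "t_a (Id a) = idn D (obj D (map_ob ov a))"
  "t_a (Tm f g) = t_a f \<oslash> t_a g"
  "t_a (As a b c) = asc D (obj D (map_ob ov a)) (obj D (map_ob ov b)) (obj D (map_ob ov c))"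
  "t_a (Ai a b c) = asci D (obj D (map_ob ov a)) (obj D (map_ob ov b)) (obj D (map_ob ov c))"
  "t_a (Lu a) = lun D (obj D (map_ob ov a))" "t_a (Li a) = luni D (obj D (map_ob ov a))"
  "t_a (Ru a) = run D (obj D (map_ob ov a))" "t_a (Ri a) = runi D (obj D (map_ob ov a))"
  "t_a (Br a b) = brar D \<beta> (obj D (map_ob ov a)) (obj D (map_ob ov b))"
  "t_a (Bi a b) = brar D \<gamma> (obj D (map_ob ov a)) (obj D (map_ob ov b))"
  by (rule ar_eqI; simp)+

lemma ta_Cm: "t_a (Cm g f) = t_a g \<odot> t_a f"
  by (rule ar_eqI) simp_all

lemma ta_arr: "wt S p t \<Longrightarrow> arr D (t_a t)"
proof (induction t)
  case (Gn n)
  then show ?case using gv[of n] by (simp add: arr_def del: arr_ob)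
next
  case (Br a b)
  then show ?case using braiding.br_arr[OF bs[of True]] by (simp add: ta_eqs)
next
  case (Bi a b)
  then show ?case using braiding.br_arr[OF bs[of False]] by (simp add: ta_eqs)
next
  case (Cm g f)
  then show ?case by (simp add: ta_Cm)
qed (simp_all add: ta_eqs)

lemma bt_ta: "wt S p t \<Longrightarrow> bt (t_a t) (map_ob ov (dm S t)) (map_ob ov (cd S t))"
  by (simp add: ta_arr)

lemma es_st [simp]: "src (e_s e) = map ov (ein S e)" "trg (e_s e) = map ov (eout S e)"
  by (cases e; simp)+

lemma es_sarr [simp]: "eok S p e \<Longrightarrow> sarr D (e_s e)"
proof (cases e)
  case (Ge n)
  assume "eok S p e"
  then show ?thesis using bt_ta[of "Gn n"] Ge by (simp del: tv.simps)
next
  case (Cr s x y)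
  assume "eok S p e"
  then show ?thesis using braiding.sarr_sbr[OF bs[of s], of "[ov x]" "[ov y]"] Cr by simp
qed

lemma okl_split:
  assumes "okl S p w (k, e)"
  obtains u v where "w = u @ ein S e @ v" "k = length u" "eok S p e"
proof
  have 1: "take (length (ein S e)) (drop k w) = ein S e" "k \<le> length w" "eok S p e" using assms by auto
  show "w = take k w @ ein S e @ drop (k + length (ein S e)) w"
    using 1(1) by (metis append_take_drop_id drop_drop add.commute)
  show "k = length (take k w)" using 1 by simp
qed (use assms in simp)

lemma lay_at: "l_ay (u @ ein S e @ v) (length u, e) = stn D (sid D (map ov u)) (stn D (e_s e) (sid D (map ov v)))"
  by simp

lemma lay_props:
  assumes "okl S p w l"
  shows "sarr D (l_ay w l)" "src (l_ay w l) = map ov w" "trg (l_ay w l) = map ov (nxt S w l)"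
proof -
  obtain k e where l: "l = (k, e)" by (cases l)
  obtain u v where *: "w = u @ ein S e @ v" "k = length u" "eok S p e" using okl_split assms l by metis
  show "sarr D (l_ay w l)" "src (l_ay w l) = map ov w" "trg (l_ay w l) = map ov (nxt S w l)"
    unfolding l * using *(3) by simp_all
qed

lemma lsem_props [simp]:
  "valid S p w L \<Longrightarrow> sarr D (l_s w L)" "src (l_s w L) = map ov w \<or> \<not> valid S p w L"
  "trg (l_s w L) = map ov (fin S w L)"
proof -
  show t: "trg (l_s w L) = map ov (fin S w L)" for w L by (induction L arbitrary: w) simp_all
  have "valid S p w L \<longrightarrow> sarr D (l_s w L) \<and> src (l_s w L) = map ov w" for w L
    by (induction L arbitrary: w) (auto simp: lay_props simp del: lay.simps)
  then show "valid S p w L \<Longrightarrow> sarr D (l_s w L)" "src (l_s w L) = map ov w \<or> \<not> valid S p w L" by auto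
qed

lemma lsem_src [simp]: "valid S p w L \<Longrightarrow> src (l_s w L) = map ov w"
  using lsem_props(2) by blast

lemma valid_append: "valid S p w (L @ M) \<longleftrightarrow> valid S p w L \<and> valid S p (fin S w L) M"
  by (induction L arbitrary: w) auto

lemma fin_append: "fin S w (L @ M) = fin S (fin S w L) M"
  by (induction L arbitrary: w) auto

lemma lsem_append: "\<lbrakk>valid S p w L; valid S p (fin S w L) M\<rbrakk>
    \<Longrightarrow> l_s w (L @ M) = scm D (l_s (fin S w L) M) (l_s w L)"
  by (induction L arbitrary: w) (auto simp: scm_assoc lay_props simp del: lay.simps)

text \<open>Running layers between idle wires \<open>u\<close> and \<open>v\<close>. The three
  claims are proved together because the value of the tail depends on its validity.\<close>

lemma shift_context:
  assumes "valid S p w L"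
  shows "valid S p (u @ w @ v) (shift (length u) L) \<and> fin S (u @ w @ v) (shift (length u) L) = u @ fin S w L @ v \<and>
    l_s (u @ w @ v) (shift (length u) L) = stn D (sid D (map ov u)) (stn D (l_s w L) (sid D (map ov v)))"
  using assms
proof (induction L arbitrary: w)
  case (Cons l L)
  obtain k e where l: "l = (k, e)" by (cases l)
  obtain u' v' where *: "w = u' @ ein S e @ v'" "k = length u'" "eok S p e"
    using okl_split Cons.prems l by (metis valid.simps(2))
  have n: "nxt S w l = u' @ eout S e @ v'" using * l by simp
  have n2: "nxt S (u @ w @ v) (length u + k, e) = u @ (u' @ eout S e @ v') @ v" using * by simp
  have IH: "valid S p (u @ (u' @ eout S e @ v') @ v) (shift (length u) L) \<and> fin S (u @ (u' @ eout S e @ v') @ v) (shift (length u) L) = u @ fin S (u' @ eout S e @ v') L @ v \<and>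
    l_s (u @ (u' @ eout S e @ v') @ v) (shift (length u) L) = stn D (sid D (map ov u)) (stn D (l_s (u' @ eout S e @ v') L) (sid D (map ov v)))"
    using Cons.IH[of "u' @ eout S e @ v'"] Cons.prems n by simp
  have val: "valid S p (u' @ eout S e @ v') L" using Cons.prems n by simp
  have ok: "okl S p (u @ w @ v) (length u + k, e)" using * by simp
  have y: "l_ay (u @ w @ v) (length u + k, e) = stn D (sid D (map ov u)) (stn D (l_ay w l) (sid D (map ov v)))"
    using lay_at[of "u @ u'" e "v' @ v"] lay_at[of u' e v'] *(3) unfolding * l
    by (simp add: stn_assoc stn_sid[symmetric] del: stn_sid lay.simps)
  show ?case
    using IH ok n2 n lay_props[OF Cons.prems[unfolded valid.simps, THEN conjunct1]] val
    by (simp add: l y stn_scm del: lay.simps nxt.simps okl.simps)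
qed simp

lemmas shift_valid = shift_context[THEN conjunct1]
  and shift_fin = shift_context[THEN conjunct2, THEN conjunct1]
  and shift_lsem = shift_context[THEN conjunct2, THEN conjunct2]

lemma shift_0 [simp]: "shift 0 L = L" by (induction L) auto

lemma cross1_sem:
  assumes p
  shows "valid S p (x # ys) (cross1 s x ys) \<and> fin S (x # ys) (cross1 s x ys) = ys @ [x] \<and>
    l_s (x # ys) (cross1 s x ys) = sbr D (bs s) [ov x] (map ov ys)"
proof (induction ys)
  case Nil
  show ?case using braiding.sbr_nil(1)[OF bs[OF assms, of s]] by simp
next
  case (Cons y ys)
  have n: "nxt S (x # y # ys) (0, Cr s x y) = [y] @ (x # ys) @ []" by simp
  have o: "okl S p (x # y # ys) (0, Cr s x y)" using assms by simp
  have l: "l_ay (x # y # ys) (0, Cr s x y) = stn D (sbr D (bs s) [ov x] [ov y]) (sid D (map ov ys))"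
    using braiding.sarr_sbr[OF bs[OF assms, of s], of "[ov x]" "[ov y]"] by simp
  have 1: "valid S p (x # y # ys) (cross1 s x (y # ys))"
    using shift_valid[of "x # ys" "cross1 s x ys" "[y]" "[]"] Cons o n by (simp del: nxt.simps okl.simps)
  have 2: "fin S (x # y # ys) (cross1 s x (y # ys)) = (y # ys) @ [x]"
    using shift_fin[of "x # ys" "cross1 s x ys" "[y]" "[]"] Cons n by (simp del: nxt.simps)
  have "l_s (x # y # ys) (cross1 s x (y # ys)) = scm D (stn D (sid D [ov y]) (sbr D (bs s) [ov x] (map ov ys)))
     (stn D (sbr D (bs s) [ov x] [ov y]) (sid D (map ov ys)))"
    using shift_lsem[of "x # ys" "cross1 s x ys" "[y]" "[]"] Cons n
      braiding.sarr_sbr[OF bs[OF assms, of s], of "[ov x]" "map ov ys"]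
    unfolding cross1.simps lsem.simps l by (simp del: nxt.simps)
  also have "\<dots> = sbr D (bs s) [ov x] (map ov (y # ys))"
    using braiding.sbr_app_right[OF bs[OF assms, of s], of "[ov x]" "[ov y]" "map ov ys"] by simp
  finally show ?case using 1 2 by blast
qed

lemma crossw_sem:
  assumes p
  shows "valid S p (xs @ ys) (crossw s xs ys) \<and> fin S (xs @ ys) (crossw s xs ys) = ys @ xs \<and>
    l_s (xs @ ys) (crossw s xs ys) = sbr D (bs s) (map ov xs) (map ov ys)"
proof (induction xs)
  case Nil
  show ?case using braiding.sbr_nil(2)[OF bs[OF assms, of s]] by simp
next
  case (Cons x xs)
  let ?A = "shift 1 (crossw s xs ys)" and ?B = "cross1 s x ys"
  have A: "valid S p (x # xs @ ys) ?A" "fin S (x # xs @ ys) ?A = (x # ys) @ xs"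
    "l_s (x # xs @ ys) ?A = stn D (sid D [ov x]) (sbr D (bs s) (map ov xs) (map ov ys))"
    using shift_context[of "xs @ ys" "crossw s xs ys" "[x]" "[]"] Cons
      braiding.sarr_sbr[OF bs[OF assms, of s], of "map ov xs" "map ov ys"] by simp_all
  have B: "valid S p ((x # ys) @ xs) ?B" "fin S ((x # ys) @ xs) ?B = ys @ x # xs"
    "l_s ((x # ys) @ xs) ?B = stn D (sbr D (bs s) [ov x] (map ov ys)) (sid D (map ov xs))"
    using shift_context[of "x # ys" ?B "[]" xs] cross1_sem[OF assms, of x ys s]
      braiding.sarr_sbr[OF bs[OF assms, of s], of "[ov x]" "map ov ys"] by simp_all
  have "l_s (x # xs @ ys) (?A @ ?B) = scm D (l_s (fin S (x # xs @ ys) ?A) ?B) (l_s (x # xs @ ys) ?A)"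
    by (rule lsem_append) (use A B in simp_all)
  also have "\<dots> = sbr D (bs s) (map ov (x # xs)) (map ov ys)"
    using braiding.sbr_app_left[OF bs[OF assms, of s], of "[ov x]" "map ov xs" "map ov ys"] A B by simp
  finally show ?case using A B by (simp add: valid_append fin_append)
qed

text \<open>The layers compose to the flattened morphism: structure isomorphisms contribute
  identities by \<open>fl_asc\<close> and its companions, crossings are handled by
  \<open>crossw_sem\<close>.\<close>

lemma tr_sem:
  "wt S p t \<Longrightarrow> valid S p (flat (dm S t)) (tr S t) \<and> fin S (flat (dm S t)) (tr S t) = flat (cd S t) \<and>
    l_s (flat (dm S t)) (tr S t) = fl D (map_ob ov (dm S t)) (map_ob ov (cd S t)) (t_a t)"
proof (induction t)
  case (Gn n)
  then show ?case using bt_ta[of "Gn n"] by simp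
next
  case (Id a)
  show ?case using fl_idn[of "map_ob ov a"] by (simp add: ta_eqs)
next
  case (Cm g f)
  then have IH: "valid S p (flat (dm S f)) (tr S f)" "fin S (flat (dm S f)) (tr S f) = flat (dm S g)"
    "l_s (flat (dm S f)) (tr S f) = fl D (map_ob ov (dm S f)) (map_ob ov (dm S g)) (t_a f)"
    "valid S p (flat (dm S g)) (tr S g)" "fin S (flat (dm S g)) (tr S g) = flat (cd S g)"
    "l_s (flat (dm S g)) (tr S g) = fl D (map_ob ov (dm S g)) (map_ob ov (cd S g)) (t_a g)" by auto
  have "fl D (map_ob ov (dm S f)) (map_ob ov (cd S g)) (t_a g \<odot> t_a f)
     = scm D (fl D (map_ob ov (dm S g)) (map_ob ov (cd S g)) (t_a g)) (fl D (map_ob ov (dm S f)) (map_ob ov (dm S g)) (t_a f))"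
    by (rule fl_cm) (use Cm.prems bt_ta[of f] bt_ta[of g] in simp_all)
  with IH show ?case by (simp add: valid_append fin_append lsem_append ta_Cm)
next
  case (Tm f g)
  let ?F = "fl D (map_ob ov (dm S f)) (map_ob ov (cd S f)) (t_a f)"
  let ?G = "fl D (map_ob ov (dm S g)) (map_ob ov (cd S g)) (t_a g)"
  have w: "wt S p f" "wt S p g" using Tm.prems by auto
  have b: "sarr D ?F" "sarr D ?G" using bt_ta w by auto
  let ?A = "tr S f" and ?B = "shift (length (flat (cd S f))) (tr S g)"
  let ?u = "flat (dm S f)" and ?v = "flat (dm S g)"
  have A: "valid S p (?u @ ?v) ?A" "fin S (?u @ ?v) ?A = flat (cd S f) @ ?v"
    "l_s (?u @ ?v) ?A = stn D ?F (sid D (map ov ?v))"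
    using shift_context[of ?u ?A "[]" ?v] Tm.IH(1)[OF w(1)] b by simp_all
  have B: "valid S p (flat (cd S f) @ ?v) ?B" "fin S (flat (cd S f) @ ?v) ?B = flat (cd S f) @ flat (cd S g)"
    "l_s (flat (cd S f) @ ?v) ?B = stn D (sid D (map ov (flat (cd S f)))) ?G"
    using shift_context[of ?v "tr S g" "flat (cd S f)" "[]"] Tm.IH(2)[OF w(2)] b by simp_all
  have "l_s (?u @ ?v) (?A @ ?B) = scm D (stn D (sid D (map ov (flat (cd S f)))) ?G) (stn D ?F (sid D (map ov ?v)))"
    using A B by (simp add: lsem_append)
  also have "\<dots> = stn D ?F ?G"
    using b by (subst stn_scm) simp_all
  also have "\<dots> = fl D (map_ob ov (dm S (Tm f g))) (map_ob ov (cd S (Tm f g))) (t_a (Tm f g))"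
    using fl_tn[OF bt_ta[OF w(1)] bt_ta[OF w(2)]] by (simp add: ta_eqs)
  finally show ?case using A B by (simp add: valid_append fin_append)
next
  case (As a b c)
  show ?case using fl_asc[of "map_ob ov a" "map_ob ov b" "map_ob ov c"] by (simp add: ta_eqs)
next
  case (Ai a b c)
  show ?case using fl_asci[of "map_ob ov a" "map_ob ov b" "map_ob ov c"] by (simp add: ta_eqs)
next
  case (Lu a)
  show ?case using fl_lun[of "map_ob ov a"] by (simp add: ta_eqs)
next
  case (Li a)
  show ?case using fl_luni[of "map_ob ov a"] by (simp add: ta_eqs)
next
  case (Ru a)
  show ?case using fl_run[of "map_ob ov a"] by (simp add: ta_eqs)
next
  case (Ri a)
  show ?case using fl_runi[of "map_ob ov a"] by (simp add: ta_eqs)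
next
  case (Br a b)
  then have p: p by simp
  show ?case using crossw_sem[OF p, of "flat a" "flat b" True] braiding.fl_brar[OF bs[OF p, of True], of "map_ob ov a" "map_ob ov b"]
    by (simp add: ta_eqs)
next
  case (Bi a b)
  then have p: p by simp
  show ?case using crossw_sem[OF p, of "flat a" "flat b" False] braiding.fl_brar[OF bs[OF p, of False], of "map_ob ov a" "map_ob ov b"]
    by (simp add: ta_eqs)
qed

text \<open>Directed on purpose: validity is assumed of the left list and concluded for the right
  one, so a chain of steps that starts at a translated term never leaves the valid lists.\<close>

definition equiv_at :: "nat list \<Rightarrow> layer list \<Rightarrow> layer list \<Rightarrow> bool" where
  "equiv_at w L L' \<longleftrightarrow> valid S p w L \<longrightarrow> valid S p w L' \<and> fin S w L = fin S w L' \<and> l_s w L = l_s w L'"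

lemma equiv_at_context:
  assumes "equiv_at w l m" "valid S p w l"
  shows "equiv_at (u @ w @ v) (shift (length u) l @ L) (shift (length u) m @ L)"
  using shift_context[of w l u v] shift_context[of w m u v] assms
  by (auto simp: equiv_at_def valid_append fin_append lsem_append)

lemma rew_sound:
  assumes r: "r = (u, l, m)" "valid S p u l" "equiv_at u l m" and e: "rew k r w L = Some L'"
  shows "equiv_at w L L'"
proof -
  have *: "k \<le> length w" "take (length u) (drop k w) = u" "take (length l) L = shift k l"
    and L': "L' = shift k m @ drop (length l) L"
    using e unfolding rew_def r(1) by (auto split: if_splits)
  have w: "w = take k w @ u @ drop (k + length u) w"
    using *(2) by (metis append_take_drop_id drop_drop add.commute)
  have L: "L = shift k l @ drop (length l) L" using *(3) by (metis append_take_drop_id)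
  have k: "length (take k w) = k" using * by simp
  have "equiv_at (take k w @ u @ drop (k + length u) w) (shift (length (take k w)) l @ drop (length l) L)
      (shift (length (take k w)) m @ drop (length l) L)"
    by (rule equiv_at_context) (use r in simp_all)
  then show ?thesis using w L k L' by simp
qed

text \<open>In either order the composite is the tensor product of \<open>e\<close>, the wires
  \<open>x\<close> in between, and \<open>e'\<close>.\<close>

lemma swap_sem:
  assumes "eok S p e" "eok S p e'"
  shows "equiv_at (ein S e @ x @ ein S e') [(0, e), (length (eout S e) + length x, e')] [(length (ein S e) + length x, e'), (0, e)]"
    "equiv_at (ein S e @ x @ ein S e') [(length (ein S e) + length x, e'), (0, e)] [(0, e), (length (eout S e) + length x, e')]"
proof -
  let ?w = "ein S e @ x @ ein S e'" and ?X = "sid D (map ov x)"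
  have c: "stn D (e_s e) (sid D (map ov x @ I)) = stn D (stn D (e_s e) ?X) (sid D I)" if "set I \<subseteq> Ob D" for I
    using assms that by (simp add: stn_assoc)
  have 1: "l_s ?w [(0, e), (length (eout S e) + length x, e')] = stn D (stn D (e_s e) ?X) (e_s e')"
    using assms c[of "map ov (ein S e')"] by (simp add: stn_scm)
  have 2: "l_s ?w [(length (ein S e) + length x, e'), (0, e)] = stn D (stn D (e_s e) ?X) (e_s e')"
    using assms c[of "map ov (eout S e')"] by (simp add: stn_scm)
  show "equiv_at ?w [(0, e), (length (eout S e) + length x, e')] [(length (ein S e) + length x, e'), (0, e)]"
    "equiv_at ?w [(length (ein S e) + length x, e'), (0, e)] [(0, e), (length (eout S e) + length x, e')]"
    using assms 1 2 by (simp_all add: equiv_at_def)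
qed

lemma append_split: "\<lbrakk>xs @ ys = zs @ ts; length xs \<le> length zs\<rbrakk> \<Longrightarrow> \<exists>us. zs = xs @ us \<and> ys = us @ ts"
  by (auto simp: append_eq_append_conv2)

lemma swapl_sound:
  assumes "swapl S w L = Some L'"
  shows "equiv_at w L L'"
  unfolding equiv_at_def
proof
  assume v: "valid S p w L"
  obtain k e k' e' M where L: "L = (k, e) # (k', e') # M" and le: "k + length (eout S e) \<le> k'"
    and L': "L' = (k' - length (eout S e) + length (ein S e), e') # (k, e) # M"
    using assms by (cases "(S, w, L)" rule: swapl.cases) (auto simp: Let_def split: if_splits)
  have o: "okl S p w (k, e)" "okl S p (nxt S w (k, e)) (k', e')" using v L by auto
  obtain u v1 where 1: "w = u @ ein S e @ v1" "k = length u" "eok S p e" using okl_split o(1) by metis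
  have n: "nxt S w (k, e) = u @ eout S e @ v1" using 1 by simp
  obtain a b where 2: "u @ eout S e @ v1 = a @ ein S e' @ b" "k' = length a" "eok S p e'"
    using okl_split o(2) unfolding n by metis
  obtain x where a: "a = u @ eout S e @ x" and v1: "v1 = x @ ein S e' @ b"
    using append_split[of "u @ eout S e" v1 a "ein S e' @ b"] 1(2) 2 le by auto
  have "equiv_at (u @ (ein S e @ x @ ein S e') @ b)
      (shift (length u) [(0, e), (length (eout S e) + length x, e')] @ M)
      (shift (length u) [(length (ein S e) + length x, e'), (0, e)] @ M)"
    by (rule equiv_at_context[OF swap_sem(1)]) (use 1 2 in simp_all)
  moreover have "k' = length u + (length (eout S e) + length x)" using 2(2) a by simp
  ultimately show "valid S p w L' \<and> fin S w L = fin S w L' \<and> l_s w L = l_s w L'"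
    using v unfolding equiv_at_def L L' 1(1,2) v1 by (simp add: ac_simps del: valid.simps fin.simps lsem.simps)
qed

lemma swapr_sound:
  assumes "swapr S w L = Some L'"
  shows "equiv_at w L L'"
  unfolding equiv_at_def
proof
  assume v: "valid S p w L"
  obtain k e k' e' M where L: "L = (k, e) # (k', e') # M" and le: "k' + length (ein S e') \<le> k"
    and L': "L' = (k', e') # (k - length (ein S e') + length (eout S e'), e) # M"
    using assms by (cases "(S, w, L)" rule: swapr.cases) (auto simp: Let_def split: if_splits)
  have o: "okl S p w (k, e)" "okl S p (nxt S w (k, e)) (k', e')" using v L by auto
  obtain u v1 where 1: "w = u @ ein S e @ v1" "k = length u" "eok S p e" using okl_split o(1) by metis
  have n: "nxt S w (k, e) = u @ eout S e @ v1" using 1 by simp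
  obtain a b where 2: "u @ eout S e @ v1 = a @ ein S e' @ b" "k' = length a" "eok S p e'"
    using okl_split o(2) unfolding n by metis
  obtain x where u: "u = a @ ein S e' @ x" and b: "b = x @ eout S e @ v1"
    using append_split[of "a @ ein S e'" b u "eout S e @ v1"] 1(2) 2 le by auto
  have "equiv_at (a @ (ein S e' @ x @ ein S e) @ v1)
      (shift (length a) [(length (ein S e') + length x, e), (0, e')] @ M)
      (shift (length a) [(0, e'), (length (eout S e') + length x, e)] @ M)"
    by (rule equiv_at_context[OF swap_sem(2)]) (use 1 2 in simp_all)
  moreover have "k = length a + (length (ein S e') + length x)" using 1(2) u by simp
  ultimately show "valid S p w L' \<and> fin S w L = fin S w L' \<and> l_s w L = l_s w L'"
    using v unfolding equiv_at_def L L' 1(1) 2(2) u by (simp add: ac_simps del: valid.simps fin.simps lsem.simps)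
qed

lemma nth_step_sound:
  assumes "\<And>w L L'. f w L = Some L' \<Longrightarrow> equiv_at w L L'"
  shows "nth_step S i f w L = Some L' \<Longrightarrow> equiv_at w L L'"
proof (induction i arbitrary: w L L')
  case (Suc i)
  then show ?case by (auto simp: equiv_at_def split: list.splits)
qed (use assms in simp)

text \<open>Naturality of a crossing of words, with the identity of the wire \<open>w\<close> as the
  other arrow.\<close>

lemma slide_sound:
  assumes "p" "eok S p e" "slide S left s w e = (u, l, m)"
  shows "valid S p u l \<and> valid S p u m \<and> equiv_at u l m"
proof -
  let ?x = "ein S e" and ?y = "eout S e"
  have c: "valid S p (xs @ ys) (crossw s xs ys)" "fin S (xs @ ys) (crossw s xs ys) = ys @ xs"
    "l_s (xs @ ys) (crossw s xs ys) = sbr D (bs s) (map ov xs) (map ov ys)" for xs ys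
    using crossw_sem[OF assms(1)] by auto
  have b: "sarr D (sbr D (bs s) (map ov xs) (map ov ys))" for xs ys
    using braiding.sarr_sbr[OF bs[OF assms(1)]] by simp
  show ?thesis
  proof (cases left)
    case True
    have e: "u = [w] @ ?x" "l = crossw s [w] ?x @ [(0, e)]" "m = (1, e) # crossw s [w] ?y"
      using assms(3) True by (auto simp: slide_def Let_def)
    have o1: "valid S p (?x @ [w]) [(0, e)]" "fin S (?x @ [w]) [(0, e)] = ?y @ [w]" using assms by simp_all
    have l1: "l_s (?x @ [w]) [(0, e)] = stn D (e_s e) (sid D [ov w])" using assms by simp
    have n: "nxt S ([w] @ ?x) (1, e) = [w] @ ?y" by simp
    have o2: "okl S p ([w] @ ?x) (1, e)" "l_ay ([w] @ ?x) (1, e) = stn D (sid D [ov w]) (e_s e)" using assms by simp_all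
    have L: "valid S p u l" "fin S u l = ?y @ [w]"
      "l_s u l = scm D (stn D (e_s e) (sid D [ov w])) (sbr D (bs s) [ov w] (map ov ?x))"
      unfolding e valid_append fin_append using c[of "[w]" ?x] o1 l1 by (simp_all add: lsem_append del: crossw.simps append_Cons)
    have M: "valid S p u m" "fin S u m = ?y @ [w]"
      "l_s u m = scm D (sbr D (bs s) [ov w] (map ov ?y)) (stn D (sid D [ov w]) (e_s e))"
      unfolding e valid.simps fin.simps lsem.simps n using c[of "[w]" ?y] o2
      by (simp_all del: crossw.simps append_Cons okl.simps lay.simps)
    have "scm D (sbr D (bs s) [ov w] (map ov ?y)) (stn D (sid D [ov w]) (e_s e))
        = scm D (stn D (e_s e) (sid D [ov w])) (sbr D (bs s) [ov w] (map ov ?x))"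
      using braiding.sbr_natural[OF bs[OF assms(1), of s], of "sid D [ov w]" "e_s e"] assms(2) by simp
    then show ?thesis using L M by (simp add: equiv_at_def)
  next
    case False
    have e: "u = ?x @ [w]" "l = crossw s ?x [w] @ [(1, e)]" "m = (0, e) # crossw s ?y [w]"
      using assms(3) False by (auto simp: slide_def Let_def)
    have o1: "valid S p ([w] @ ?x) [(1, e)]" "fin S ([w] @ ?x) [(1, e)] = [w] @ ?y" using assms by simp_all
    have l1: "l_s ([w] @ ?x) [(1, e)] = stn D (sid D [ov w]) (e_s e)" using assms by simp
    have n: "nxt S (?x @ [w]) (0, e) = ?y @ [w]" by simp
    have o2: "okl S p (?x @ [w]) (0, e)" "l_ay (?x @ [w]) (0, e) = stn D (e_s e) (sid D [ov w])" using assms by simp_all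
    have L: "valid S p u l" "fin S u l = [w] @ ?y"
      "l_s u l = scm D (stn D (sid D [ov w]) (e_s e)) (sbr D (bs s) (map ov ?x) [ov w])"
      unfolding e valid_append fin_append using c[of ?x "[w]"] o1 l1 by (simp_all add: lsem_append del: crossw.simps append_Cons)
    have M: "valid S p u m" "fin S u m = [w] @ ?y"
      "l_s u m = scm D (sbr D (bs s) (map ov ?y) [ov w]) (stn D (e_s e) (sid D [ov w]))"
      unfolding e valid.simps fin.simps lsem.simps n using c[of ?y "[w]"] o2
      by (simp_all del: crossw.simps append_Cons okl.simps lay.simps)
    have "scm D (sbr D (bs s) (map ov ?y) [ov w]) (stn D (e_s e) (sid D [ov w]))
        = scm D (stn D (sid D [ov w]) (e_s e)) (sbr D (bs s) (map ov ?x) [ov w])"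
      using braiding.sbr_natural[OF bs[OF assms(1), of s], of "e_s e" "sid D [ov w]"] assms(2) by simp
    then show ?thesis using L M by (simp add: equiv_at_def)
  qed
qed

lemma cancel_sound:
  assumes "p" "cancel s x y = (u, l, m)"
  shows "valid S p u l \<and> valid S p u m \<and> equiv_at u l m"
proof -
  have e: "u = [x, y]" "l = [(0, Cr s x y), (0, Cr (\<not> s) y x)]" "m = []"
    using assms(2) by (auto simp: cancel_def)
  have "scm D (sbr D (bs (\<not> s)) [ov y] [ov x]) (sbr D (bs s) [ov x] [ov y]) = sid D [ov x, ov y]"
    using braiding_pair.sbr_inverse[OF pair[OF assms(1)], of "[ov x]" "[ov y]"] by (cases s) simp_all
  then show ?thesis
    unfolding e equiv_at_def
    using assms(1) braiding.sarr_sbr[OF bs[OF assms(1), of s], of "[ov x]" "[ov y]"]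
      braiding.sarr_sbr[OF bs[OF assms(1), of "\<not> s"], of "[ov y]" "[ov x]"]
    by auto
qed

definition good :: "rule \<Rightarrow> bool" where
  "good r \<longleftrightarrow> (case r of (u, l, m) \<Rightarrow> valid S p u l \<and> valid S p u m \<and> equiv_at u l m)"

text \<open>A relation may be used backwards because \<open>good\<close> asks for validity of both
  sides.\<close>

lemma good_rew: "\<lbrakk>good r; rew k (flip b r) w L = Some L'\<rbrakk> \<Longrightarrow> equiv_at w L L'"
proof -
  assume g: "good r" and e: "rew k (flip b r) w L = Some L'"
  obtain u l m where r: "r = (u, l, m)" by (cases r)
  show ?thesis
  proof (cases b)
    case True
    then show ?thesis using rew_sound[of r u l m k w L L'] g e r by (simp add: good_def flip_def)
  next
    case False
    then show ?thesis using rew_sound[of "(u, m, l)" u m l k w L L'] g e r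
      by (auto simp: good_def flip_def equiv_at_def)
  qed
qed

lemma do_step_sound:
  assumes R: "\<forall>r \<in> set R. good r" and e: "do_step S p R st w L = Some L'"
  shows "equiv_at w L L'"
proof (cases st)
  case (SL i)
  then show ?thesis using e nth_step_sound[of "swapl S"] swapl_sound by simp
next
  case (SR i)
  then show ?thesis using e nth_step_sound[of "swapr S"] swapr_sound by simp
next
  case (RW i k n b)
  then have n: "n < length R" "nth_step S i (rew k (flip b (R ! n))) w L = Some L'"
    using e by (auto split: if_splits)
  show ?thesis by (rule nth_step_sound[OF good_rew n(2)]) (use R n(1) in auto)
next
  case (NB i k left s x e' b)
  then have n: p "eok S p e'" "nth_step S i (rew k (flip b (slide S left s x e'))) w L = Some L'"
    using e by (auto split: if_splits)
  have "good (slide S left s x e')"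
    using slide_sound[OF n(1,2)] by (auto simp: good_def split: prod.splits)
  then show ?thesis using nth_step_sound[where f = "rew k (flip b (slide S left s x e'))"] good_rew n(3) by blast
next
  case (XX i k s x y b)
  then have n: p "nth_step S i (rew k (flip b (cancel s x y))) w L = Some L'"
    using e by (auto split: if_splits)
  have "good (cancel s x y)"
    using cancel_sound[OF n(1)] by (auto simp: good_def split: prod.splits)
  then show ?thesis using nth_step_sound[where f = "rew k (flip b (cancel s x y))"] good_rew n(2) by blast
qed

lemma steps_sound:
  assumes R: "\<forall>r \<in> set R. good r"
  shows "steps S p R w ss L = Some L' \<Longrightarrow> equiv_at w L L'"
proof (induction ss arbitrary: L)
  case (Cons s ss)
  then show ?case using do_step_sound[OF R, of s w L] by (auto simp: equiv_at_def split: option.splits)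
qed (simp add: equiv_at_def)

text \<open>Relations that hold under the valuation are good rules, so \<open>tr t\<close> and
  \<open>tr u\<close> denote the same arrow between words; \<open>fl_inj\<close> returns from words
  to \<open>D\<close>.\<close>

lemma derives_sound:
  assumes d: "derives S p R t u ss" and R: "\<forall>r \<in> set R. t_v (fst r) = t_v (snd r)"
  shows "t_v t = t_v u"
proof -
  have w: "wt S p t" "wt S p u" "dm S t = dm S u" "cd S t = cd S u" "list_all (wteq S p) R"
    using d by (auto simp: derives_def wteq_def)
  let ?R = "map (\<lambda>r. (flat (dm S (fst r)), tr S (fst r), tr S (snd r))) R"
  have "good r" if r: "r \<in> set ?R" for r
  proof -
    obtain t' u' where tu: "(t', u') \<in> set R" and r: "r = (flat (dm S t'), tr S t', tr S u')" using r by auto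
    have w': "wt S p t'" "wt S p u'" "dm S t' = dm S u'" "cd S t' = cd S u'"
      using w(5) tu by (auto simp: list_all_iff wteq_def)
    have "t_a t' = t_a u'" using R tu w' by (auto intro!: ar_eqI)
    then show ?thesis using tr_sem[OF w'(1)] tr_sem[OF w'(2)] w' by (simp add: good_def r equiv_at_def)
  qed
  then have "equiv_at (flat (dm S t)) (tr S t) (tr S u)"
    using d steps_sound[of ?R] by (auto simp: derives_def)
  then have "fl D (map_ob ov (dm S t)) (map_ob ov (cd S t)) (t_a t) = fl D (map_ob ov (dm S t)) (map_ob ov (cd S t)) (t_a u)"
    using tr_sem[OF w(1)] tr_sem[OF w(2)] w by (simp add: equiv_at_def)
  then have "t_a t = t_a u"
    using bt_ta[OF w(1)] bt_ta[OF w(2)] w(3,4) by (intro fl_inj) simp_all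
  then show ?thesis by (metis ta_simps(3))
qed

end

text \<open>Lookup with a default, so that every number denotes an object, as
  \<open>diagrams\<close> demands; objects default to the unit.\<close>

primrec lk :: "'b \<Rightarrow> 'b list \<Rightarrow> nat \<Rightarrow> 'b" where
  "lk d [] n = d" | "lk d (x # xs) n = (case n of 0 \<Rightarrow> x | Suc m \<Rightarrow> lk d xs m)"

lemma lk_simps [simp]: "lk d (x # xs) 0 = x" "lk d (x # xs) (Suc m) = lk d xs m" "lk d (x # xs) 1 = lk d xs 0"
  "lk d (x # xs) (numeral k) = lk d xs (pred_numeral k)"
  by (simp_all add: numeral_eq_Suc)

declare lk.simps(2) [simp del]

lemma lk_nth: "n < length xs \<Longrightarrow> lk d xs n = xs ! n"
  by (induction xs arbitrary: n) (auto split: nat.split simp: lk.simps)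

lemma lk_Ob: "\<lbrakk>d \<in> A; set xs \<subseteq> A\<rbrakk> \<Longrightarrow> lk d xs n \<in> A"
  by (induction xs arbitrary: n) (auto split: nat.split simp: lk.simps)

abbreviation tms :: "('o, 'a, 'k, 'z) monoidal_scheme \<Rightarrow> ('o \<Rightarrow> 'o \<Rightarrow> 'a) \<Rightarrow> ('o \<Rightarrow> 'o \<Rightarrow> 'a) \<Rightarrow> 'o list \<Rightarrow> 'a list \<Rightarrow> tm \<Rightarrow> 'a" where
  "tms D \<beta> \<gamma> os gs \<equiv> tv D \<beta> \<gamma> (lk (Uni D) os) (lk undefined gs)"

abbreviation deq :: "('o, 'a, 'k, 'z) monoidal_scheme \<Rightarrow> 'o list \<Rightarrow> 'a list \<Rightarrow> tm \<Rightarrow> tm \<Rightarrow> bool" where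
  "deq D os gs t u \<equiv> tms D undefined undefined os gs t = tms D undefined undefined os gs u"

abbreviation dhom :: "('o, 'a, 'k, 'z) monoidal_scheme \<Rightarrow> 'o list \<Rightarrow> 'a list \<Rightarrow> tm \<Rightarrow> nat ob \<Rightarrow> nat ob \<Rightarrow> bool" where
  "dhom D os gs t a b \<equiv> tms D undefined undefined os gs t \<in> Hom D (obj D (map_ob (lk (Uni D) os) a)) (obj D (map_ob (lk (Uni D) os) b))"

abbreviation beq :: "('o, 'a, 'k, 'z) braided_scheme \<Rightarrow> 'o list \<Rightarrow> 'a list \<Rightarrow> tm \<Rightarrow> tm \<Rightarrow> bool" where
  "beq B os gs t u \<equiv> tms B (Braid B) (BraidInv B) os gs t = tms B (Braid B) (BraidInv B) os gs u"

abbreviation bhom :: "('o, 'a, 'k, 'z) braided_scheme \<Rightarrow> 'o list \<Rightarrow> 'a list \<Rightarrow> tm \<Rightarrow> nat ob \<Rightarrow> nat ob \<Rightarrow> bool" where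
  "bhom B os gs t a b \<equiv> tms B (Braid B) (BraidInv B) os gs t \<in> Hom B (obj B (map_ob (lk (Uni B) os) a)) (obj B (map_ob (lk (Uni B) os) b))"

text \<open>Terms for composites that recur: \<open>zl\<close> and \<open>zr\<close> are the two
  triangle identities, \<open>msd\<close> is \<open>middle_swap\<close>, \<open>ned\<close> is
  \<open>nest\<close>, \<open>mud\<close> is the composite action of two nested pairings, and
  \<open>gad\<close>, \<open>jcd\<close>, \<open>fad\<close> are the formulas of
  \<open>gact\<close>, \<open>JC\<close> and \<open>pairing_action_factor\<close>.\<close>

abbreviation zl :: "nat ob \<Rightarrow> nat ob \<Rightarrow> tm \<Rightarrow> tm \<Rightarrow> tm \<times> tm" where
  "zl a b e c \<equiv> (Lu a ;; e ## Id a ;; Ai a b a ;; Id a ## c ;; Ri a, Id a)"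

abbreviation zr :: "nat ob \<Rightarrow> nat ob \<Rightarrow> tm \<Rightarrow> tm \<Rightarrow> tm \<times> tm" where
  "zr a b e c \<equiv> (Ru a ;; Id a ## e ;; As a b a ;; c ## Id a ;; Li a, Id a)"

abbreviation "RF i k n \<equiv> RW i k n True"
abbreviation "RB i k n \<equiv> RW i k n False"

abbreviation msd where "msd w x y z \<equiv> Ai w y (x**z) ;; Id w##(As y x z ;; Br x y##Id z ;; Ai x y z) ;; As w x (y**z)"

abbreviation ned where "ned x x' y' y e e' \<equiv> e ;; Id x##(Lu y ;; e'##Id y ;; Ai x' y' y) ;; As x x' (y'**y)"

abbreviation mud where "mud m x y x' y' g g' \<equiv> g' ;; Id y'##g##Id x' ;; Id y'##Ai y (m**x) x' ;; Id y'##Id y##Ai m x x' ;; As y' y (m**x**x')"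

abbreviation gad where "gad a m x y g \<equiv> Id a##g ;; As a y (m**x) ;; Bi y a##Id (m**x) ;; Ai y a (m**x) ;; Id y##As a m x"

abbreviation jcd where "jcd m v w h k g c \<equiv> Bi m k ;; g##Id k ;; (Id w##As m v h)##Id k ;; As w (m**v) h##Id k
  ;; Ai (w**m**v) h k ;; Id (w**m**v)##(Br k h ;; c) ;; Ri (w**m**v)"

abbreviation fad where "fad x y' y s m g' g c \<equiv> g' ;; Id y'##g##Id s ;; Id y'##Ai y (m**x**y') s ;; Id y'##Id y##As m x y'##Id s
  ;; Id y'##Id y##Ai (m**x) y' s ;; As y' y ((m**x)**y'**s) ;; As (y'**y) (m**x) (y'**s) ;; Id ((y'**y)**m**x)##c ;; Ri ((y'**y)**m**x)"

lemma (in linear_monoidal_category) diagrams_lk: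
  assumes "set os \<subseteq> Ob D \<and> list_all2 (\<lambda>v s. v \<in> Hom D (obj D (map_ob (lk \<one> os) (fst s))) (obj D (map_ob (lk \<one> os) (snd s)))) gs S"
    and "p \<Longrightarrow> braiding_pair D \<beta> \<gamma>"
  shows "diagrams D \<beta> \<gamma> (lk \<one> os) (lk undefined gs) S p"
proof (intro diagrams.intro diagrams_axioms.intro linear_monoidal_category_axioms)
  show "lk \<one> os n \<in> Ob D" for n using lk_Ob assms(1) uni_ob by metis
  show "lk undefined gs n \<in> Hom D (obj D (map_ob (lk \<one> os) (fst (S ! n)))) (obj D (map_ob (lk \<one> os) (snd (S ! n))))"
    if "n < length S" for n
    using assms(1) that by (simp add: list_all2_conv_all_nth lk_nth)
qed (rule assms(2))

context diagrams
begin

lemma derives_eq: "\<lbrakk>derives S p R t u ss; list_all (\<lambda>r. tv D \<beta> \<gamma> ov gv (fst r) = tv D \<beta> \<gamma> ov gv (snd r)) R\<rbrakk>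
    \<Longrightarrow> tv D \<beta> \<gamma> ov gv t = tv D \<beta> \<gamma> ov gv u"
  by (rule derives_sound) (simp_all add: list_all_iff)

lemma typed_hom: "wt S p t \<and> dm S t = a \<and> cd S t = b \<Longrightarrow> tv D \<beta> \<gamma> ov gv t \<in> Hom D (obj D (map_ob ov a)) (obj D (map_ob ov b))"
  using ta_arr[of t] by (simp add: arr_def del: arr_ob)

end

context linear_monoidal_category
begin

text \<open>Pattern of use: \<open>code_simp\<close> evaluates \<open>derives\<close>; the second
  premise is the typing of the listed objects and morphisms; the third consists of the relations
  that the steps may apply, supplied from facts about the category.\<close>

lemma diagram:
  assumes "derives S False R t u ss"
    and "set os \<subseteq> Ob D \<and> list_all2 (\<lambda>v s. v \<in> Hom D (obj D (map_ob (lk \<one> os) (fst s))) (obj D (map_ob (lk \<one> os) (snd s)))) gs S"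
    and "list_all (\<lambda>r. deq D os gs (fst r) (snd r)) R"
  shows "deq D os gs t u"
  using diagrams.derives_eq[OF diagrams_lk[OF assms(2)] assms(1,3)] by simp

lemma diagram_hom:
  assumes "wt S False t \<and> dm S t = a \<and> cd S t = b"
    and "set os \<subseteq> Ob D \<and> list_all2 (\<lambda>v s. v \<in> Hom D (obj D (map_ob (lk \<one> os) (fst s))) (obj D (map_ob (lk \<one> os) (snd s)))) gs S"
  shows "dhom D os gs t a b"
  using diagrams.typed_hom[OF diagrams_lk[OF assms(2)] assms(1)] by simp

end

lemmas diag_simps = list.pred_inject fst_conv snd_conv tv.simps lk_simps obj.simps ob.map simp_thms
  pred_numeral_simps BitM.simps arith_simps numeral_One One_nat_def

section \<open>Objects of \<open>HH(D)\<close> as actions of pairings\<close>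

text \<open>\<open>e\<close> pairs the outer factors \<open>X\<close>, \<open>Y\<close> and
  \<open>e'\<close> the inner ones \<open>X'\<close>, \<open>Y'\<close>, in accordance with the
  reversal of tensor products under duality.\<close>

definition nest :: "('o, 'a, 'k, 'z) monoidal_scheme \<Rightarrow> 'o \<Rightarrow> 'o \<Rightarrow> 'o \<Rightarrow> 'o \<Rightarrow> 'a \<Rightarrow> 'a \<Rightarrow> 'a" where
  "nest D X X' Y' Y e e' = Cmp D e (Cmp D (Tar D (Ide D X) (Cmp D (Lun D Y) (Cmp D (Tar D e' (Ide D Y)) (AscInv D X' Y' Y))))
    (Asc D X X' (Ten D Y' Y)))"

context
  fixes D :: "('o, 'a, 'k, 'z) rigid_scheme" (structure)
begin

text \<open>
  A family \<open>G e : Y \<otimes> (M \<otimes> X) \<rightarrow> M\<close> indexed by pairings \<open>e : X \<otimes> Y \<rightarrow> 1\<close>.  This is a half braiding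
  with all duals removed: \<open>t X\<close> is the mate of \<open>G (ev_right X)\<close>, and \<open>G\<close> is recovered from \<open>t\<close> by
  evaluating \<open>\<^sup>#X\<close> against the map \<open>Y \<rightarrow> \<^sup>*X\<close> adjoint to \<open>e\<close>.
\<close>

definition pairing_action :: "'o \<Rightarrow> ('o \<Rightarrow> 'o \<Rightarrow> 'a \<Rightarrow> 'a) \<Rightarrow> bool" where
  "pairing_action M G \<longleftrightarrow> M \<in> Ob D \<and>
    (\<forall>X \<in> Ob D. \<forall>Y \<in> Ob D. \<forall>e \<in> Hom D (X \<otimes> Y) \<one>. G X Y e \<in> Hom D (Y \<otimes> (M \<otimes> X)) M) \<and>
    (\<forall>X \<in> Ob D. \<forall>Y \<in> Ob D. \<forall>X' \<in> Ob D. \<forall>Y' \<in> Ob D. \<forall>e \<in> Hom D (X \<otimes> Y) \<one>.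
      \<forall>f \<in> Hom D X' X. \<forall>k \<in> Hom D Y' Y. G X' Y' (e \<cdot> (f \<star> k)) = G X Y e \<cdot> (k \<star> (Ide D M \<star> f))) \<and>
    G \<one> \<one> (Lun D \<one>) = Lun D M \<cdot> (Ide D \<one> \<star> Run D M) \<and>
    (\<forall>X \<in> Ob D. \<forall>Y \<in> Ob D. \<forall>X' \<in> Ob D. \<forall>Y' \<in> Ob D. \<forall>e \<in> Hom D (X \<otimes> Y) \<one>. \<forall>e' \<in> Hom D (X' \<otimes> Y') \<one>.
      G (X \<otimes> X') (Y' \<otimes> Y) (nest D X X' Y' Y e e') = G X' Y' e' \<cdot> (Ide D Y' \<star> (G X Y e \<star> Ide D X'))
        \<cdot> (Ide D Y' \<star> AscInv D Y (M \<otimes> X) X') \<cdot> (Ide D Y' \<star> (Ide D Y \<star> AscInv D M X X')) \<cdot> Asc D Y' Y (M \<otimes> (X \<otimes> X')))"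

definition pairact :: "'o \<times> ('o \<Rightarrow> 'a) \<Rightarrow> 'o \<Rightarrow> 'o \<Rightarrow> 'a \<Rightarrow> 'a" where
  "pairact = (\<lambda>(M, t) X Y e. Lun D M \<cdot> (ev_right D (rdual D X) \<star> Ide D M) \<cdot> AscInv D (rdual D X) (sharp D X) M
    \<cdot> (rcurry D X Y e \<star> t X))"

definition acthalf :: "'o \<Rightarrow> ('o \<Rightarrow> 'o \<Rightarrow> 'a \<Rightarrow> 'a) \<Rightarrow> 'o \<Rightarrow> 'a" where
  "acthalf M G = (\<lambda>X \<in> Ob D. (Ide D (sharp D X) \<star> G X (rdual D X) (ev_right D X))
    \<cdot> Asc D (sharp D X) (rdual D X) (M \<otimes> X) \<cdot> (coev_right D (rdual D X) \<star> Ide D (M \<otimes> X)) \<cdot> LunInv D (M \<otimes> X))"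

end

context linear_monoidal_category
begin

abbreviation (input) ten_short (infixr "*." 70) where "X *. Y \<equiv> X \<otimes> Y"
abbreviation (input) tar_short (infixr "*:" 70) where "f *: g \<equiv> f \<star> g"
abbreviation (input) cmp_short (infixr ":." 55) where "f :. g \<equiv> f \<cdot> g"

end

section \<open>Transposes, comparison of duals, and the double right dual\<close>

context rigid_monoidal_category
begin

lemma sharp_ob: "X \<in> Ob D \<Longrightarrow> sharp D X \<in> Ob D" by (simp add: sharp_def rdual_ob)

lemma lsharp_ob: "X \<in> Ob D \<Longrightarrow> lsharp D X \<in> Ob D" by (simp add: lsharp_def ldual_ob)

lemmas rigid_homs = ten_ob uni_ob ldual_ob rdual_ob sharp_ob lsharp_ob lev_hom lcoev_hom rev_hom rcoev_hom

lemmas zigzags = ldual_zigzag ldual_zagzig rdual_zigzag rdual_zagzig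

lemma ev_rcurry:
  assumes "X \<in> Ob D" "A \<in> Ob D" "e \<in> Hom D (X*.A) \<one>"
  shows "ev_right D X :. (Ide D X*:rcurry D X A e) = e"
proof -
  have "deq D [X, A, rdual D X] [ev_right D X, coev_right D X, e]
    ($$0 ;; Id $0##(Ru $2 ;; Id $2##$$2 ;; As $2 $0 $1 ;; $$1##Id $1 ;; Li $1))
    ($$2)"
    by (rule diagram[of "[($0**$2, Ue), (Ue, $2**$0), ($0**$1, Ue)]"
  "[zl $0 $2 $$0 $$1]" _ _ "[SR 1, RF 0 0 0]"],
  code_simp, simp add: assms rigid_homs, simp only: diag_simps, (intro conjI TrueI zigzags; simp add: assms rigid_homs))
  then show ?thesis by (simp add: rcurry_def)
qed

lemma rcurry_hom:
  assumes "X \<in> Ob D" "A \<in> Ob D" "e \<in> Hom D (X*.A) \<one>"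
  shows "rcurry D X A e \<in> Hom D A (rdual D X)"
proof -
  have "dhom D [X, A, rdual D X] [coev_right D X, e]
    (Ru $2 ;; Id $2##$$1 ;; As $2 $0 $1 ;; $$0##Id $1 ;; Li $1) ($1) ($2)"
    by (rule diagram_hom[of "[(Ue, $2**$0), ($0**$1, Ue)]"], code_simp, simp add: assms rigid_homs)
  then show ?thesis by (simp add: rcurry_def)
qed

lemma rcurry_ev:
  assumes "X \<in> Ob D" "A \<in> Ob D" "f \<in> Hom D A (rdual D X)"
  shows "rcurry D X A (ev_right D X :. (Ide D X*:f)) = f"
proof -
  have "deq D [X, A, rdual D X] [ev_right D X, coev_right D X, f]
    (Ru $2 ;; Id $2##($$0 ;; Id $0##$$2) ;; As $2 $0 $1 ;; $$1##Id $1 ;; Li $1)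
    ($$2)"
    by (rule diagram[of "[($0**$2, Ue), (Ue, $2**$0), ($1, $2)]"
  "[zr $2 $0 $$0 $$1]" _ _ "[SL 0, RF 1 0 0]"],
  code_simp, simp add: assms rigid_homs, simp only: diag_simps, (intro conjI TrueI zigzags; simp add: assms rigid_homs))
  then show ?thesis by (simp add: rcurry_def)
qed

text \<open>A copairing satisfying the triangle identities makes \<open>A\<close> a second right
  dual of \<open>X\<close>. Right duals are unique up to isomorphism, and \<open>?g\<close> is the
  comparison in the other direction.\<close>

lemma rcurry_iso:
  assumes "X \<in> Ob D" "A \<in> Ob D" "e \<in> Hom D (X*.A) \<one>" "c \<in> Hom D \<one> (A*.X)"
    "Lun D X :. e*:Ide D X :. AscInv D X A X :. Ide D X*:c :. RunInv D X = Ide D X" "Run D A :. Ide D A*:e :. Asc D A X A :. c*:Ide D A :. LunInv D A = Ide D A"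
  shows "is_iso D A (rdual D X) (rcurry D X A e)"
proof -
  let ?g = "Run D A :. Ide D A*:ev_right D X :. Asc D A X (rdual D X) :. c*:Ide D (rdual D X) :. LunInv D (rdual D X)"
  have 1: "rcurry D X A e :. ?g = Ide D (rdual D X)"
  proof -
    have "deq D [X, A, rdual D X] [ev_right D X, coev_right D X, e, c]
      ((Ru $2 ;; Id $2##$$2 ;; As $2 $0 $1 ;; $$1##Id $1 ;; Li $1) ;; Ru $1 ;; Id $1##$$0 ;; As $1 $0 $2 ;; $$3##Id $2 ;; Li $2)
      (Id $2)"
      by (rule diagram[of "[($0**$2, Ue), (Ue, $2**$0), ($0**$1, Ue), (Ue, $1**$0)]"
  "[zr $2 $0 $$0 $$1, zl $0 $1 $$2 $$3]" _ _ "[SR 1, SR 0, SR 2, RF 1 1 1, RF 0 0 0]"],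
  code_simp, simp add: assms(1-4) rigid_homs, simp only: diag_simps, (intro conjI TrueI assms(5-) zigzags; simp add: assms(1-4) rigid_homs))
    then show ?thesis by (simp add: rcurry_def)
  qed
  have 2: "?g :. rcurry D X A e = Ide D A"
  proof -
    have "deq D [X, A, rdual D X] [ev_right D X, coev_right D X, e, c]
      ((Ru $1 ;; Id $1##$$0 ;; As $1 $0 $2 ;; $$3##Id $2 ;; Li $2) ;; Ru $2 ;; Id $2##$$2 ;; As $2 $0 $1 ;; $$1##Id $1 ;; Li $1)
      (Id $1)"
      by (rule diagram[of "[($0**$2, Ue), (Ue, $2**$0), ($0**$1, Ue), (Ue, $1**$0)]"
  "[zl $0 $2 $$0 $$1, zr $1 $0 $$2 $$3]" _ _ "[SR 1, SR 0, SR 2, RF 1 1 0, RF 0 0 1]"],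
  code_simp, simp add: assms(1-4) rigid_homs, simp only: diag_simps, (intro conjI TrueI assms(5-) zigzags; simp add: assms(1-4) rigid_homs))
    then show ?thesis by (simp add: rcurry_def)
  qed
  have "dhom D [X, A, rdual D X] [ev_right D X, c]
    (Ru $1 ;; Id $1##$$0 ;; As $1 $0 $2 ;; $$1##Id $2 ;; Li $2) ($2) ($1)"
    by (rule diagram_hom[of "[($0**$2, Ue), (Ue, $1**$0)]"], code_simp, simp add: assms rigid_homs)
  then have 3: "?g \<in> Hom D (rdual D X) A" by simp
  show ?thesis using 1 2 3 rcurry_hom[of X A e] assms(1-3) by (auto simp: is_iso_def inverse_pair_def)
qed

lemma nest_hom:
  assumes "X \<in> Ob D" "Y \<in> Ob D" "X' \<in> Ob D" "Y' \<in> Ob D" "e \<in> Hom D (X*.Y) \<one>" "e' \<in> Hom D (X'*.Y') \<one>"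
  shows "nest D X X' Y' Y e e' \<in> Hom D ((X*.X')*.(Y'*.Y)) \<one>"
proof -
  have "dhom D [X, X', Y', Y] [e, e']
    (ned $0 $1 $2 $3 $$0 $$1) (($0**$1)**$2**$3) (Ue)"
    by (rule diagram_hom[of "[($0**$3, Ue), ($1**$2, Ue)]"], code_simp, simp add: assms)
  then show ?thesis by (simp add: nest_def)
qed

lemma ev_tar_hom:
  assumes "X \<in> Ob D" "Y \<in> Ob D" "f \<in> Hom D X Y"
  shows "(ev_right D Y :. f*:Ide D (rdual D Y)) \<in> Hom D (X*.rdual D Y) \<one>"
proof -
  have "dhom D [X, Y, rdual D Y] [ev_right D Y, f]
    ($$0 ;; $$1##Id $2) ($0**$2) (Ue)"
    by (rule diagram_hom[of "[($1**$2, Ue), ($0, $1)]"], code_simp, simp add: assms rigid_homs)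
  then show ?thesis by simp
qed

lemma ev_rdual_ar:
  assumes "X \<in> Ob D" "Y \<in> Ob D" "f \<in> Hom D X Y"
  shows "ev_right D X :. (Ide D X*:rdual_ar D X Y f) = ev_right D Y :. (f*:Ide D (rdual D Y))"
  unfolding rdual_ar_def by (rule ev_rcurry) (simp_all add: assms ev_tar_hom rdual_ob)

lemma rdual_ar_hom: "\<lbrakk>X \<in> Ob D; Y \<in> Ob D; f \<in> Hom D X Y\<rbrakk> \<Longrightarrow> rdual_ar D X Y f \<in> Hom D (rdual D Y) (rdual D X)"
  unfolding rdual_ar_def by (rule rcurry_hom) (simp_all add: ev_tar_hom rdual_ob)

lemma sharp_ar_hom: "\<lbrakk>X \<in> Ob D; Y \<in> Ob D; f \<in> Hom D X Y\<rbrakk> \<Longrightarrow> sharp_ar D X Y f \<in> Hom D (sharp D X) (sharp D Y)"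
  unfolding sharp_ar_def sharp_def by (intro rdual_ar_hom rdual_ob)

lemma ev_sharp_ar:
  assumes "X \<in> Ob D" "Y \<in> Ob D" "f \<in> Hom D X Y"
  shows "ev_right D (rdual D Y) :. (Ide D (rdual D Y)*:sharp_ar D X Y f)
    = ev_right D (rdual D X) :. (rdual_ar D X Y f*:Ide D (sharp D X))"
  unfolding sharp_ar_def sharp_def using ev_rdual_ar[of "rdual D Y" "rdual D X" "rdual_ar D X Y f"] assms
  by (simp add: rdual_ob rdual_ar_hom)

lemma coev_rdual_ar:
  assumes "X \<in> Ob D" "Y \<in> Ob D" "f \<in> Hom D X Y"
  shows "(Ide D (rdual D X)*:f) :. coev_right D X = (rdual_ar D X Y f*:Ide D Y) :. coev_right D Y"
proof -
  have "deq D [X, Y, rdual D X, rdual D Y] [coev_right D X, ev_right D Y, coev_right D Y, f]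
    (Id $2##$$3 ;; $$0)
    ((Ru $2 ;; Id $2##($$1 ;; $$3##Id $3) ;; As $2 $0 $3 ;; $$0##Id $3 ;; Li $3)##Id $1 ;; $$2)"
    by (rule diagram[of "[(Ue, $2**$0), ($1**$3, Ue), (Ue, $3**$1), ($0, $1)]"
  "[zl $1 $3 $$1 $$2]" _ _ "[RB 2 1 0, SL 1, SL 0]"],
  code_simp, simp add: assms rigid_homs, simp only: diag_simps, (intro conjI TrueI zigzags; simp add: assms rigid_homs))
  then show ?thesis by (simp add: rdual_ar_def rcurry_def)
qed

lemma Inv_hom: "\<lbrakk>is_iso D X Y f; X \<in> Ob D; Y \<in> Ob D\<rbrakk> \<Longrightarrow> Inv D X Y f \<in> Hom D Y X"
  "\<lbrakk>is_iso D X Y f; X \<in> Ob D; Y \<in> Ob D\<rbrakk> \<Longrightarrow> f \<in> Hom D X Y"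
  "\<lbrakk>is_iso D X Y f; X \<in> Ob D; Y \<in> Ob D\<rbrakk> \<Longrightarrow> f :. Inv D X Y f = Ide D Y"
  "\<lbrakk>is_iso D X Y f; X \<in> Ob D; Y \<in> Ob D\<rbrakk> \<Longrightarrow> Inv D X Y f :. f = Ide D X"
  using inverse_pair_Inv by (auto simp: inverse_pair_def)

lemma ev_Inv:
  assumes "X \<in> Ob D" "A \<in> Ob D" "is_iso D A (rdual D X) f" "ev_right D X :. (Ide D X*:f) = e" "e \<in> Hom D (X*.A) \<one>"
  shows "e :. (Ide D X*:Inv D A (rdual D X) f) = ev_right D X"
proof -
  have "deq D [X, A, rdual D X] [ev_right D X, e, f, Inv D A (rdual D X) f]
    ($$1 ;; Id $0##$$3)
    ($$0)"
    by (rule diagram[of "[($0**$2, Ue), ($0**$1, Ue), ($1, $2), ($2, $1)]"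
  "[($$0 ;; Id $0##$$2, $$1), ($$2 ;; $$3, Id $2)]" _ _ "[RB 1 0 0, RF 0 1 1]"],
  code_simp, simp add: assms Inv_hom rigid_homs, simp only: diag_simps, (intro conjI TrueI assms Inv_hom; simp add: assms Inv_hom rigid_homs))
  then show ?thesis by simp
qed

lemma Lun_hom: "X \<in> Ob D \<Longrightarrow> Lun D X \<in> Hom D (\<one>*.X) X" "X \<in> Ob D \<Longrightarrow> LunInv D X \<in> Hom D X (\<one>*.X)"
  using arr_asc(3,4)[of X] by (simp_all add: arr_def del: arr_ob arr_asc)

lemma rdual_uni_iso: "is_iso D \<one> (rdual D \<one>) (rdual_uni D)"
  unfolding rdual_uni_def
proof (rule rcurry_iso[where c = "LunInv D \<one>"])
  show "Lun D \<one> :. Lun D \<one>*:Ide D \<one> :. AscInv D \<one> \<one> \<one> :. Ide D \<one>*:LunInv D \<one> :. RunInv D \<one> = Ide D \<one>"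
  proof -
    have "deq D [] []
      (Lu Ue ;; Lu Ue##Id Ue ;; Ai Ue Ue Ue ;; Id Ue##Li Ue ;; Ri Ue)
      (Id Ue)"
      by (rule diagram[of "[]"
  "[]" _ _ "[]"],
  code_simp, simp add: uni_ob, simp)
    then show ?thesis by simp
  qed
  show "Run D \<one> :. Ide D \<one>*:Lun D \<one> :. Asc D \<one> \<one> \<one> :. LunInv D \<one>*:Ide D \<one> :. LunInv D \<one> = Ide D \<one>"
  proof -
    have "deq D [] []
      (Ru Ue ;; Id Ue##Lu Ue ;; As Ue Ue Ue ;; Li Ue##Id Ue ;; Li Ue)
      (Id Ue)"
      by (rule diagram[of "[]"
  "[]" _ _ "[]"],
  code_simp, simp add: uni_ob, simp)
    then show ?thesis by simp
  qed
qed (simp_all add: Lun_hom)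

lemma dual_unit_iso: "X \<in> Ob D \<Longrightarrow> is_iso D X (rdual D (ldual D X)) (dual_unit D X)"
  unfolding dual_unit_def
  by (rule rcurry_iso[where c = "coev_left D X"]) (simp_all add: ldual_zigzag ldual_zagzig ldual_ob lev_hom lcoev_hom)

lemma ev_dual_unit: "X \<in> Ob D \<Longrightarrow> ev_right D (ldual D X) :. (Ide D (ldual D X)*:dual_unit D X) = ev_left D X"
  unfolding dual_unit_def by (rule ev_rcurry) (simp_all add: ldual_ob lev_hom)

lemma ev_rdual_uni: "ev_right D \<one> :. (Ide D \<one>*:rdual_uni D) = Lun D \<one>"
  unfolding rdual_uni_def by (rule ev_rcurry) (simp_all add: Lun_hom)

lemma rdual_ten_iso:
  assumes "X \<in> Ob D" "Y \<in> Ob D"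
  shows "is_iso D (rdual D Y*.rdual D X) (rdual D (X*.Y)) (rdual_ten D X Y)"
  unfolding rdual_ten_def
\<comment> \<open>The copairing dual to the nested evaluation: \<open>coev_right X\<close> inserted
  into \<open>coev_right Y\<close>.\<close>
proof (rule rcurry_iso[where c = "AscInv D (rdual D Y) (rdual D X) (X*.Y) :. Ide D (rdual D Y)*:Asc D (rdual D X) X Y :. Ide D (rdual D Y)*:coev_right D X*:Ide D Y :. Ide D (rdual D Y)*:LunInv D Y :. coev_right D Y"])
  show "Lun D (X*.Y) :. ev_right2 D X Y*:Ide D (X*.Y) :. AscInv D (X*.Y) (rdual D Y*.rdual D X) (X*.Y) :. Ide D (X*.Y)*:(AscInv D (rdual D Y) (rdual D X) (X*.Y) :. Ide D (rdual D Y)*:Asc D (rdual D X) X Y :. Ide D (rdual D Y)*:coev_right D X*:Ide D Y :. Ide D (rdual D Y)*:LunInv D Y :. coev_right D Y) :. RunInv D (X*.Y) = Ide D (X*.Y)"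
  proof -
    have "deq D [X, Y, rdual D X, rdual D Y] [ev_right D X, coev_right D X, ev_right D Y, coev_right D Y]
      (Lu ($0**$1) ;; ned $0 $1 $3 $2 $$0 $$2##Id ($0**$1) ;; Ai ($0**$1) ($3**$2) ($0**$1) ;; Id ($0**$1)##(Ai $3 $2 ($0**$1) ;; Id $3##As $2 $0 $1 ;; Id $3##$$1##Id $1 ;; Id $3##Li $1 ;; $$3) ;; Ri ($0**$1))
      (Id ($0**$1))"
      by (rule diagram[of "[($0**$2, Ue), (Ue, $2**$0), ($1**$3, Ue), (Ue, $3**$1)]"
  "[zl $0 $2 $$0 $$1, zl $1 $3 $$2 $$3]" _ _ "[SR 1, RF 2 0 0, RF 0 1 1]"],
  code_simp, simp add: assms rigid_homs, simp only: diag_simps, (intro conjI TrueI zigzags; simp add: assms rigid_homs))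
    then show ?thesis by (simp add: ev_right2_def)
  qed
  show "Run D (rdual D Y*.rdual D X) :. Ide D (rdual D Y*.rdual D X)*:ev_right2 D X Y :. Asc D (rdual D Y*.rdual D X) (X*.Y) (rdual D Y*.rdual D X) :. (AscInv D (rdual D Y) (rdual D X) (X*.Y) :. Ide D (rdual D Y)*:Asc D (rdual D X) X Y :. Ide D (rdual D Y)*:coev_right D X*:Ide D Y :. Ide D (rdual D Y)*:LunInv D Y :. coev_right D Y)*:Ide D (rdual D Y*.rdual D X) :. LunInv D (rdual D Y*.rdual D X) = Ide D (rdual D Y*.rdual D X)"
  proof -
    have "deq D [X, Y, rdual D X, rdual D Y] [ev_right D X, coev_right D X, ev_right D Y, coev_right D Y]
      (Ru ($3**$2) ;; Id ($3**$2)##ned $0 $1 $3 $2 $$0 $$2 ;; As ($3**$2) ($0**$1) ($3**$2) ;; (Ai $3 $2 ($0**$1) ;; Id $3##As $2 $0 $1 ;; Id $3##$$1##Id $1 ;; Id $3##Li $1 ;; $$3)##Id ($3**$2) ;; Li ($3**$2))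
      (Id ($3**$2))"
      by (rule diagram[of "[($0**$2, Ue), (Ue, $2**$0), ($1**$3, Ue), (Ue, $3**$1)]"
  "[zr $2 $0 $$0 $$1, zr $3 $1 $$2 $$3]" _ _ "[SL 1, RF 2 1 0, RF 0 0 1]"],
  code_simp, simp add: assms rigid_homs, simp only: diag_simps, (intro conjI TrueI zigzags; simp add: assms rigid_homs))
    then show ?thesis by (simp add: ev_right2_def)
  qed
  have "dhom D [X, Y, rdual D X, rdual D Y] [coev_right D X, coev_right D Y]
    (Ai $3 $2 ($0**$1) ;; Id $3##As $2 $0 $1 ;; Id $3##$$0##Id $1 ;; Id $3##Li $1 ;; $$1) (Ue) (($3**$2)**$0**$1)"
    by (rule diagram_hom[of "[(Ue, $2**$0), (Ue, $3**$1)]"], code_simp, simp add: assms rigid_homs)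
  then show "AscInv D (rdual D Y) (rdual D X) (X*.Y) :. Ide D (rdual D Y)*:Asc D (rdual D X) X Y :. Ide D (rdual D Y)*:coev_right D X*:Ide D Y :. Ide D (rdual D Y)*:LunInv D Y :. coev_right D Y \<in> Hom D \<one> ((rdual D Y*.rdual D X)*.(X*.Y))" by simp
  show "ev_right2 D X Y \<in> Hom D ((X*.Y)*.(rdual D Y*.rdual D X)) \<one>"
    using nest_hom[of X "rdual D X" Y "rdual D Y" "ev_right D X" "ev_right D Y"] assms
    by (simp add: nest_def ev_right2_def rdual_ob rev_hom)
qed (simp_all add: assms rdual_ob)

lemma ev_right2_nest: "ev_right2 D X Y = nest D X Y (rdual D Y) (rdual D X) (ev_right D X) (ev_right D Y)"
  by (simp add: nest_def ev_right2_def)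

lemma ev_right2_hom: "\<lbrakk>X \<in> Ob D; Y \<in> Ob D\<rbrakk> \<Longrightarrow> ev_right2 D X Y \<in> Hom D ((X*.Y)*.(rdual D Y*.rdual D X)) \<one>"
  unfolding ev_right2_nest by (rule nest_hom) (simp_all add: rdual_ob rev_hom)

lemma ev_rdual_ten: "\<lbrakk>X \<in> Ob D; Y \<in> Ob D\<rbrakk>
    \<Longrightarrow> ev_right D (X*.Y) :. (Ide D (X*.Y)*:rdual_ten D X Y) = ev_right2 D X Y"
  unfolding rdual_ten_def by (rule ev_rcurry) (simp_all add: rdual_ob ev_right2_hom)

text \<open>Each structure map of the double right dual is some \<open>g\<close> followed by the
  transpose of an inverse \<open>r^-1\<close>; pairing it against \<open>r\<close> removes the
  inverse. The instances \<open>ev_sharp_uni\<close>, \<open>ev_sharp_ten\<close> and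
  \<open>ev_sharp_lsharp\<close> are what makes double duals disappear.\<close>

lemma ev_rdual_ar_Inv:
  assumes "Z \<in> Ob D" "P \<in> Ob D" "A \<in> Ob D" "is_iso D P Z r" "g \<in> Hom D A (rdual D P)"
  shows "ev_right D Z :. (r*:(rdual_ar D Z P (Inv D P Z r) :. g)) = ev_right D P :. (Ide D P*:g)"
proof -
  note hs = assms Inv_hom rdual_ar_hom rigid_homs
  have "deq D [Z, P, A, rdual D Z, rdual D P] [ev_right D Z, ev_right D P, Inv D P Z r, r, rdual_ar D Z P (Inv D P Z r), g]
    ($$0 ;; $$3##($$4 ;; $$5))
    ($$1 ;; Id $1##$$5)"
    by (rule diagram[of "[($0**$3, Ue), ($1**$4, Ue), ($0, $1), ($1, $0), ($4, $3), ($2, $4)]"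
  "[($$0 ;; Id $0##$$4, $$1 ;; $$2##Id $4), ($$2 ;; $$3, Id $1)]" _ _ "[RF 2 0 0, SR 1, RF 0 0 1]"],
  code_simp, simp add: hs, simp only: diag_simps, (intro conjI TrueI ev_rdual_ar Inv_hom; simp add: hs))
  then show ?thesis by simp
qed

lemma rdual_uni_hom: "rdual_uni D \<in> Hom D \<one> (rdual D \<one>)"
  by (rule Inv_hom(2)[OF rdual_uni_iso]) (simp_all add: rdual_ob)

lemma rdual_ten_hom: "\<lbrakk>X \<in> Ob D; Y \<in> Ob D\<rbrakk> \<Longrightarrow> rdual_ten D X Y \<in> Hom D (rdual D Y*.rdual D X) (rdual D (X*.Y))"
  by (rule Inv_hom(2)[OF rdual_ten_iso]) (simp_all add: rdual_ob)

lemma dual_unit_hom: "X \<in> Ob D \<Longrightarrow> dual_unit D X \<in> Hom D X (rdual D (ldual D X))"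
  by (rule Inv_hom(2)[OF dual_unit_iso]) (simp_all add: rdual_ob ldual_ob)

lemma ev_sharp_uni: "ev_right D (rdual D \<one>) :. (rdual_uni D*:sharp_uni D) = Lun D \<one>"
  unfolding sharp_uni_def
  using ev_rdual_ar_Inv[of "rdual D \<one>" \<one> \<one> "rdual_uni D" "rdual_uni D"] ev_rdual_uni
  by (simp add: rdual_ob rdual_uni_iso rdual_uni_hom)

lemma ev_sharp_ten: "\<lbrakk>X \<in> Ob D; Y \<in> Ob D\<rbrakk> \<Longrightarrow> ev_right D (rdual D (X*.Y)) :. (rdual_ten D X Y*:sharp_ten D X Y)
    = ev_right2 D (rdual D Y) (rdual D X)"
  unfolding sharp_ten_def
  using ev_rdual_ar_Inv[of "rdual D (X*.Y)" "rdual D Y*.rdual D X" "sharp D X*.sharp D Y" "rdual_ten D X Y" "rdual_ten D (rdual D Y) (rdual D X)"]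
    ev_rdual_ten[of "rdual D Y" "rdual D X"] rdual_ten_hom[of "rdual D Y" "rdual D X"]
  by (simp add: rdual_ob rdual_ten_iso sharp_ob, simp add: sharp_def)

lemma ev_sharp_lsharp: "X \<in> Ob D \<Longrightarrow> ev_right D (rdual D (lsharp D X)) :. (dual_unit D (ldual D X)*:sharp_lsharp D X) = ev_left D X"
  unfolding sharp_lsharp_def
  using ev_rdual_ar_Inv[of "rdual D (lsharp D X)" "ldual D X" X "dual_unit D (ldual D X)" "dual_unit D X"]
    ev_dual_unit[of X] dual_unit_iso[of "ldual D X"]
  by (simp add: rdual_ob ldual_ob lsharp_def dual_unit_hom)

lemma sharp_uni_hom: "sharp_uni D \<in> Hom D \<one> (sharp D \<one>)"
  unfolding sharp_uni_def sharp_def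
  by (rule cmp_hom[of _ "rdual D \<one>"]) (simp_all add: rdual_ob rdual_uni_hom rdual_ar_hom Inv_hom rdual_uni_iso)

lemma sharp_ten_hom: "\<lbrakk>X \<in> Ob D; Y \<in> Ob D\<rbrakk> \<Longrightarrow> sharp_ten D X Y \<in> Hom D (sharp D X*.sharp D Y) (sharp D (X*.Y))"
  unfolding sharp_ten_def sharp_def
  by (rule cmp_hom[of _ "rdual D (rdual D Y*.rdual D X)"]) (simp_all add: rdual_ob rdual_ten_hom rdual_ar_hom Inv_hom rdual_ten_iso)

lemma sharp_lsharp_hom: "X \<in> Ob D \<Longrightarrow> sharp_lsharp D X \<in> Hom D X (sharp D (lsharp D X))"
  unfolding sharp_lsharp_def sharp_def
  by (rule cmp_hom[of _ "rdual D (ldual D X)"])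
    (simp_all add: rdual_ob ldual_ob lsharp_ob dual_unit_hom rdual_ar_hom Inv_hom dual_unit_iso[of "ldual D X", folded lsharp_def])

end

section \<open>From half braidings to pairing actions and back\<close>

context rigid_monoidal_category
begin

lemma ev_sharp_hom: "X \<in> Ob D \<Longrightarrow> ev_right D (rdual D X) \<in> Hom D (rdual D X*.sharp D X) \<one>"
  "X \<in> Ob D \<Longrightarrow> coev_right D (rdual D X) \<in> Hom D \<one> (sharp D X*.rdual D X)"
  using rev_hom[of "rdual D X"] rcoev_hom[of "rdual D X"] by (simp_all add: sharp_def rdual_ob)

lemma sharp_zigzag:
  assumes "X \<in> Ob D"
  shows "Lun D (rdual D X) :. (ev_right D (rdual D X)*:Ide D (rdual D X)) :. AscInv D (rdual D X) (sharp D X) (rdual D X)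
      :. (Ide D (rdual D X)*:coev_right D (rdual D X)) :. RunInv D (rdual D X) = Ide D (rdual D X)"
    "Run D (sharp D X) :. (Ide D (sharp D X)*:ev_right D (rdual D X)) :. Asc D (sharp D X) (rdual D X) (sharp D X)
      :. (coev_right D (rdual D X)*:Ide D (sharp D X)) :. LunInv D (sharp D X) = Ide D (sharp D X)"
  using rdual_zigzag[of "rdual D X"] rdual_zagzig[of "rdual D X"] assms by (simp_all add: sharp_def rdual_ob)

text \<open>Both sides are arrows into a right dual, so by \<open>rcurry_ev\<close> it suffices to
  compare them after evaluation.\<close>

lemma rcurry_nat:
  assumes "X \<in> Ob D" "Y \<in> Ob D" "X' \<in> Ob D" "Y' \<in> Ob D" "e \<in> Hom D (X*.Y) \<one>" "f \<in> Hom D X' X" "k \<in> Hom D Y' Y"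
  shows "rcurry D X' Y' (e :. (f*:k)) = rdual_ar D X' X f :. (rcurry D X Y e :. k)"
proof -
  have "dhom D [Y, Y', rdual D X, rdual D X'] [k, rdual_ar D X' X f, rcurry D X Y e]
    ($$1 ;; $$2 ;; $$0) ($1) ($3)"
    by (rule diagram_hom[of "[($1, $0), ($2, $3), ($0, $2)]"], code_simp, simp add: assms rcurry_hom rdual_ar_hom ev_sharp_hom rigid_homs)
  then have h: "rdual_ar D X' X f :. (rcurry D X Y e :. k) \<in> Hom D Y' (rdual D X')" by simp
  note hs = assms rcurry_hom rdual_ar_hom ev_sharp_hom rigid_homs
  have "deq D [X, Y, X', Y', rdual D X, rdual D X'] [ev_right D X, ev_right D X', e, f, k, rdual_ar D X' X f, rcurry D X Y e]
    ($$1 ;; Id $2##($$5 ;; $$6 ;; $$4))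
    ($$2 ;; $$3##$$4)"
    by (rule diagram[of "[($0**$4, Ue), ($2**$5, Ue), ($0**$1, Ue), ($2, $0), ($3, $1), ($4, $5), ($1, $4)]"
  "[($$1 ;; Id $2##$$5, $$0 ;; $$3##Id $4), ($$0 ;; Id $0##$$6, $$2)]" _ _ "[RF 2 0 0, SR 1, SR 0, RF 2 0 1]"],
  code_simp, simp add: hs, simp only: diag_simps, (intro conjI TrueI ev_rdual_ar ev_rcurry; simp add: hs))
  then show ?thesis using rcurry_ev[OF _ _ h] assms by simp
qed

lemma rcurry_nest:
  assumes "X \<in> Ob D" "Y \<in> Ob D" "X' \<in> Ob D" "Y' \<in> Ob D" "e \<in> Hom D (X*.Y) \<one>" "e' \<in> Hom D (X'*.Y') \<one>"
  shows "rcurry D (X*.X') (Y'*.Y) (nest D X X' Y' Y e e') = rdual_ten D X X' :. (rcurry D X' Y' e'*:rcurry D X Y e)"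
proof -
  have "dhom D [Y, Y', rdual D X, rdual D X', rdual D (X*.X')] [rdual_ten D X X', rcurry D X Y e, rcurry D X' Y' e']
    ($$0 ;; $$2##$$1) ($1**$0) ($4)"
    by (rule diagram_hom[of "[($3**$2, $4), ($0, $2), ($1, $3)]"], code_simp, simp add: assms rcurry_hom rdual_ten_hom ev_sharp_hom rigid_homs)
  then have h: "rdual_ten D X X' :. (rcurry D X' Y' e'*:rcurry D X Y e) \<in> Hom D (Y'*.Y) (rdual D (X*.X'))" by simp
  note hs = assms rcurry_hom rdual_ten_hom ev_sharp_hom rigid_homs
  have "deq D [X, Y, X', Y', rdual D X, rdual D X', rdual D (X*.X')] [ev_right D X, ev_right D X', ev_right D (X*.X'), rdual_ten D X X', e, e', rcurry D X Y e, rcurry D X' Y' e']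
    ($$2 ;; Id ($0**$2)##($$3 ;; $$7##$$6))
    (ned $0 $2 $3 $1 $$4 $$5)"
    by (rule diagram[of "[($0**$4, Ue), ($2**$5, Ue), (($0**$2)**$6, Ue), ($5**$4, $6), ($0**$1, Ue), ($2**$3, Ue), ($1, $4), ($3, $5)]"
  "[($$0 ;; Id $0##$$6, $$4), ($$1 ;; Id $2##$$7, $$5), ($$2 ;; Id ($0**$2)##$$3, ned $0 $2 $5 $4 $$0 $$1)]" _ _ "[RF 2 0 2, SR 1, RF 2 0 0, RF 0 1 1]"],
  code_simp, simp add: hs, simp only: diag_simps, (intro conjI TrueI ev_rdual_ten[unfolded ev_right2_def] ev_rcurry; simp add: hs))
  then show ?thesis using rcurry_ev[OF _ _ h] assms by (simp add: nest_def)
qed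

lemma half_braidingD:
  assumes "half_braiding D M t"
  shows "M \<in> Ob D" "X \<in> Ob D \<Longrightarrow> is_iso D (M*.X) (sharp D X*.M) (t X)"
    "X \<in> Ob D \<Longrightarrow> t X \<in> Hom D (M*.X) (sharp D X*.M)"
    "\<lbrakk>X \<in> Ob D; Y \<in> Ob D; f \<in> Hom D X Y\<rbrakk> \<Longrightarrow> t Y :. (Ide D M*:f) = (sharp_ar D X Y f*:Ide D M) :. t X"
    "t \<one> = (sharp_uni D*:Ide D M) :. LunInv D M :. Run D M"
    "\<lbrakk>X \<in> Ob D; Y \<in> Ob D\<rbrakk> \<Longrightarrow> t (X*.Y) = (sharp_ten D X Y*:Ide D M) :. AscInv D (sharp D X) (sharp D Y) M
        :. (Ide D (sharp D X)*:t Y) :. Asc D (sharp D X) M Y :. (t X*:Ide D Y) :. AscInv D M X Y"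
    "t \<in> extensional (Ob D)"
  using assms Inv_hom(2)[of "M*.X" "sharp D X*.M" "t X"] by (auto simp: half_braiding_def ten_ob sharp_ob)

lemma pairact_hom:
  assumes t: "half_braiding D M t" and a: "X \<in> Ob D" "Y \<in> Ob D" "e \<in> Hom D (X*.Y) \<one>"
  shows "pairact D (M, t) X Y e \<in> Hom D (Y*.(M*.X)) M"
proof -
  have "dhom D [M, X, Y, rdual D X, sharp D X] [ev_right D (rdual D X), rcurry D X Y e, t X]
    (Lu $0 ;; $$0##Id $0 ;; Ai $3 $4 $0 ;; $$1##$$2) ($2**$0**$1) ($0)"
    by (rule diagram_hom[of "[($3**$4, Ue), ($2, $3), ($0**$1, $4**$0)]"], code_simp, simp add: a rcurry_hom half_braidingD(1,3)[OF t] ev_sharp_hom rigid_homs)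
  then show ?thesis by (simp add: pairact_def)
qed

lemma pairact_nat:
  assumes t: "half_braiding D M t" and a: "X \<in> Ob D" "Y \<in> Ob D" "X' \<in> Ob D" "Y' \<in> Ob D" "e \<in> Hom D (X*.Y) \<one>" "f \<in> Hom D X' X" "k \<in> Hom D Y' Y"
  shows "pairact D (M, t) X' Y' (e :. (f*:k)) = pairact D (M, t) X Y e :. (k*:(Ide D M*:f))"
proof -
  have h: "rcurry D X' Y' (e :. (f*:k)) \<in> Hom D Y' (rdual D X')"
    by (rule rcurry_hom) (use a in \<open>auto intro!: cmp_hom[of _ "X*.Y"] tar_hom ten_ob uni_ob\<close>)
  note hs = a h rcurry_hom rdual_ar_hom sharp_ar_hom half_braidingD(1,3)[OF t] ev_sharp_hom rigid_homs
  have "deq D [M, X, Y, X', Y', rdual D X, rdual D X', sharp D X, sharp D X'] [ev_right D (rdual D X), ev_right D (rdual D X'), f, k, rdual_ar D X' X f, sharp_ar D X' X f, rcurry D X Y e, rcurry D X' Y' (e :. (f*:k)), t X, t X']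
    (Lu $0 ;; $$1##Id $0 ;; Ai $6 $8 $0 ;; $$7##$$9)
    ((Lu $0 ;; $$0##Id $0 ;; Ai $5 $7 $0 ;; $$6##$$8) ;; $$3##Id $0##$$2)"
    by (rule diagram[of "[($5**$7, Ue), ($6**$8, Ue), ($3, $1), ($4, $2), ($5, $6), ($8, $7), ($2, $5), ($4, $6), ($0**$1, $7**$0), ($0**$3, $8**$0)]"
  "[($$7, $$4 ;; $$6 ;; $$3), ($$8 ;; Id $0##$$2, $$5##Id $0 ;; $$9), ($$0 ;; Id $5##$$5, $$1 ;; $$4##Id $8)]" _ _ "[RF 0 0 0, SL 2, RB 3 0 2, RB 2 1 1, SL 1]"],
  code_simp, simp add: hs, simp only: diag_simps, (intro conjI TrueI rcurry_nat half_braidingD(4)[OF t] ev_sharp_ar; simp add: hs))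
  then show ?thesis by (simp add: pairact_def)
qed

lemma pairact_unit:
  assumes t: "half_braiding D M t"
  shows "pairact D (M, t) \<one> \<one> (Lun D \<one>) = Lun D M :. (Ide D \<one>*:Run D M)"
proof -
  note hs = rdual_uni_hom sharp_uni_hom half_braidingD(1,3)[OF t] ev_sharp_hom rigid_homs
  have "deq D [M, rdual D \<one>, sharp D \<one>] [ev_right D (rdual D \<one>), rdual_uni D, sharp_uni D, t \<one>]
    (Lu $0 ;; $$0##Id $0 ;; Ai $1 $2 $0 ;; $$1##$$3)
    (Lu $0 ;; Id Ue##Ru $0)"
    by (rule diagram[of "[($1**$2, Ue), (Ue, $1), (Ue, $2), ($0**Ue, $2**$0)]"
  "[($$3, $$2##Id $0 ;; Li $0 ;; Ru $0), ($$0 ;; $$1##$$2, Lu Ue)]" _ _ "[RF 1 1 0, RF 0 0 1]"],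
  code_simp, simp add: hs, simp only: diag_simps, (intro conjI TrueI half_braidingD(5)[OF t] ev_sharp_uni; simp add: hs))
  then show ?thesis by (simp add: pairact_def rdual_uni_def)
qed

text \<open>The map \<open>rdual_ten\<close>, coming from \<open>rcurry_nest\<close>, and the map
  \<open>sharp_ten\<close>, coming from the half braiding, meet in a single evaluation, which
  \<open>ev_sharp_ten\<close> opens into two nested ones.\<close>

lemma pairact_mult:
  assumes t: "half_braiding D M t" and a: "X \<in> Ob D" "Y \<in> Ob D" "X' \<in> Ob D" "Y' \<in> Ob D" "e \<in> Hom D (X*.Y) \<one>" "e' \<in> Hom D (X'*.Y') \<one>"
  shows "pairact D (M, t) (X*.X') (Y'*.Y) (nest D X X' Y' Y e e') = pairact D (M, t) X' Y' e' :. (Ide D Y'*:(pairact D (M, t) X Y e*:Ide D X'))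
        :. (Ide D Y'*:AscInv D Y (M*.X) X') :. (Ide D Y'*:(Ide D Y*:AscInv D M X X')) :. Asc D Y' Y (M*.(X*.X'))"
proof -
  have h: "rcurry D (X*.X') (Y'*.Y) (nest D X X' Y' Y e e') \<in> Hom D (Y'*.Y) (rdual D (X*.X'))"
    by (intro rcurry_hom nest_hom ten_ob a)
  note hs = a h rcurry_hom rdual_ten_hom sharp_ten_hom half_braidingD(1,3)[OF t] ev_sharp_hom rigid_homs
  have "deq D [M, X, Y, X', Y', rdual D X, rdual D X', sharp D X, sharp D X', rdual D (X*.X'), sharp D (X*.X')] [ev_right D (rdual D X), ev_right D (rdual D X'), ev_right D (rdual D (X*.X')), rcurry D X Y e, rcurry D X' Y' e', rcurry D (X*.X') (Y'*.Y) (nest D X X' Y' Y e e'), rdual_ten D X X', sharp_ten D X X', t X, t X', t (X*.X')]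
    (Lu $0 ;; $$2##Id $0 ;; Ai $9 $10 $0 ;; $$5##$$10)
    (mud $0 $1 $2 $3 $4 (Lu $0 ;; $$0##Id $0 ;; Ai $5 $7 $0 ;; $$3##$$8) (Lu $0 ;; $$1##Id $0 ;; Ai $6 $8 $0 ;; $$4##$$9))"
    by (rule diagram[of "[($5**$7, Ue), ($6**$8, Ue), ($9**$10, Ue), ($2, $5), ($4, $6), ($4**$2, $9), ($6**$5, $9), ($7**$8, $10), ($0**$1, $7**$0), ($0**$3, $8**$0), ($0**$1**$3, $10**$0)]"
  "[($$5, $$6 ;; $$4##$$3), ($$10, $$7##Id $0 ;; Ai $7 $8 $0 ;; Id $7##$$9 ;; As $7 $0 $3 ;; $$8##Id $3 ;; Ai $0 $1 $3), ($$2 ;; $$6##$$7, ned $6 $5 $7 $8 $$1 $$0)]" _ _ "[RF 0 0 0, RF 3 1 1, SL 2, SL 3, RF 4 0 2, SL 0, SL 1, SR 3, SL 2]"],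
  code_simp, simp add: hs, simp only: diag_simps, (intro conjI TrueI rcurry_nest half_braidingD(6)[OF t] ev_sharp_ten[unfolded ev_right2_def, folded sharp_def]; simp add: hs))
  then show ?thesis by (simp add: pairact_def)
qed

lemma pairing_action_pairact:
  assumes t: "half_braiding D M t"
  shows "pairing_action D M (pairact D (M, t))"
  unfolding pairing_action_def
  using half_braidingD(1)[OF t] pairact_hom[OF t] pairact_nat[OF t] pairact_unit[OF t] pairact_mult[OF t] by auto

lemma pairing_actionD:
  assumes "pairing_action D M G"
  shows "M \<in> Ob D"
    "\<lbrakk>X \<in> Ob D; Y \<in> Ob D; e \<in> Hom D (X*.Y) \<one>\<rbrakk> \<Longrightarrow> G X Y e \<in> Hom D (Y*.(M*.X)) M"
    "\<lbrakk>X \<in> Ob D; Y \<in> Ob D; X' \<in> Ob D; Y' \<in> Ob D; e \<in> Hom D (X*.Y) \<one>; f \<in> Hom D X' X; k \<in> Hom D Y' Y\<rbrakk>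
      \<Longrightarrow> G X' Y' (e :. (f*:k)) = G X Y e :. (k*:(Ide D M*:f))"
    "G \<one> \<one> (Lun D \<one>) = Lun D M :. (Ide D \<one>*:Run D M)"
    "\<lbrakk>X \<in> Ob D; Y \<in> Ob D; X' \<in> Ob D; Y' \<in> Ob D; e \<in> Hom D (X*.Y) \<one>; e' \<in> Hom D (X'*.Y') \<one>\<rbrakk>
      \<Longrightarrow> G (X*.X') (Y'*.Y) (nest D X X' Y' Y e e') = G X' Y' e' :. (Ide D Y'*:(G X Y e*:Ide D X'))
        :. (Ide D Y'*:AscInv D Y (M*.X) X') :. (Ide D Y'*:(Ide D Y*:AscInv D M X X')) :. Asc D Y' Y (M*.(X*.X'))"
  using assms unfolding pairing_action_def by auto

text \<open>The working form of naturality: a pairing of \<open>X'\<close> with \<open>Y'\<close>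
  that factors in two ways yields two expressions for one action.\<close>

lemma pairing_action_eq:
  assumes G: "pairing_action D M G" and a: "X \<in> Ob D" "Y \<in> Ob D" "X' \<in> Ob D" "Y' \<in> Ob D" "X1 \<in> Ob D" "Y1 \<in> Ob D"
    "e \<in> Hom D (X*.Y) \<one>" "f \<in> Hom D X' X" "k \<in> Hom D Y' Y" "e1 \<in> Hom D (X1*.Y1) \<one>" "f1 \<in> Hom D X' X1" "k1 \<in> Hom D Y' Y1"
    and eq: "e :. (f*:k) = e1 :. (f1*:k1)"
  shows "G X Y e :. (k*:(Ide D M*:f)) = G X1 Y1 e1 :. (k1*:(Ide D M*:f1))"
  using pairing_actionD(3)[OF G a(1-4,7-9)] pairing_actionD(3)[OF G a(5,6,3,4,10-12)] eq by simp

text \<open>Two successive actions are the action of a nested pairing. If a copairing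
  \<open>c\<close> reduces that pairing to \<open>d\<close>, only the normalised action of the unit
  remains. The inverses of half braidings and of the twist arise from this fact and its mirror
  image.\<close>

lemma pairing_action_cancel_right:
  assumes G: "pairing_action D M G" and a: "X \<in> Ob D" "Y \<in> Ob D" "X' \<in> Ob D" "Y' \<in> Ob D" "e \<in> Hom D (X*.Y) \<one>" "e' \<in> Hom D (X'*.Y') \<one>" "c \<in> Hom D \<one> (X*.X')" "d \<in> Hom D (Y'*.Y) \<one>"
    and eq: "nest D X X' Y' Y e e' :. (c*:Ide D (Y'*.Y)) = Lun D \<one> :. (Ide D \<one>*:d)"
  shows "(G X' Y' e' :. Ide D Y'*:G X Y e*:Ide D X' :. Ide D Y'*:AscInv D Y (M*.X) X' :. Ide D Y'*:Ide D Y*:AscInv D M X X' :. Asc D Y' Y (M*.(X*.X'))) :. Ide D (Y'*.Y)*:Ide D M*:c = Lun D M :. d*:Run D M"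
proof -
  have n: "G (X*.X') (Y'*.Y) (nest D X X' Y' Y e e') :. (Ide D (Y'*.Y)*:(Ide D M*:c)) = G \<one> \<one> (Lun D \<one>) :. (d*:(Ide D M*:Ide D \<one>))"
    by (rule pairing_action_eq[OF G, where X' = "\<one>" and Y' = "Y'*.Y"]) (simp_all add: eq a ten_ob uni_ob Lun_hom ide_hom nest_hom)
  note hs = a nest_hom ten_ob uni_ob Lun_hom pairing_actionD(1,2)[OF G]
  have "deq D [M, X, Y, X', Y'] [G X Y e, G X' Y' e', G (X*.X') (Y'*.Y) (nest D X X' Y' Y e e'), G \<one> \<one> (Lun D \<one>), c, d]
    (mud $0 $1 $2 $3 $4 $$0 $$1 ;; Id ($4**$2)##Id $0##$$4)
    (Lu $0 ;; $$5##Ru $0)"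
    by (rule diagram[of "[($2**$0**$1, $0), ($4**$0**$3, $0), (($4**$2)**$0**$1**$3, $0), (Ue**$0**Ue, $0), (Ue, $1**$3), ($4**$2, Ue)]"
  "[($$2, mud $0 $1 $2 $3 $4 $$0 $$1), ($$3, Lu $0 ;; Id Ue##Ru $0), ($$2 ;; Id ($4**$2)##Id $0##$$4, $$3 ;; $$5##Id $0##Id Ue)]" _ _ "[RB 1 0 0, RF 0 0 2, RF 1 0 1]"],
  code_simp, simp add: hs, simp only: diag_simps, (intro conjI TrueI n pairing_actionD(4,5)[OF G]; simp add: hs))
  then show ?thesis by simp
qed

lemma pairing_action_cancel_left:
  assumes G: "pairing_action D M G" and a: "X \<in> Ob D" "Y \<in> Ob D" "X' \<in> Ob D" "Y' \<in> Ob D" "e \<in> Hom D (X*.Y) \<one>" "e' \<in> Hom D (X'*.Y') \<one>" "c \<in> Hom D \<one> (Y'*.Y)" "d \<in> Hom D (X*.X') \<one>"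
    and eq: "nest D X X' Y' Y e e' :. (Ide D (X*.X')*:c) = Lun D \<one> :. (d*:Ide D \<one>)"
  shows "(G X' Y' e' :. Ide D Y'*:G X Y e*:Ide D X' :. Ide D Y'*:AscInv D Y (M*.X) X' :. Ide D Y'*:Ide D Y*:AscInv D M X X' :. Asc D Y' Y (M*.(X*.X'))) :. c*:Ide D M*:Ide D (X*.X') = Lun D M :. Ide D \<one>*:(Run D M :. Ide D M*:d)"
proof -
  have n: "G (X*.X') (Y'*.Y) (nest D X X' Y' Y e e') :. (c*:(Ide D M*:Ide D (X*.X'))) = G \<one> \<one> (Lun D \<one>) :. (Ide D \<one>*:(Ide D M*:d))"
    by (rule pairing_action_eq[OF G, where X' = "X*.X'" and Y' = "\<one>"]) (simp_all add: eq a ten_ob uni_ob Lun_hom ide_hom nest_hom)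
  note hs = a nest_hom ten_ob uni_ob Lun_hom pairing_actionD(1,2)[OF G]
  have "deq D [M, X, Y, X', Y'] [G X Y e, G X' Y' e', G (X*.X') (Y'*.Y) (nest D X X' Y' Y e e'), G \<one> \<one> (Lun D \<one>), c, d]
    (mud $0 $1 $2 $3 $4 $$0 $$1 ;; $$4##Id $0##Id ($1**$3))
    (Lu $0 ;; Id Ue##(Ru $0 ;; Id $0##$$5))"
    by (rule diagram[of "[($2**$0**$1, $0), ($4**$0**$3, $0), (($4**$2)**$0**$1**$3, $0), (Ue**$0**Ue, $0), (Ue, $4**$2), ($1**$3, Ue)]"
  "[($$2, mud $0 $1 $2 $3 $4 $$0 $$1), ($$3, Lu $0 ;; Id Ue##Ru $0), ($$2 ;; $$4##Id $0##Id ($1**$3), $$3 ;; Id Ue##Id $0##$$5)]" _ _ "[RB 1 0 0, RF 0 0 2, SR 0, RF 0 0 1]"],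
  code_simp, simp add: hs, simp only: diag_simps, (intro conjI TrueI n pairing_actionD(4,5)[OF G]; simp add: hs))
  then show ?thesis by simp
qed

lemma acthalf_hom:
  assumes G: "pairing_action D M G" and X: "X \<in> Ob D"
  shows "acthalf D M G X \<in> Hom D (M*.X) (sharp D X*.M)"
proof -
  have "dhom D [M, X, rdual D X, sharp D X] [coev_right D (rdual D X), G X (rdual D X) (ev_right D X)]
    (Id $3##$$1 ;; As $3 $2 ($0**$1) ;; $$0##Id ($0**$1) ;; Li ($0**$1)) ($0**$1) ($3**$0)"
    by (rule diagram_hom[of "[(Ue, $3**$2), ($2**$0**$1, $0)]"], code_simp, simp add: X pairing_actionD(1,2)[OF G] ev_sharp_hom rigid_homs)
  then show ?thesis by (simp add: acthalf_def X)
qed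

text \<open>Every pairing factors through \<open>ev_right X\<close> by \<open>rcurry\<close>, so
  \<open>G\<close> is determined by its values there; a triangle identity undoes the passage to the
  mate.\<close>

lemma pairact_acthalf:
  assumes G: "pairing_action D M G" and a: "X \<in> Ob D" "Y \<in> Ob D" "e \<in> Hom D (X*.Y) \<one>"
  shows "pairact D (M, acthalf D M G) X Y e = G X Y e"
proof -
  have n: "G X Y e = G X (rdual D X) (ev_right D X) :. (rcurry D X Y e*:(Ide D M*:Ide D X))"
    using pairing_actionD(3)[OF G, of X "rdual D X" X Y "ev_right D X" "Ide D X" "rcurry D X Y e"] a
    by (simp add: ev_rcurry rdual_ob rev_hom ide_hom rcurry_hom)
  note hs = a rcurry_hom pairing_actionD(1,2)[OF G] ev_sharp_hom rigid_homs
  have "deq D [M, X, Y, rdual D X, sharp D X] [ev_right D (rdual D X), coev_right D (rdual D X), G X (rdual D X) (ev_right D X), G X Y e, rcurry D X Y e]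
    (Lu $0 ;; $$0##Id $0 ;; Ai $3 $4 $0 ;; $$4##(Id $4##$$2 ;; As $4 $3 ($0**$1) ;; $$1##Id ($0**$1) ;; Li ($0**$1)))
    ($$3)"
    by (rule diagram[of "[($3**$4, Ue), (Ue, $4**$3), ($3**$0**$1, $0), ($2**$0**$1, $0), ($2, $3)]"
  "[zl $3 $4 $$0 $$1, ($$3, $$2 ;; $$4##Id $0##Id $1)]" _ _ "[SR 2, RF 1 0 0, RB 0 0 1]"],
  code_simp, simp add: hs, simp only: diag_simps, (intro conjI TrueI n sharp_zigzag; simp add: hs))
  then show ?thesis by (simp add: pairact_def acthalf_def a)
qed

lemma acthalf_pairact:
  assumes t: "half_braiding D M t"
  shows "acthalf D M (pairact D (M, t)) = t"
proof
  fix X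
  show "acthalf D M (pairact D (M, t)) X = t X"
  proof (cases "X \<in> Ob D")
    case True
    have r: "rcurry D X (rdual D X) (ev_right D X) = Ide D (rdual D X)"
      using rcurry_ev[of X "rdual D X" "Ide D (rdual D X)"] True
      by (simp add: rdual_ob ide_hom tar_ide ten_ob uni_ob ide_right[of "X*.rdual D X" \<one>] rev_hom)
    note hs = True half_braidingD(1,3)[OF t] ev_sharp_hom rigid_homs
    have "deq D [M, X, rdual D X, sharp D X] [ev_right D (rdual D X), coev_right D (rdual D X), t X]
      (Id $3##(Lu $0 ;; $$0##Id $0 ;; Ai $2 $3 $0 ;; Id $2##$$2) ;; As $3 $2 ($0**$1) ;; $$1##Id ($0**$1) ;; Li ($0**$1))
      ($$2)"
      by (rule diagram[of "[($2**$3, Ue), (Ue, $3**$2), ($0**$1, $3**$0)]"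
  "[zr $3 $2 $$0 $$1]" _ _ "[SL 0, RF 1 0 0]"],
  code_simp, simp add: hs, simp only: diag_simps, (intro conjI TrueI sharp_zigzag; simp add: hs))
    then show ?thesis using True by (simp add: acthalf_def pairact_def r)
  next
    case False
    then show ?thesis using half_braidingD(7)[OF t] by (simp add: acthalf_def extensional_def)
  qed
qed

text \<open>The mate of the action of the next evaluation, which pairs \<open>rdual X\<close> with
  \<open>sharp X\<close>.\<close>

definition actinv :: "'o \<Rightarrow> ('o \<Rightarrow> 'o \<Rightarrow> 'a \<Rightarrow> 'a) \<Rightarrow> 'o \<Rightarrow> 'a" where
  "actinv M G X = G (rdual D X) (sharp D X) (ev_right D (rdual D X))*:Ide D X :. AscInv D (sharp D X) (M*.rdual D X) X :. Ide D (sharp D X)*:AscInv D M (rdual D X) X :. Ide D (sharp D X)*:(Ide D M*:coev_right D X :. RunInv D M)"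

text \<open>In each composite the evaluations of \<open>X\<close> and of \<open>rdual X\<close> are
  nested and joined by a coevaluation. A triangle identity collapses the nested pairing, and the
  cancellation lemmas apply.\<close>

lemma acthalf_inverse:
  assumes G: "pairing_action D M G" and X: "X \<in> Ob D"
  shows "inverse_pair D (M*.X) (sharp D X*.M) (acthalf D M G X) (actinv M G X)"
proof -
  note hs = X pairing_actionD(1)[OF G] ev_sharp_hom rigid_homs
  have "deq D [X, rdual D X, sharp D X] [ev_right D X, coev_right D X, ev_right D (rdual D X)]
    (ned $1 $0 $1 $2 $$2 $$0 ;; $$1##Id ($1**$2))
    (Lu Ue ;; Id Ue##$$2)"
    by (rule diagram[of "[($0**$1, Ue), (Ue, $1**$0), ($1**$2, Ue)]"
  "[zr $1 $0 $$0 $$1]" _ _ "[RF 0 0 0]"],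
  code_simp, simp add: hs, simp only: diag_simps, (intro conjI TrueI sharp_zigzag zigzags; simp add: hs))
  then have "nest D (rdual D X) X (rdual D X) (sharp D X) (ev_right D (rdual D X)) (ev_right D X) :. (coev_right D X*:Ide D (rdual D X*.sharp D X))
    = Lun D \<one> :. (Ide D \<one>*:ev_right D (rdual D X))" by (simp add: nest_def)
  then have cR: "(G X (rdual D X) (ev_right D X) :. Ide D (rdual D X)*:G (rdual D X) (sharp D X) (ev_right D (rdual D X))*:Ide D X :. Ide D (rdual D X)*:AscInv D (sharp D X) (M*.rdual D X) X :. Ide D (rdual D X)*:Ide D (sharp D X)*:AscInv D M (rdual D X) X :. Asc D (rdual D X) (sharp D X) (M*.(rdual D X*.X))) :. Ide D (rdual D X*.sharp D X)*:Ide D M*:coev_right D X = Lun D M :. ev_right D (rdual D X)*:Run D M"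
    by (intro pairing_action_cancel_right[OF G]) (simp_all add: X ev_sharp_hom rigid_homs)
  note hs = X pairing_actionD(1)[OF G] ev_sharp_hom rigid_homs
  have "deq D [X, rdual D X, sharp D X] [ev_right D X, ev_right D (rdual D X), coev_right D (rdual D X)]
    (ned $0 $1 $2 $1 $$0 $$1 ;; Id ($0**$1)##$$2)
    (Lu Ue ;; $$0##Id Ue)"
    by (rule diagram[of "[($0**$1, Ue), ($1**$2, Ue), (Ue, $2**$1)]"
  "[zl $1 $2 $$1 $$2]" _ _ "[RF 0 1 0]"],
  code_simp, simp add: hs, simp only: diag_simps, (intro conjI TrueI sharp_zigzag zigzags; simp add: hs))
  then have "nest D X (rdual D X) (sharp D X) (rdual D X) (ev_right D X) (ev_right D (rdual D X)) :. (Ide D (X*.rdual D X)*:coev_right D (rdual D X))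
    = Lun D \<one> :. (ev_right D X*:Ide D \<one>)" by (simp add: nest_def)
  then have cL: "(G (rdual D X) (sharp D X) (ev_right D (rdual D X)) :. Ide D (sharp D X)*:G X (rdual D X) (ev_right D X)*:Ide D (rdual D X) :. Ide D (sharp D X)*:AscInv D (rdual D X) (M*.X) (rdual D X) :. Ide D (sharp D X)*:Ide D (rdual D X)*:AscInv D M X (rdual D X) :. Asc D (sharp D X) (rdual D X) (M*.(X*.rdual D X))) :. coev_right D (rdual D X)*:Ide D M*:Ide D (X*.rdual D X) = Lun D M :. Ide D \<one>*:(Run D M :. Ide D M*:ev_right D X)"
    by (intro pairing_action_cancel_left[OF G]) (simp_all add: X ev_sharp_hom rigid_homs)
  note hs = X pairing_actionD(1,2)[OF G] ev_sharp_hom rigid_homs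
  have "deq D [M, X, rdual D X, sharp D X] [coev_right D X, ev_right D (rdual D X), coev_right D (rdual D X), G X (rdual D X) (ev_right D X), G (rdual D X) (sharp D X) (ev_right D (rdual D X))]
    ((Id $3##$$3 ;; As $3 $2 ($0**$1) ;; $$2##Id ($0**$1) ;; Li ($0**$1)) ;; $$4##Id $1 ;; Ai $3 ($0**$2) $1 ;; Id $3##Ai $0 $2 $1 ;; Id $3##(Id $0##$$0 ;; Ri $0))
    (Id ($3**$0))"
    by (rule diagram[of "[(Ue, $2**$1), ($2**$3, Ue), (Ue, $3**$2), ($2**$0**$1, $0), ($3**$0**$2, $0)]"
  "[zr $3 $2 $$1 $$2, (mud $0 $2 $3 $1 $2 $$4 $$3 ;; Id ($2**$3)##Id $0##$$0, Lu $0 ;; $$1##Ru $0)]" _ _ "[SR 1, SR 0, RF 1 1 1, RF 0 0 0]"],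
  code_simp, simp add: hs, simp only: diag_simps, (intro conjI TrueI cR cL sharp_zigzag zigzags; simp add: hs))
  then have 1: "acthalf D M G X :. actinv M G X = Ide D (sharp D X*.M)" by (simp add: acthalf_def actinv_def X)
  note hs = X pairing_actionD(1,2)[OF G] ev_sharp_hom rigid_homs
  have "deq D [M, X, rdual D X, sharp D X] [ev_right D X, coev_right D X, coev_right D (rdual D X), G X (rdual D X) (ev_right D X), G (rdual D X) (sharp D X) (ev_right D (rdual D X))]
    (($$4##Id $1 ;; Ai $3 ($0**$2) $1 ;; Id $3##Ai $0 $2 $1 ;; Id $3##(Id $0##$$1 ;; Ri $0)) ;; Id $3##$$3 ;; As $3 $2 ($0**$1) ;; $$2##Id ($0**$1) ;; Li ($0**$1))
    (Id ($0**$1))"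
    by (rule diagram[of "[($1**$2, Ue), (Ue, $2**$1), (Ue, $3**$2), ($2**$0**$1, $0), ($3**$0**$2, $0)]"
  "[zl $1 $2 $$0 $$1, (mud $0 $1 $2 $2 $3 $$3 $$4 ;; $$2##Id $0##Id ($1**$2), Lu $0 ;; Id Ue##(Ru $0 ;; Id $0##$$0))]" _ _ "[SL 1, SL 0, RF 1 0 1, RF 0 1 0]"],
  code_simp, simp add: hs, simp only: diag_simps, (intro conjI TrueI cR cL sharp_zigzag zigzags; simp add: hs))
  then have 2: "actinv M G X :. acthalf D M G X = Ide D (M*.X)" by (simp add: acthalf_def actinv_def X)
  have "dhom D [M, X, rdual D X, sharp D X] [coev_right D X, G (rdual D X) (sharp D X) (ev_right D (rdual D X))]
    ($$1##Id $1 ;; Ai $3 ($0**$2) $1 ;; Id $3##Ai $0 $2 $1 ;; Id $3##(Id $0##$$0 ;; Ri $0)) ($3**$0) ($0**$1)"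
    by (rule diagram_hom[of "[(Ue, $2**$1), ($3**$0**$2, $0)]"], code_simp, simp add: X pairing_actionD(1,2)[OF G] ev_sharp_hom rigid_homs)
  then have "actinv M G X \<in> Hom D (sharp D X*.M) (M*.X)" by (simp add: actinv_def)
  then show ?thesis using 1 2 acthalf_hom[OF G X] by (simp add: inverse_pair_def)
qed

lemma acthalf_nat:
  assumes G: "pairing_action D M G" and a: "X \<in> Ob D" "Y \<in> Ob D" "f \<in> Hom D X Y"
  shows "acthalf D M G Y :. (Ide D M*:f) = (sharp_ar D X Y f*:Ide D M) :. acthalf D M G X"
proof -
  have n: "G Y (rdual D Y) (ev_right D Y) :. Ide D (rdual D Y)*:Ide D M*:f = G X (rdual D X) (ev_right D X) :. rdual_ar D X Y f*:Ide D M*:Ide D X"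
    by (rule pairing_action_eq[OF G, where X' = X and Y' = "rdual D Y"])
      (simp_all add: a ide_hom rdual_ar_hom ev_rdual_ar ev_sharp_hom rigid_homs)
  have c: "Ide D (sharp D Y)*:rdual_ar D X Y f :. coev_right D (rdual D Y) = sharp_ar D X Y f*:Ide D (rdual D X) :. coev_right D (rdual D X)"
    using coev_rdual_ar[of "rdual D Y" "rdual D X" "rdual_ar D X Y f"] a by (simp add: rdual_ob rdual_ar_hom sharp_ar_def sharp_def)
  note hs = a rdual_ar_hom sharp_ar_hom pairing_actionD(1,2)[OF G] ev_sharp_hom rigid_homs
  have "deq D [M, X, Y, rdual D X, rdual D Y, sharp D X, sharp D Y] [coev_right D (rdual D X), coev_right D (rdual D Y), G X (rdual D X) (ev_right D X), G Y (rdual D Y) (ev_right D Y), f, rdual_ar D X Y f, sharp_ar D X Y f]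
    ((Id $6##$$3 ;; As $6 $4 ($0**$2) ;; $$1##Id ($0**$2) ;; Li ($0**$2)) ;; Id $0##$$4)
    ($$6##Id $0 ;; Id $5##$$2 ;; As $5 $3 ($0**$1) ;; $$0##Id ($0**$1) ;; Li ($0**$1))"
    by (rule diagram[of "[(Ue, $5**$3), (Ue, $6**$4), ($3**$0**$1, $0), ($4**$0**$2, $0), ($1, $2), ($4, $3), ($5, $6)]"
  "[($$3 ;; Id $4##Id $0##$$4, $$2 ;; $$5##Id $0##Id $1), (Id $6##$$5 ;; $$1, $$6##Id $3 ;; $$0)]" _ _ "[SR 0, RF 1 1 0, RF 0 0 1, SL 1]"],
  code_simp, simp add: hs, simp only: diag_simps, (intro conjI TrueI n c; simp add: hs))
  then show ?thesis by (simp add: acthalf_def a)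
qed

lemma acthalf_unit:
  assumes G: "pairing_action D M G"
  shows "acthalf D M G \<one> = (sharp_uni D*:Ide D M) :. LunInv D M :. Run D M"
proof -
  have i: "Inv D \<one> (rdual D \<one>) (rdual_uni D) \<in> Hom D (rdual D \<one>) \<one>" by (simp add: Inv_hom rdual_uni_iso rdual_ob uni_ob)
  have e: "Lun D \<one> :. (Ide D \<one>*:Inv D \<one> (rdual D \<one>) (rdual_uni D)) = ev_right D \<one>"
    by (rule ev_Inv) (simp_all add: rdual_uni_iso ev_rdual_uni Lun_hom)
  have n: "G \<one> (rdual D \<one>) (ev_right D \<one>) = G \<one> \<one> (Lun D \<one>) :. (Inv D \<one> (rdual D \<one>) (rdual_uni D)*:(Ide D M*:Ide D \<one>))"
    using pairing_actionD(3)[OF G, of \<one> \<one> \<one> "rdual D \<one>" "Lun D \<one>" "Ide D \<one>" "Inv D \<one> (rdual D \<one>) (rdual_uni D)"]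
    by (simp add: e i rdual_ob Lun_hom ide_hom)
  have c: "Ide D (sharp D \<one>)*:Inv D \<one> (rdual D \<one>) (rdual_uni D) :. coev_right D (rdual D \<one>) = rdual_ar D (rdual D \<one>) \<one> (Inv D \<one> (rdual D \<one>) (rdual_uni D))*:Ide D \<one> :. coev_right D \<one>"
    using coev_rdual_ar[of "rdual D \<one>" \<one> "Inv D \<one> (rdual D \<one>) (rdual_uni D)"] i by (simp add: rdual_ob sharp_def)
  have a: "rdual_ar D (rdual D \<one>) \<one> (Inv D \<one> (rdual D \<one>) (rdual_uni D)) \<in> Hom D (rdual D \<one>) (sharp D \<one>)"
    using rdual_ar_hom[OF _ _ i] by (simp add: rdual_ob sharp_def)
  note hs = i a rdual_uni_hom Lun_hom pairing_actionD(1,2)[OF G] ev_sharp_hom rigid_homs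
  have "deq D [M, rdual D \<one>, sharp D \<one>] [coev_right D \<one>, coev_right D (rdual D \<one>), rdual_uni D, Inv D \<one> (rdual D \<one>) (rdual_uni D), rdual_ar D (rdual D \<one>) \<one> (Inv D \<one> (rdual D \<one>) (rdual_uni D)), G \<one> (rdual D \<one>) (ev_right D \<one>), G \<one> \<one> (Lun D \<one>)]
    (Id $2##$$5 ;; As $2 $1 ($0**Ue) ;; $$1##Id ($0**Ue) ;; Li ($0**Ue))
    (($$4 ;; $$2)##Id $0 ;; Li $0 ;; Ru $0)"
    by (rule diagram[of "[(Ue, $1**Ue), (Ue, $2**$1), (Ue, $1), ($1, Ue), ($1, $2), ($1**$0**Ue, $0), (Ue**$0**Ue, $0)]"
  "[($$6, Lu $0 ;; Id Ue##Ru $0), ($$5, $$6 ;; $$3##Id $0##Id Ue), ($$2, Ru $1 ;; Id $1##Lu Ue ;; As $1 Ue Ue ;; $$0##Id Ue ;; Li Ue), (Id $2##$$3 ;; $$1, $$4##Id Ue ;; $$0)]" _ _ "[RF 1 1 1, SL 1, SL 0, RF 0 0 0, RF 0 0 3, RB 0 0 2]"],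
  code_simp, simp add: hs, simp only: diag_simps, (intro conjI TrueI n c rdual_uni_def[unfolded rcurry_def] pairing_actionD(4)[OF G]; simp add: hs))
  then show ?thesis by (simp add: acthalf_def sharp_uni_def)
qed

text \<open>\<open>?J\<close> replaces the evaluation of \<open>X \<otimes> Y\<close> by the nested
  one, on which \<open>G\<close> is multiplicative. Carried through the coevaluation,
  \<open>?J\<close> turns into its transpose, which is a factor of \<open>sharp_ten\<close>.\<close>

lemma acthalf_mult:
  assumes G: "pairing_action D M G" and X: "X \<in> Ob D" "Y \<in> Ob D"
  shows "acthalf D M G (X*.Y) = (sharp_ten D X Y*:Ide D M) :. AscInv D (sharp D X) (sharp D Y) M
        :. (Ide D (sharp D X)*:acthalf D M G Y) :. Asc D (sharp D X) M Y :. (acthalf D M G X*:Ide D Y) :. AscInv D M X Y"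
proof -
  let ?J = "Inv D (rdual D Y*.rdual D X) (rdual D (X*.Y)) (rdual_ten D X Y)" and ?N = "nest D X Y (rdual D Y) (rdual D X) (ev_right D X) (ev_right D Y)"
  have i: "?J \<in> Hom D (rdual D (X*.Y)) (rdual D Y*.rdual D X)" by (simp add: Inv_hom rdual_ten_iso rdual_ob ten_ob X)
  have e: "?N :. (Ide D (X*.Y)*:?J) = ev_right D (X*.Y)"
    by (rule ev_Inv) (simp_all add: rdual_ten_iso ev_rdual_ten ev_right2_nest nest_hom X ev_sharp_hom rigid_homs)
  have h: "?N \<in> Hom D ((X*.Y)*.(rdual D Y*.rdual D X)) \<one>" by (rule nest_hom) (simp_all add: X ev_sharp_hom rigid_homs)
  have n: "G (X*.Y) (rdual D (X*.Y)) (ev_right D (X*.Y)) = G (X*.Y) (rdual D Y*.rdual D X) ?N :. (?J*:(Ide D M*:Ide D (X*.Y)))"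
    using pairing_actionD(3)[OF G, of "X*.Y" "rdual D Y*.rdual D X" "X*.Y" "rdual D (X*.Y)" ?N "Ide D (X*.Y)" ?J]
    by (simp add: e i h rdual_ob ide_hom X ten_ob)
  have c: "Ide D (sharp D (X*.Y))*:Inv D (rdual D Y*.rdual D X) (rdual D (X*.Y)) (rdual_ten D X Y) :. coev_right D (rdual D (X*.Y)) = rdual_ar D (rdual D (X*.Y)) (rdual D Y*.rdual D X) (Inv D (rdual D Y*.rdual D X) (rdual D (X*.Y)) (rdual_ten D X Y))*:Ide D (rdual D Y*.rdual D X) :. coev_right D (rdual D Y*.rdual D X)"
    using coev_rdual_ar[of "rdual D (X*.Y)" "rdual D Y*.rdual D X" ?J] i by (simp add: rdual_ob sharp_def X ten_ob)
  have a: "rdual_ar D (rdual D (X*.Y)) (rdual D Y*.rdual D X) ?J \<in> Hom D (rdual D (rdual D Y*.rdual D X)) (sharp D (X*.Y))"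
    using rdual_ar_hom[OF _ _ i] by (simp add: rdual_ob sharp_def X ten_ob)
  note hs = i a h X pairing_actionD(1,2)[OF G] ev_sharp_hom rigid_homs
  have "deq D [M, X, Y, rdual D X, rdual D Y, sharp D X, sharp D Y, rdual D (X*.Y), sharp D (X*.Y), rdual D (rdual D Y*.rdual D X)] [ev_right D (rdual D X), coev_right D (rdual D X), ev_right D (rdual D Y), coev_right D (rdual D Y), coev_right D (rdual D (X*.Y)), coev_right D (rdual D Y*.rdual D X), Inv D (rdual D Y*.rdual D X) (rdual D (X*.Y)) (rdual_ten D X Y), rdual_ar D (rdual D (X*.Y)) (rdual D Y*.rdual D X) (Inv D (rdual D Y*.rdual D X) (rdual D (X*.Y)) (rdual_ten D X Y)), G X (rdual D X) (ev_right D X), G Y (rdual D Y) (ev_right D Y), G (X*.Y) (rdual D (X*.Y)) (ev_right D (X*.Y)), G (X*.Y) (rdual D Y*.rdual D X) (nest D X Y (rdual D Y) (rdual D X) (ev_right D X) (ev_right D Y))]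
    (Id $8##$$10 ;; As $8 $7 ($0**$1**$2) ;; $$4##Id ($0**$1**$2) ;; Li ($0**$1**$2))
    (($$7 ;; Ru $9 ;; Id $9##ned $4 $3 $5 $6 $$2 $$0 ;; As $9 ($4**$3) ($5**$6) ;; $$5##Id ($5**$6) ;; Li ($5**$6))##Id $0 ;; Ai $5 $6 $0 ;; Id $5##(Id $6##$$9 ;; As $6 $4 ($0**$2) ;; $$3##Id ($0**$2) ;; Li ($0**$2)) ;; As $5 $0 $2 ;; (Id $5##$$8 ;; As $5 $3 ($0**$1) ;; $$1##Id ($0**$1) ;; Li ($0**$1))##Id $2 ;; Ai $0 $1 $2)"
    by (rule diagram[of "[($3**$5, Ue), (Ue, $5**$3), ($4**$6, Ue), (Ue, $6**$4), (Ue, $8**$7), (Ue, $9**$4**$3), ($7, $4**$3), ($9, $8), ($3**$0**$1, $0), ($4**$0**$2, $0), ($7**$0**$1**$2, $0), (($4**$3)**$0**$1**$2, $0)]"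
  "[zl $3 $5 $$0 $$1, zl $4 $6 $$2 $$3, ($$10, $$11 ;; $$6##Id $0##Id ($1**$2)), ($$11, mud $0 $1 $3 $2 $4 $$8 $$9), (Id $8##$$6 ;; $$4, $$7##Id ($4**$3) ;; $$5)]" _ _ "[RF 1 1 2, RF 0 0 4, RF 2 1 3, RB 3 1 1, RB 2 2 0, SL 1, SL 0, SL 3, SL 2, SL 1, SL 4, SL 3, SL 2, SL 6, SL 5, SL 4, SL 3, SL 5, SL 6]"],
  code_simp, simp add: hs, simp only: diag_simps, (intro conjI TrueI n c sharp_zigzag pairing_actionD(5)[OF G]; simp add: hs))
  then show ?thesis by (simp add: acthalf_def sharp_ten_def rdual_ten_def[of D "rdual D Y" "rdual D X"] rcurry_def ev_right2_def X ten_ob sharp_def[symmetric])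
qed

lemma half_braiding_acthalf:
  assumes G: "pairing_action D M G"
  shows "half_braiding D M (acthalf D M G)"
proof -
  have "acthalf D M G \<in> extensional (Ob D)" by (simp add: acthalf_def)
  moreover have "\<forall>X \<in> Ob D. is_iso D (M*.X) (sharp D X*.M) (acthalf D M G X)"
    using acthalf_inverse[OF G] unfolding is_iso_def by blast
  ultimately show ?thesis
    unfolding half_braiding_def
    using pairing_actionD(1)[OF G] acthalf_nat[OF G] acthalf_unit[OF G] acthalf_mult[OF G] by blast
qed

lemma HH_simps:
  "Ob (HH D) = {(M, t). half_braiding D M t}"
  "f \<in> Hom (HH D) (M, t) (N, s) \<longleftrightarrow> f \<in> Hom D M N \<and> (\<forall>X \<in> Ob D. s X :. (f*:Ide D X) = (Ide D (sharp D X)*:f) :. t X)"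
  "Ide (HH D) (M, t) = Ide D M" "Cmp (HH D) = Cmp D" "Zer (HH D) (M, t) (N, s) = Zer D M N" "Add (HH D) = Add D" "Smul (HH D) = Smul D"
  by (simp_all add: HH_def)

lemma HH_Hom_pairact:
  assumes t: "half_braiding D M t" and s: "half_braiding D N s" and f: "f \<in> Hom (HH D) (M, t) (N, s)"
    and a: "X \<in> Ob D" "Y \<in> Ob D" "e \<in> Hom D (X*.Y) \<one>"
  shows "f :. pairact D (M, t) X Y e = pairact D (N, s) X Y e :. (Ide D Y*:(f*:Ide D X))"
proof -
  have f1: "f \<in> Hom D M N" and f2: "s X :. (f*:Ide D X) = (Ide D (sharp D X)*:f) :. t X" using f a by (simp_all add: HH_simps)
  note hs = a f1 rcurry_hom half_braidingD(1,3)[OF t] half_braidingD(1,3)[OF s] ev_sharp_hom rigid_homs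
  have "deq D [M, N, X, Y, rdual D X, sharp D X] [ev_right D (rdual D X), rcurry D X Y e, t X, s X, f]
    ($$4 ;; Lu $0 ;; $$0##Id $0 ;; Ai $4 $5 $0 ;; $$1##$$2)
    ((Lu $1 ;; $$0##Id $1 ;; Ai $4 $5 $1 ;; $$1##$$3) ;; Id $3##$$4##Id $2)"
    by (rule diagram[of "[($4**$5, Ue), ($3, $4), ($0**$2, $5**$0), ($1**$2, $5**$1), ($0, $1)]"
  "[($$3 ;; $$4##Id $2, Id $5##$$4 ;; $$2)]" _ _ "[SL 2, RB 1 1 0, SL 0]"],
  code_simp, simp add: hs, simp only: diag_simps, (intro conjI TrueI f2; simp add: hs))
  then show ?thesis by (simp add: pairact_def)
qed

text \<open>It is enough to test on the evaluations \<open>ev_right X\<close>, because the half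
  braidings are the mates of the actions of these.\<close>

lemma HH_HomI:
  assumes t: "half_braiding D M t" and s: "half_braiding D N s" and f: "f \<in> Hom D M N"
    and n: "\<And>X. X \<in> Ob D \<Longrightarrow> f :. pairact D (M, t) X (rdual D X) (ev_right D X)
      = pairact D (N, s) X (rdual D X) (ev_right D X) :. (Ide D (rdual D X)*:(f*:Ide D X))"
  shows "f \<in> Hom (HH D) (M, t) (N, s)"
proof -
  have "s X :. (f*:Ide D X) = (Ide D (sharp D X)*:f) :. t X" if X: "X \<in> Ob D" for X
  proof -
    note hs = X f pairact_hom[OF t] pairact_hom[OF s] half_braidingD(1)[OF t] half_braidingD(1)[OF s] ev_sharp_hom rigid_homs
    have "deq D [M, N, X, rdual D X, sharp D X] [coev_right D (rdual D X), pairact D (M, t) X (rdual D X) (ev_right D X), pairact D (N, s) X (rdual D X) (ev_right D X), f]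
      ((Id $4##$$2 ;; As $4 $3 ($1**$2) ;; $$0##Id ($1**$2) ;; Li ($1**$2)) ;; $$3##Id $2)
      (Id $4##$$3 ;; Id $4##$$1 ;; As $4 $3 ($0**$2) ;; $$0##Id ($0**$2) ;; Li ($0**$2))"
      by (rule diagram[of "[(Ue, $4**$3), ($3**$0**$2, $0), ($3**$1**$2, $1), ($0, $1)]"
  "[($$3 ;; $$1, $$2 ;; Id $3##$$3##Id $2)]" _ _ "[SR 0, RB 1 1 0]"],
  code_simp, simp add: hs, simp only: diag_simps, (intro conjI TrueI n; simp add: hs))
    then show ?thesis using acthalf_pairact[OF t, THEN fun_cong, of X] acthalf_pairact[OF s, THEN fun_cong, of X]
      by (simp add: acthalf_def X)
  qed
  then show ?thesis using f by (simp add: HH_simps)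
qed

section \<open>The twist as an automorphism of the identity functor\<close>

definition acttwist :: "'o \<Rightarrow> ('o \<Rightarrow> 'o \<Rightarrow> 'a \<Rightarrow> 'a) \<Rightarrow> 'a" where
  "acttwist M G = G (ldual D M) M (ev_left D M) :. (Ide D M*:coev_left D M) :. RunInv D M"

text \<open>In \<open>acttwist\<close> the given \<open>M\<close> is the first argument of
  \<open>G\<close>; here it is the last one, and a right coevaluation supplies the other
  two.\<close>

definition acttwinv :: "'o \<Rightarrow> ('o \<Rightarrow> 'o \<Rightarrow> 'a \<Rightarrow> 'a) \<Rightarrow> 'a" where
  "acttwinv M G = G M (rdual D M) (ev_right D M) :. Asc D (rdual D M) M M :. (coev_right D M*:Ide D M) :. LunInv D M"

lemma coev_dual_unit:
  assumes "X \<in> Ob D"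
  shows "(dual_unit D X*:Ide D (ldual D X)) :. coev_left D X = coev_right D (ldual D X)"
proof -
  have "deq D [X, ldual D X, rdual D (ldual D X)] [ev_left D X, coev_left D X, coev_right D (ldual D X)]
    ((Ru $2 ;; Id $2##$$0 ;; As $2 $1 $0 ;; $$2##Id $0 ;; Li $0)##Id $1 ;; $$1)
    ($$2)"
    by (rule diagram[of "[($1**$0, Ue), (Ue, $0**$1), (Ue, $2**$1)]"
  "[zl $1 $0 $$0 $$1]" _ _ "[SR 0, RF 1 1 0]"],
  code_simp, simp add: assms ev_sharp_hom rigid_homs, simp only: diag_simps, (intro conjI TrueI zigzags; simp add: assms ev_sharp_hom rigid_homs))
  then show ?thesis by (simp add: dual_unit_def rcurry_def)
qed

text \<open>\<open>actinv\<close> computes the inverse inside \<open>left_half\<close>. The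
  canonical maps to double duals are then absorbed by naturality of \<open>G\<close> and by triangle
  identities.\<close>

lemma HH_twist_acttwist:
  assumes t: "half_braiding D M t"
  shows "HH_twist D (M, t) = acttwist M (pairact D (M, t))"
proof -
  define G where "G = pairact D (M, t)"
  have G: "pairing_action D M G" unfolding G_def by (rule pairing_action_pairact[OF t])
  have M: "M \<in> Ob D" by (rule half_braidingD(1)[OF t])
  have tG: "acthalf D M G = t" unfolding G_def by (rule acthalf_pairact[OF t])
  have i: "Inv D (M*.lsharp D M) (sharp D (lsharp D M)*.M) (t (lsharp D M)) = actinv M G (lsharp D M)"
    using acthalf_inverse[OF G, of "lsharp D M"] by (intro Inv_eqI) (simp_all add: tG M ev_sharp_hom rigid_homs)
  have d: "dual_unit D (ldual D M) \<in> Hom D (ldual D M) (rdual D (lsharp D M))"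
    using dual_unit_hom[of "ldual D M"] by (simp add: M ldual_ob lsharp_def)
  have l: "ev_left D (ldual D M) \<in> Hom D (lsharp D M*.ldual D M) \<one>" "coev_left D (ldual D M) \<in> Hom D \<one> (ldual D M*.lsharp D M)"
    using lev_hom[of "ldual D M"] lcoev_hom[of "ldual D M"] by (simp_all add: M ldual_ob lsharp_def)
  \<comment> \<open>Pulled back along \<open>dual_unit\<close> and \<open>sharp_lsharp\<close>, the
    evaluation of iterated duals is \<open>ev_left M\<close>.\<close>
  have n: "G (rdual D (lsharp D M)) (sharp D (lsharp D M)) (ev_right D (rdual D (lsharp D M))) :. sharp_lsharp D M*:Ide D M*:dual_unit D (ldual D M) = G (ldual D M) M (ev_left D M) :. Ide D M*:Ide D M*:Ide D (ldual D M)"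
    by (rule pairing_action_eq[OF G, where X' = "ldual D M" and Y' = M])
      (simp_all add: d ev_sharp_lsharp sharp_lsharp_hom tar_ide ide_right[of "ldual D M*.M" \<one>] ide_hom M ev_sharp_hom rigid_homs)
  have c: "dual_unit D (ldual D M)*:Ide D (lsharp D M) :. coev_left D (ldual D M) = (coev_right D (lsharp D M))"
    using coev_dual_unit[of "ldual D M"] by (simp add: M ldual_ob lsharp_def)
  have z: "Run D (ldual D M) :. Ide D (ldual D M)*:ev_left D (ldual D M) :. Asc D (ldual D M) (lsharp D M) (ldual D M) :. coev_left D (ldual D M)*:Ide D (ldual D M) :. LunInv D (ldual D M) = Ide D (ldual D M)"
    using ldual_zigzag[of "ldual D M"] by (simp add: M ldual_ob lsharp_def)
  note hs = M d l sharp_lsharp_hom pairing_actionD(2)[OF G] ev_sharp_hom rigid_homs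
  have "deq D [M, ldual D M, lsharp D M, rdual D (lsharp D M), sharp D (lsharp D M)] [coev_left D M, ev_left D (ldual D M), coev_left D (ldual D M), coev_right D (lsharp D M), dual_unit D (ldual D M), sharp_lsharp D M, G (rdual D (lsharp D M)) (sharp D (lsharp D M)) (ev_right D (rdual D (lsharp D M))), G (ldual D M) M (ev_left D M)]
    (Ru $0 ;; Id $0##$$1 ;; As $0 $2 $1 ;; (($$6##Id $2 ;; Ai $4 ($0**$3) $2 ;; Id $4##Ai $0 $3 $2 ;; Id $4##(Id $0##$$3 ;; Ri $0)) ;; $$5##Id $0)##Id $1 ;; Ai $0 $0 $1 ;; Id $0##$$0 ;; Ri $0)
    ($$7 ;; Id $0##$$0 ;; Ri $0)"
    by (rule diagram[of "[(Ue, $0**$1), ($2**$1, Ue), (Ue, $1**$2), (Ue, $3**$2), ($1, $3), ($0, $4), ($4**$0**$3, $0), ($0**$0**$1, $0)]"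
  "[zr $1 $2 $$1 $$2, ($$6 ;; $$5##Id $0##$$4, $$7 ;; Id $0##Id $0##Id $1), ($$4##Id $2 ;; $$2, $$3)]" _ _ "[SR 0, RB 2 2 2, SL 4, SL 3, RF 2 2 0, SL 0, RF 1 0 1]"],
  code_simp, simp add: hs, simp only: diag_simps, (intro conjI TrueI n c z; simp add: hs))
  then have "HH_twist D (M, t) = acttwist M G"
    by (simp add: HH_twist_def left_half_def i actinv_def acttwist_def)
  then show ?thesis by (simp add: G_def)
qed

text \<open>The left transpose of \<open>f\<close>, packaged through its compatibilities with
  evaluation and coevaluation.\<close>

lemma ldual_arrow:
  assumes M: "M \<in> Ob D" and N: "N \<in> Ob D" and f: "f \<in> Hom D M N"
  obtains k where "k \<in> Hom D (ldual D N) (ldual D M)"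
    "ev_left D M :. (k*:Ide D M) = ev_left D N :. (Ide D (ldual D N)*:f)"
    "(f*:Ide D (ldual D M)) :. coev_left D M = (Ide D N*:k) :. coev_left D N"
proof
  let ?k = "Lun D (ldual D M) :. (ev_left D N :. Ide D (ldual D N)*:f)*:Ide D (ldual D M) :. AscInv D (ldual D N) M (ldual D M) :. Ide D (ldual D N)*:coev_left D M :. RunInv D (ldual D N)"
  have "dhom D [M, N, ldual D M, ldual D N] [coev_left D M, ev_left D N, f]
    (Lu $2 ;; ($$1 ;; Id $3##$$2)##Id $2 ;; Ai $3 $0 $2 ;; Id $3##$$0 ;; Ri $3) ($3) ($2)"
    by (rule diagram_hom[of "[(Ue, $0**$2), ($3**$1, Ue), ($0, $1)]"], code_simp, simp add: M N f ev_sharp_hom rigid_homs)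
  then show "?k \<in> Hom D (ldual D N) (ldual D M)" by simp
  have "deq D [M, N, ldual D M, ldual D N] [ev_left D M, coev_left D M, ev_left D N, f]
    ($$0 ;; (Lu $2 ;; ($$2 ;; Id $3##$$3)##Id $2 ;; Ai $3 $0 $2 ;; Id $3##$$1 ;; Ri $3)##Id $0)
    ($$2 ;; Id $3##$$3)"
    by (rule diagram[of "[($2**$0, Ue), (Ue, $0**$2), ($3**$1, Ue), ($0, $1)]"
  "[zr $0 $2 $$0 $$1]" _ _ "[SL 2, SL 1, RF 0 1 0]"],
  code_simp, simp add: M N f ev_sharp_hom rigid_homs, simp only: diag_simps, (intro conjI TrueI zigzags; simp add: M N f ev_sharp_hom rigid_homs))
  then show "ev_left D M :. (?k*:Ide D M) = ev_left D N :. (Ide D (ldual D N)*:f)" by simp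
  have "deq D [M, N, ldual D M, ldual D N] [coev_left D M, ev_left D N, coev_left D N, f]
    ($$3##Id $2 ;; $$0)
    (Id $1##(Lu $2 ;; ($$1 ;; Id $3##$$3)##Id $2 ;; Ai $3 $0 $2 ;; Id $3##$$0 ;; Ri $3) ;; $$2)"
    by (rule diagram[of "[(Ue, $0**$2), ($3**$1, Ue), (Ue, $1**$3), ($0, $1)]"
  "[zr $1 $3 $$1 $$2]" _ _ "[RB 2 0 0, SR 1, SR 0]"],
  code_simp, simp add: M N f ev_sharp_hom rigid_homs, simp only: diag_simps, (intro conjI TrueI zigzags; simp add: M N f ev_sharp_hom rigid_homs))
  then show "(f*:Ide D (ldual D M)) :. coev_left D M = (Ide D N*:?k) :. coev_left D N" by simp
qed

text \<open>By \<open>h\<close> the arrow \<open>f\<close> moves to the middle argument of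
  \<open>G'\<close>; the coevaluation turns it into the transpose \<open>k\<close> on the last
  argument, and naturality of \<open>G'\<close> turns that into \<open>f\<close> on the
  first.\<close>

lemma acttwist_nat:
  assumes G: "pairing_action D M G" and G': "pairing_action D N G'" and f: "f \<in> Hom D M N"
    and h: "f :. G (ldual D M) M (ev_left D M) = G' (ldual D M) M (ev_left D M) :. (Ide D M*:(f*:Ide D (ldual D M)))"
  shows "f :. acttwist M G = acttwist N G' :. f"
proof -
  note M = pairing_actionD(1)[OF G] and N = pairing_actionD(1)[OF G']
  obtain k where k: "k \<in> Hom D (ldual D N) (ldual D M)"
    "ev_left D M :. (k*:Ide D M) = ev_left D N :. (Ide D (ldual D N)*:f)"
    "(f*:Ide D (ldual D M)) :. coev_left D M = (Ide D N*:k) :. coev_left D N"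
    using ldual_arrow[OF M N f] by blast
  have n: "G' (ldual D M) M (ev_left D M) :. Ide D M*:Ide D N*:k = G' (ldual D N) N (ev_left D N) :. f*:Ide D N*:Ide D (ldual D N)"
    by (rule pairing_action_eq[OF G', where X' = "ldual D N" and Y' = M]) (simp_all add: k(1,2) f M N ide_hom ev_sharp_hom rigid_homs)
  note hs = M N f k(1) pairing_actionD(2)[OF G] pairing_actionD(2)[OF G'] ev_sharp_hom rigid_homs
  have "deq D [M, N, ldual D M, ldual D N] [coev_left D M, coev_left D N, f, k, G (ldual D M) M (ev_left D M), G' (ldual D M) M (ev_left D M), G' (ldual D N) N (ev_left D N)]
    ($$2 ;; $$4 ;; Id $0##$$0 ;; Ri $0)
    (($$6 ;; Id $1##$$1 ;; Ri $1) ;; $$2)"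
    by (rule diagram[of "[(Ue, $0**$2), (Ue, $1**$3), ($0, $1), ($3, $2), ($0**$0**$2, $0), ($0**$1**$2, $1), ($1**$1**$3, $1)]"
  "[($$2 ;; $$4, $$5 ;; Id $0##$$2##Id $2), ($$5 ;; Id $0##Id $1##$$3, $$6 ;; $$2##Id $1##Id $3), ($$2##Id $2 ;; $$0, Id $1##$$3 ;; $$1)]" _ _ "[RF 1 0 0, RF 0 1 2, RF 1 0 1, SR 0]"],
  code_simp, simp add: hs, simp only: diag_simps, (intro conjI TrueI h n k(3); simp add: hs))
  then show ?thesis by (simp add: acttwist_def)
qed

text \<open>The twist commutes with the action: dualise the inner copy of the action, and cancel it against the outer ones.\<close>

lemma acttwist_act:
  assumes G: "pairing_action D M G" and X: "X \<in> Ob D"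
  shows "acttwist M G :. G X (rdual D X) (ev_right D X) = G X (rdual D X) (ev_right D X) :. (Ide D (rdual D X)*:(acttwist M G*:Ide D X))"
proof -
  note M = pairing_actionD(1)[OF G]
  \<comment> \<open>The source \<open>rdual X \<otimes> (M \<otimes> X)\<close> of
    \<open>G (ev_right X)\<close> has as a left dual the product of \<open>ldual X\<close>,
    \<open>ldual M\<close> and \<open>X\<close>, with evaluation \<open>?B\<close> and coevaluation
    \<open>?c\<close>; \<open>?k\<close> is the transpose of \<open>G (ev_right X)\<close> for this
    dual.\<close>
  let ?k = "AscInv D (ldual D X) (ldual D M) X :. Lun D (ldual D X*.(ldual D M*.X)) :. Ide D \<one>*:Asc D (ldual D X) (ldual D M) X :. (ev_left D M :. Ide D (ldual D M)*:G X (rdual D X) (ev_right D X))*:Ide D ((ldual D X*.ldual D M)*.X) :. Ide D (ldual D M*.(rdual D X*.(M*.X)))*:AscInv D (ldual D X) (ldual D M) X :. AscInv D (ldual D M) (rdual D X*.(M*.X)) (ldual D X*.(ldual D M*.X)) :. Ide D (ldual D M)*:Ide D (rdual D X*.(M*.X))*:Asc D (ldual D X) (ldual D M) X :. Ide D (ldual D M)*:(Ide D (rdual D X*.(M*.X))*:AscInv D (ldual D X) (ldual D M) X :. AscInv D (rdual D X) (M*.X) (ldual D X*.(ldual D M*.X)) :. Ide D (rdual D X)*:AscInv D M X (ldual D X*.(ldual D M*.X)) :. Ide D (rdual D X)*:Ide D M*:Asc D X (ldual D X) (ldual D M*.X) :. Ide D (rdual D X)*:Ide D M*:coev_left D X*:Ide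 D (ldual D M*.X) :. Ide D (rdual D X)*:Ide D M*:LunInv D (ldual D M*.X) :. Ide D (rdual D X)*:Asc D M (ldual D M) X :. Ide D (rdual D X)*:coev_left D M*:Ide D X :. Ide D (rdual D X)*:LunInv D X :. coev_right D X) :. RunInv D (ldual D M)" and ?c = "Ide D (rdual D X*.(M*.X))*:AscInv D (ldual D X) (ldual D M) X :. AscInv D (rdual D X) (M*.X) (ldual D X*.(ldual D M*.X)) :. Ide D (rdual D X)*:AscInv D M X (ldual D X*.(ldual D M*.X)) :. Ide D (rdual D X)*:Ide D M*:Asc D X (ldual D X) (ldual D M*.X) :. Ide D (rdual D X)*:Ide D M*:coev_left D X*:Ide D (ldual D M*.X) :. Ide D (rdual D X)*:Ide D M*:LunInv D (ldual D M*.X) :. Ide D (rdual D X)*:Asc D M (ldual D M) X :. Ide D (rdual D X)*:coev_left D M*:Ide D X :. Ide D (rdual D X)*:LunInv D X :. coev_right D X"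
  let ?A = "nest D (ldual D X) (ldual D M) M X (ev_left D X) (ev_left D M)"
  let ?B = "nest D (ldual D X*.ldual D M) X (rdual D X) (M*.X) ?A (ev_right D X)"
  obtain k where k: "k \<in> Hom D (ldual D M) ((ldual D X*.ldual D M)*.X)"
    and q1: "ev_left D M :. (Ide D (ldual D M)*:G X (rdual D X) (ev_right D X)) = ?B :. (k*:Ide D (rdual D X*.(M*.X)))"
    and kc: "(Ide D M*:k) :. coev_left D M = (G X (rdual D X) (ev_right D X)*:Ide D ((ldual D X*.ldual D M)*.X)) :. ?c"
  proof
  have "dhom D [M, X, rdual D X, ldual D M, ldual D X] [ev_left D M, coev_left D M, coev_left D X, coev_right D X, G X (rdual D X) (ev_right D X)]
    (Ai $4 $3 $1 ;; Lu ($4**$3**$1) ;; Id Ue##As $4 $3 $1 ;; ($$0 ;; Id $3##$$4)##Id (($4**$3)**$1) ;; Id ($3**$2**$0**$1)##Ai $4 $3 $1 ;; Ai $3 ($2**$0**$1) ($4**$3**$1) ;; Id $3##Id ($2**$0**$1)##As $4 $3 $1 ;; Id $3##(Id ($2**$0**$1)##Ai $4 $3 $1 ;; Ai $2 ($0**$1) ($4**$3**$1) ;; Id $2##Ai $0 $1 ($4**$3**$1) ;; Id $2##Id $0##As $1 $4 ($3**$1) ;; Id $2##Id $0##$$2##Id ($3**$1) ;; Id $2##Id $0##Li ($3**$1) ;; Id $2##As $0 $3 $1 ;; Id $2##$$1##Id $1 ;; Id $2##Li $1 ;; $$3) ;; Ri $3) ($3) (($4**$3)**$1)"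
    by (rule diagram_hom[of "[($3**$0, Ue), (Ue, $0**$3), (Ue, $1**$4), (Ue, $2**$1), ($2**$0**$1, $0)]"], code_simp, simp add: X M pairing_actionD(2)[OF G] ev_sharp_hom rigid_homs)
    then show "?k \<in> Hom D (ldual D M) ((ldual D X*.ldual D M)*.X)" by simp
  note hs = X M pairing_actionD(2)[OF G] ev_sharp_hom rigid_homs
  have "deq D [M, X, rdual D X, ldual D M, ldual D X] [ev_left D M, coev_left D M, ev_left D X, coev_left D X, ev_right D X, coev_right D X, G X (rdual D X) (ev_right D X)]
    ($$0 ;; Id $3##$$6)
    (ned ($4**$3) $1 $2 ($0**$1) (ned $4 $3 $0 $1 $$2 $$0) $$4 ;; (Ai $4 $3 $1 ;; Lu ($4**$3**$1) ;; Id Ue##As $4 $3 $1 ;; ($$0 ;; Id $3##$$6)##Id (($4**$3)**$1) ;; Id ($3**$2**$0**$1)##Ai $4 $3 $1 ;; Ai $3 ($2**$0**$1) ($4**$3**$1) ;; Id $3##Id ($2**$0**$1)##As $4 $3 $1 ;; Id $3##(Id ($2**$0**$1)##Ai $4 $3 $1 ;; Ai $2 ($0**$1) ($4**$3**$1) ;; Id $2##Ai $0 $1 ($4**$3**$1) ;; Id $2##Id $0##As $1 $4 ($3**$1) ;; Id $2##Id $0##$$3##Id ($3**$1) ;; Id $2##Id $0##Li ($3**$1) ;; Id $2##As $0 $3 $1 ;; Id $2##$$1##Id $1 ;; Id $2##Li $1 ;; $$5) ;; Ri $3)##Id ($2**$0**$1))"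
    by (rule diagram[of "[($3**$0, Ue), (Ue, $0**$3), ($4**$1, Ue), (Ue, $1**$4), ($1**$2, Ue), (Ue, $2**$1), ($2**$0**$1, $0)]"
  "[zr $0 $3 $$0 $$1, zr $1 $4 $$2 $$3, zr $2 $1 $$4 $$5]" _ _ "[RB 0 1 2, RB 2 3 1, SR 3, SR 4, RB 2 2 0, SR 3, SR 4, SR 5, SR 1, SR 2, SR 3, SR 4]"],
  code_simp, simp add: hs, simp only: diag_simps, (intro conjI TrueI zigzags; simp add: hs))
    then show "ev_left D M :. (Ide D (ldual D M)*:G X (rdual D X) (ev_right D X)) = ?B :. (?k*:Ide D (rdual D X*.(M*.X)))"
      by (simp add: nest_def)
  note hs = X M pairing_actionD(2)[OF G] ev_sharp_hom rigid_homs
  have "deq D [M, X, rdual D X, ldual D M, ldual D X] [ev_left D M, coev_left D M, coev_left D X, coev_right D X, G X (rdual D X) (ev_right D X)]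
    (Id $0##(Ai $4 $3 $1 ;; Lu ($4**$3**$1) ;; Id Ue##As $4 $3 $1 ;; ($$0 ;; Id $3##$$4)##Id (($4**$3)**$1) ;; Id ($3**$2**$0**$1)##Ai $4 $3 $1 ;; Ai $3 ($2**$0**$1) ($4**$3**$1) ;; Id $3##Id ($2**$0**$1)##As $4 $3 $1 ;; Id $3##(Id ($2**$0**$1)##Ai $4 $3 $1 ;; Ai $2 ($0**$1) ($4**$3**$1) ;; Id $2##Ai $0 $1 ($4**$3**$1) ;; Id $2##Id $0##As $1 $4 ($3**$1) ;; Id $2##Id $0##$$2##Id ($3**$1) ;; Id $2##Id $0##Li ($3**$1) ;; Id $2##As $0 $3 $1 ;; Id $2##$$1##Id $1 ;; Id $2##Li $1 ;; $$3) ;; Ri $3) ;; $$1)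
    ($$4##Id (($4**$3)**$1) ;; Id ($2**$0**$1)##Ai $4 $3 $1 ;; Ai $2 ($0**$1) ($4**$3**$1) ;; Id $2##Ai $0 $1 ($4**$3**$1) ;; Id $2##Id $0##As $1 $4 ($3**$1) ;; Id $2##Id $0##$$2##Id ($3**$1) ;; Id $2##Id $0##Li ($3**$1) ;; Id $2##As $0 $3 $1 ;; Id $2##$$1##Id $1 ;; Id $2##Li $1 ;; $$3)"
    by (rule diagram[of "[($3**$0, Ue), (Ue, $0**$3), (Ue, $1**$4), (Ue, $2**$1), ($2**$0**$1, $0)]"
  "[zr $0 $3 $$0 $$1]" _ _ "[SL 0, SL 1, SL 2, SL 3, RF 4 0 0]"],
  code_simp, simp add: hs, simp only: diag_simps, (intro conjI TrueI zigzags; simp add: hs))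
    then show "(Ide D M*:?k) :. coev_left D M = (G X (rdual D X) (ev_right D X)*:Ide D ((ldual D X*.ldual D M)*.X)) :. ?c"
      by simp
  qed
  note hs = X M pairing_actionD(2)[OF G] ev_sharp_hom rigid_homs
  have "deq D [X, rdual D X, ldual D X] [ev_left D X, coev_left D X, ev_right D X]
    (ned $0 $2 $0 $1 $$2 $$0 ;; $$1##Id ($0**$1))
    (Lu Ue ;; Id Ue##$$2)"
    by (rule diagram[of "[($2**$0, Ue), (Ue, $0**$2), ($0**$1, Ue)]"
  "[zr $0 $2 $$0 $$1]" _ _ "[RF 0 0 0]"],
  code_simp, simp add: hs, simp only: diag_simps, (intro conjI TrueI zigzags; simp add: hs))
  then have "nest D X (ldual D X) X (rdual D X) (ev_right D X) (ev_left D X) :. (coev_left D X*:Ide D (X*.rdual D X)) = Lun D \<one> :. (Ide D \<one>*:ev_right D X)"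
    by (simp add: nest_def)
  then have cR: "(G (ldual D X) X (ev_left D X) :. Ide D X*:G X (rdual D X) (ev_right D X)*:Ide D (ldual D X) :. Ide D X*:AscInv D (rdual D X) (M*.X) (ldual D X) :. Ide D X*:Ide D (rdual D X)*:AscInv D M X (ldual D X) :. Asc D X (rdual D X) (M*.(X*.ldual D X))) :. Ide D (X*.rdual D X)*:Ide D M*:coev_left D X = Lun D M :. ev_right D X*:Run D M"
    by (intro pairing_action_cancel_right[OF G]) (simp_all add: X M ev_sharp_hom rigid_homs)
  have A: "?A \<in> Hom D ((ldual D X*.ldual D M)*.(M*.X)) \<one>" by (rule nest_hom) (simp_all add: X M ev_sharp_hom rigid_homs)
  have B: "?B \<in> Hom D (((ldual D X*.ldual D M)*.X)*.(rdual D X*.(M*.X))) \<one>"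
    by (rule nest_hom[OF _ _ _ _ A]) (simp_all add: X M ev_sharp_hom rigid_homs)
  \<comment> \<open>Naturality trades \<open>G (ev_right X)\<close> on the first argument for its
    transpose \<open>k\<close> on the last one, at the price of the larger pairing
    \<open>?B\<close>.\<close>
  have n: "G (ldual D M) M (ev_left D M) :. G X (rdual D X) (ev_right D X)*:Ide D M*:Ide D (ldual D M) = G ((ldual D X*.ldual D M)*.X) (rdual D X*.(M*.X)) ?B :. (Ide D (rdual D X*.(M*.X))*:(Ide D M*:k))"
    by (rule pairing_action_eq[OF G, where X' = "ldual D M" and Y' = "rdual D X*.(M*.X)"])
      (simp_all add: k q1 B X M pairing_actionD(2)[OF G] ide_hom ev_sharp_hom rigid_homs)
  note hs = k A B X M pairing_actionD(2)[OF G] ev_sharp_hom rigid_homs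
  \<comment> \<open>Multiplicativity splits the action of \<open>?B\<close> into those of
    \<open>ev_left X\<close>, \<open>ev_left M\<close> and \<open>ev_right X\<close>, applied in
    this order. \<open>kc\<close> puts one more action of \<open>ev_right X\<close> in front, and
    \<open>cR\<close> cancels it against \<open>ev_left X\<close>.\<close>
  have "deq D [M, X, rdual D X, ldual D M, ldual D X] [coev_left D M, coev_left D X, ev_right D X, coev_right D X, G X (rdual D X) (ev_right D X), k, G (ldual D M) M (ev_left D M), G (ldual D X) X (ev_left D X), G (ldual D X*.ldual D M) (M*.X) (nest D (ldual D X) (ldual D M) M X (ev_left D X) (ev_left D M)), G ((ldual D X*.ldual D M)*.X) (rdual D X*.(M*.X)) (nest D (ldual D X*.ldual D M) X (rdual D X) (M*.X) (nest D (ldual D X) (ldual D M) M X (ev_left D X) (ev_left D M)) (ev_right D X))]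
    (($$6 ;; Id $0##$$0 ;; Ri $0) ;; $$4)
    ($$4 ;; Id $2##($$6 ;; Id $0##$$0 ;; Ri $0)##Id $1)"
    by (rule diagram[of "[(Ue, $0**$3), (Ue, $1**$4), ($1**$2, Ue), (Ue, $2**$1), ($2**$0**$1, $0), ($3, ($4**$3)**$1), ($0**$0**$3, $0), ($1**$0**$4, $0), (($0**$1)**$0**$4**$3, $0), (($2**$0**$1)**$0**($4**$3)**$1, $0)]"
  "[zl $1 $2 $$2 $$3, ($$6 ;; $$4##Id $0##Id $3, $$9 ;; Id ($2**$0**$1)##Id $0##$$5), ($$8, mud $0 $4 $1 $3 $0 $$7 $$6), ($$9, mud $0 ($4**$3) ($0**$1) $1 $2 $$8 $$4), (Id $0##$$5 ;; $$0, $$4##Id (($4**$3)**$1) ;; Id ($2**$0**$1)##Ai $4 $3 $1 ;; Ai $2 ($0**$1) ($4**$3**$1) ;; Id $2##Ai $0 $1 ($4**$3**$1) ;; Id $2##Id $0##As $1 $4 ($3**$1) ;; Id $2##Id $0##$$1##Id ($3**$1) ;; Id $2##Id $0##Li ($3**$1) ;; Id $2##As $0 $3 $1 ;; Id $2##$$0##Id $1 ;; Id $2##Li $1 ;; $$3), (mud $0 $1 $2 $4 $1 $$4 $$7 ;; Id ($1**$2)##Id $0##$$1, Lu $0 ;; $$2##Ru $0)]" _ _ "[SL 0, RF 1 0 1, RF 2 0 3, RF 2 1 2, RF 0 3 4, RF 2 2 5, SR 1, RF 0 2 0]"],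
  code_simp, simp add: hs, simp only: diag_simps, (intro conjI TrueI n kc cR pairing_actionD(5)[OF G] zigzags; simp add: hs))
  then show ?thesis by (simp add: acttwist_def)
qed

lemma acttwist_hom:
  assumes G: "pairing_action D M G"
  shows "acttwist M G \<in> Hom D M M"
proof -
  have "dhom D [M, ldual D M] [coev_left D M, G (ldual D M) M (ev_left D M)]
    ($$1 ;; Id $0##$$0 ;; Ri $0) ($0) ($0)"
    by (rule diagram_hom[of "[(Ue, $0**$1), ($0**$0**$1, $0)]"], code_simp, simp add: pairing_actionD(1,2)[OF G] ev_sharp_hom rigid_homs)
  then show ?thesis by (simp add: acttwist_def)
qed

text \<open>In one composite \<open>acttwist_act\<close> moves the twist inside the action of
  \<open>ev_right M\<close>; in the other it gets there around the coevaluation, as a transpose.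
  Either way a nested pair of actions remains, to which \<open>cL\<close> applies.\<close>

lemma acttwist_inverse:
  assumes G: "pairing_action D M G"
  shows "inverse_pair D M M (acttwist M G) (acttwinv M G)"
proof -
  note M = pairing_actionD(1)[OF G] and tau = acttwist_hom[OF G] and a = acttwist_act[OF G pairing_actionD(1)[OF G]]
  note rt = rdual_ar_hom[OF M M tau]
  have "deq D [M, rdual D M, ldual D M] [ev_left D M, ev_right D M, coev_right D M]
    (ned $2 $0 $1 $0 $$0 $$1 ;; Id ($2**$0)##$$2)
    (Lu Ue ;; $$0##Id Ue)"
    by (rule diagram[of "[($2**$0, Ue), ($0**$1, Ue), (Ue, $1**$0)]"
  "[zl $0 $1 $$1 $$2]" _ _ "[RF 0 1 0]"],
  code_simp, simp add: M ev_sharp_hom rigid_homs, simp only: diag_simps, (intro conjI TrueI zigzags; simp add: M ev_sharp_hom rigid_homs))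
  then have "nest D (ldual D M) M (rdual D M) M (ev_left D M) (ev_right D M) :. (Ide D (ldual D M*.M)*:coev_right D M) = Lun D \<one> :. (ev_left D M*:Ide D \<one>)"
    by (simp add: nest_def)
  then have cL: "(G M (rdual D M) (ev_right D M) :. Ide D (rdual D M)*:G (ldual D M) M (ev_left D M)*:Ide D M :. Ide D (rdual D M)*:AscInv D M (M*.ldual D M) M :. Ide D (rdual D M)*:Ide D M*:AscInv D M (ldual D M) M :. Asc D (rdual D M) M (M*.(ldual D M*.M))) :. coev_right D M*:Ide D M*:Ide D (ldual D M*.M) = Lun D M :. Ide D \<one>*:(Run D M :. Ide D M*:ev_left D M)"
    by (intro pairing_action_cancel_left[OF G]) (simp_all add: M ev_sharp_hom rigid_homs)
  have tau_def: "acttwist M G = G (ldual D M) M (ev_left D M) :. Ide D M*:coev_left D M :. RunInv D M" by (simp add: acttwist_def)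
  have n: "G M (rdual D M) (ev_right D M) :. Ide D (rdual D M)*:Ide D M*:acttwist M G = G M (rdual D M) (ev_right D M) :. rdual_ar D M M (acttwist M G)*:Ide D M*:Ide D M"
    by (rule pairing_action_eq[OF G, where X' = M and Y' = "rdual D M"]) (simp_all add: M tau rt ide_hom ev_rdual_ar ev_sharp_hom rigid_homs)
  have c: "Ide D (rdual D M)*:acttwist M G :. coev_right D M = rdual_ar D M M (acttwist M G)*:Ide D M :. coev_right D M"
    by (rule coev_rdual_ar) (simp_all add: M tau)
  note hs = M rt tau pairing_actionD(2)[OF G] ev_sharp_hom rigid_homs
  have "deq D [M, rdual D M, ldual D M] [ev_left D M, coev_left D M, coev_right D M, G (ldual D M) M (ev_left D M), G M (rdual D M) (ev_right D M), acttwist M G]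
    ($$5 ;; $$4 ;; As $1 $0 $0 ;; $$2##Id $0 ;; Li $0)
    (Id $0)"
    by (rule diagram[of "[($2**$0, Ue), (Ue, $0**$2), (Ue, $1**$0), ($0**$0**$2, $0), ($1**$0**$0, $0), ($0, $0)]"
  "[zr $0 $2 $$0 $$1, (mud $0 $2 $0 $0 $1 $$3 $$4 ;; $$2##Id $0##Id ($2**$0), Lu $0 ;; Id Ue##(Ru $0 ;; Id $0##$$0)), ($$5, $$3 ;; Id $0##$$1 ;; Ri $0), ($$5 ;; $$4, $$4 ;; Id $1##$$5##Id $0)]" _ _ "[RF 1 0 3, RF 1 1 2, SL 0, RF 1 0 1, RF 0 0 0]"],
  code_simp, simp add: hs, simp only: diag_simps, (intro conjI TrueI cL tau_def a n c zigzags; simp add: hs))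
  then have 1: "acttwist M G :. acttwinv M G = Ide D M" by (simp add: acttwinv_def)
  note hs = M rt tau pairing_actionD(2)[OF G] ev_sharp_hom rigid_homs
  have "deq D [M, rdual D M, ldual D M] [ev_left D M, coev_left D M, coev_right D M, G (ldual D M) M (ev_left D M), G M (rdual D M) (ev_right D M), acttwist M G, rdual_ar D M M (acttwist M G)]
    (($$4 ;; As $1 $0 $0 ;; $$2##Id $0 ;; Li $0) ;; $$5)
    (Id $0)"
    by (rule diagram[of "[($2**$0, Ue), (Ue, $0**$2), (Ue, $1**$0), ($0**$0**$2, $0), ($1**$0**$0, $0), ($0, $0), ($1, $1)]"
  "[zr $0 $2 $$0 $$1, (mud $0 $2 $0 $0 $1 $$3 $$4 ;; $$2##Id $0##Id ($2**$0), Lu $0 ;; Id Ue##(Ru $0 ;; Id $0##$$0)), ($$5, $$3 ;; Id $0##$$1 ;; Ri $0), ($$4 ;; Id $1##Id $0##$$5, $$4 ;; $$6##Id $0##Id $0), (Id $1##$$5 ;; $$2, $$6##Id $0 ;; $$2)]" _ _ "[SR 0, RF 1 0 3, RB 0 0 4, RF 1 1 2, SL 0, RF 1 0 1, RF 0 0 0]"],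
  code_simp, simp add: hs, simp only: diag_simps, (intro conjI TrueI cL tau_def a n c zigzags; simp add: hs))
  then have 2: "acttwinv M G :. acttwist M G = Ide D M" by (simp add: acttwinv_def)
  have "dhom D [M, rdual D M] [coev_right D M, G M (rdual D M) (ev_right D M)]
    ($$1 ;; As $1 $0 $0 ;; $$0##Id $0 ;; Li $0) ($0) ($0)"
    by (rule diagram_hom[of "[(Ue, $1**$0), ($1**$0**$0, $0)]"], code_simp, simp add: M rt tau pairing_actionD(2)[OF G] ev_sharp_hom rigid_homs)
  then have "acttwinv M G \<in> Hom D M M" by (simp add: acttwinv_def)
  then show ?thesis using 1 2 tau by (simp add: inverse_pair_def)
qed

lemma HH_inverse:
  assumes t: "half_braiding D M t" and u: "half_braiding D N u" and f: "f \<in> Hom (HH D) (M, t) (N, u)" and g: "inverse_pair D M N f g"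
  shows "g \<in> Hom (HH D) (N, u) (M, t)"
proof -
  have h: "f \<in> Hom D M N" "g \<in> Hom D N M" "f :. g = Ide D N" "g :. f = Ide D M" using g by (simp_all add: inverse_pair_def)
  have "t X :. (g*:Ide D X) = (Ide D (sharp D X)*:g) :. u X" if X: "X \<in> Ob D" for X
  proof -
    have f3: "u X :. (f*:Ide D X) = (Ide D (sharp D X)*:f) :. t X" using f X by (simp add: HH_simps)
    note hs = X h half_braidingD(1,3)[OF t] half_braidingD(1,3)[OF u] ev_sharp_hom rigid_homs
    have "deq D [M, N, X, sharp D X] [f, g, t X, u X]
      ($$2 ;; $$1##Id $2)
      (Id $3##$$1 ;; $$3)"
      by (rule diagram[of "[($0, $1), ($1, $0), ($0**$2, $3**$0), ($1**$2, $3**$1)]"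
  "[($$0 ;; $$1, Id $1), ($$1 ;; $$0, Id $0), ($$3 ;; $$0##Id $2, Id $3##$$0 ;; $$2)]" _ _ "[RB 2 1 1, RB 1 0 2, RF 0 0 0]"],
  code_simp, simp add: hs, simp only: diag_simps, (intro conjI TrueI h f3; simp add: hs))
    then show ?thesis by simp
  qed
  then show ?thesis using h by (simp add: HH_simps)
qed

theorem identity_automorphism_HH_twist: "identity_automorphism (HH D) (HH_twist D)"
  unfolding identity_automorphism_def
proof (intro conjI ballI)
  fix Z assume "Z \<in> Ob (HH D)"
  then obtain M t where Z: "Z = (M, t)" and t: "half_braiding D M t" by (auto simp: HH_simps)
  note G = pairing_action_pairact[OF t]
  have h: "HH_twist D Z \<in> Hom (HH D) Z Z" unfolding Z HH_twist_acttwist[OF t]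
    by (rule HH_HomI[OF t t acttwist_hom[OF G] acttwist_act[OF G]])
  have i: "inverse_pair D M M (HH_twist D Z) (acttwinv M (pairact D (M, t)))"
    unfolding Z HH_twist_acttwist[OF t] by (rule acttwist_inverse[OF G])
  have "acttwinv M (pairact D (M, t)) \<in> Hom (HH D) Z Z"
    using HH_inverse[OF t t] h i unfolding Z by blast
  then have "inverse_pair (HH D) Z Z (HH_twist D Z) (acttwinv M (pairact D (M, t)))"
    using h i by (simp add: inverse_pair_def Z HH_simps)
  then show "is_iso (HH D) Z Z (HH_twist D Z)" by (auto simp: is_iso_def)
next
  fix Y Z f assume "Y \<in> Ob (HH D)" "Z \<in> Ob (HH D)" and f: "f \<in> Hom (HH D) Y Z"
  then obtain M t N s where Y: "Y = (M, t)" and t: "half_braiding D M t" and Z: "Z = (N, s)" and s: "half_braiding D N s"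
    by (auto simp: HH_simps)
  have M: "M \<in> Ob D" by (rule half_braidingD(1)[OF t])
  have "f :. acttwist M (pairact D (M, t)) = acttwist N (pairact D (N, s)) :. f"
    by (rule acttwist_nat[OF pairing_action_pairact[OF t] pairing_action_pairact[OF s]])
      (use f HH_Hom_pairact[OF t s f[unfolded Y Z]] M in \<open>simp_all add: Y Z HH_simps ldual_ob lev_hom\<close>)
  then show "Cmp (HH D) (HH_twist D Z) f = Cmp (HH D) f (HH_twist D Y)"
    by (simp add: Y Z HH_simps HH_twist_acttwist[OF t] HH_twist_acttwist[OF s])
qed

end

text \<open>For categories of objects with structure whose arrows are arrows of \<open>D\<close>:
  the equational axioms are inherited, and what has to be checked is closure of the
  hom-sets.\<close>

lemma linear_category_over:
  assumes D: "linear_category D"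
    and ob: "\<And>X. X \<in> Ob C \<Longrightarrow> V X \<in> Ob D"
    and sub: "\<And>X Y f. \<lbrakk>X \<in> Ob C; Y \<in> Ob C; f \<in> Hom C X Y\<rbrakk> \<Longrightarrow> f \<in> Hom D (V X) (V Y)"
    and eqs: "\<And>X. X \<in> Ob C \<Longrightarrow> Ide C X = Ide D (V X)" "Cmp C = Cmp D" "\<And>X Y. \<lbrakk>X \<in> Ob C; Y \<in> Ob C\<rbrakk> \<Longrightarrow> Zer C X Y = Zer D (V X) (V Y)"
      "Add C = Add D" "Smul C = Smul D"
    and ide: "\<And>X. X \<in> Ob C \<Longrightarrow> Ide D (V X) \<in> Hom C X X"
    and cmp: "\<And>X Y Z f g. \<lbrakk>X \<in> Ob C; Y \<in> Ob C; Z \<in> Ob C; f \<in> Hom C X Y; g \<in> Hom C Y Z\<rbrakk> \<Longrightarrow> Cmp D g f \<in> Hom C X Z"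
    and zer: "\<And>X Y. \<lbrakk>X \<in> Ob C; Y \<in> Ob C\<rbrakk> \<Longrightarrow> Zer D (V X) (V Y) \<in> Hom C X Y"
    and add: "\<And>X Y f g. \<lbrakk>X \<in> Ob C; Y \<in> Ob C; f \<in> Hom C X Y; g \<in> Hom C X Y\<rbrakk> \<Longrightarrow> Add D f g \<in> Hom C X Y"
    and smul: "\<And>X Y f c. \<lbrakk>X \<in> Ob C; Y \<in> Ob C; f \<in> Hom C X Y\<rbrakk> \<Longrightarrow> Smul D c f \<in> Hom C X Y"
  shows "linear_category C"
proof -
  interpret D: linear_category D by (rule D)
  show ?thesis
    by (unfold_locales; simp add: eqs ide cmp zer add smul;
      (blast intro: D.ide_left D.ide_right D.cmp_assoc D.add_assoc D.add_commute D.add_zer D.add_neg D.smul_add D.add_smul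
        D.mult_smul D.one_smul D.cmp_add_left D.cmp_add_right D.cmp_smul_left D.cmp_smul_right ob sub)?)
qed

context linear_category
begin

text \<open>By \<open>add_neg\<close> the zero arrow is \<open>0 + (-1) 0\<close>, and bilinearity
  carries this through the composition.\<close>

lemma cmp_zer_right: "\<lbrakk>X \<in> Ob C; Y \<in> Ob C; Z \<in> Ob C; h \<in> Hom C Y Z\<rbrakk> \<Longrightarrow> h \<cdot> Zer C X Y = Zer C X Z"
proof -
  assume a: "X \<in> Ob C" "Y \<in> Ob C" "Z \<in> Ob C" "h \<in> Hom C Y Z"
  note z = zer_hom[OF a(1,2)]
  have "h \<cdot> Zer C X Y = h \<cdot> (Zer C X Y \<oplus> Smul C (-1) (Zer C X Y))" using add_neg[OF a(1,2) z] by simp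
  also have "\<dots> = (h \<cdot> Zer C X Y) \<oplus> Smul C (-1) (h \<cdot> Zer C X Y)"
    using cmp_add_right[OF a(1-3) z smul_hom[OF a(1,2) z] a(4)] cmp_smul_right[OF a(1-3) z a(4)] by simp
  also have "\<dots> = Zer C X Z" by (rule add_neg[OF a(1,3) cmp_hom[OF a(1-3) z a(4)]])
  finally show ?thesis .
qed

lemma cmp_zer_left: "\<lbrakk>X \<in> Ob C; Y \<in> Ob C; Z \<in> Ob C; h \<in> Hom C X Y\<rbrakk> \<Longrightarrow> Zer C Y Z \<cdot> h = Zer C X Z"
proof -
  assume a: "X \<in> Ob C" "Y \<in> Ob C" "Z \<in> Ob C" "h \<in> Hom C X Y"
  note z = zer_hom[OF a(2,3)]
  have "Zer C Y Z \<cdot> h = (Zer C Y Z \<oplus> Smul C (-1) (Zer C Y Z)) \<cdot> h" using add_neg[OF a(2,3) z] by simp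
  also have "\<dots> = (Zer C Y Z \<cdot> h) \<oplus> Smul C (-1) (Zer C Y Z \<cdot> h)"
    using cmp_add_left[OF a(1-4) z smul_hom[OF a(2,3) z]] cmp_smul_left[OF a(1-4) z] by simp
  also have "\<dots> = Zer C X Z" by (rule add_neg[OF a(1,3) cmp_hom[OF a(1-4) z]])
  finally show ?thesis .
qed

end

context linear_monoidal_category
begin

lemma tar_zer_left: "\<lbrakk>X \<in> Ob D; Y \<in> Ob D; X' \<in> Ob D; Y' \<in> Ob D; h \<in> Hom D X' Y'\<rbrakk>
  \<Longrightarrow> Zer D X Y \<star> h = Zer D (X \<otimes> X') (Y \<otimes> Y')"
proof -
  assume a: "X \<in> Ob D" "Y \<in> Ob D" "X' \<in> Ob D" "Y' \<in> Ob D" "h \<in> Hom D X' Y'"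
  note z = zer_hom[OF a(1,2)]
  have "Zer D X Y \<star> h = (Zer D X Y \<oplus> Smul D (-1) (Zer D X Y)) \<star> h" using add_neg[OF a(1,2) z] by simp
  also have "\<dots> = (Zer D X Y \<star> h) \<oplus> Smul D (-1) (Zer D X Y \<star> h)"
    using tar_add_left[OF a(1-4) z smul_hom[OF a(1,2) z] a(5)] tar_smul_left[OF a(1-4) z a(5)] by simp
  also have "\<dots> = Zer D (X \<otimes> X') (Y \<otimes> Y')"
    by (rule add_neg[OF ten_ob ten_ob tar_hom[OF a(1-4) z a(5)]]) (use a in simp_all)
  finally show ?thesis .
qed

lemma tar_zer_right: "\<lbrakk>X \<in> Ob D; Y \<in> Ob D; X' \<in> Ob D; Y' \<in> Ob D; h \<in> Hom D X Y\<rbrakk>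
  \<Longrightarrow> h \<star> Zer D X' Y' = Zer D (X \<otimes> X') (Y \<otimes> Y')"
proof -
  assume a: "X \<in> Ob D" "Y \<in> Ob D" "X' \<in> Ob D" "Y' \<in> Ob D" "h \<in> Hom D X Y"
  note z = zer_hom[OF a(3,4)]
  have "h \<star> Zer D X' Y' = h \<star> (Zer D X' Y' \<oplus> Smul D (-1) (Zer D X' Y'))" using add_neg[OF a(3,4) z] by simp
  also have "\<dots> = (h \<star> Zer D X' Y') \<oplus> Smul D (-1) (h \<star> Zer D X' Y')"
    using tar_add_right[OF a(1-4) a(5) z smul_hom[OF a(3,4) z]] tar_smul_right[OF a(1-4) a(5) z] by simp
  also have "\<dots> = Zer D (X \<otimes> X') (Y \<otimes> Y')"
    by (rule add_neg[OF ten_ob ten_ob tar_hom[OF a(1-4) a(5) z]]) (use a in simp_all)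
  finally show ?thesis .
qed

lemma tar_zer_ide: "\<lbrakk>X \<in> Ob D; Y \<in> Ob D; Z \<in> Ob D\<rbrakk> \<Longrightarrow> Ide D Z \<star> Zer D X Y = Zer D (Z \<otimes> X) (Z \<otimes> Y)"
  "\<lbrakk>X \<in> Ob D; Y \<in> Ob D; Z \<in> Ob D\<rbrakk> \<Longrightarrow> Zer D X Y \<star> Ide D Z = Zer D (X \<otimes> Z) (Y \<otimes> Z)"
  by (simp_all add: tar_zer_left[of X Y Z Z] tar_zer_right[of Z Z X Y] ide_hom)

lemma tar_hom_ide: "\<lbrakk>X \<in> Ob D; Y \<in> Ob D; Z \<in> Ob D; f \<in> Hom D X Y\<rbrakk> \<Longrightarrow> f \<star> Ide D Z \<in> Hom D (X \<otimes> Z) (Y \<otimes> Z)"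
  "\<lbrakk>X \<in> Ob D; Y \<in> Ob D; Z \<in> Ob D; f \<in> Hom D X Y\<rbrakk> \<Longrightarrow> Ide D Z \<star> f \<in> Hom D (Z \<otimes> X) (Z \<otimes> Y)"
  by (simp_all add: tar_hom ide_hom)

end

context rigid_monoidal_category
begin

lemma linear_category_HH: "linear_category (HH D)"
proof (rule linear_category_over[where V = fst, OF linear_category_axioms])
  note o = half_braidingD(1) and h = half_braidingD(3)
  show "fst Z \<in> Ob D" if "Z \<in> Ob (HH D)" for Z using that o by (auto simp: HH_simps)
  show "f \<in> Hom D (fst X) (fst Y)" if "X \<in> Ob (HH D)" "Y \<in> Ob (HH D)" "f \<in> Hom (HH D) X Y" for X Y f
    using that by (cases X; cases Y) (simp add: HH_simps)
  show "Ide (HH D) X = Ide D (fst X)" if "X \<in> Ob (HH D)" for X by (cases X) (simp add: HH_simps)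
  show "Zer (HH D) X Y = Zer D (fst X) (fst Y)" if "X \<in> Ob (HH D)" "Y \<in> Ob (HH D)" for X Y
    by (cases X; cases Y) (simp add: HH_simps)
  show "Ide D (fst Z) \<in> Hom (HH D) Z Z" if "Z \<in> Ob (HH D)" for Z
  proof -
    obtain M t where Z: "Z = (M, t)" and t: "half_braiding D M t" using \<open>Z \<in> Ob (HH D)\<close> by (auto simp: HH_simps)
    have "t X :. Ide D (M*.X) = Ide D (sharp D X*.M) :. t X" if "X \<in> Ob D" for X
      using ide_left[of "M*.X" "sharp D X*.M" "t X"] ide_right[of "M*.X" "sharp D X*.M" "t X"] o[OF t] h[OF t that] that
      by (simp add: sharp_ob)
    then show ?thesis using o[OF t] by (simp add: Z HH_simps ide_hom tar_ide sharp_ob)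
  qed
  fix Z W assume ZW: "Z \<in> Ob (HH D)" "W \<in> Ob (HH D)"
  then obtain M t N s where Z: "Z = (M, t)" and t: "half_braiding D M t" and W: "W = (N, s)" and s: "half_braiding D N s"
    by (auto simp: HH_simps)
  note ob = o[OF t] o[OF s]
  show "Zer D (fst Z) (fst W) \<in> Hom (HH D) Z W"
    using ob h[OF t] h[OF s] cmp_zer_left[of "M*.X" "sharp D X*.M" "sharp D X*.N" "t X" for X]
      cmp_zer_right[of "M*.X" "N*.X" "sharp D X*.N" "s X" for X]
    by (simp add: Z W HH_simps zer_hom tar_zer_ide sharp_ob)
  show "Add D f g \<in> Hom (HH D) Z W" if fg: "f \<in> Hom (HH D) Z W" "g \<in> Hom (HH D) Z W" for f g
  proof -
    have f: "f \<in> Hom D M N" "g \<in> Hom D M N" using fg by (simp_all add: Z W HH_simps)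
    have "s X :. ((f \<oplus> g)*:Ide D X) = (Ide D (sharp D X)*:(f \<oplus> g)) :. t X" if X: "X \<in> Ob D" for X
      using fg X ob f h[OF t X] h[OF s X]
        cmp_add_left[of "M*.X" "sharp D X*.M" "sharp D X*.N" "t X" "Ide D (sharp D X)*:f" "Ide D (sharp D X)*:g"]
        cmp_add_right[of "M*.X" "N*.X" "sharp D X*.N" "f*:Ide D X" "g*:Ide D X" "s X"]
        tar_add_left[of M N X X f g "Ide D X"] tar_add_right[of "sharp D X" "sharp D X" M N "Ide D (sharp D X)" f g]
      by (simp add: Z W HH_simps ide_hom sharp_ob tar_hom_ide)
    then show ?thesis using f ob by (simp add: Z W HH_simps add_hom)
  qed
  show "Smul D c f \<in> Hom (HH D) Z W" if fg: "f \<in> Hom (HH D) Z W" for f c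
  proof -
    have f: "f \<in> Hom D M N" using fg by (simp_all add: Z W HH_simps)
    have "s X :. (Smul D c f*:Ide D X) = (Ide D (sharp D X)*:Smul D c f) :. t X" if X: "X \<in> Ob D" for X
      using fg X ob f h[OF t X] h[OF s X]
        cmp_smul_left[of "M*.X" "sharp D X*.M" "sharp D X*.N" "t X" "Ide D (sharp D X)*:f" c]
        cmp_smul_right[of "M*.X" "N*.X" "sharp D X*.N" "f*:Ide D X" "s X" c]
        tar_smul_left[of M N X X f "Ide D X" c] tar_smul_right[of "sharp D X" "sharp D X" M N "Ide D (sharp D X)" f c]
      by (simp add: Z W HH_simps ide_hom sharp_ob tar_hom_ide)
    then show ?thesis using f ob by (simp add: Z W HH_simps smul_hom)
  qed
  fix V f g assume V: "V \<in> Ob (HH D)" and fg: "f \<in> Hom (HH D) Z W" "g \<in> Hom (HH D) W V"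
  then obtain P u where V: "V = (P, u)" and u: "half_braiding D P u" by (auto simp: HH_simps)
  have f: "f \<in> Hom D M N" "g \<in> Hom D N P" using fg by (simp_all add: Z W V HH_simps)
  have "u X :. ((g :. f)*:Ide D X) = (Ide D (sharp D X)*:(g :. f)) :. t X" if X: "X \<in> Ob D" for X
  proof -
    have fX: "s X :. (f*:Ide D X) = (Ide D (sharp D X)*:f) :. t X" "u X :. (g*:Ide D X) = (Ide D (sharp D X)*:g) :. s X"
      using fg X by (simp_all add: Z W V HH_simps)
    note hs = X f ob o[OF u] h[OF t] h[OF s] h[OF u] ev_sharp_hom rigid_homs
    have "deq D [M, N, P, X, sharp D X] [f, g, t X, s X, u X]
      ($$4 ;; ($$1 ;; $$0)##Id $3)
      (Id $4##($$1 ;; $$0) ;; $$2)"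
      by (rule diagram[of "[($0, $1), ($1, $2), ($0**$3, $4**$0), ($1**$3, $4**$1), ($2**$3, $4**$2)]"
  "[($$3 ;; $$0##Id $3, Id $4##$$0 ;; $$2), ($$4 ;; $$1##Id $3, Id $4##$$1 ;; $$3)]" _ _ "[RF 1 0 1, RF 0 0 0]"],
  code_simp, simp add: hs, simp only: diag_simps, (intro conjI TrueI fX; simp add: hs))
    then show ?thesis by simp
  qed
  then show "g :. f \<in> Hom (HH D) Z V" using f ob o[OF u] cmp_hom[of M N P f g] by (simp add: Z V HH_simps)
qed (simp_all add: HH_simps)

end

section \<open>Modules over a Hopf algebra\<close>

lemma (in rigid_braided_category) braiding_pair_braid: "braiding_pair B (Braid B) (BraidInv B)"
proof unfold_locales
  show "iso_ar B (brar B (Braid B) X Y)" if "X \<in> Ob B" "Y \<in> Ob B" for X Y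
    using that braid_iso by (simp add: iso_ar_def)
  show "brar B (Braid B) (trg f) (trg g) \<odot> (f \<oslash> g) = (g \<oslash> f) \<odot> brar B (Braid B) (src f) (src g)"
    if "arr B f" "arr B g" for f g
    using that braid_nat[of "src f" "src g" "trg f" "trg g" "val f" "val g"]
    by (intro ar_eqI) (simp_all add: arr_def del: arr_ob)
  show "asc B Y Z X \<odot> brar B (Braid B) X (Y \<otimes> Z) \<odot> asc B X Y Z
        = (idn B Y \<oslash> brar B (Braid B) X Z) \<odot> asc B Y X Z \<odot> (brar B (Braid B) X Y \<oslash> idn B Z)"
    if "X \<in> Ob B" "Y \<in> Ob B" "Z \<in> Ob B" for X Y Z
    using hexagon1[OF that] by (intro ar_eqI) simp_all
  show "asci B Z X Y \<odot> brar B (Braid B) (X \<otimes> Y) Z \<odot> asci B X Y Z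
        = (brar B (Braid B) X Z \<oslash> idn B Y) \<odot> asci B X Z Y \<odot> (idn B X \<oslash> brar B (Braid B) Y Z)"
    if "X \<in> Ob B" "Y \<in> Ob B" "Z \<in> Ob B" for X Y Z
    using hexagon2[OF that] by (intro ar_eqI) simp_all
  show "brar B (BraidInv B) X Y = inv_ar B (brar B (Braid B) Y X)" for X Y
    by (rule ar_eqI) (simp_all add: BraidInv_def)
qed

context rigid_braided_category
begin

abbreviation (input) bten_short (infixr "*." 70) where "X *. Y \<equiv> X \<otimes> Y"
abbreviation (input) btar_short (infixr "*:" 70) where "f *: g \<equiv> f \<star> g"
abbreviation (input) bcmp_short (infixr ":." 55) where "f :. g \<equiv> f \<cdot> g"

lemma braid_diagram:
  assumes "derives S True R t u ss"
    and "set os \<subseteq> Ob B \<and> list_all2 (\<lambda>v s. v \<in> Hom B (obj B (map_ob (lk \<one> os) (fst s))) (obj B (map_ob (lk \<one> os) (snd s)))) gs S"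
    and "list_all (\<lambda>r. beq B os gs (fst r) (snd r)) R"
  shows "beq B os gs t u"
  using diagrams.derives_eq[OF diagrams_lk[OF assms(2) braiding_pair_braid] assms(1,3)] by simp

lemma braid_diagram_hom:
  assumes "wt S True t \<and> dm S t = a \<and> cd S t = b"
    and "set os \<subseteq> Ob B \<and> list_all2 (\<lambda>v s. v \<in> Hom B (obj B (map_ob (lk \<one> os) (fst s))) (obj B (map_ob (lk \<one> os) (snd s)))) gs S"
  shows "bhom B os gs t a b"
  using diagrams.typed_hom[OF diagrams_lk[OF assms(2) braiding_pair_braid] assms(1)] by simp

end

context linear_monoidal_category
begin

text \<open>The usual argument in the convolution monoid:
  \<open>f = f (g k) = (f g) k = k\<close>.\<close>

lemma convolution_inverse_unique:
  assumes "H \<in> Ob D" "A \<in> Ob D" "m \<in> Hom D (H \<otimes> H) H" "u \<in> Hom D \<one> H" "d \<in> Hom D A (A \<otimes> A)" "e \<in> Hom D A \<one>"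
    "g \<in> Hom D A H" "f \<in> Hom D A H" "k \<in> Hom D A H"
    and "m \<cdot> m \<star> Ide D H = (m \<cdot> Ide D H \<star> m \<cdot> Asc D H H H)"
    and "m \<cdot> u \<star> Ide D H = (Lun D H)"
    and "m \<cdot> Ide D H \<star> u = (Run D H)"
    and "Asc D A A A \<cdot> d \<star> Ide D A \<cdot> d = (Ide D A \<star> d \<cdot> d)"
    and "Lun D A \<cdot> e \<star> Ide D A \<cdot> d = (Ide D A)"
    and "Run D A \<cdot> Ide D A \<star> e \<cdot> d = (Ide D A)"
    and "m \<cdot> f \<star> g \<cdot> d = (u \<cdot> e)"
    and "m \<cdot> g \<star> k \<cdot> d = (u \<cdot> e)"
  shows "f = k"
proof -
  have "deq D [H, A] [m, u, d, e, g, f, k]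
    ($$5)
    ($$6)"
    by (rule diagram[of "[($0**$0, $0), (Ue, $0), ($1, $1**$1), ($1, Ue), ($1, $0), ($1, $0), ($1, $0)]"
  "[($$0 ;; $$0##Id $0, $$0 ;; Id $0##$$0 ;; As $0 $0 $0), ($$0 ;; $$1##Id $0, Lu $0), ($$0 ;; Id $0##$$1, Ru $0), (As $1 $1 $1 ;; $$2##Id $1 ;; $$2, Id $1##$$2 ;; $$2), (Lu $1 ;; $$3##Id $1 ;; $$2, Id $1), (Ru $1 ;; Id $1##$$3 ;; $$2, Id $1), ($$0 ;; $$5##$$4 ;; $$2, $$1 ;; $$3), ($$0 ;; $$4##$$6 ;; $$2, $$1 ;; $$3)]" _ _ "[RB 0 0 5, SR 1, RB 3 0 2, RB 2 1 7, SL 1, RB 0 0 3, RB 5 0 0, SL 3, SL 2, SL 1, RF 2 0 6, SR 1, SR 2, SL 2, RF 3 0 1, RF 0 0 4]"],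
  code_simp, simp add: assms(1-9) ten_ob uni_ob, simp only: diag_simps, (intro conjI TrueI assms(10-); simp add: assms(1-9) ten_ob uni_ob))
  then show ?thesis by simp
qed

end

section \<open>The antipode and its inverse\<close>

context hopf_algebra
begin

abbreviation hh :: 'o where "hh \<equiv> carr H"

abbreviation kk :: 'o where "kk \<equiv> rdual B (carr H)"

abbreviation ll :: 'o where "ll \<equiv> ldual B (carr H)"

abbreviation HM :: "('o \<times> 'a, 'a, 'k) rigid" where "HM \<equiv> Hmod B H"
abbreviation (input) tenC (infixr "*C" 70) where "X *C Y \<equiv> X \<otimes>\<^bsub>HM\<^esub> Y"
abbreviation (input) tarC (infixr "**C" 70) where "f **C g \<equiv> f \<star>\<^bsub>HM\<^esub> g"
abbreviation (input) cmpC (infixr ":C" 55) where "f :C g \<equiv> f \<cdot>\<^bsub>HM\<^esub> g"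
abbreviation (input) oneC where "oneC \<equiv> \<one>\<^bsub>HM\<^esub>"

lemma antipode_hom: "antipode H \<in> Hom B hh hh" "Inv B hh hh (antipode H) \<in> Hom B hh hh"
  "antipode H :. Inv B hh hh (antipode H) = Ide B hh"
  "Inv B hh hh (antipode H) :. antipode H = Ide B hh"
  using Inv_hom[OF antipode_iso carr_ob carr_ob] by auto

lemmas hopf_hom = carr_ob mul_hom unt_hom comul_hom counit_hom antipode_hom(1,2) rigid_homs

lemmas hopf_rel = mul_assoc mul_unt_left mul_unt_right comul_coassoc counit_left counit_right comul_mul[unfolded middle_swap_def]
  comul_unt counit_mul counit_unt antipode_left antipode_right antipode_hom(3,4)

text \<open>Both sides are convolution inverses of \<open>mul\<close> on the coalgebra
  \<open>H \<otimes> H\<close>, whose comultiplication is \<open>?d\<close> and whose counit is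
  \<open>?e\<close>.\<close>

lemma antipode_mul: "antipode H :. mul H = mul H :. (antipode H*:antipode H) :. Braid B hh hh"
proof -
  let ?d = "(AscInv B hh hh (hh*.hh) :. Ide B hh*:(Asc B hh hh hh :. Braid B hh hh*:Ide B hh :. AscInv B hh hh hh) :. Asc B hh hh (hh*.hh)) :. comul H*:comul H" and ?e = "Lun B \<one> :. counit H*:counit H"
  show ?thesis
  proof (rule convolution_inverse_unique[where A = "hh*.hh" and d = ?d and e = ?e and g = "mul H" and m = "mul H" and u = "unt H"])
    show "Asc B (hh*.hh) (hh*.hh) (hh*.hh) :. ((AscInv B hh hh (hh*.hh) :. Ide B hh*:(Asc B hh hh hh :. Braid B hh hh*:Ide B hh :. AscInv B hh hh hh) :. Asc B hh hh (hh*.hh)) :. comul H*:comul H)*:Ide B (hh*.hh) :. (AscInv B hh hh (hh*.hh) :. Ide B hh*:(Asc B hh hh hh :. Braid B hh hh*:Ide B hh :. AscInv B hh hh hh) :. Asc B hh hh (hh*.hh)) :. comul H*:comul H = Ide B (hh*.hh)*:((AscInv B hh hh (hh*.hh) :. Ide B hh*:(Asc B hh hh hh :. Braid B hh hh*:Ide B hh :. AscInv B hh hh hh) :. Asc B hh hh (hh*.hh)) :. comul H*:comul H) :. (AscInv B hh hh (hh*.hh) :. Ide B hh*:(Asc B hh hh hh :. Braid B hh hh*:Ide B hh :. AscInv B hh hh hh) :. Asc B hh hh (hh*.hh)) :. comul H*:comul H"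
    proof -
    have "beq B [hh] [comul H]
      (As ($0**$0) ($0**$0) ($0**$0) ;; (msd $0 $0 $0 $0 ;; $$0##$$0)##Id ($0**$0) ;; msd $0 $0 $0 $0 ;; $$0##$$0)
      (Id ($0**$0)##(msd $0 $0 $0 $0 ;; $$0##$$0) ;; msd $0 $0 $0 $0 ;; $$0##$$0)"
      by (rule braid_diagram[of "[($0, $0**$0)]"
  "[(As $0 $0 $0 ;; $$0##Id $0 ;; $$0, Id $0##$$0 ;; $$0)]" _ _ "[SR 2, SR 1, RF 0 0 0, NB 3 2 True True 0 (Ge 0) True, SL 1, SL 2, SR 5, NB 3 1 False True 0 (Ge 0) False, RF 1 2 0, SR 2, SR 3]"],
  code_simp, simp add: hopf_hom, simp only: diag_simps, (intro conjI TrueI hopf_rel; simp add: hopf_hom))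
      then show ?thesis by simp
    qed
    show "Lun B (hh*.hh) :. (Lun B \<one> :. counit H*:counit H)*:Ide B (hh*.hh) :. (AscInv B hh hh (hh*.hh) :. Ide B hh*:(Asc B hh hh hh :. Braid B hh hh*:Ide B hh :. AscInv B hh hh hh) :. Asc B hh hh (hh*.hh)) :. comul H*:comul H = Ide B (hh*.hh)"
    proof -
    have "beq B [hh] [comul H, counit H]
      (Lu ($0**$0) ;; (Lu Ue ;; $$1##$$1)##Id ($0**$0) ;; msd $0 $0 $0 $0 ;; $$0##$$0)
      (Id ($0**$0))"
      by (rule braid_diagram[of "[($0, $0**$0), ($0, Ue)]"
  "[(Lu $0 ;; $$1##Id $0 ;; $$0, Id $0)]" _ _ "[SR 2, SR 1, RF 0 0 0, NB 1 0 True True 0 (Ge 1) True, RF 0 1 0]"],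
  code_simp, simp add: hopf_hom, simp only: diag_simps, (intro conjI TrueI hopf_rel; simp add: hopf_hom))
      then show ?thesis by simp
    qed
    show "Run B (hh*.hh) :. Ide B (hh*.hh)*:(Lun B \<one> :. counit H*:counit H) :. (AscInv B hh hh (hh*.hh) :. Ide B hh*:(Asc B hh hh hh :. Braid B hh hh*:Ide B hh :. AscInv B hh hh hh) :. Asc B hh hh (hh*.hh)) :. comul H*:comul H = Ide B (hh*.hh)"
    proof -
    have "beq B [hh] [comul H, counit H]
      (Ru ($0**$0) ;; Id ($0**$0)##(Lu Ue ;; $$1##$$1) ;; msd $0 $0 $0 $0 ;; $$0##$$0)
      (Id ($0**$0))"
      by (rule braid_diagram[of "[($0, $0**$0), ($0, Ue)]"
  "[(Ru $0 ;; Id $0##$$1 ;; $$0, Id $0)]" _ _ "[SL 3, SL 2, RF 1 2 0, NB 1 1 False True 0 (Ge 1) True, RF 0 0 0]"],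
  code_simp, simp add: hopf_hom, simp only: diag_simps, (intro conjI TrueI hopf_rel; simp add: hopf_hom))
      then show ?thesis by simp
    qed
    show "mul H :. (antipode H :. mul H)*:mul H :. (AscInv B hh hh (hh*.hh) :. Ide B hh*:(Asc B hh hh hh :. Braid B hh hh*:Ide B hh :. AscInv B hh hh hh) :. Asc B hh hh (hh*.hh)) :. comul H*:comul H = unt H :. Lun B \<one> :. counit H*:counit H"
    proof -
    have "beq B [hh] [mul H, unt H, comul H, counit H, antipode H]
      ($$0 ;; ($$4 ;; $$0)##$$0 ;; msd $0 $0 $0 $0 ;; $$2##$$2)
      ($$1 ;; Lu Ue ;; $$3##$$3)"
      by (rule braid_diagram[of "[($0**$0, $0), (Ue, $0), ($0, $0**$0), ($0, Ue), ($0, $0)]"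
  "[($$2 ;; $$0, $$0##$$0 ;; msd $0 $0 $0 $0 ;; $$2##$$2), ($$3 ;; $$0, Lu Ue ;; $$3##$$3), ($$0 ;; $$4##Id $0 ;; $$2, $$1 ;; $$3)]" _ _ "[SL 4, RB 0 0 0, RF 1 0 2, RF 0 0 1]"],
  code_simp, simp add: hopf_hom, simp only: diag_simps, (intro conjI TrueI hopf_rel; simp add: hopf_hom))
      then show ?thesis by simp
    qed
    show "mul H :. mul H*:(mul H :. antipode H*:antipode H :. Braid B hh hh) :. (AscInv B hh hh (hh*.hh) :. Ide B hh*:(Asc B hh hh hh :. Braid B hh hh*:Ide B hh :. AscInv B hh hh hh) :. Asc B hh hh (hh*.hh)) :. comul H*:comul H = unt H :. Lun B \<one> :. counit H*:counit H"
    proof -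
    have "beq B [hh] [mul H, unt H, comul H, counit H, antipode H]
      ($$0 ;; $$0##($$0 ;; $$4##$$4 ;; Br $0 $0) ;; msd $0 $0 $0 $0 ;; $$2##$$2)
      ($$1 ;; Lu Ue ;; $$3##$$3)"
      by (rule braid_diagram[of "[($0**$0, $0), (Ue, $0), ($0, $0**$0), ($0, Ue), ($0, $0)]"
  "[($$0 ;; $$0##Id $0, $$0 ;; Id $0##$$0 ;; As $0 $0 $0), ($$0 ;; $$1##Id $0, Lu $0), ($$0 ;; Id $0##$$4 ;; $$2, $$1 ;; $$3)]" _ _ "[SL 3, NB 1 1 True True 0 (Ge 2) False, SL 3, SL 4, SL 5, RF 6 0 0, RB 5 1 0, SR 4, RF 2 1 2, SL 3, RF 4 1 1, NB 1 1 True True 0 (Ge 3) True, SL 0, RF 1 0 2, SR 0]"],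
  code_simp, simp add: hopf_hom, simp only: diag_simps, (intro conjI TrueI hopf_rel; simp add: hopf_hom))
      then show ?thesis by simp
    qed
    show "(AscInv B hh hh (hh*.hh) :. Ide B hh*:(Asc B hh hh hh :. Braid B hh hh*:Ide B hh :. AscInv B hh hh hh) :. Asc B hh hh (hh*.hh)) :. comul H*:comul H \<in> Hom B (hh*.hh) ((hh*.hh)*.(hh*.hh))"
    proof -
    have "bhom B [hh] [comul H]
      (msd $0 $0 $0 $0 ;; $$0##$$0) ($0**$0) (($0**$0)**$0**$0)"
      by (rule braid_diagram_hom[of "[($0, $0**$0)]"], code_simp, simp add: hopf_hom)
      then show ?thesis by simp
    qed
    show "Lun B \<one> :. counit H*:counit H \<in> Hom B (hh*.hh) \<one>"
    proof -
    have "bhom B [hh] [counit H]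
      (Lu Ue ;; $$0##$$0) ($0**$0) (Ue)"
      by (rule braid_diagram_hom[of "[($0, Ue)]"], code_simp, simp add: hopf_hom)
      then show ?thesis by simp
    qed
    show "antipode H :. mul H \<in> Hom B (hh*.hh) hh"
    proof -
    have "bhom B [hh] [mul H, antipode H]
      ($$1 ;; $$0) ($0**$0) ($0)"
      by (rule braid_diagram_hom[of "[($0**$0, $0), ($0, $0)]"], code_simp, simp add: hopf_hom)
      then show ?thesis by simp
    qed
    show "mul H :. antipode H*:antipode H :. Braid B hh hh \<in> Hom B (hh*.hh) hh"
    proof -
    have "bhom B [hh] [mul H, antipode H]
      ($$0 ;; $$1##$$1 ;; Br $0 $0) ($0**$0) ($0)"
      by (rule braid_diagram_hom[of "[($0**$0, $0), ($0, $0)]"], code_simp, simp add: hopf_hom)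
      then show ?thesis by simp
    qed
  qed (simp_all add: hopf_hom hopf_rel)
qed

lemma antipode_unt:
  shows "antipode H :. unt H = unt H"
proof -
  have "beq B [hh] [mul H, unt H, comul H, counit H, antipode H]
    ($$4 ;; $$1)
    ($$1)"
    by (rule braid_diagram[of "[($0**$0, $0), (Ue, $0), ($0, $0**$0), ($0, Ue), ($0, $0)]"
  "[($$0 ;; Id $0##$$1, Ru $0), ($$2 ;; $$1, $$1##$$1 ;; Li Ue), ($$3 ;; $$1, Id Ue), ($$0 ;; $$4##Id $0 ;; $$2, $$1 ;; $$3)]" _ _ "[RB 2 0 0, SL 1, RB 0 0 1, RF 1 0 3, RF 0 0 2]"],
  code_simp, simp add: hopf_hom, simp only: diag_simps, (intro conjI TrueI hopf_rel; simp add: hopf_hom))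
  then show ?thesis by simp
qed

text \<open>\<open>antipode_mul\<close> conjugated by the inverse antipode; solving for the other
  side inverts the braiding.\<close>

lemma antipode_inv_mul:
  shows "Inv B hh hh (antipode H) :. mul H = mul H :. Inv B hh hh (antipode H)*:Inv B hh hh (antipode H) :. BraidInv B hh hh"
proof -
  have "beq B [hh] [mul H, antipode H, Inv B hh hh (antipode H)]
    ($$2 ;; $$0)
    ($$0 ;; $$2##$$2 ;; Bi $0 $0)"
    by (rule braid_diagram[of "[($0**$0, $0), ($0, $0), ($0, $0)]"
  "[($$1 ;; $$2, Id $0), ($$2 ;; $$1, Id $0), ($$1 ;; $$0, $$0 ;; $$1##$$1 ;; Br $0 $0)]" _ _ "[RB 0 1 0, RB 0 0 0, SL 1, XX 2 0 False 0 0 False, RB 3 0 2, RF 4 0 1, NB 1 0 True False 0 (Ge 2) False, NB 0 0 False False 0 (Ge 2) False, SR 1]"],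
  code_simp, simp add: hopf_hom, simp only: diag_simps, (intro conjI TrueI antipode_mul antipode_unt hopf_rel; simp add: hopf_hom))
  then show ?thesis by simp
qed

lemma antipode_inv_unt:
  shows "Inv B hh hh (antipode H) :. unt H = unt H"
proof -
  have "beq B [hh] [unt H, antipode H, Inv B hh hh (antipode H)]
    ($$2 ;; $$0)
    ($$0)"
    by (rule braid_diagram[of "[(Ue, $0), ($0, $0), ($0, $0)]"
  "[($$2 ;; $$1, Id $0), ($$1 ;; $$0, $$0)]" _ _ "[RB 0 0 1, RF 1 0 0]"],
  code_simp, simp add: hopf_hom, simp only: diag_simps, (intro conjI TrueI antipode_mul antipode_unt hopf_rel; simp add: hopf_hom))
  then show ?thesis by simp
qed

text \<open>The inverse antipode is an antipode for the comultiplication followed by the inverse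
  braiding: after applying the antipode, antimultiplicativity undoes the crossing and
  \<open>antipode_left\<close> remains. This is why the action on right duals combines the inverse
  antipode with the inverse braiding.\<close>

lemma antipode_inv_left:
  shows "mul H :. Inv B hh hh (antipode H)*:Ide B hh :. BraidInv B hh hh :. comul H = unt H :. counit H"
proof -
  have "beq B [hh] [mul H, unt H, comul H, counit H, antipode H, Inv B hh hh (antipode H)]
    ($$0 ;; $$5##Id $0 ;; Bi $0 $0 ;; $$2)
    ($$1 ;; $$3)"
    by (rule braid_diagram[of "[($0**$0, $0), (Ue, $0), ($0, $0**$0), ($0, Ue), ($0, $0), ($0, $0)]"
  "[($$4 ;; $$5, Id $0), ($$5 ;; $$4, Id $0), ($$0 ;; $$4##Id $0 ;; $$2, $$1 ;; $$3), ($$4 ;; $$0, $$0 ;; $$4##$$4 ;; Br $0 $0), ($$4 ;; $$1, $$1)]" _ _ "[RB 4 0 1, NB 1 0 True False 0 (Ge 5) True, RF 3 0 3, XX 2 0 False 0 0 True, SR 1, RF 2 1 0, RF 0 0 2, RB 1 0 4, RF 2 0 1]"],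
  code_simp, simp add: hopf_hom, simp only: diag_simps, (intro conjI TrueI antipode_mul antipode_unt hopf_rel; simp add: hopf_hom))
  then show ?thesis by simp
qed

lemma antipode_inv_right:
  shows "mul H :. Ide B hh*:Inv B hh hh (antipode H) :. BraidInv B hh hh :. comul H = unt H :. counit H"
proof -
  have "beq B [hh] [mul H, unt H, comul H, counit H, antipode H, Inv B hh hh (antipode H)]
    ($$0 ;; Id $0##$$5 ;; Bi $0 $0 ;; $$2)
    ($$1 ;; $$3)"
    by (rule braid_diagram[of "[($0**$0, $0), (Ue, $0), ($0, $0**$0), ($0, Ue), ($0, $0), ($0, $0)]"
  "[($$4 ;; $$5, Id $0), ($$5 ;; $$4, Id $0), ($$0 ;; Id $0##$$4 ;; $$2, $$1 ;; $$3), ($$4 ;; $$0, $$0 ;; $$4##$$4 ;; Br $0 $0), ($$4 ;; $$1, $$1)]" _ _ "[RB 4 0 1, NB 1 0 False False 0 (Ge 5) True, RF 3 0 3, XX 2 0 False 0 0 True, RF 1 0 0, RF 0 0 2, RB 1 0 4, RF 2 0 1]"],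
  code_simp, simp add: hopf_hom, simp only: diag_simps, (intro conjI TrueI antipode_mul antipode_unt hopf_rel; simp add: hopf_hom))
  then show ?thesis by simp
qed

section \<open>Modules, their tensor products and their duals\<close>

lemma hmodD:
  assumes "is_hopf_module B H V r"
  shows "V \<in> Ob B" "r \<in> Hom B (hh*.V) V"
    "r :. (mul H*:Ide B V) = r :. (Ide B hh*:r) :. Asc B hh hh V"
    "r :. (unt H*:Ide B V) = Lun B V"
  using assms by (simp_all add: is_hopf_module_def)

lemma tensor_action_hom:
  assumes r: "V \<in> Ob B" "W \<in> Ob B" "r \<in> Hom B (hh*.V) V" "s \<in> Hom B (hh*.W) W"
  shows "tensor_action B H V r W s \<in> Hom B (hh*.(V*.W)) (V*.W)"
proof -
  have "bhom B [hh, V, W] [comul H, r, s]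
    ($$1##$$2 ;; msd $0 $0 $1 $2 ;; $$0##Id ($1**$2)) ($0**$1**$2) ($1**$2)"
    by (rule braid_diagram_hom[of "[($0, $0**$0), ($0**$1, $1), ($0**$2, $2)]"], code_simp, simp add: r hopf_hom)
  then show ?thesis by (simp add: tensor_action_def middle_swap_def)
qed

lemma tensor_module:
  assumes r: "is_hopf_module B H V r" and s: "is_hopf_module B H W s"
  shows "is_hopf_module B H (V*.W) (tensor_action B H V r W s)"
  unfolding is_hopf_module_def
proof (intro conjI)
  show "tensor_action B H V r W s \<in> Hom B (hh*.(V*.W)) (V*.W)" by (intro tensor_action_hom hmodD(1,2)[OF r] hmodD(1,2)[OF s])
  show "tensor_action B H V r W s :. (mul H*:Ide B (V*.W)) = tensor_action B H V r W s :. (Ide B hh*:tensor_action B H V r W s) :. Asc B hh hh (V*.W)"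
  proof -
    note hs = hmodD(1,2)[OF r] hmodD(1,2)[OF s] hopf_hom
    have "beq B [hh, V, W] [mul H, comul H, r, s]
      (($$2##$$3 ;; msd $0 $0 $1 $2 ;; $$1##Id ($1**$2)) ;; $$0##Id ($1**$2))
      (($$2##$$3 ;; msd $0 $0 $1 $2 ;; $$1##Id ($1**$2)) ;; Id $0##($$2##$$3 ;; msd $0 $0 $1 $2 ;; $$1##Id ($1**$2)) ;; As $0 $0 ($1**$2))"
      by (rule braid_diagram[of "[($0**$0, $0), ($0, $0**$0), ($0**$1, $1), ($0**$2, $2)]"
  "[($$1 ;; $$0, $$0##$$0 ;; msd $0 $0 $0 $0 ;; $$1##$$1), ($$2 ;; $$0##Id $1, $$2 ;; Id $0##$$2 ;; As $0 $0 $1), ($$3 ;; $$0##Id $2, $$3 ;; Id $0##$$3 ;; As $0 $0 $2)]" _ _ "[RF 0 0 0, SL 3, SL 4, RF 5 0 1, NB 3 2 False True 1 (Ge 0) False, SL 2, SR 5, SR 6, NB 3 1 True True 0 (Ge 2) True, RF 6 1 2, SL 0, SL 1, SL 2, SL 5, SL 4, SL 3]"],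
  code_simp, simp add: hs, simp only: diag_simps, (intro conjI TrueI hmodD(3,4)[OF r] hmodD(3,4)[OF s] hopf_rel; simp add: hs))
    then show ?thesis by (simp add: tensor_action_def middle_swap_def)
  qed
  show "tensor_action B H V r W s :. (unt H*:Ide B (V*.W)) = Lun B (V*.W)"
  proof -
    note hs = hmodD(1,2)[OF r] hmodD(1,2)[OF s] hopf_hom
    have "beq B [hh, V, W] [unt H, comul H, r, s]
      (($$2##$$3 ;; msd $0 $0 $1 $2 ;; $$1##Id ($1**$2)) ;; $$0##Id ($1**$2))
      (Lu ($1**$2))"
      by (rule braid_diagram[of "[(Ue, $0), ($0, $0**$0), ($0**$1, $1), ($0**$2, $2)]"
  "[($$1 ;; $$0, $$0##$$0 ;; Li Ue), ($$2 ;; $$0##Id $1, Lu $1), ($$3 ;; $$0##Id $2, Lu $2)]" _ _ "[RF 0 0 0, SL 0, SL 1, RF 2 0 1, NB 0 0 False True 1 (Ge 0) False, RF 0 1 2]"],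
  code_simp, simp add: hs, simp only: diag_simps, (intro conjI TrueI hmodD(3,4)[OF r] hmodD(3,4)[OF s] hopf_rel; simp add: hs))
    then show ?thesis by (simp add: tensor_action_def middle_swap_def)
  qed
qed (simp add: ten_ob hmodD(1)[OF r] hmodD(1)[OF s])

abbreviation triv :: "'o \<Rightarrow> 'a" where "triv X \<equiv> Lun B X :. (counit H*:Ide B X)"

lemma triv_module:
  assumes X: "X \<in> Ob B"
  shows "is_hopf_module B H X (triv X)"
  unfolding is_hopf_module_def
proof (intro conjI)
  show "triv X \<in> Hom B (hh*.X) X"
  proof -
    have "bhom B [hh, X] [counit H]
      (Lu $1 ;; $$0##Id $1) ($0**$1) ($1)"
      by (rule braid_diagram_hom[of "[($0, Ue)]"], code_simp, simp add: X hopf_hom)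
    then show ?thesis by (simp add: hopf_hom)
  qed
  show "(triv X) :. (mul H*:Ide B X) = (triv X) :. (Ide B hh*:(triv X)) :. Asc B hh hh X"
  proof -
    have "beq B [hh, X] [mul H, counit H]
      ((Lu $1 ;; $$1##Id $1) ;; $$0##Id $1)
      ((Lu $1 ;; $$1##Id $1) ;; Id $0##(Lu $1 ;; $$1##Id $1) ;; As $0 $0 $1)"
      by (rule braid_diagram[of "[($0**$0, $0), ($0, Ue)]"
  "[($$1 ;; $$0, Lu Ue ;; $$1##$$1)]" _ _ "[RF 0 0 0, SL 0]"],
  code_simp, simp add: X hopf_hom, simp only: diag_simps, (intro conjI TrueI hopf_rel; simp add: X hopf_hom))
    then show ?thesis by (simp add: hopf_hom)
  qed
  show "(triv X) :. (unt H*:Ide B X) = Lun B X"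
  proof -
    have "beq B [hh, X] [unt H, counit H]
      ((Lu $1 ;; $$1##Id $1) ;; $$0##Id $1)
      (Lu $1)"
      by (rule braid_diagram[of "[(Ue, $0), ($0, Ue)]"
  "[($$1 ;; $$0, Id Ue)]" _ _ "[RF 0 0 0]"],
  code_simp, simp add: X hopf_hom, simp only: diag_simps, (intro conjI TrueI hopf_rel; simp add: X hopf_hom))
    then show ?thesis by (simp add: hopf_hom)
  qed
qed (simp add: X hopf_hom)

text \<open>Precomposing functionals reverses products; antimultiplicativity of the antipode
  restores the order, and its braiding matches the passage of \<open>H\<close> across the
  dual.\<close>

lemma ldual_module:
  assumes r: "is_hopf_module B H V r"
  shows "is_hopf_module B H (ldual B V) (ldual_action B H V r)"
  unfolding is_hopf_module_def
proof (intro conjI)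
  show "ldual_action B H V r \<in> Hom B (hh*.(ldual B V)) (ldual B V)"
  proof -
    have "bhom B [hh, V, ldual B V] [antipode H, r, ev_left B V, coev_left B V]
      (Lu $2 ;; ($$2 ;; Id $2##($$1 ;; $$0##Id $1) ;; As $2 $0 $1 ;; Br $0 $2##Id $1)##Id $2 ;; Ai ($0**$2) $1 $2 ;; Id ($0**$2)##$$3 ;; Ri ($0**$2)) ($0**$2) ($2)"
      by (rule braid_diagram_hom[of "[($0, $0), ($0**$1, $1), ($2**$1, Ue), (Ue, $1**$2)]"], code_simp, simp add: hmodD(1,2)[OF r] hopf_hom)
    then show ?thesis by (simp add: ldual_action_def lcurry_def)
  qed
  show "(ldual_action B H V r) :. (mul H*:Ide B (ldual B V)) = (ldual_action B H V r) :. (Ide B hh*:(ldual_action B H V r)) :. Asc B hh hh (ldual B V)"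
  proof -
    have "beq B [hh, V, ldual B V] [mul H, antipode H, r, ev_left B V, coev_left B V]
      ((Lu $2 ;; ($$3 ;; Id $2##($$2 ;; $$1##Id $1) ;; As $2 $0 $1 ;; Br $0 $2##Id $1)##Id $2 ;; Ai ($0**$2) $1 $2 ;; Id ($0**$2)##$$4 ;; Ri ($0**$2)) ;; $$0##Id $2)
      ((Lu $2 ;; ($$3 ;; Id $2##($$2 ;; $$1##Id $1) ;; As $2 $0 $1 ;; Br $0 $2##Id $1)##Id $2 ;; Ai ($0**$2) $1 $2 ;; Id ($0**$2)##$$4 ;; Ri ($0**$2)) ;; Id $0##(Lu $2 ;; ($$3 ;; Id $2##($$2 ;; $$1##Id $1) ;; As $2 $0 $1 ;; Br $0 $2##Id $1)##Id $2 ;; Ai ($0**$2) $1 $2 ;; Id ($0**$2)##$$4 ;; Ri ($0**$2)) ;; As $0 $0 $2)"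
      by (rule braid_diagram[of "[($0**$0, $0), ($0, $0), ($0**$1, $1), ($2**$1, Ue), (Ue, $1**$2)]"
  "[($$1 ;; $$0, $$0 ;; $$1##$$1 ;; Br $0 $0), ($$2 ;; $$0##Id $1, $$2 ;; Id $0##$$2 ;; As $0 $0 $1), zr $1 $2 $$3 $$4]" _ _ "[SR 1, SR 2, NB 0 0 False True 2 (Ge 0) False, RF 2 1 0, NB 0 0 True True 0 (Cr True 0 2) False, SL 5, RF 6 1 1, RB 7 2 2, SR 6, SR 5, SR 4, SL 3, SL 2, SR 8, SR 7, SR 6, SR 5, SR 9, SR 8, SR 7, SR 6, SL 7, SR 2, SR 3, SR 7, SL 6, SL 5, SL 4, NB 0 0 True True 0 (Cr True 0 2) True, NB 2 1 True True 0 (Ge 1) True, SR 4, SR 5, SR 6, NB 4 2 True True 0 (Ge 4) True, SL 3, SR 6, SR 7, NB 4 1 True True 0 (Ge 2) True, SL 1, SL 2, SL 3, NB 4 0 True True 0 (Ge 3) True, SL 1, SL 0, SL 6, SL 5]"],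
  code_simp, simp add: hmodD(1,2)[OF r] hopf_hom, simp only: diag_simps, (intro conjI TrueI hmodD(3,4)[OF r] antipode_mul antipode_unt hopf_rel zigzags; simp add: hmodD(1,2)[OF r] hopf_hom))
    then show ?thesis by (simp add: ldual_action_def lcurry_def)
  qed
  show "(ldual_action B H V r) :. (unt H*:Ide B (ldual B V)) = Lun B (ldual B V)"
  proof -
    have "beq B [hh, V, ldual B V] [unt H, antipode H, r, ev_left B V, coev_left B V]
      ((Lu $2 ;; ($$3 ;; Id $2##($$2 ;; $$1##Id $1) ;; As $2 $0 $1 ;; Br $0 $2##Id $1)##Id $2 ;; Ai ($0**$2) $1 $2 ;; Id ($0**$2)##$$4 ;; Ri ($0**$2)) ;; $$0##Id $2)
      (Lu $2)"
      by (rule braid_diagram[of "[(Ue, $0), ($0, $0), ($0**$1, $1), ($2**$1, Ue), (Ue, $1**$2)]"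
  "[($$1 ;; $$0, $$0), ($$2 ;; $$0##Id $1, Lu $1), zl $2 $1 $$3 $$4]" _ _ "[SR 1, SR 2, NB 0 0 False True 2 (Ge 0) False, SL 1, SL 0, RF 1 1 0, RF 1 1 1, RF 0 0 2]"],
  code_simp, simp add: hmodD(1,2)[OF r] hopf_hom, simp only: diag_simps, (intro conjI TrueI hmodD(3,4)[OF r] antipode_mul antipode_unt hopf_rel zigzags; simp add: hmodD(1,2)[OF r] hopf_hom))
    then show ?thesis by (simp add: ldual_action_def lcurry_def)
  qed
qed (simp add: hmodD(1,2)[OF r] hopf_hom)

text \<open>Acting on both factors brings \<open>S(h_1)\<close> and \<open>h_2\<close> together on
  \<open>V\<close>, where \<open>antipode_left\<close> cancels them.\<close>

lemma ev_left_linear: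
  assumes r: "is_hopf_module B H V r"
  shows "ev_left B V :. tensor_action B H (ldual B V) (ldual_action B H V r) V r = triv \<one> :. (Ide B hh*:ev_left B V)"
proof -
  have "beq B [hh, V, ldual B V] [mul H, unt H, comul H, counit H, antipode H, r, ev_left B V, coev_left B V]
    ($$6 ;; (Lu $2 ;; ($$6 ;; Id $2##($$5 ;; $$4##Id $1) ;; As $2 $0 $1 ;; Br $0 $2##Id $1)##Id $2 ;; Ai ($0**$2) $1 $2 ;; Id ($0**$2)##$$7 ;; Ri ($0**$2))##$$5 ;; msd $0 $0 $2 $1 ;; $$2##Id ($2**$1))
    ((Lu Ue ;; $$3##Id Ue) ;; Id $0##$$6)"
    by (rule braid_diagram[of "[($0**$0, $0), (Ue, $0), ($0, $0**$0), ($0, Ue), ($0, $0), ($0**$1, $1), ($2**$1, Ue), (Ue, $1**$2)]"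
  "[($$0 ;; $$4##Id $0 ;; $$2, $$1 ;; $$3), ($$5 ;; $$0##Id $1, $$5 ;; Id $0##$$5 ;; As $0 $0 $1), ($$5 ;; $$1##Id $1, Lu $1), zr $1 $2 $$6 $$7]" _ _ "[SR 2, SR 3, SL 6, SL 5, SL 4, SL 7, SL 6, RF 5 2 3, NB 0 0 False True 2 (Ge 2) False, RB 3 1 1, RF 1 1 0, RF 2 1 2, NB 0 0 False True 2 (Ge 3) True, SL 0]"],
  code_simp, simp add: hmodD(1,2)[OF r] hopf_hom, simp only: diag_simps, (intro conjI TrueI hmodD(3,4)[OF r] antipode_mul antipode_unt hopf_rel zigzags; simp add: hmodD(1,2)[OF r] hopf_hom))
  then show ?thesis by (simp add: ldual_action_def lcurry_def rdual_action_def rcurry_def tensor_action_def middle_swap_def)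
qed

lemma coev_left_linear:
  assumes r: "is_hopf_module B H V r"
  shows "coev_left B V :. triv \<one> = tensor_action B H V r (ldual B V) (ldual_action B H V r) :. (Ide B hh*:coev_left B V)"
proof -
  have "beq B [hh, V, ldual B V] [mul H, unt H, comul H, counit H, antipode H, r, ev_left B V, coev_left B V]
    ($$7 ;; Lu Ue ;; $$3##Id Ue)
    (($$5##(Lu $2 ;; ($$6 ;; Id $2##($$5 ;; $$4##Id $1) ;; As $2 $0 $1 ;; Br $0 $2##Id $1)##Id $2 ;; Ai ($0**$2) $1 $2 ;; Id ($0**$2)##$$7 ;; Ri ($0**$2)) ;; msd $0 $0 $1 $2 ;; $$2##Id ($1**$2)) ;; Id $0##$$7)"
    by (rule braid_diagram[of "[($0**$0, $0), (Ue, $0), ($0, $0**$0), ($0, Ue), ($0, $0), ($0**$1, $1), ($2**$1, Ue), (Ue, $1**$2)]"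
  "[($$0 ;; Id $0##$$4 ;; $$2, $$1 ;; $$3), ($$5 ;; $$0##Id $1, $$5 ;; Id $0##$$5 ;; As $0 $0 $1), ($$5 ;; $$1##Id $1, Lu $1), zr $1 $2 $$6 $$7]" _ _ "[RB 2 0 2, SR 1, RB 0 0 0, SL 2, RF 3 0 1, RB 4 1 3, SR 3, SR 2, SR 1, SR 5, SR 4, SR 3, SR 2, NB 1 1 True True 0 (Ge 7) True, SL 0, SR 3, SL 5, SL 4]"],
  code_simp, simp add: hmodD(1,2)[OF r] hopf_hom, simp only: diag_simps, (intro conjI TrueI hmodD(3,4)[OF r] antipode_mul antipode_unt hopf_rel zigzags; simp add: hmodD(1,2)[OF r] hopf_hom))
  then show ?thesis by (simp add: ldual_action_def lcurry_def rdual_action_def rcurry_def tensor_action_def middle_swap_def)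
qed

lemma rdual_module:
  assumes r: "is_hopf_module B H V r"
  shows "is_hopf_module B H (rdual B V) (rdual_action B H V r)"
  unfolding is_hopf_module_def
proof (intro conjI)
  show "rdual_action B H V r \<in> Hom B (hh*.(rdual B V)) (rdual B V)"
  proof -
    have "bhom B [hh, V, rdual B V] [Inv B hh hh (antipode H), r, ev_right B V, coev_right B V]
      (Ru $2 ;; Id $2##($$2 ;; ($$1 ;; $$0##Id $1 ;; Bi $1 $0)##Id $2 ;; Ai $1 $0 $2) ;; As $2 $1 ($0**$2) ;; $$3##Id ($0**$2) ;; Li ($0**$2)) ($0**$2) ($2)"
      by (rule braid_diagram_hom[of "[($0, $0), ($0**$1, $1), ($1**$2, Ue), (Ue, $2**$1)]"], code_simp, simp add: hmodD(1,2)[OF r] hopf_hom)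
    then show ?thesis by (simp add: rdual_action_def rcurry_def)
  qed
  show "(rdual_action B H V r) :. (mul H*:Ide B (rdual B V)) = (rdual_action B H V r) :. (Ide B hh*:(rdual_action B H V r)) :. Asc B hh hh (rdual B V)"
  proof -
    have "beq B [hh, V, rdual B V] [mul H, Inv B hh hh (antipode H), r, ev_right B V, coev_right B V]
      ((Ru $2 ;; Id $2##($$3 ;; ($$2 ;; $$1##Id $1 ;; Bi $1 $0)##Id $2 ;; Ai $1 $0 $2) ;; As $2 $1 ($0**$2) ;; $$4##Id ($0**$2) ;; Li ($0**$2)) ;; $$0##Id $2)
      ((Ru $2 ;; Id $2##($$3 ;; ($$2 ;; $$1##Id $1 ;; Bi $1 $0)##Id $2 ;; Ai $1 $0 $2) ;; As $2 $1 ($0**$2) ;; $$4##Id ($0**$2) ;; Li ($0**$2)) ;; Id $0##(Ru $2 ;; Id $2##($$3 ;; ($$2 ;; $$1##Id $1 ;; Bi $1 $0)##Id $2 ;; Ai $1 $0 $2) ;; As $2 $1 ($0**$2) ;; $$4##Id ($0**$2) ;; Li ($0**$2)) ;; As $0 $0 $2)"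
      by (rule braid_diagram[of "[($0**$0, $0), ($0, $0), ($0**$1, $1), ($1**$2, Ue), (Ue, $2**$1)]"
  "[($$1 ;; $$0, $$0 ;; $$1##$$1 ;; Bi $0 $0), ($$2 ;; $$0##Id $1, $$2 ;; Id $0##$$2 ;; As $0 $0 $1), zl $1 $2 $$3 $$4]" _ _ "[SR 0, NB 1 1 True False 1 (Ge 0) False, RF 3 1 0, SL 4, NB 3 1 False False 0 (Ge 1) True, SR 2, RF 6 1 1, SL 5, NB 3 1 False False 0 (Ge 2) True, RB 4 1 2, SL 3, SL 2, SL 1, SL 0, SL 5, SL 4, SL 3, SL 2, SL 1, SL 6, SL 5, SL 4, SL 3, SL 2, SL 7, SL 6, SL 5, SL 4, SL 3, SL 8, SL 7, SL 6, SL 5, SL 4]"],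
  code_simp, simp add: hmodD(1,2)[OF r] hopf_hom, simp only: diag_simps, (intro conjI TrueI hmodD(3,4)[OF r] antipode_inv_mul antipode_inv_unt antipode_inv_left antipode_inv_right hopf_rel zigzags; simp add: hmodD(1,2)[OF r] hopf_hom))
    then show ?thesis by (simp add: rdual_action_def rcurry_def)
  qed
  show "(rdual_action B H V r) :. (unt H*:Ide B (rdual B V)) = Lun B (rdual B V)"
  proof -
    have "beq B [hh, V, rdual B V] [unt H, Inv B hh hh (antipode H), r, ev_right B V, coev_right B V]
      ((Ru $2 ;; Id $2##($$3 ;; ($$2 ;; $$1##Id $1 ;; Bi $1 $0)##Id $2 ;; Ai $1 $0 $2) ;; As $2 $1 ($0**$2) ;; $$4##Id ($0**$2) ;; Li ($0**$2)) ;; $$0##Id $2)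
      (Lu $2)"
      by (rule braid_diagram[of "[(Ue, $0), ($0, $0), ($0**$1, $1), ($1**$2, Ue), (Ue, $2**$1)]"
  "[($$1 ;; $$0, $$0), ($$2 ;; $$0##Id $1, Lu $1), zr $2 $1 $$3 $$4]" _ _ "[SR 0, NB 1 1 True False 1 (Ge 0) False, RF 1 1 0, RF 1 1 1, RF 0 0 2]"],
  code_simp, simp add: hmodD(1,2)[OF r] hopf_hom, simp only: diag_simps, (intro conjI TrueI hmodD(3,4)[OF r] antipode_inv_mul antipode_inv_unt antipode_inv_left antipode_inv_right hopf_rel zigzags; simp add: hmodD(1,2)[OF r] hopf_hom))
    then show ?thesis by (simp add: rdual_action_def rcurry_def)
  qed
qed (simp add: hmodD(1,2)[OF r] hopf_hom)

text \<open>Here the two legs of the comultiplication meet on \<open>V\<close> after an inverse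
  crossing, and \<open>antipode_inv_left\<close> cancels them.\<close>

lemma ev_right_linear:
  assumes r: "is_hopf_module B H V r"
  shows "ev_right B V :. tensor_action B H V r (rdual B V) (rdual_action B H V r) = triv \<one> :. (Ide B hh*:ev_right B V)"
proof -
  have "beq B [hh, V, rdual B V] [mul H, unt H, comul H, counit H, Inv B hh hh (antipode H), r, ev_right B V, coev_right B V]
    ($$6 ;; $$5##(Ru $2 ;; Id $2##($$6 ;; ($$5 ;; $$4##Id $1 ;; Bi $1 $0)##Id $2 ;; Ai $1 $0 $2) ;; As $2 $1 ($0**$2) ;; $$7##Id ($0**$2) ;; Li ($0**$2)) ;; msd $0 $0 $1 $2 ;; $$2##Id ($1**$2))
    ((Lu Ue ;; $$3##Id Ue) ;; Id $0##$$6)"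
    by (rule braid_diagram[of "[($0**$0, $0), (Ue, $0), ($0, $0**$0), ($0, Ue), ($0, $0), ($0**$1, $1), ($1**$2, Ue), (Ue, $2**$1)]"
  "[($$0 ;; $$4##Id $0 ;; Bi $0 $0 ;; $$2, $$1 ;; $$3), ($$5 ;; $$0##Id $1, $$5 ;; Id $0##$$5 ;; As $0 $0 $1), ($$5 ;; $$1##Id $1, Lu $1), zl $1 $2 $$6 $$7]" _ _ "[SR 7, SR 6, SR 5, SR 4, RF 3 0 3, NB 2 0 False False 0 (Ge 5) False, SR 4, XX 1 1 True 0 1 True, RB 3 0 1, RF 0 0 0, RF 1 0 2, SL 0]"],
  code_simp, simp add: hmodD(1,2)[OF r] hopf_hom, simp only: diag_simps, (intro conjI TrueI hmodD(3,4)[OF r] antipode_inv_mul antipode_inv_unt antipode_inv_left antipode_inv_right hopf_rel zigzags; simp add: hmodD(1,2)[OF r] hopf_hom))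
  then show ?thesis by (simp add: ldual_action_def lcurry_def rdual_action_def rcurry_def tensor_action_def middle_swap_def)
qed

lemma coev_right_linear:
  assumes r: "is_hopf_module B H V r"
  shows "coev_right B V :. triv \<one> = tensor_action B H (rdual B V) (rdual_action B H V r) V r :. (Ide B hh*:coev_right B V)"
proof -
  have "beq B [hh, V, rdual B V] [mul H, unt H, comul H, counit H, Inv B hh hh (antipode H), r, ev_right B V, coev_right B V]
    ($$7 ;; Lu Ue ;; $$3##Id Ue)
    (((Ru $2 ;; Id $2##($$6 ;; ($$5 ;; $$4##Id $1 ;; Bi $1 $0)##Id $2 ;; Ai $1 $0 $2) ;; As $2 $1 ($0**$2) ;; $$7##Id ($0**$2) ;; Li ($0**$2))##$$5 ;; msd $0 $0 $2 $1 ;; $$2##Id ($2**$1)) ;; Id $0##$$7)"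
    by (rule braid_diagram[of "[($0**$0, $0), (Ue, $0), ($0, $0**$0), ($0, Ue), ($0, $0), ($0**$1, $1), ($1**$2, Ue), (Ue, $2**$1)]"
  "[($$0 ;; Id $0##$$4 ;; Bi $0 $0 ;; $$2, $$1 ;; $$3), ($$5 ;; $$0##Id $1, $$5 ;; Id $0##$$5 ;; As $0 $0 $1), ($$5 ;; $$1##Id $1, Lu $1), zl $1 $2 $$6 $$7]" _ _ "[SL 0, NB 0 0 False False 0 (Ge 7) True, NB 2 0 True False 2 (Ge 3) True, RB 3 1 2, RB 2 1 0, NB 3 1 False False 0 (Ge 4) True, RF 5 1 1, NB 1 1 True False 1 (Ge 2) True, SR 3, NB 4 1 False False 0 (Ge 5) True, RB 6 2 3, SL 5, XX 6 2 True 0 2 False, NB 7 1 False False 0 (Ge 6) True, SL 4, SL 3, SL 2, SL 1, SL 0, SL 1, SL 5, SL 4, SL 3, SL 2]"],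
  code_simp, simp add: hmodD(1,2)[OF r] hopf_hom, simp only: diag_simps, (intro conjI TrueI hmodD(3,4)[OF r] antipode_inv_mul antipode_inv_unt antipode_inv_left antipode_inv_right hopf_rel zigzags; simp add: hmodD(1,2)[OF r] hopf_hom))
  then show ?thesis by (simp add: ldual_action_def lcurry_def rdual_action_def rcurry_def tensor_action_def middle_swap_def)
qed

lemma tar_linear:
  assumes a: "V \<in> Ob B" "W \<in> Ob B" "V' \<in> Ob B" "W' \<in> Ob B" "r \<in> Hom B (hh*.V) V" "s \<in> Hom B (hh*.W) W" "r' \<in> Hom B (hh*.V') V'" "s' \<in> Hom B (hh*.W') W'" "f \<in> Hom B V V'" "g \<in> Hom B W W'"
    and e: "f :. r = r' :. (Ide B hh*:f)" "g :. s = s' :. (Ide B hh*:g)"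
  shows "(f*:g) :. tensor_action B H V r W s = tensor_action B H V' r' W' s' :. (Ide B hh*:(f*:g))"
proof -
  have "beq B [hh, V, W, V', W'] [comul H, r, s, r', s', f, g]
    ($$5##$$6 ;; $$1##$$2 ;; msd $0 $0 $1 $2 ;; $$0##Id ($1**$2))
    (($$3##$$4 ;; msd $0 $0 $3 $4 ;; $$0##Id ($3**$4)) ;; Id $0##$$5##$$6)"
    by (rule braid_diagram[of "[($0, $0**$0), ($0**$1, $1), ($0**$2, $2), ($0**$3, $3), ($0**$4, $4), ($1, $3), ($2, $4)]"
  "[($$5 ;; $$1, $$3 ;; Id $0##$$5), ($$6 ;; $$2, $$4 ;; Id $0##$$6)]" _ _ "[SR 3, RF 2 0 0, RF 4 1 1, NB 1 1 True True 0 (Ge 5) True, SL 0, SL 3, SL 2, SL 1]"],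
  code_simp, simp add: a hopf_hom, simp only: diag_simps, (intro conjI TrueI e hopf_rel; simp add: a hopf_hom))
  then show ?thesis by (simp add: tensor_action_def middle_swap_def)
qed

lemma asc_linear:
  assumes a: "Q \<in> Ob B" "V \<in> Ob B" "W \<in> Ob B" "p \<in> Hom B (hh*.Q) Q" "r \<in> Hom B (hh*.V) V" "s \<in> Hom B (hh*.W) W"
  shows "Asc B Q V W :. tensor_action B H (Q*.V) (tensor_action B H Q p V r) W s = tensor_action B H Q p (V*.W) (tensor_action B H V r W s) :. (Ide B hh*:Asc B Q V W)"
proof -
  have "beq B [hh, Q, V, W] [comul H, p, r, s]
    (As $1 $2 $3 ;; ($$1##$$2 ;; msd $0 $0 $1 $2 ;; $$0##Id ($1**$2))##$$3 ;; msd $0 $0 ($1**$2) $3 ;; $$0##Id (($1**$2)**$3))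
    (($$1##($$2##$$3 ;; msd $0 $0 $2 $3 ;; $$0##Id ($2**$3)) ;; msd $0 $0 $1 ($2**$3) ;; $$0##Id ($1**$2**$3)) ;; Id $0##As $1 $2 $3)"
    by (rule braid_diagram[of "[($0, $0**$0), ($0**$1, $1), ($0**$2, $2), ($0**$3, $3)]"
  "[(As $0 $0 $0 ;; $$0##Id $0 ;; $$0, Id $0##$$0 ;; $$0)]" _ _ "[SR 2, SR 1, SR 3, SR 4, RF 0 0 0, NB 1 1 False True 1 (Ge 0) False, SR 2]"],
  code_simp, simp add: a hopf_hom, simp only: diag_simps, (intro conjI TrueI hopf_rel; simp add: a hopf_hom))
  then show ?thesis by (simp add: tensor_action_def middle_swap_def)
qed

lemma lun_linear:
  assumes a: "V \<in> Ob B" "r \<in> Hom B (hh*.V) V"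
  shows "Lun B V :. tensor_action B H \<one> (triv \<one>) V r = r :. (Ide B hh*:Lun B V)"
proof -
  have "beq B [hh, V] [comul H, counit H, r]
    (Lu $1 ;; (Lu Ue ;; $$1##Id Ue)##$$2 ;; msd $0 $0 Ue $1 ;; $$0##Id (Ue**$1))
    ($$2 ;; Id $0##Lu $1)"
    by (rule braid_diagram[of "[($0, $0**$0), ($0, Ue), ($0**$1, $1)]"
  "[(Lu $0 ;; $$1##Id $0 ;; $$0, Id $0)]" _ _ "[RF 0 0 0]"],
  code_simp, simp add: a hopf_hom, simp only: diag_simps, (intro conjI TrueI hopf_rel; simp add: a hopf_hom))
  then show ?thesis by (simp add: tensor_action_def middle_swap_def)
qed

lemma run_linear:
  assumes a: "V \<in> Ob B" "r \<in> Hom B (hh*.V) V"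
  shows "Run B V :. tensor_action B H V r \<one> (triv \<one>) = r :. (Ide B hh*:Run B V)"
proof -
  have "beq B [hh, V] [comul H, counit H, r]
    (Ru $1 ;; $$2##(Lu Ue ;; $$1##Id Ue) ;; msd $0 $0 $1 Ue ;; $$0##Id ($1**Ue))
    ($$2 ;; Id $0##Ru $1)"
    by (rule braid_diagram[of "[($0, $0**$0), ($0, Ue), ($0**$1, $1)]"
  "[(Ru $0 ;; Id $0##$$1 ;; $$0, Id $0)]" _ _ "[SL 2, NB 1 1 False True 1 (Ge 1) True, RF 0 0 0]"],
  code_simp, simp add: a hopf_hom, simp only: diag_simps, (intro conjI TrueI hopf_rel; simp add: a hopf_hom))
  then show ?thesis by (simp add: tensor_action_def middle_swap_def)
qed

lemma inverse_linear:
  assumes a: "V \<in> Ob B" "W \<in> Ob B" "r \<in> Hom B (hh*.V) V" "s \<in> Hom B (hh*.W) W" "f \<in> Hom B V W" "g \<in> Hom B W V"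
    and e: "f :. g = Ide B W" "g :. f = Ide B V" "f :. r = s :. (Ide B hh*:f)"
  shows "g :. s = r :. Ide B hh*:g"
proof -
  have "beq B [hh, V, W] [r, s, f, g]
    ($$3 ;; $$1)
    ($$0 ;; Id $0##$$3)"
    by (rule braid_diagram[of "[($0**$1, $1), ($0**$2, $2), ($1, $2), ($2, $1)]"
  "[($$2 ;; $$3, Id $2), ($$3 ;; $$2, Id $1), ($$2 ;; $$0, $$1 ;; Id $0##$$2)]" _ _ "[RB 0 1 0, RB 1 0 2, RF 2 0 1]"],
  code_simp, simp add: a hopf_hom, simp only: diag_simps, (intro conjI TrueI e hopf_rel; simp add: a hopf_hom))
  then show ?thesis by simp
qed

lemma cmp_linear:
  assumes a: "V \<in> Ob B" "W \<in> Ob B" "P \<in> Ob B" "r \<in> Hom B (hh*.V) V" "s \<in> Hom B (hh*.W) W" "p \<in> Hom B (hh*.P) P" "f \<in> Hom B V W" "g \<in> Hom B W P"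
    and e: "g :. s = p :. (Ide B hh*:g)" "f :. r = s :. (Ide B hh*:f)"
  shows "(g :. f) :. r = p :. (Ide B hh*:(g :. f))"
proof -
  have "beq B [hh, V, W, P] [r, s, p, f, g]
    (($$4 ;; $$3) ;; $$0)
    ($$2 ;; Id $0##($$4 ;; $$3))"
    by (rule braid_diagram[of "[($0**$1, $1), ($0**$2, $2), ($0**$3, $3), ($1, $2), ($2, $3)]"
  "[($$4 ;; $$1, $$2 ;; Id $0##$$4), ($$3 ;; $$0, $$1 ;; Id $0##$$3)]" _ _ "[RF 0 0 1, RF 1 0 0]"],
  code_simp, simp add: a hopf_hom, simp only: diag_simps, (intro conjI TrueI e hopf_rel; simp add: a hopf_hom))
  then show ?thesis by simp
qed

section \<open>The rigid monoidal category of modules\<close>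

lemma Hmod_simps:
  "Ob HM = {(V, r). is_hopf_module B H V r}"
  "f \<in> Hom HM (V, r) (W, s) \<longleftrightarrow> f \<in> Hom B V W \<and> f :. r = s :. (Ide B hh*:f)"
  "Ide HM (V, r) = Ide B V" "Cmp HM = Cmp B" "Zer HM (V, r) (W, s) = Zer B V W"
  "Add HM = Add B" "Smul HM = Smul B"
  "Ten HM (V, r) (W, s) = (V*.W, tensor_action B H V r W s)" "Tar HM = Tar B" "Uni HM = (\<one>, triv \<one>)"
  "Asc HM (Q, p) (V, r) (W, s) = Asc B Q V W" "Lun HM (V, r) = Lun B V" "Run HM (V, r) = Run B V"
  "ldual HM (V, r) = (ldual B V, ldual_action B H V r)" "ev_left HM (V, r) = ev_left B V"
  "coev_left HM (V, r) = coev_left B V" "rdual HM (V, r) = (rdual B V, rdual_action B H V r)"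
  "ev_right HM (V, r) = ev_right B V" "coev_right HM (V, r) = coev_right B V"
  by (simp_all add: Hmod_def)

lemma linear_category_Hmod: "linear_category HM"
proof (rule linear_category_over[where V = fst, OF linear_category_axioms])
  show "fst Z \<in> Ob B" if "Z \<in> Ob HM" for Z using that hmodD(1) by (auto simp: Hmod_simps)
  show "f \<in> Hom B (fst X) (fst Y)" if "X \<in> Ob HM" "Y \<in> Ob HM" "f \<in> Hom HM X Y" for X Y f
    using that by (cases X; cases Y) (simp add: Hmod_simps)
  show "Ide HM X = Ide B (fst X)" if "X \<in> Ob HM" for X by (cases X) (simp add: Hmod_simps)
  show "Zer HM X Y = Zer B (fst X) (fst Y)" if "X \<in> Ob HM" "Y \<in> Ob HM" for X Y
    by (cases X; cases Y) (simp add: Hmod_simps)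
  show "Ide B (fst Z) \<in> Hom HM Z Z" if z: "Z \<in> Ob HM" for Z
  proof -
    obtain V r where Z: "Z = (V, r)" and r: "is_hopf_module B H V r" using z by (auto simp: Hmod_simps)
    show ?thesis using hmodD(1,2)[OF r] ide_left[of "hh*.V" V r] ide_right[of "hh*.V" V r]
      by (simp add: Z Hmod_simps ide_hom tar_ide carr_ob)
  qed
  fix Z W assume ZW: "Z \<in> Ob HM" "W \<in> Ob HM"
  then obtain V r U s where Z: "Z = (V, r)" and r: "is_hopf_module B H V r" and W: "W = (U, s)" and s: "is_hopf_module B H U s"
    by (auto simp: Hmod_simps)
  note rs = hmodD(1,2)[OF r] hmodD(1,2)[OF s] carr_ob
  show "Zer B (fst Z) (fst W) \<in> Hom HM Z W"
    using rs cmp_zer_left[of "hh*.V" V U r] cmp_zer_right[of "hh*.V" "hh*.U" U s]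
    by (simp add: Z W Hmod_simps zer_hom tar_zer_ide)
  show "Add B f g \<in> Hom HM Z W" if fg: "f \<in> Hom HM Z W" "g \<in> Hom HM Z W" for f g
    using fg rs cmp_add_left[of "hh*.V" V U r f g] cmp_add_right[of "hh*.V" "hh*.U" U "Ide B hh*:f" "Ide B hh*:g" s]
      tar_add_right[of "hh" "hh" V U "Ide B hh" f g]
    by (simp add: Z W Hmod_simps ide_hom tar_hom_ide add_hom)
  show "Smul B c f \<in> Hom HM Z W" if fg: "f \<in> Hom HM Z W" for f c
    using fg rs cmp_smul_left[of "hh*.V" V U r f c] cmp_smul_right[of "hh*.V" "hh*.U" U "Ide B hh*:f" s c]
      tar_smul_right[of "hh" "hh" V U "Ide B hh" f c]
    by (simp add: Z W Hmod_simps ide_hom tar_hom_ide smul_hom)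
  fix Y f g assume Y: "Y \<in> Ob HM" and fg: "f \<in> Hom HM Z W" "g \<in> Hom HM W Y"
  then obtain P p where Y: "Y = (P, p)" and p: "is_hopf_module B H P p" by (auto simp: Hmod_simps)
  show "g :. f \<in> Hom HM Z Y"
    using fg rs hmodD(1,2)[OF p] cmp_linear[of V U P r s p f g] cmp_hom[of V U P f g] by (simp add: Z W Y Hmod_simps)
qed (simp_all add: Hmod_simps)

lemma Hmod_inverse:
  assumes "is_hopf_module B H V r" "is_hopf_module B H W s" "f \<in> Hom HM (V, r) (W, s)" "inverse_pair B V W f g"
  shows "inverse_pair HM (V, r) (W, s) f g"
  using assms inverse_linear[of V W r s f g] hmodD(1,2)[OF assms(1)] hmodD(1,2)[OF assms(2)]
  by (simp add: inverse_pair_def Hmod_simps)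

text \<open>\<open>Inv\<close> is a description relative to the hom-sets of its category. Inverses
  in \<open>Hmod\<close> have to be identified with those in \<open>B\<close> before formulas over
  the two categories can be compared.\<close>

lemma Hmod_Inv:
  assumes "is_hopf_module B H V r" "is_hopf_module B H W s" "f \<in> Hom HM (V, r) (W, s)" "is_iso B V W f"
  shows "is_iso HM (V, r) (W, s) f" "Inv HM (V, r) (W, s) f = Inv B V W f"
proof -
  interpret L: linear_category "HM" by (rule linear_category_Hmod)
  have i: "inverse_pair HM (V, r) (W, s) f (Inv B V W f)"
    using inverse_pair_Inv[OF assms(4)] hmodD(1) assms by (intro Hmod_inverse) auto
  then show "is_iso HM (V, r) (W, s) f" by (auto simp: is_iso_def)
  show "Inv HM (V, r) (W, s) f = Inv B V W f"
    using i assms by (intro L.Inv_eqI) (simp_all add: Hmod_simps)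
qed

lemma str_hom: "\<lbrakk>X \<in> Ob B; Y \<in> Ob B; Z \<in> Ob B\<rbrakk> \<Longrightarrow> Asc B X Y Z \<in> Hom B ((X*.Y)*.Z) (X*.(Y*.Z))"
  "X \<in> Ob B \<Longrightarrow> Lun B X \<in> Hom B (\<one>*.X) X" "X \<in> Ob B \<Longrightarrow> Run B X \<in> Hom B (X*.\<one>) X"
  using arr_asc(1,3,5) by (simp_all add: arr_def del: arr_ob arr_asc)

lemma Hmod_str:
  assumes q: "is_hopf_module B H Q p" and r: "is_hopf_module B H V r" and s: "is_hopf_module B H W s"
  shows "Asc B Q V W \<in> Hom HM ((Q*.V)*.W, tensor_action B H (Q*.V) (tensor_action B H Q p V r) W s)
      (Q*.(V*.W), tensor_action B H Q p (V*.W) (tensor_action B H V r W s))"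
    "Lun B V \<in> Hom HM (\<one>*.V, tensor_action B H \<one> (triv \<one>) V r) (V, r)"
    "Run B V \<in> Hom HM (V*.\<one>, tensor_action B H V r \<one> (triv \<one>)) (V, r)"
  using asc_linear[OF hmodD(1)[OF q] hmodD(1)[OF r] hmodD(1)[OF s] hmodD(2)[OF q] hmodD(2)[OF r] hmodD(2)[OF s]]
    lun_linear[OF hmodD(1,2)[OF r]] run_linear[OF hmodD(1,2)[OF r]] hmodD(1)[OF q] hmodD(1)[OF r] hmodD(1)[OF s]
  by (simp_all add: Hmod_simps str_hom)

lemma Hmod_str_inv:
  assumes q: "is_hopf_module B H Q p" and r: "is_hopf_module B H V r" and s: "is_hopf_module B H W s"
  shows "is_iso HM ((Q*.V)*.W, tensor_action B H (Q*.V) (tensor_action B H Q p V r) W s)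
      (Q*.(V*.W), tensor_action B H Q p (V*.W) (tensor_action B H V r W s)) (Asc B Q V W)"
    "is_iso HM (\<one>*.V, tensor_action B H \<one> (triv \<one>) V r) (V, r) (Lun B V)"
    "is_iso HM (V*.\<one>, tensor_action B H V r \<one> (triv \<one>)) (V, r) (Run B V)"
    "AscInv HM (Q, p) (V, r) (W, s) = AscInv B Q V W" "LunInv HM (V, r) = LunInv B V" "RunInv HM (V, r) = RunInv B V"
  using Hmod_Inv[OF _ _ Hmod_str(1)[OF assms]] Hmod_Inv[OF _ _ Hmod_str(2)[OF assms]] Hmod_Inv[OF _ _ Hmod_str(3)[OF assms]]
    asc_iso[of Q V W] lun_iso[of V] run_iso[of V] assms hmodD(1) triv_module[OF uni_ob]
  by (simp_all add: tensor_module AscInv_def LunInv_def RunInv_def Hmod_simps)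

lemma Hmod_unit_inv:
  assumes r: "is_hopf_module B H V r"
  shows "is_iso HM (\<one>*.V, tensor_action B H \<one> (triv \<one>) V r) (V, r) (Lun B V)"
    "is_iso HM (V*.\<one>, tensor_action B H V r \<one> (triv \<one>)) (V, r) (Run B V)"
    "LunInv HM (V, r) = LunInv B V" "RunInv HM (V, r) = RunInv B V"
  using Hmod_str_inv[OF r r r] by simp_all

text \<open>All structure morphisms, evaluations and coevaluations are those of \<open>B\<close>;
  their linearity is the new content, and the equations are inherited.\<close>

theorem rigid_monoidal_category_Hmod: "rigid_monoidal_category HM"
proof (intro rigid_monoidal_category.intro linear_monoidal_category.intro linear_category_Hmod
    linear_monoidal_category_axioms.intro rigid_monoidal_category_axioms.intro)
qed (auto simp: Hmod_simps tensor_module triv_module[OF uni_ob] ldual_module rdual_module Hmod_str_inv(1,4) Hmod_unit_inv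
      hmodD(1) tar_ide pentagon triangle ldual_zigzag ldual_zagzig rdual_zigzag rdual_zagzig lev_hom lcoev_hom rev_hom rcoev_hom
      ev_left_linear coev_left_linear ev_right_linear coev_right_linear,
    (blast intro: hmodD(1,2) tar_hom tar_linear tar_cmp tar_add_left tar_add_right tar_smul_left tar_smul_right asc_nat lun_nat run_nat)+)

end

section \<open>\<open>HH(B)\<close> as a stable braided module\<close>

context linear_category
begin

lemma is_isoD: "\<lbrakk>is_iso C X Y f; X \<in> Ob C; Y \<in> Ob C\<rbrakk> \<Longrightarrow> f \<in> Hom C X Y \<and> Inv C X Y f \<in> Hom C Y X \<and> f \<cdot> Inv C X Y f = Ide C Y \<and> Inv C X Y f \<cdot> f = Ide C X"
  using inverse_pair_Inv by (auto simp: inverse_pair_def)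

lemma is_iso_Inv: "\<lbrakk>is_iso C X Y f; X \<in> Ob C; Y \<in> Ob C\<rbrakk> \<Longrightarrow> is_iso C Y X (Inv C X Y f)"
  using is_isoD[of X Y f] by (auto simp: is_iso_def inverse_pair_def)

lemma is_iso_cmp:
  assumes "is_iso C X Y f" "is_iso C Y Z g" "X \<in> Ob C" "Y \<in> Ob C" "Z \<in> Ob C"
  shows "is_iso C X Z (g \<cdot> f)"
proof -
  let ?f = "Inv C X Y f" and ?g = "Inv C Y Z g"
  note f = is_isoD[OF assms(1,3,4)] and g = is_isoD[OF assms(2,4,5)]
  have "(?f \<cdot> ?g) \<cdot> (g \<cdot> f) = ?f \<cdot> ((?g \<cdot> g) \<cdot> f)"
    using f g assms cmp_assoc[of X Z Y X "g \<cdot> f" ?g ?f] cmp_assoc[of X Y Z Y f g ?g] cmp_hom[of X Y Z f g] by simp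
  moreover have "(g \<cdot> f) \<cdot> (?f \<cdot> ?g) = g \<cdot> ((f \<cdot> ?f) \<cdot> ?g)"
    using f g assms cmp_assoc[of Z X Y Z "?f \<cdot> ?g" f g] cmp_assoc[of Z Y X Y ?g ?f f] cmp_hom[of Z Y X ?g ?f] by simp
  ultimately have "inverse_pair C X Z (g \<cdot> f) (?f \<cdot> ?g)"
    using f g assms by (simp add: inverse_pair_def cmp_hom ide_left)
  then show ?thesis by (auto simp: is_iso_def)
qed

end

context rigid_monoidal_category
begin

lemma HH_Inv:
  assumes t: "half_braiding D M t" and u: "half_braiding D N u" and f: "f \<in> Hom (HH D) (M, t) (N, u)" and i: "is_iso D M N f"
  shows "is_iso (HH D) (M, t) (N, u) f" "Inv (HH D) (M, t) (N, u) f = Inv D M N f"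
proof -
  interpret L: linear_category "HH D" by (rule linear_category_HH)
  have p: "inverse_pair D M N f (Inv D M N f)" using inverse_pair_Inv[OF i] half_braidingD(1)[OF t] half_braidingD(1)[OF u] by simp
  then have "inverse_pair (HH D) (M, t) (N, u) f (Inv D M N f)"
    using HH_inverse[OF t u f p] f by (simp add: inverse_pair_def HH_simps)
  then show "is_iso (HH D) (M, t) (N, u) f" "Inv (HH D) (M, t) (N, u) f = Inv D M N f"
    using t u by (auto simp: is_iso_def HH_simps intro!: L.Inv_eqI)
qed

text \<open>The twist may be computed with any left dual: \<open>k\<close> compares the chosen one
  with \<open>P\<close> and passes through \<open>G\<close> by naturality.\<close>

lemma acttwist_dual:
  assumes G: "pairing_action D M G" and p: "P \<in> Ob D" "e \<in> Hom D (P*.M) \<one>" "c \<in> Hom D \<one> (M*.P)"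
    and z: "Run D M :. Ide D M*:e :. Asc D M P M :. c*:Ide D M :. LunInv D M = Ide D M"
  shows "G P M e :. Ide D M*:c :. RunInv D M = acttwist M G"
proof -
  note a = p pairing_actionD(1)[OF G]
  obtain k where k: "k \<in> Hom D (ldual D M) P" "e :. (k*:Ide D M) = ev_left D M" "(Ide D M*:k) :. coev_left D M = c"
  proof
    let ?k = "Lun D P :. ev_left D M*:Ide D P :. AscInv D (ldual D M) M P :. Ide D (ldual D M)*:c :. RunInv D (ldual D M)"
  have "dhom D [M, P, ldual D M] [ev_left D M, c]
    (Lu $1 ;; $$0##Id $1 ;; Ai $2 $0 $1 ;; Id $2##$$1 ;; Ri $2) ($2) ($1)"
    by (rule diagram_hom[of "[($2**$0, Ue), (Ue, $0**$1)]"], code_simp, simp add: a rigid_homs)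
    then show "?k \<in> Hom D (ldual D M) P" by simp
  have "deq D [M, P, ldual D M] [ev_left D M, e, c]
    ($$1 ;; (Lu $1 ;; $$0##Id $1 ;; Ai $2 $0 $1 ;; Id $2##$$2 ;; Ri $2)##Id $0)
    ($$0)"
    by (rule diagram[of "[($2**$0, Ue), ($1**$0, Ue), (Ue, $0**$1)]"
  "[zr $0 $1 $$1 $$2]" _ _ "[SL 1, RF 0 1 0]"],
  code_simp, simp add: a rigid_homs, simp only: diag_simps, (intro conjI TrueI z zigzags; simp add: a rigid_homs))
    then show "e :. (?k*:Ide D M) = ev_left D M" by simp
  have "deq D [M, P, ldual D M] [ev_left D M, coev_left D M, c]
    (Id $0##(Lu $1 ;; $$0##Id $1 ;; Ai $2 $0 $1 ;; Id $2##$$2 ;; Ri $2) ;; $$1)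
    ($$2)"
    by (rule diagram[of "[($2**$0, Ue), (Ue, $0**$2), (Ue, $0**$1)]"
  "[zr $0 $2 $$0 $$1]" _ _ "[SL 0, RF 1 0 0]"],
  code_simp, simp add: a rigid_homs, simp only: diag_simps, (intro conjI TrueI z zigzags; simp add: a rigid_homs))
    then show "(Ide D M*:?k) :. coev_left D M = c" by simp
  qed
  have n: "G P M e :. Ide D M*:Ide D M*:k = G (ldual D M) M (ev_left D M) :. Ide D M*:Ide D M*:Ide D (ldual D M)"
    by (rule pairing_action_eq[OF G, where X' = "ldual D M" and Y' = M])
      (simp_all add: k(1,2) a ide_hom ldual_ob lev_hom tar_ide ide_right[of "ldual D M*.M" \<one>] ten_ob uni_ob)
  note hs = a k(1) pairing_actionD(2)[OF G] rigid_homs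
  have "deq D [M, P, ldual D M] [coev_left D M, c, k, G (ldual D M) M (ev_left D M), G P M e]
    ($$4 ;; Id $0##$$1 ;; Ri $0)
    ($$3 ;; Id $0##$$0 ;; Ri $0)"
    by (rule diagram[of "[(Ue, $0**$2), (Ue, $0**$1), ($2, $1), ($0**$0**$2, $0), ($0**$0**$1, $0)]"
  "[($$4 ;; Id $0##Id $0##$$2, $$3 ;; Id $0##Id $0##Id $2), (Id $0##$$2 ;; $$0, $$1)]" _ _ "[RB 0 1 1, RF 1 0 0]"],
  code_simp, simp add: hs, simp only: diag_simps, (intro conjI TrueI n z k(3) zigzags; simp add: hs))
  then show ?thesis by (simp add: acttwist_def)
qed

end

context rigid_braided_category
begin

abbreviation MM :: "('o, 'a, 'o \<times> ('o \<Rightarrow> 'a), 'a, 'k) stable_module" where "MM \<equiv> HH_module B"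
abbreviation (input) actM (infixr "|>" 72) where "X |> M \<equiv> X \<rhd>\<^bsub>MM\<^esub> M"
abbreviation (input) aarM (infixr "|*" 72) where "f |* u \<equiv> f \<bullet>\<^bsub>MM\<^esub> u"
abbreviation (input) cmpM (infixr "|." 55) where "u |. v \<equiv> u \<cdot>\<^bsub>MM\<^esub> v"

text \<open>The structure of \<open>HH_act\<close> in terms of pairings: \<open>Y\<close> passes
  \<open>A\<close> along the inverse braiding, then \<open>G\<close> acts on \<open>M\<close>. The
  match is \<open>HH_act_acthalf\<close>.\<close>

definition gact :: "'o \<Rightarrow> 'o \<Rightarrow> ('o \<Rightarrow> 'o \<Rightarrow> 'a \<Rightarrow> 'a) \<Rightarrow> 'o \<Rightarrow> 'o \<Rightarrow> 'a \<Rightarrow> 'a" where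
  "gact A M G X Y e = Ide B A*:G X Y e :. Asc B A Y (M*.X) :. BraidInv B Y A*:Ide B (M*.X) :. AscInv B Y A (M*.X) :. Ide B Y*:Asc B A M X"

lemma gact_hom:
  assumes G: "pairing_action B M G" and a: "A \<in> Ob B" "X \<in> Ob B" "Y \<in> Ob B" "e \<in> Hom B (X*.Y) \<one>"
  shows "gact A M G X Y e \<in> Hom B (Y*.((A*.M)*.X)) (A*.M)"
proof -
  have "bhom B [A, M, X, Y] [G X Y e]
    (gad $0 $1 $2 $3 $$0) ($3**($0**$1)**$2) ($0**$1)"
    by (rule braid_diagram_hom[of "[($3**$1**$2, $1)]"], code_simp, simp add: a pairing_actionD(1,2)[OF G] ev_sharp_hom rigid_homs)
  then show ?thesis by (simp add: gact_def)
qed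

text \<open>The crossing with \<open>A\<close> is natural in \<open>Y\<close> and splits over
  \<open>Y' \<otimes> Y\<close>, so each law reduces to the one for \<open>G\<close>.\<close>

lemma pairing_action_gact:
  assumes G: "pairing_action B M G" and A: "A \<in> Ob B"
  shows "pairing_action B (A*.M) (gact A M G)"
  unfolding pairing_action_def
proof (intro conjI ballI)
  show "A*.M \<in> Ob B" using A pairing_actionD(1)[OF G] by (simp add: ten_ob)
  show "gact A M G X Y e \<in> Hom B (Y*.((A*.M)*.X)) (A*.M)" if "X \<in> Ob B" "Y \<in> Ob B" "e \<in> Hom B (X*.Y) \<one>" for X Y e
    by (rule gact_hom[OF G A that])
  show "gact A M G \<one> \<one> (Lun B \<one>) = Lun B (A*.M) :. (Ide B \<one>*:Run B (A*.M))"
  proof -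
    note hs = A Lun_hom pairing_actionD(1,2)[OF G] ev_sharp_hom rigid_homs
    have "beq B [A, M] [G \<one> \<one> (Lun B \<one>)]
      (gad $0 $1 Ue Ue $$0)
      (Lu ($0**$1) ;; Id Ue##Ru ($0**$1))"
      by (rule braid_diagram[of "[(Ue**$1**Ue, $1)]"
  "[($$0, Lu $1 ;; Id Ue##Ru $1)]" _ _ "[RF 0 1 0]"],
  code_simp, simp add: hs, simp only: diag_simps, (intro conjI TrueI pairing_actionD(4)[OF G]; simp add: hs))
    then show ?thesis by (simp add: gact_def)
  qed
  fix X Y X' Y' e assume a: "X \<in> Ob B" "Y \<in> Ob B" "X' \<in> Ob B" "Y' \<in> Ob B" "e \<in> Hom B (X*.Y) \<one>"
  show "gact A M G X' Y' (e :. (f*:k)) = gact A M G X Y e :. (k*:(Ide B (A*.M)*:f))" if b: "f \<in> Hom B X' X" "k \<in> Hom B Y' Y" for f k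
  proof -
    have ek: "e :. (f*:k) \<in> Hom B (X'*.Y') \<one>" using a b cmp_hom[of "X'*.Y'" "X*.Y" \<one> "f*:k" e] by (simp add: tar_hom ten_ob uni_ob)
    note b = b A
    note hs = a b ek pairing_actionD(1,2)[OF G] ev_sharp_hom rigid_homs
    have "beq B [A, M, X, Y, X', Y'] [G X Y e, G X' Y' (e :. (f*:k)), f, k]
      (gad $0 $1 $4 $5 $$1)
      (gad $0 $1 $2 $3 $$0 ;; $$3##Id ($0**$1)##$$2)"
      by (rule braid_diagram[of "[($3**$1**$2, $1), ($5**$1**$4, $1), ($4, $2), ($5, $3)]"
  "[($$1, $$0 ;; $$3##Id $1##$$2)]" _ _ "[RF 1 1 0, NB 0 0 False False 0 (Ge 3) True, SL 1]"],
  code_simp, simp add: hs, simp only: diag_simps, (intro conjI TrueI pairing_actionD(3)[OF G]; simp add: hs))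
    then show ?thesis by (simp add: gact_def)
  qed
  show "gact A M G (X*.X') (Y'*.Y) (nest B X X' Y' Y e e') = gact A M G X' Y' e' :. (Ide B Y'*:(gact A M G X Y e*:Ide B X')) :. (Ide B Y'*:AscInv B Y ((A*.M)*.X) X') :. (Ide B Y'*:(Ide B Y*:AscInv B (A*.M) X X')) :. Asc B Y' Y ((A*.M)*.(X*.X'))" if e: "e' \<in> Hom B (X'*.Y') \<one>" for e'
  proof -
    note b = e A
    note hs = a b nest_hom pairing_actionD(1,2)[OF G] ev_sharp_hom rigid_homs
    have "beq B [A, M, X, Y, X', Y'] [G X Y e, G X' Y' e', G (X*.X') (Y'*.Y) (nest B X X' Y' Y e e')]
      (gad $0 $1 ($2**$4) ($5**$3) $$2)
      (mud ($0**$1) $2 $3 $4 $5 (gad $0 $1 $2 $3 $$0) (gad $0 $1 $4 $5 $$1))"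
      by (rule braid_diagram[of "[($3**$1**$2, $1), ($5**$1**$4, $1), (($5**$3)**$1**$2**$4, $1)]"
  "[($$2, mud $1 $2 $3 $4 $5 $$0 $$1)]" _ _ "[RF 2 1 0, SL 1]"],
  code_simp, simp add: hs, simp only: diag_simps, (intro conjI TrueI pairing_actionD(5)[OF G]; simp add: hs))
    then show ?thesis by (simp add: gact_def)
  qed
qed

text \<open>\<open>HH_act\<close> uses the positive crossing of \<open>A\<close> with
  \<open>sharp X\<close>, whereas \<open>gact\<close> uses the inverse crossing with
  \<open>rdual X\<close>; rotating the strand along the coevaluation turns one into the other. It
  follows that \<open>HH_act\<close> takes values in \<open>HH\<close>.\<close>

lemma HH_act_acthalf:
  assumes t: "half_braiding B M t" and A: "A \<in> Ob B"
  shows "HH_act B A (M, t) = (A*.M, acthalf B (A*.M) (gact A M (pairact B (M, t))))"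
proof -
  have "acthalf B (A*.M) (gact A M (pairact B (M, t))) X
    = Asc B (sharp B X) A M :. Braid B A (sharp B X)*:Ide B M :. AscInv B A (sharp B X) M :. Ide B A*:t X :. Asc B A M X" if X: "X \<in> Ob B" for X
  proof -
    have r: "rcurry B X (rdual B X) (ev_right B X) = Ide B (rdual B X)"
      using rcurry_ev[of X "rdual B X" "Ide B (rdual B X)"] X
      by (simp add: rdual_ob ide_hom tar_ide ten_ob uni_ob ide_right[of "X*.rdual B X" \<one>] rev_hom)
    note hs = X A half_braidingD(1,3)[OF t] ev_sharp_hom rigid_homs
    have "beq B [A, M, X, rdual B X, sharp B X] [ev_right B (rdual B X), coev_right B (rdual B X), t X]
      (Id $4##gad $0 $1 $2 $3 (Lu $1 ;; $$0##Id $1 ;; Ai $3 $4 $1 ;; Id $3##$$2) ;; As $4 $3 (($0**$1)**$2) ;; $$1##Id (($0**$1)**$2) ;; Li (($0**$1)**$2))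
      (As $4 $0 $1 ;; Br $0 $4##Id $1 ;; Ai $0 $4 $1 ;; Id $0##$$2 ;; As $0 $1 $2)"
      by (rule braid_diagram[of "[($3**$4, Ue), (Ue, $4**$3), ($1**$2, $4**$1)]"
  "[zr $4 $3 $$0 $$1]" _ _ "[NB 3 1 True True 0 (Ge 0) False, SR 2, XX 1 1 False 3 0 True, SL 0, SL 1, RF 2 0 0]"],
  code_simp, simp add: hs, simp only: diag_simps, (intro conjI TrueI sharp_zigzag; simp add: hs))
    then show ?thesis by (simp add: acthalf_def gact_def pairact_def r X)
  qed
  then show ?thesis by (auto simp: HH_act_def acthalf_def)
qed

definition hact :: "'o \<Rightarrow> 'o \<Rightarrow> ('o \<Rightarrow> 'a) \<Rightarrow> 'o \<Rightarrow> 'a" where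
  "hact A M t = snd (HH_act B A (M, t))"

lemma HH_act_half_braiding:
  assumes t: "half_braiding B M t" and A: "A \<in> Ob B"
  shows "half_braiding B (A*.M) (hact A M t)"
    "\<lbrakk>X \<in> Ob B; Y \<in> Ob B; e \<in> Hom B (X*.Y) \<one>\<rbrakk>
      \<Longrightarrow> pairact B (A*.M, hact A M t) X Y e = gact A M (pairact B (M, t)) X Y e"
    "HH_act B A (M, t) = (A*.M, hact A M t)"
  using half_braiding_acthalf pairact_acthalf pairing_action_gact[OF pairing_action_pairact[OF t] A]
  unfolding HH_act_acthalf[OF t A] hact_def by simp_all

lemma HH_tar_hom:
  assumes t: "half_braiding B M t" and s: "half_braiding B N s" and A: "A \<in> Ob B" "A' \<in> Ob B" "f \<in> Hom B A A'"
    and u: "u \<in> Hom (HH B) (M, t) (N, s)"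
  shows "f*:u \<in> Hom (HH B) (HH_act B A (M, t)) (HH_act B A' (N, s))"
proof -
  note a = A half_braidingD(1)[OF t] half_braidingD(1)[OF s]
  have uh: "u \<in> Hom B M N" using u by (simp add: HH_simps)
  show ?thesis unfolding HH_act_half_braiding(3)[OF t A(1)] HH_act_half_braiding(3)[OF s A(2)]
  proof (rule HH_HomI[OF HH_act_half_braiding(1)[OF t A(1)] HH_act_half_braiding(1)[OF s A(2)]])
    show "f*:u \<in> Hom B (A*.M) (A'*.N)" using a uh by (simp add: tar_hom)
    fix X assume X: "X \<in> Ob B"
    note hs = X a uh pairact_hom[OF t] pairact_hom[OF s] ev_sharp_hom rigid_homs
    have "beq B [A, A', M, N, X, rdual B X] [pairact B (M, t) X (rdual B X) (ev_right B X), pairact B (N, s) X (rdual B X) (ev_right B X), f, u]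
      ($$2##$$3 ;; gad $0 $2 $4 $5 $$0)
      (gad $1 $3 $4 $5 $$1 ;; Id $5##($$2##$$3)##Id $4)"
      by (rule braid_diagram[of "[($5**$2**$4, $2), ($5**$3**$4, $3), ($0, $1), ($2, $3)]"
  "[($$3 ;; $$0, $$1 ;; Id $5##$$3##Id $4)]" _ _ "[SR 1, NB 0 0 True False 5 (Ge 2) True, RF 2 1 0, SL 1]"],
  code_simp, simp add: hs, simp only: diag_simps, (intro conjI TrueI HH_Hom_pairact[OF t s u]; simp add: hs))
    then show "(f*:u) :. pairact B (A*.M, hact A M t) X (rdual B X) (ev_right B X)
      = pairact B (A'*.N, hact A' N s) X (rdual B X) (ev_right B X) :. (Ide B (rdual B X)*:((f*:u)*:Ide B X))"
      by (simp add: HH_act_half_braiding(2)[OF t A(1)] HH_act_half_braiding(2)[OF s A(2)] X gact_def rdual_ob rev_hom)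
  qed
qed

lemma HH_asc_hom:
  assumes t: "half_braiding B M t" and A: "A \<in> Ob B" "A' \<in> Ob B"
  shows "Asc B A A' M \<in> Hom (HH B) (HH_act B (A*.A') (M, t)) (HH_act B A (HH_act B A' (M, t)))"
proof -
  note a = A half_braidingD(1)[OF t]
  let ?s = "hact A' M t"
  have AA: "A*.A' \<in> Ob B" using A by (simp add: ten_ob)
  note s = HH_act_half_braiding(1)[OF t A(2)]
  show ?thesis unfolding HH_act_half_braiding(3)[OF t AA] HH_act_half_braiding(3)[OF t A(2)] HH_act_half_braiding(3)[OF s A(1)]
  proof (rule HH_HomI[OF HH_act_half_braiding(1)[OF t AA] HH_act_half_braiding(1)[OF s A(1)]])
    show "Asc B A A' M \<in> Hom B ((A*.A')*.M) (A*.(A'*.M))" using a arr_asc(1)[of A A' M] by (simp add: arr_def del: arr_ob arr_asc)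
    fix X assume X: "X \<in> Ob B"
    have "beq B [A, A', M, X, rdual B X] [pairact B (M, t) X (rdual B X) (ev_right B X)]
      (As $0 $1 $2 ;; gad ($0**$1) $2 $3 $4 $$0)
      (gad $0 ($1**$2) $3 $4 (gad $1 $2 $3 $4 $$0) ;; Id $4##As $0 $1 $2##Id $3)"
      by (rule braid_diagram[of "[($4**$2**$3, $2)]"
  "[]" _ _ "[]"],
  code_simp, simp add: X a pairact_hom[OF t] ev_sharp_hom rigid_homs, simp)
    then show "Asc B A A' M :. pairact B ((A*.A')*.M, hact (A*.A') M t) X (rdual B X) (ev_right B X)
      = pairact B (A*.(A'*.M), hact A (A'*.M) ?s) X (rdual B X) (ev_right B X) :. (Ide B (rdual B X)*:(Asc B A A' M*:Ide B X))"
      by (simp add: HH_act_half_braiding(2)[OF t AA] HH_act_half_braiding(2)[OF s A(1)] HH_act_half_braiding(2)[OF t A(2)] X gact_def rdual_ob rev_hom)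
  qed
qed

lemma HH_lun_hom:
  assumes t: "half_braiding B M t"
  shows "Lun B M \<in> Hom (HH B) (HH_act B \<one> (M, t)) (M, t)"
proof -
  note a = half_braidingD(1)[OF t]
  show ?thesis unfolding HH_act_half_braiding(3)[OF t uni_ob]
  proof (rule HH_HomI[OF HH_act_half_braiding(1)[OF t uni_ob] t])
    show "Lun B M \<in> Hom B (\<one>*.M) M" using a by (simp add: Lun_hom)
    fix X assume X: "X \<in> Ob B"
    have "beq B [M, X, rdual B X] [pairact B (M, t) X (rdual B X) (ev_right B X)]
      (Lu $0 ;; gad Ue $0 $1 $2 $$0)
      ($$0 ;; Id $2##Lu $0##Id $1)"
      by (rule braid_diagram[of "[($2**$0**$1, $0)]"
  "[]" _ _ "[]"],
  code_simp, simp add: X a pairact_hom[OF t] ev_sharp_hom rigid_homs, simp)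
    then show "Lun B M :. pairact B (\<one>*.M, hact \<one> M t) X (rdual B X) (ev_right B X)
      = pairact B (M, t) X (rdual B X) (ev_right B X) :. (Ide B (rdual B X)*:(Lun B M*:Ide B X))"
      by (simp add: HH_act_half_braiding(2)[OF t uni_ob] X gact_def rdual_ob rev_hom)
  qed
qed

text \<open>A closed form of \<open>E\<close> in which no twist and no inverse of a twist occurs:
  the original \<open>X\<close> is absorbed by \<open>G\<close>, and the \<open>X\<close> that
  remains is produced by the coevaluation. The identification with \<open>Bra\<close> is part of
  \<open>HH_module_Bra\<close>.\<close>

definition ebr :: "'o \<Rightarrow> 'o \<Rightarrow> ('o \<Rightarrow> 'o \<Rightarrow> 'a \<Rightarrow> 'a) \<Rightarrow> 'a" where
  "ebr X M G = Ide B X*:G (ldual B X) X (ev_left B X) :. Ide B X*:Asc B X M (ldual B X) :. Asc B X (X*.M) (ldual B X) :. BraidInv B (X*.M) X*:Ide B (ldual B X) :. AscInv B (X*.M) X (ldual B X) :. Ide B (X*.M)*:coev_left B X :. RunInv B (X*.M)"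

lemma ebr_hom:
  assumes G: "pairing_action B M G" and X: "X \<in> Ob B"
  shows "ebr X M G \<in> Hom B (X*.M) (X*.M)"
proof -
  have "bhom B [X, M, ldual B X] [G (ldual B X) X (ev_left B X), coev_left B X]
    (Id $0##$$0 ;; Id $0##As $0 $1 $2 ;; As $0 ($0**$1) $2 ;; Bi ($0**$1) $0##Id $2 ;; Ai ($0**$1) $0 $2 ;; Id ($0**$1)##$$1 ;; Ri ($0**$1)) ($0**$1) ($0**$1)"
    by (rule braid_diagram_hom[of "[($0**$1**$2, $1), (Ue, $0**$2)]"], code_simp, simp add: X pairing_actionD(1,2)[OF G] ev_sharp_hom rigid_homs)
  then show ?thesis by (simp add: ebr_def)
qed

text \<open>The twist of \<open>X \<otimes> M\<close> is computed with the left dual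
  \<open>ldual M \<otimes> ldual X\<close>. Its evaluation is nested, so the action splits into that
  of \<open>ev_left M\<close>, giving the twist of \<open>M\<close>, and that of
  \<open>ev_left X\<close>, giving \<open>ebr\<close>.\<close>

lemma acttwist_gact:
  assumes G: "pairing_action B M G" and X: "X \<in> Ob B"
  shows "acttwist (X*.M) (gact X M G) = ebr X M G :. (Ide B X*:acttwist M G)"
proof -
  note a = X pairing_actionD(1)[OF G]
  let ?n = "nest B (ldual B M) (ldual B X) X M (ev_left B M) (ev_left B X)" and ?c = "AscInv B X M (ldual B M*.ldual B X) :. Ide B X*:Asc B M (ldual B M) (ldual B X) :. Ide B X*:coev_left B M*:Ide B (ldual B X) :. Ide B X*:LunInv B (ldual B X) :. coev_left B X"
  have "beq B [X, M, ldual B X, ldual B M] [coev_left B X, ev_left B X, coev_left B M, ev_left B M]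
    (Ru ($0**$1) ;; Id ($0**$1)##ned $3 $2 $0 $1 $$3 $$1 ;; As ($0**$1) ($3**$2) ($0**$1) ;; (Ai $0 $1 ($3**$2) ;; Id $0##As $1 $3 $2 ;; Id $0##$$2##Id $2 ;; Id $0##Li $2 ;; $$0)##Id ($0**$1) ;; Li ($0**$1))
    (Id ($0**$1))"
    by (rule braid_diagram[of "[(Ue, $0**$2), ($2**$0, Ue), (Ue, $1**$3), ($3**$1, Ue)]"
  "[zr $0 $2 $$1 $$0, zr $1 $3 $$3 $$2]" _ _ "[SL 1, RF 0 0 0, RF 0 1 1]"],
  code_simp, simp add: a ev_sharp_hom rigid_homs, simp only: diag_simps, (intro conjI TrueI ldual_zigzag; simp add: a ev_sharp_hom rigid_homs))
  then have z: "Run B (X*.M) :. Ide B (X*.M)*:?n :. Asc B (X*.M) (ldual B M*.ldual B X) (X*.M) :. (?c)*:Ide B (X*.M) :. LunInv B (X*.M) = Ide B (X*.M)" by (simp add: nest_def)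
  have "bhom B [X, M, ldual B X, ldual B M] [coev_left B X, coev_left B M]
    (Ai $0 $1 ($3**$2) ;; Id $0##As $1 $3 $2 ;; Id $0##$$1##Id $2 ;; Id $0##Li $2 ;; $$0) (Ue) (($0**$1)**$3**$2)"
    by (rule braid_diagram_hom[of "[(Ue, $0**$2), (Ue, $1**$3)]"], code_simp, simp add: a ev_sharp_hom rigid_homs)
  then have c: "?c \<in> Hom B \<one> ((X*.M)*.(ldual B M*.ldual B X))" by simp
  have nh: "?n \<in> Hom B ((ldual B M*.ldual B X)*.(X*.M)) \<one>" by (rule nest_hom) (simp_all add: a ldual_ob lev_hom)
  have "acttwist (X*.M) (gact X M G) = gact X M G (ldual B M*.ldual B X) (X*.M) ?n :. (Ide B (X*.M)*:?c) :. RunInv B (X*.M)"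
    by (rule acttwist_dual[OF pairing_action_gact[OF G X] _ nh c z, symmetric]) (simp add: ten_ob ldual_ob a)
  note hs = a nh nest_hom pairing_actionD(2)[OF G] ev_sharp_hom rigid_homs
  have "beq B [X, M, ldual B X, ldual B M] [G (ldual B X) X (ev_left B X), coev_left B X, G (ldual B M) M (ev_left B M), coev_left B M, G (ldual B M*.ldual B X) (X*.M) (nest B (ldual B M) (ldual B X) X M (ev_left B M) (ev_left B X))]
    (gad $0 $1 ($3**$2) ($0**$1) $$4 ;; Id ($0**$1)##(Ai $0 $1 ($3**$2) ;; Id $0##As $1 $3 $2 ;; Id $0##$$3##Id $2 ;; Id $0##Li $2 ;; $$1) ;; Ri ($0**$1))
    ((Id $0##$$0 ;; Id $0##As $0 $1 $2 ;; As $0 ($0**$1) $2 ;; Bi ($0**$1) $0##Id $2 ;; Ai ($0**$1) $0 $2 ;; Id ($0**$1)##$$1 ;; Ri ($0**$1)) ;; Id $0##($$2 ;; Id $1##$$3 ;; Ri $1))"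
    by (rule braid_diagram[of "[($0**$1**$2, $1), (Ue, $0**$2), ($1**$1**$3, $1), (Ue, $1**$3), (($0**$1)**$1**$3**$2, $1)]"
  "[($$4, mud $1 $3 $1 $2 $0 $$2 $$0)]" _ _ "[SR 1, SR 2, RF 4 1 0, SL 2, SL 1, NB 1 2 False False 0 (Ge 3) True, SR 0, SL 5, NB 2 1 False False 0 (Ge 2) True, SR 1]"],
  code_simp, simp add: hs, simp only: diag_simps, (intro conjI TrueI pairing_actionD(5)[OF G] ldual_zigzag; simp add: hs))
  then have "gact X M G (ldual B M*.ldual B X) (X*.M) ?n :. (Ide B (X*.M)*:?c) :. RunInv B (X*.M) = ebr X M G :. (Ide B X*:acttwist M G)"
    by (simp add: gact_def ebr_def acttwist_def)
  with \<open>acttwist (X*.M) (gact X M G) = _\<close> show ?thesis by simp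
qed

lemma HH_HomD: "f \<in> Hom (HH B) (M, t) (N, s) \<Longrightarrow> f \<in> Hom B M N"
  by (simp add: HH_simps)

lemma HH_module_simps:
  "Ob MM = {(M, t). half_braiding B M t}" "Hom MM = Hom (HH B)" "Ide MM (M, t) = Ide B M"
  "Cmp MM = Cmp B" "Zer MM = Zer (HH B)" "Add MM = Add B" "Smul MM = Smul B"
  "Act MM = HH_act B" "Aar MM = Tar B" "Mas MM X Y (M, t) = Asc B X Y M"
  "Mun MM (M, t) = Lun B M" "Twi MM = HH_twist B"
  by (simp_all add: HH_module_def HH_simps)

text \<open>\<open>HH_module B\<close> and \<open>HH B\<close> are records of different types with
  the same category fields; this carries categorical notions from one to the other.\<close>

lemma HH_module_core:
  "linear_category MM \<longleftrightarrow> linear_category (HH B)"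
  "is_iso MM = is_iso (HH B)" "Inv MM = Inv (HH B)"
  "identity_automorphism MM = identity_automorphism (HH B)"
proof -
  have i: "inverse_pair MM = inverse_pair (HH B)"
    by (intro ext) (simp add: inverse_pair_def HH_module_def)
  show "linear_category MM \<longleftrightarrow> linear_category (HH B)"
    by (simp add: linear_category_def HH_module_def)
  show j: "is_iso MM = is_iso (HH B)" "Inv MM = Inv (HH B)"
    by (simp_all add: fun_eq_iff is_iso_def Inv_def i)
  show "identity_automorphism MM = identity_automorphism (HH B)"
    unfolding identity_automorphism_def j by (simp add: fun_eq_iff HH_module_def)
qed

lemma HH_twist_iso:
  assumes t: "half_braiding B M t"
  shows "HH_twist B (M, t) \<in> Hom B M M" "Inv B M M (HH_twist B (M, t)) \<in> Hom B M M"
    "HH_twist B (M, t) :. Inv B M M (HH_twist B (M, t)) = Ide B M"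
    "Inv B M M (HH_twist B (M, t)) :. HH_twist B (M, t) = Ide B M"
    "HH_twist B (M, t) \<in> Hom (HH B) (M, t) (M, t)" "Inv B M M (HH_twist B (M, t)) \<in> Hom (HH B) (M, t) (M, t)"
proof -
  note M = half_braidingD(1)[OF t]
  have p: "inverse_pair B M M (HH_twist B (M, t)) (Inv B M M (HH_twist B (M, t)))"
    using acttwist_inverse[OF pairing_action_pairact[OF t]] inverse_pair_Inv[OF _ M M]
    by (auto simp: HH_twist_acttwist[OF t] is_iso_def)
  then show "HH_twist B (M, t) \<in> Hom B M M" "Inv B M M (HH_twist B (M, t)) \<in> Hom B M M"
    "HH_twist B (M, t) :. Inv B M M (HH_twist B (M, t)) = Ide B M"
    "Inv B M M (HH_twist B (M, t)) :. HH_twist B (M, t) = Ide B M" by (simp_all add: inverse_pair_def)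
  show T: "HH_twist B (M, t) \<in> Hom (HH B) (M, t) (M, t)"
    using identity_automorphism_HH_twist t by (force simp: identity_automorphism_def HH_simps is_iso_def inverse_pair_def)
  show "Inv B M M (HH_twist B (M, t)) \<in> Hom (HH B) (M, t) (M, t)" by (rule HH_inverse[OF t t T p])
qed

lemma HH_twist_natural: "\<lbrakk>half_braiding B M t; half_braiding B N s; f \<in> Hom (HH B) (M, t) (N, s)\<rbrakk>
    \<Longrightarrow> HH_twist B (N, s) :. f = f :. HH_twist B (M, t)"
  using identity_automorphism_HH_twist by (force simp: identity_automorphism_def HH_simps)

lemma HH_twist_Inv_natural:
  assumes t: "half_braiding B M t" and s: "half_braiding B N s" and f: "f \<in> Hom (HH B) (M, t) (N, s)"
  shows "Inv B N N (HH_twist B (N, s)) :. f = f :. Inv B M M (HH_twist B (M, t))"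
proof -
  let ?T = "HH_twist B (M, t)" and ?S = "HH_twist B (N, s)"
  note M = half_braidingD(1)[OF t] and N = half_braidingD(1)[OF s] and T = HH_twist_iso[OF t] and S = HH_twist_iso[OF s]
    and f' = HH_HomD[OF f]
  have "Inv B N N ?S :. f = Inv B N N ?S :. (f :. (?T :. Inv B M M ?T))" using T f' M N by (simp add: ide_right)
  also have "\<dots> = Inv B N N ?S :. ((f :. ?T) :. Inv B M M ?T)" using T f' M N by (simp add: cmp_assoc)
  also have "\<dots> = Inv B N N ?S :. (?S :. (f :. Inv B M M ?T))"
    using T(1,2) S(1) f' M N by (simp add: HH_twist_natural[OF t s f, symmetric] cmp_assoc)
  also have "\<dots> = (Inv B N N ?S :. ?S) :. (f :. Inv B M M ?T)"
    by (rule cmp_assoc[symmetric, of M N N N]) (use T(1,2) S(1,2) f' M N in \<open>simp_all add: cmp_hom[of M M N]\<close>)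
  also have "\<dots> = f :. Inv B M M ?T" using T(2) S(4) f' M N cmp_hom[of M M N] by (simp add: ide_left)
  finally show ?thesis .
qed

text \<open>Twists are invertible, so \<open>acttwist_gact\<close> can be solved for
  \<open>E\<close>.\<close>

lemma HH_module_Bra:
  assumes t: "half_braiding B M t" and X: "X \<in> Ob B"
  shows "Inv (HH B) (HH_act B X (M, t)) (HH_act B X (M, t)) (Ide B X*:HH_twist B (M, t)) = Ide B X*:Inv B M M (HH_twist B (M, t))"
    "is_iso (HH B) (HH_act B X (M, t)) (HH_act B X (M, t)) (Ide B X*:HH_twist B (M, t))"
    "Bra MM X (M, t) = HH_twist B (X*.M, hact X M t) :. (Ide B X*:Inv B M M (HH_twist B (M, t)))"
    "Bra MM X (M, t) = ebr X M (pairact B (M, t))"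
proof -
  interpret L: linear_category "HH B" by (rule linear_category_HH)
  let ?T = "HH_twist B (M, t)" and ?G = "pairact B (M, t)"
  note T = HH_twist_iso[OF t] and M = half_braidingD(1)[OF t] and h = HH_act_half_braiding[OF t X]
  note G = pairing_action_pairact[OF t]
  have c: "(Ide B X*:Inv B M M ?T) :. (Ide B X*:?T) = Ide B (X*.M)" "(Ide B X*:?T) :. (Ide B X*:Inv B M M ?T) = Ide B (X*.M)"
    using tar_cmp[of X X X M M M "Ide B X" "Ide B X" ?T "Inv B M M ?T"] tar_cmp[of X X X M M M "Ide B X" "Ide B X" "Inv B M M ?T" ?T] T X M
    by (simp_all add: ide_hom ide_left tar_ide)
  have p: "inverse_pair (HH B) (HH_act B X (M, t)) (HH_act B X (M, t)) (Ide B X*:?T) (Ide B X*:Inv B M M ?T)"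
    using HH_tar_hom[OF t t X X ide_hom[OF X] T(5)] HH_tar_hom[OF t t X X ide_hom[OF X] T(6)] c
    unfolding inverse_pair_def by (simp add: h(3) HH_simps(3,4))
  then show i: "Inv (HH B) (HH_act B X (M, t)) (HH_act B X (M, t)) (Ide B X*:?T) = Ide B X*:Inv B M M ?T"
    "is_iso (HH B) (HH_act B X (M, t)) (HH_act B X (M, t)) (Ide B X*:?T)"
    using h(1) by (auto simp: h(3) HH_simps(1) is_iso_def intro!: L.Inv_eqI)
  then show b: "Bra MM X (M, t) = HH_twist B (X*.M, hact X M t) :. (Ide B X*:Inv B M M ?T)"
    by (simp add: HH_module_def HH_simps(4) h(3))
  have "HH_twist B (X*.M, hact X M t) = acttwist (X*.M) (gact X M ?G)"
    using X M by (simp add: HH_twist_acttwist[OF h(1)] acttwist_def h(2) ldual_ob lev_hom ten_ob)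
  also have "\<dots> = ebr X M ?G :. (Ide B X*:?T)" by (simp add: acttwist_gact[OF G X] HH_twist_acttwist[OF t])
  finally show "Bra MM X (M, t) = ebr X M ?G"
    using X M T c ebr_hom[OF G X] unfolding b
    by (simp add: cmp_assoc[of "X*.M" "X*.M" "X*.M" "X*.M"] ten_ob tar_hom_ide ide_right[of "X*.M" "X*.M"])
qed

lemma HH_asc_iso:
  assumes t: "half_braiding B M t" and a: "X \<in> Ob B" "Y \<in> Ob B"
  shows "is_iso (HH B) (HH_act B (X*.Y) (M, t)) (HH_act B X (HH_act B Y (M, t))) (Asc B X Y M)"
    "Inv (HH B) (HH_act B (X*.Y) (M, t)) (HH_act B X (HH_act B Y (M, t))) (Asc B X Y M) = AscInv B X Y M"
proof -
  note M = half_braidingD(1)[OF t] and h = HH_act_half_braiding(1,3)[OF t a(2)]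
  note k = HH_act_half_braiding(1,3)[OF t ten_ob[OF a]] HH_act_half_braiding(1,3)[OF h(1) a(1)]
  note i = HH_Inv[OF k(1,3) HH_asc_hom[OF t a, unfolded h(2) k(2) k(4)] asc_iso[OF a M]]
  then show "is_iso (HH B) (HH_act B (X*.Y) (M, t)) (HH_act B X (HH_act B Y (M, t))) (Asc B X Y M)"
    "Inv (HH B) (HH_act B (X*.Y) (M, t)) (HH_act B X (HH_act B Y (M, t))) (Asc B X Y M) = AscInv B X Y M"
    by (simp_all add: h(2) k(2,4) AscInv_def)
qed

lemma HH_lun_iso:
  assumes t: "half_braiding B M t"
  shows "is_iso (HH B) (HH_act B \<one> (M, t)) (M, t) (Lun B M)"
    "Inv (HH B) (HH_act B \<one> (M, t)) (M, t) (Lun B M) = LunInv B M"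
proof -
  note k = HH_act_half_braiding(1,3)[OF t uni_ob]
  note i = HH_Inv[OF k(1) t HH_lun_hom[OF t, unfolded k(2)] lun_iso[OF half_braidingD(1)[OF t]]]
  then show "is_iso (HH B) (HH_act B \<one> (M, t)) (M, t) (Lun B M)"
    "Inv (HH B) (HH_act B \<one> (M, t)) (M, t) (Lun B M) = LunInv B M"
    by (simp_all add: k(2) LunInv_def)
qed

lemma HH_module_inverses:
  assumes "half_braiding B M t"
  shows "\<lbrakk>X \<in> Ob B; Y \<in> Ob B\<rbrakk> \<Longrightarrow> MasInv MM B X Y (M, t) = AscInv B X Y M"
    "MunInv MM B (M, t) = LunInv B M"
  using HH_asc_iso[OF assms] HH_lun_iso[OF assms] by (simp_all add: MasInv_def MunInv_def HH_module_core HH_module_simps)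

lemma linear_module_category_HH_module: "linear_module_category MM B"
proof (intro linear_module_category.intro linear_module_category_axioms.intro)
  note d = half_braidingD(1) HH_HomD ten_ob and S = HH_module_simps and h = HH_act_half_braiding
  show "linear_category MM" using HH_module_core(1) linear_category_HH by simp
  show "linear_monoidal_category B" by (rule linear_monoidal_category_axioms)
  fix X Y X' Y' Z f f' M N P u u' c
  show "X |> M \<in> Ob MM" if "X \<in> Ob B" "M \<in> Ob MM"
    using that h by (auto simp: S)
  show "f |* u \<in> Hom MM (X |> M) (Y |> N)"
    if "X \<in> Ob B" "Y \<in> Ob B" "M \<in> Ob MM" "N \<in> Ob MM" "f \<in> Hom B X Y" "u \<in> Hom MM M N"
    using that HH_tar_hom by (cases M; cases N) (simp add: S)
  show "Ide B X |* Ide MM M = Ide MM (X |> M)"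
    if "X \<in> Ob B" "M \<in> Ob MM"
    using that d by (cases M) (simp add: S h(3) tar_ide)
  show "(f' :. f) |* (u' |. u) = (f' |* u') |. (f |* u)"
    if "X \<in> Ob B" "Y \<in> Ob B" "Z \<in> Ob B" "M \<in> Ob MM" "N \<in> Ob MM" "P \<in> Ob MM"
      "f \<in> Hom B X Y" "f' \<in> Hom B Y Z" "u \<in> Hom MM M N" "u' \<in> Hom MM N P"
    using that d tar_cmp[of X Y Z "fst M" "fst N" "fst P" f f' u u'] by (cases M; cases N; cases P) (simp add: S)
  show "(f \<oplus> f') |* u = (f |* u) \<oplus>\<^bsub>MM\<^esub> (f' |* u)"
    if "X \<in> Ob B" "Y \<in> Ob B" "M \<in> Ob MM" "N \<in> Ob MM" "f \<in> Hom B X Y" "f' \<in> Hom B X Y" "u \<in> Hom MM M N"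
    using that d tar_add_left[of X Y "fst M" "fst N" f f' u] by (cases M; cases N) (simp add: S)
  show "f |* (u \<oplus>\<^bsub>MM\<^esub> u') = (f |* u) \<oplus>\<^bsub>MM\<^esub> (f |* u')"
    if "X \<in> Ob B" "Y \<in> Ob B" "M \<in> Ob MM" "N \<in> Ob MM" "f \<in> Hom B X Y" "u \<in> Hom MM M N" "u' \<in> Hom MM M N"
    using that d tar_add_right[of X Y "fst M" "fst N" f u u'] by (cases M; cases N) (simp add: S)
  show "Smul B c f |* u = Smul MM c (f |* u)"
    if "X \<in> Ob B" "Y \<in> Ob B" "M \<in> Ob MM" "N \<in> Ob MM" "f \<in> Hom B X Y" "u \<in> Hom MM M N"
    using that d tar_smul_left[of X Y "fst M" "fst N" f u] by (cases M; cases N) (simp add: S)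
  show "f |* Smul MM c u = Smul MM c (f |* u)"
    if "X \<in> Ob B" "Y \<in> Ob B" "M \<in> Ob MM" "N \<in> Ob MM" "f \<in> Hom B X Y" "u \<in> Hom MM M N"
    using that d tar_smul_right[of X Y "fst M" "fst N" f u] by (cases M; cases N) (simp add: S)
  show "is_iso MM ((X*.Y) |> M) (X |> (Y |> M)) (Mas MM X Y M)"
    if "X \<in> Ob B" "Y \<in> Ob B" "M \<in> Ob MM"
    using that HH_asc_iso by (cases M) (simp add: S HH_module_core)
  show "Mas MM X' Y' N |. ((f*:f') |* u) = (f |* (f' |* u)) |. Mas MM X Y M"
    if "X \<in> Ob B" "Y \<in> Ob B" "X' \<in> Ob B" "Y' \<in> Ob B" "M \<in> Ob MM" "N \<in> Ob MM"
      "f \<in> Hom B X X'" "f' \<in> Hom B Y Y'" "u \<in> Hom MM M N"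
    using that d asc_nat[of X Y "fst M" X' Y' "fst N" f f' u] by (cases M; cases N) (simp add: S)
  show "is_iso MM (\<one> |> M) M (Mun MM M)" if "M \<in> Ob MM"
    using that HH_lun_iso by (cases M) (simp add: S HH_module_core)
  show "Mun MM N |. (Ide B \<one> |* u) = u |. Mun MM M"
    if "M \<in> Ob MM" "N \<in> Ob MM" "u \<in> Hom MM M N"
    using that d lun_nat[of "fst M" "fst N" u] by (cases M; cases N) (simp add: S)
  show "Mas MM X Y (Z |> M) |. Mas MM (X*.Y) Z M
      = (Ide B X |* Mas MM Y Z M) |. Mas MM X (Y*.Z) M
        |. (Asc B X Y Z |* Ide MM M)"
    if "X \<in> Ob B" "Y \<in> Ob B" "Z \<in> Ob B" "M \<in> Ob MM"
    using that d pentagon[of X Y Z "fst M"] by (cases M) (simp add: S h(3))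
  show "(Ide B X |* Mun MM M) |. Mas MM X \<one> M = Run B X |* Ide MM M"
    if "X \<in> Ob B" "M \<in> Ob MM"
    using that d triangle[of X "fst M"] by (cases M) (simp add: S)
qed

text \<open>An isotopy: the loop of \<open>Y\<close> is the same on both sides, and naturality of
  crossings moves it past \<open>X\<close>.\<close>

lemma ebr_gact:
  assumes G: "pairing_action B M G" and a: "X \<in> Ob B" "Y \<in> Ob B"
  shows "ebr Y (X*.M) (gact X M G) = Asc B Y X M :. (BraidInv B X Y*:Ide B M) :. AscInv B X Y M :. (Ide B X*:ebr Y M G)
    :. Asc B X Y M :. (BraidInv B Y X*:Ide B M) :. AscInv B Y X M"
proof -
  note a = a pairing_actionD(1)[OF G]
  have "beq B [X, Y, M, ldual B Y] [G (ldual B Y) Y (ev_left B Y), coev_left B Y]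
    (Id $1##gad $0 $2 $3 $1 $$0 ;; Id $1##As $1 ($0**$2) $3 ;; As $1 ($1**$0**$2) $3 ;; Bi ($1**$0**$2) $1##Id $3 ;; Ai ($1**$0**$2) $1 $3 ;; Id ($1**$0**$2)##$$1 ;; Ri ($1**$0**$2))
    (As $1 $0 $2 ;; Bi $0 $1##Id $2 ;; Ai $0 $1 $2 ;; Id $0##(Id $1##$$0 ;; Id $1##As $1 $2 $3 ;; As $1 ($1**$2) $3 ;; Bi ($1**$2) $1##Id $3 ;; Ai ($1**$2) $1 $3 ;; Id ($1**$2)##$$1 ;; Ri ($1**$2)) ;; As $0 $1 $2 ;; Bi $1 $0##Id $2 ;; Ai $1 $0 $2)"
    by (rule braid_diagram[of "[($1**$2**$3, $2), (Ue, $1**$3)]"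
  "[]" _ _ "[NB 2 0 True False 1 (Cr False 0 1) False, SR 1, SR 0, SL 4]"],
  code_simp, simp add: a pairing_actionD(2)[OF G] ev_sharp_hom rigid_homs, simp)
  then show ?thesis by (simp add: ebr_def gact_def)
qed

lemma stable_braided_HH_module: "stable_braided_module_category MM B"
proof (intro stable_braided_module_category.intro stable_braided_module_category_axioms.intro braided_module_category.intro
    braided_module_category_axioms.intro linear_module_category_HH_module rigid_braided_category_axioms)
  interpret L: linear_category "HH B" by (rule linear_category_HH)
  note S = HH_module_simps HH_module_core and h = HH_act_half_braiding
  show "identity_automorphism MM (Twi MM)"
    using identity_automorphism_HH_twist by (simp add: S)
  show "Bra MM X M = Twi MM (X |> M) |.
      Inv MM (X |> M) (X |> M) (Ide B X |* Twi MM M)" for X M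
    unfolding S by (simp add: HH_module_def HH_simps(4))
  fix X Y :: 'o and Mt Ns :: "'o \<times> ('o \<Rightarrow> 'a)" and f u
  assume X: "X \<in> Ob B" and Mt: "Mt \<in> Ob MM"
  obtain M t where [simp]: "Mt = (M, t)" and t: "half_braiding B M t" using Mt by (auto simp: S)
  note M = half_braidingD(1)[OF t]
  have o: "HH_act B X (M, t) \<in> Ob (HH B)" using h(1,3)[OF t X] by (simp add: HH_simps(1))
  have "is_iso (HH B) (HH_act B X (M, t)) (HH_act B X (M, t)) (HH_twist B (HH_act B X (M, t)))"
    using identity_automorphism_HH_twist o by (simp add: identity_automorphism_def)
  then have "is_iso (HH B) (HH_act B X (M, t)) (HH_act B X (M, t))
      (HH_twist B (HH_act B X (M, t)) \<cdot>\<^bsub>HH B\<^esub> Inv (HH B) (HH_act B X (M, t)) (HH_act B X (M, t)) (Ide B X*:HH_twist B (M, t)))"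
    by (rule L.is_iso_cmp[OF L.is_iso_Inv[OF HH_module_Bra(2)[OF t X] o o] _ o o o])
  then show "is_iso MM (X |> Mt) (X |> Mt) (Bra MM X Mt)"
    unfolding S by (simp add: HH_module_def)
  assume Y: "Y \<in> Ob B"
  note a = X Y M
  show "Bra MM Y Ns |. (f |* u) = (f |* u) |. Bra MM X Mt"
    if Ns: "Ns \<in> Ob MM" and f: "f \<in> Hom B X Y" and u: "u \<in> Hom MM Mt Ns"
  proof -
    obtain N s where [simp]: "Ns = (N, s)" and s: "half_braiding B N s" using Ns by (auto simp: S)
    have u: "u \<in> Hom B M N" "u \<in> Hom (HH B) (M, t) (N, s)" using u by (simp_all add: S HH_simps)
    note a = a half_braidingD(1)[OF s] f
    \<comment> \<open>\<open>E\<close> is a quotient of twists, so its naturality is that of the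
      twist and of the inverse twist.\<close>
    note n1 = HH_twist_natural[OF h(1)[OF t X] h(1)[OF s Y] HH_tar_hom[OF t s X Y f u(2), unfolded h(3)[OF t X] h(3)[OF s Y]]]
      and n2 = HH_twist_Inv_natural[OF t s u(2)]
    note w1 = HH_twist_iso(1,2)[OF t] and w2 = HH_twist_iso(1,2)[OF s]
      and w3 = HH_twist_iso(1,2)[OF h(1)[OF t X]] and w4 = HH_twist_iso(1,2)[OF h(1)[OF s Y]]
    have "beq B [X, Y, M, N] [Inv B M M (HH_twist B (M, t)), Inv B N N (HH_twist B (N, s)), HH_twist B (X*.M, hact X M t), HH_twist B (Y*.N, hact Y N s), f, u]
      (($$3 ;; Id $1##$$1) ;; $$4##$$5)
      ($$4##$$5 ;; $$2 ;; Id $0##$$0)"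
      by (rule braid_diagram[of "[($2, $2), ($3, $3), ($0**$2, $0**$2), ($1**$3, $1**$3), ($0, $1), ($2, $3)]"
  "[($$3 ;; $$4##$$5, $$4##$$5 ;; $$2), ($$1 ;; $$5, $$5 ;; $$0)]" _ _ "[RF 1 1 1, SL 0, RF 1 0 0]"],
  code_simp, simp add: a u(1) w1 w2 w3 w4 ten_ob, simp only: diag_simps, (intro conjI TrueI n1 n2; simp add: a u(1) w1 w2 w3 w4 ten_ob))
    then show ?thesis by (simp add: S HH_module_Bra(3)[OF t X] HH_module_Bra(3)[OF s Y])
  qed
  note tX = h(1)[OF t X] and tY = h(1)[OF t Y]
  have "ebr Y (X*.M) (pairact B (X*.M, hact X M t)) = ebr Y (X*.M) (gact X M (pairact B (M, t)))"
    using Y by (simp add: ebr_def h(2)[OF t X] ldual_ob lev_hom)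
  then show "Bra MM Y (X |> Mt)
        = Mas MM Y X Mt |. (BraidInv B X Y |* Ide MM Mt)
          |. MasInv MM B X Y Mt |. (Ide B X |* Bra MM Y Mt)
          |. Mas MM X Y Mt |. (BraidInv B Y X |* Ide MM Mt)
          |. MasInv MM B Y X Mt"
    using X Y by (simp add: S h(3)[OF t X] HH_module_Bra(4)[OF tX Y] HH_module_Bra(4)[OF t Y] HH_module_inverses(1)[OF t]
      ebr_gact[OF pairing_action_pairact[OF t] X Y])
  \<comment> \<open>Between the two factors the inverse twist of \<open>X \<otimes> M\<close>
    cancels against the twist; what remains is naturality of the twist along the associator.\<close>
  show "Bra MM (Y*.X) Mt = MasInv MM B Y X Mt |. Bra MM Y (X |> Mt)
      |. (Ide B Y |* Bra MM X Mt) |. Mas MM Y X Mt"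
  proof -
    note YX = ten_ob[OF Y X]
    note w1 = HH_twist_iso(1,2)[OF t] and w2 = HH_twist_iso(1,2)[OF h(1)[OF t YX]] and w3 = HH_twist_iso[OF tX]
      and w4 = HH_twist_iso(1,2)[OF h(1)[OF tX Y]]
    note n = HH_twist_natural[OF h(1)[OF t YX] h(1)[OF tX Y] HH_asc_hom[OF t Y X, unfolded h(3)[OF t YX] h(3)[OF t X] h(3)[OF tX Y]]]
    have "beq B [X, Y, M] [Inv B M M (HH_twist B (M, t)), HH_twist B ((Y*.X)*.M, hact (Y*.X) M t), HH_twist B (Y*.(X*.M), hact Y (X*.M) (hact X M t)), HH_twist B (X*.M, hact X M t), Inv B (X*.M) (X*.M) (HH_twist B (X*.M, hact X M t))]
      ($$1 ;; Id ($1**$0)##$$0)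
      (Ai $1 $0 $2 ;; ($$2 ;; Id $1##$$4) ;; Id $1##($$3 ;; Id $0##$$0) ;; As $1 $0 $2)"
      by (rule braid_diagram[of "[($2, $2), (($1**$0)**$2, ($1**$0)**$2), ($1**$0**$2, $1**$0**$2), ($0**$2, $0**$2), ($0**$2, $0**$2)]"
  "[($$2 ;; As $1 $0 $2, As $1 $0 $2 ;; $$1), ($$4 ;; $$3, Id ($0**$2))]" _ _ "[RB 1 0 0, RB 1 1 1]"],
  code_simp, simp add: a w1 w2 w3 w4 ten_ob, simp only: diag_simps, (intro conjI TrueI n w3(4); simp add: a w1 w2 w3 w4 ten_ob))
    then show ?thesis
      using X Y by (simp add: S h(3)[OF t X] HH_module_Bra(3)[OF t YX] HH_module_Bra(3)[OF tX Y] HH_module_Bra(3)[OF t X] HH_module_inverses(1)[OF t])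
  qed
qed

end

section \<open>Anti-Yetter-Drinfeld modules and \<open>HH\<close> of the category of modules\<close>

context rigid_monoidal_category
begin

text \<open>Pairings with \<open>Y' \<otimes> Y\<close> act through a pairing with \<open>Y\<close> and the evaluation of \<open>Y'\<close>.\<close>

lemma pairing_action_factor:
  assumes G: "pairing_action D M G" and a: "X \<in> Ob D" "Y \<in> Ob D" "Y' \<in> Ob D" "e \<in> Hom D (X*.(Y'*.Y)) \<one>"
  shows "G X (Y'*.Y) e = G (ldual D Y') Y' (ev_left D Y') :. Ide D Y'*:(G (X*.Y') Y (e :. Asc D X Y' Y))*:Ide D (ldual D Y') :. Ide D Y'*:AscInv D Y (M*.(X*.Y')) (ldual D Y') :. Ide D Y'*:Ide D Y*:Asc D M X Y'*:Ide D (ldual D Y') :. Ide D Y'*:Ide D Y*:AscInv D (M*.X) Y' (ldual D Y') :. Asc D Y' Y ((M*.X)*.(Y'*.ldual D Y')) :. Asc D (Y'*.Y) (M*.X) (Y'*.ldual D Y') :. Ide D ((Y'*.Y)*.(M*.X))*:coev_left D Y' :. RunInv D ((Y'*.Y)*.(M*.X))"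
proof -
  note a = a pairing_actionD(1)[OF G]
  \<comment> \<open>Inserting \<open>coev_left Y'\<close> exhibits \<open>e\<close> as the nested
    pairing \<open>?n\<close>, with \<open>ev_left Y'\<close> as its inner part.\<close>
  let ?k = "AscInv D X Y' (ldual D Y') :. Ide D X*:coev_left D Y' :. RunInv D X" and ?n = "nest D (X*.Y') (ldual D Y') Y' Y (e :. Asc D X Y' Y) (ev_left D Y')"
  have "deq D [X, Y, Y', ldual D Y'] [e, ev_left D Y', coev_left D Y']
    (ned ($0**$2) $3 $2 $1 ($$0 ;; As $0 $2 $1) $$1 ;; (Ai $0 $2 $3 ;; Id $0##$$2 ;; Ri $0)##Id ($2**$1))
    ($$0)"
    by (rule diagram[of "[($0**$2**$1, Ue), ($3**$2, Ue), (Ue, $2**$3)]"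
  "[zr $2 $3 $$1 $$2]" _ _ "[RF 0 1 0]"],
  code_simp, simp add: a rigid_homs, simp only: diag_simps, (intro conjI TrueI zigzags; simp add: a rigid_homs))
  then have n: "?n :. (?k*:Ide D (Y'*.Y)) = e" by (simp add: nest_def)
  have "dhom D [X, Y', ldual D Y'] [coev_left D Y']
    (Ai $0 $1 $2 ;; Id $0##$$0 ;; Ri $0) ($0) (($0**$1)**$2)"
    by (rule diagram_hom[of "[(Ue, $1**$2)]"], code_simp, simp add: a rigid_homs)
  then have k: "?k \<in> Hom D X ((X*.Y')*.ldual D Y')" by simp
  have "dhom D [X, Y, Y'] [e]
    ($$0 ;; As $0 $2 $1) (($0**$2)**$1) (Ue)"
    by (rule diagram_hom[of "[($0**$2**$1, Ue)]"], code_simp, simp add: a rigid_homs)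
  then have eb: "e :. Asc D X Y' Y \<in> Hom D ((X*.Y')*.Y) \<one>" by simp
  have "G X (Y'*.Y) (?n :. (?k*:Ide D (Y'*.Y))) = G ((X*.Y')*.ldual D Y') (Y'*.Y) ?n :. (Ide D (Y'*.Y)*:(Ide D M*:?k))"
    by (rule pairing_actionD(3)[OF G]) (simp_all add: a k eb nest_hom ide_hom rigid_homs)
  then have n: "G X (Y'*.Y) e = (G (ldual D Y') Y' (ev_left D Y') :. Ide D Y'*:(G (X*.Y') Y (e :. Asc D X Y' Y))*:Ide D (ldual D Y') :. Ide D Y'*:AscInv D Y (M*.(X*.Y')) (ldual D Y') :. Ide D Y'*:Ide D Y*:AscInv D M (X*.Y') (ldual D Y') :. Asc D Y' Y (M*.((X*.Y')*.ldual D Y'))) :. Ide D (Y'*.Y)*:Ide D M*:(AscInv D X Y' (ldual D Y') :. Ide D X*:coev_left D Y' :. RunInv D X)"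
    using pairing_actionD(5)[OF G, of "X*.Y'" Y "ldual D Y'" Y' "e :. Asc D X Y' Y" "ev_left D Y'"] a eb by (simp add: n rigid_homs)
  note hs = a eb pairing_actionD(1,2)[OF G] rigid_homs
  have "deq D [M, X, Y, Y', ldual D Y'] [coev_left D Y', G (X*.Y') Y (e :. Asc D X Y' Y), G (ldual D Y') Y' (ev_left D Y'), G X (Y'*.Y) e]
    ($$3)
    (fad $1 $3 $2 $4 $0 $$2 $$1 $$0)"
    by (rule diagram[of "[(Ue, $3**$4), ($2**$0**$1**$3, $0), ($3**$0**$4, $0), (($3**$2)**$0**$1, $0)]"
  "[($$3, mud $0 ($1**$3) $2 $4 $3 $$1 $$2 ;; Id ($3**$2)##Id $0##(Ai $1 $3 $4 ;; Id $1##$$0 ;; Ri $1))]" _ _ "[RF 0 0 0]"],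
  code_simp, simp add: hs, simp only: diag_simps, (intro conjI TrueI n; simp add: hs))
  then show ?thesis by simp
qed

end

context hopf_algebra
begin

lemma dual_unt_hom: "dual_unt B H \<in> Hom B \<one> kk"
  by (simp add: dual_unt_def cmp_hom[of \<one> "rdual B \<one>"] rdual_uni_hom rdual_ar_hom hopf_hom)

lemma coev_dual_unt: "(Ide B kk*:counit H) :. coev_right B hh = (dual_unt B H*:Ide B \<one>) :. LunInv B \<one>"
proof -
  note hs = rdual_uni_hom rdual_ar_hom hopf_hom
  have "beq B [hh, kk, rdual B \<one>] [counit H, coev_right B hh, coev_right B \<one>, rdual_uni B, rdual_ar B hh \<one> (counit H)]
    (Id $1##$$0 ;; $$1)
    (($$4 ;; $$3)##Id Ue ;; Li Ue)"
    by (rule braid_diagram[of "[($0, Ue), (Ue, $1**$0), (Ue, $2**Ue), (Ue, $2), ($2, $1)]"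
  "[(Id $1##$$0 ;; $$1, $$4##Id Ue ;; $$2), ($$3, Ru $2 ;; Id $2##Lu Ue ;; As $2 Ue Ue ;; $$2##Id Ue ;; Li Ue)]" _ _ "[RF 0 0 0, RB 0 0 1]"],
  code_simp, simp add: hs, simp only: diag_simps, (intro conjI TrueI coev_rdual_ar rdual_uni_def[unfolded rcurry_def]; simp add: hs))
  then show ?thesis by (simp add: dual_unt_def)
qed

lemma dual_mul_hom: "dual_mul B H \<in> Hom B (kk*.kk) kk"
  and ev_dual_mul: "ev_right B hh :. (Ide B hh*:dual_mul B H)
    = ev_right2 B hh hh :. ((BraidInv B hh hh :. comul H)*:Ide B (kk*.kk))"
proof -
  have e: "ev_right2 B hh hh :. ((BraidInv B hh hh :. comul H)*:Ide B (kk*.kk))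
    \<in> Hom B (hh*.(kk*.kk)) \<one>"
  proof -
    have "bhom B [hh, kk] [comul H, ev_right B hh]
      (ned $0 $0 $1 $1 $$1 $$1 ;; (Bi $0 $0 ;; $$0)##Id ($1**$1)) ($0**$1**$1) (Ue)"
      by (rule braid_diagram_hom[of "[($0, $0**$0), ($0**$1, Ue)]"], code_simp, simp add: hopf_hom)
    then show ?thesis by (simp add: ev_right2_def)
  qed
  show "dual_mul B H \<in> Hom B (kk*.kk) kk"
    unfolding dual_mul_def by (rule rcurry_hom) (simp_all add: e hopf_hom)
  show "ev_right B hh :. (Ide B hh*:dual_mul B H)
    = ev_right2 B hh hh :. ((BraidInv B hh hh :. comul H)*:Ide B (kk*.kk))"
    unfolding dual_mul_def by (rule ev_rcurry) (simp_all add: e hopf_hom)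
qed

text \<open>The definition of \<open>dual_mul\<close> read on coevaluations: comultiplying the
  \<open>H\<close> leg gives two coevaluations whose dual legs are multiplied. The crossing of the
  two \<open>H\<close> legs compensates the inverse braiding in \<open>dual_mul\<close>.\<close>

lemma coev_dual_mul: "Ide B kk*:comul H :. coev_right B hh
    = dual_mul B H*:Braid B hh hh :. AscInv B kk kk (hh*.hh) :. Ide B kk*:Asc B kk hh hh :. Ide B kk*:coev_right B hh*:Ide B hh :. Ide B kk*:LunInv B hh :. coev_right B hh"
proof -
  have "beq B [hh, kk] [comul H, ev_right B hh, coev_right B hh, dual_mul B H]
    (Id $1##$$0 ;; $$2)
    ($$3##Br $0 $0 ;; Ai $1 $1 ($0**$0) ;; Id $1##As $1 $0 $0 ;; Id $1##$$2##Id $0 ;; Id $1##Li $0 ;; $$2)"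
    by (rule braid_diagram[of "[($0, $0**$0), ($0**$1, Ue), (Ue, $1**$0), ($1**$1, $1)]"
  "[zl $0 $1 $$1 $$2, zr $1 $0 $$1 $$2, ($$1 ;; Id $0##$$3, ned $0 $0 $1 $1 $$1 $$1 ;; (Bi $0 $0 ;; $$0)##Id ($1**$1))]" _ _ "[XX 2 1 False 0 0 False, RB 3 1 0, RB 3 2 0, SL 2, SL 1, SL 4, SL 3, SL 2, SL 6, SL 5, SL 4, SL 3, SR 3, SR 4, SR 5, SR 6, RB 3 1 2, SL 4, SL 3, SL 0, SL 1, SR 3, SL 2, SR 4, RF 3 0 1]"],
  code_simp, simp add: dual_mul_hom hopf_hom, simp only: diag_simps, (intro conjI TrueI ev_dual_mul[unfolded ev_right2_def] zigzags; simp add: dual_mul_hom hopf_hom))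
  then show ?thesis by simp
qed

section \<open>The map \<open>JC\<close>, its naturality, and its section for the regular
  module\<close>

definition erho :: "'o \<Rightarrow> 'o \<Rightarrow> 'a \<Rightarrow> 'a \<Rightarrow> 'a" where
  "erho V W w e = e :. Ide B V*:w :. Asc B V hh W"

text \<open>
  For a pairing \<open>e : V \<otimes> W \<rightarrow> 1\<close> of \<open>H\<close>-modules the map \<open>W \<otimes> M \<otimes> V \<rightarrow> \<^sup>*H \<otimes> M\<close> sends \<open>w m v\<close> to
  \<open>\<chi> \<otimes> m'\<close> with \<open>m' \<chi>(h)\<close> given by the pairing \<open>e(v, h w)\<close>; following it with an action of
  \<open>\<^sup>*H\<close> on \<open>M\<close> yields the pairing action over \<open>H\<close>-modules.
\<close>

definition JC :: "'o \<Rightarrow> ('o \<Rightarrow> 'o \<Rightarrow> 'a \<Rightarrow> 'a) \<Rightarrow> 'o \<Rightarrow> 'o \<Rightarrow> 'a \<Rightarrow> 'a \<Rightarrow> 'a" where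
  "JC M G V W w e = BraidInv B M kk :. G (V*.hh) W (erho V W w e)*:Ide B kk :. (Ide B W*:Asc B M V hh)*:Ide B kk :. Asc B W (M*.V) hh*:Ide B kk :. AscInv B (W*.(M*.V)) hh kk :. Ide B (W*.(M*.V))*:(Braid B kk hh :. coev_right B hh) :. RunInv B (W*.(M*.V))"

text \<open>Compares the right with the left dual of \<open>H\<close> along the inverse braiding:
  \<open>JC\<close> produces the former, while the evaluation of the regular module uses the
  latter.\<close>

definition dual_swap :: 'a where
  "dual_swap = lcurry B hh kk (ev_right B hh :. BraidInv B kk hh)"

text \<open>A section of \<open>JC\<close> for the evaluation of the regular module, which recovers the action of \<open>\<^sup>*H\<close>.\<close>

definition jsec :: "'o \<Rightarrow> 'a" where
  "jsec M = unt H*:Ide B (M*.ll) :. LunInv B (M*.ll) :. Ide B M*:dual_swap :. Braid B kk M"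

lemma erho_hom:
  assumes V: "V \<in> Ob B" "W \<in> Ob B" "w \<in> Hom B (hh*.W) W" "e \<in> Hom B (V*.W) \<one>"
  shows "erho V W w e \<in> Hom B ((V*.hh)*.W) \<one>"
proof -
  have "bhom B [hh, V, W] [w, e]
    ($$1 ;; Id $1##$$0 ;; As $1 $0 $2) (($1**$0)**$2) (Ue)"
    by (rule braid_diagram_hom[of "[($0**$2, $2), ($1**$2, Ue)]"], code_simp, simp add: V hopf_hom)
  then show ?thesis by (simp add: erho_def)
qed

lemma JC_hom:
  assumes G: "pairing_action B M G" and V: "V \<in> Ob B" "W \<in> Ob B" "w \<in> Hom B (hh*.W) W" "e \<in> Hom B (V*.W) \<one>"
  shows "JC M G V W w e \<in> Hom B (W*.(M*.V)) (kk*.M)"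
proof -
  have "bhom B [hh, kk, M, V, W] [G (V*.hh) W (erho V W w e), coev_right B hh]
    (jcd $2 $3 $4 $0 $1 $$0 $$1) ($4**$2**$3) ($1**$2)"
    by (rule braid_diagram_hom[of "[($4**$2**$3**$0, $2), (Ue, $1**$0)]"], code_simp, simp add: V erho_hom pairing_actionD(1,2)[OF G] hopf_hom)
  then show ?thesis by (simp add: JC_def)
qed

lemma dual_swap_hom: "dual_swap \<in> Hom B kk ll"
proof -
  have "bhom B [hh, kk, ll] [ev_right B hh, coev_left B hh]
    (Lu $2 ;; ($$0 ;; Bi $1 $0)##Id $2 ;; Ai $1 $0 $2 ;; Id $1##$$1 ;; Ri $1) ($1) ($2)"
    by (rule braid_diagram_hom[of "[($0**$1, Ue), (Ue, $0**$2)]"], code_simp, simp add: hopf_hom)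
  then show ?thesis by (simp add: dual_swap_def lcurry_def)
qed

lemma jsec_hom: "M \<in> Ob B \<Longrightarrow> jsec M \<in> Hom B (kk*.M) (hh*.(M*.ll))"
proof -
  assume M: "M \<in> Ob B"
  have "bhom B [hh, kk, ll, M] [unt H, dual_swap]
    ($$0##Id ($3**$2) ;; Li ($3**$2) ;; Id $3##$$1 ;; Br $1 $3) ($1**$3) ($0**$3**$2)"
    by (rule braid_diagram_hom[of "[(Ue, $0), ($1, $2)]"], code_simp, simp add: M dual_swap_hom hopf_hom)
  then show ?thesis by (simp add: jsec_def)
qed

text \<open>Linearity of \<open>k\<close> lets it pass the action inside \<open>erho\<close>; the
  rest is naturality of \<open>G\<close>.\<close>

lemma JC_nat:
  assumes G: "pairing_action B M G" and V: "V \<in> Ob B" "W \<in> Ob B" "w \<in> Hom B (hh*.W) W" "e \<in> Hom B (V*.W) \<one>"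
    and f: "V' \<in> Ob B" "W' \<in> Ob B" "w' \<in> Hom B (hh*.W') W'" "f \<in> Hom B V' V" "k \<in> Hom B W' W"
    and l: "k :. w' = w :. (Ide B hh*:k)"
  shows "JC M G V' W' w' (e :. (f*:k)) = JC M G V W w e :. (k*:(Ide B M*:f))"
proof -
  have "beq B [hh, V, W, V', W'] [w, w', e, f, k]
    (($$2 ;; $$3##$$4) ;; Id $3##$$1 ;; As $3 $0 $4)
    (($$2 ;; Id $1##$$0 ;; As $1 $0 $2) ;; ($$3##Id $0)##$$4)"
    by (rule braid_diagram[of "[($0**$2, $2), ($0**$4, $4), ($1**$2, Ue), ($3, $1), ($4, $2)]"
  "[($$4 ;; $$1, $$0 ;; Id $0##$$4)]" _ _ "[SR 0, RF 1 1 0]"],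
  code_simp, simp add: V f hopf_hom, simp only: diag_simps, (intro conjI TrueI l; simp add: V f hopf_hom))
  then have e: "erho V' W' w' (e :. (f*:k)) = erho V W w e :. ((f*:Ide B hh)*:k)" by (simp add: erho_def)
  have fk: "e :. (f*:k) \<in> Hom B (V'*.W') \<one>" using V f cmp_hom[of "V'*.W'" "V*.W" \<one>] by (simp add: tar_hom ten_ob uni_ob)
  have n: "G (V'*.hh) W' (erho V' W' w' (e :. (f*:k))) = G (V*.hh) W (erho V W w e) :. (k*:(Ide B M*:(f*:Ide B hh)))"
    unfolding e by (rule pairing_actionD(3)[OF G]) (simp_all add: V f erho_hom hopf_hom tar_hom_ide)
  note hs = V f fk erho_hom pairing_actionD(1,2)[OF G] hopf_hom
  have "beq B [hh, kk, M, V, W, V', W'] [coev_right B hh, f, k, G (V*.hh) W (erho V W w e), G (V'*.hh) W' (erho V' W' w' (e :. (f*:k)))]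
    (jcd $2 $5 $6 $0 $1 $$4 $$0)
    (jcd $2 $3 $4 $0 $1 $$3 $$0 ;; $$2##Id $2##$$1)"
    by (rule braid_diagram[of "[(Ue, $1**$0), ($5, $3), ($6, $4), ($4**$2**$3**$0, $2), ($6**$2**$5**$0, $2)]"
  "[($$4, $$3 ;; $$2##Id $2##$$1##Id $0)]" _ _ "[RF 2 0 0, SR 1, SR 0, SR 2, SR 1]"],
  code_simp, simp add: hs, simp only: diag_simps, (intro conjI TrueI n; simp add: hs))
  then show ?thesis by (simp add: JC_def)
qed

text \<open>On a trivial module \<open>h\<close> enters through the counit only, so the functional
  on \<open>H\<close> is the unit of the dual algebra.\<close>

lemma JC_triv:
  assumes G: "pairing_action B M G" and V: "V \<in> Ob B" "W \<in> Ob B" "e \<in> Hom B (V*.W) \<one>"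
  shows "JC M G V W (triv W) e = (dual_unt B H*:Ide B M) :. LunInv B M :. G V W e"
proof -
  note tr = hmodD(2)[OF triv_module[OF V(2)]]
  have "beq B [hh, V, W] [counit H, e]
    ($$1 ;; Id $1##(Lu $2 ;; $$0##Id $2) ;; As $1 $0 $2)
    ($$1 ;; (Ru $1 ;; Id $1##$$0)##Id $2)"
    by (rule braid_diagram[of "[($0, Ue), ($1**$2, Ue)]"
  "[]" _ _ "[]"],
  code_simp, simp add: V hopf_hom, simp)
  then have e: "erho V W (triv W) e = e :. ((Run B V :. (Ide B V*:counit H))*:Ide B W)" by (simp add: erho_def)
  have "bhom B [hh, V] [counit H]
    (Ru $1 ;; Id $1##$$0) ($1**$0) ($1)"
    by (rule braid_diagram_hom[of "[($0, Ue)]"], code_simp, simp add: V hopf_hom)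
  then have r: "Run B V :. (Ide B V*:counit H) \<in> Hom B (V*.hh) V" by simp
  have n: "G (V*.hh) W (erho V W (triv W) e) = G V W e :. (Ide B W*:(Ide B M*:(Run B V :. (Ide B V*:counit H))))"
    unfolding e by (rule pairing_actionD(3)[OF G]) (simp_all add: V r ide_hom hopf_hom)
  note hs = V tr dual_unt_hom erho_hom pairing_actionD(1,2)[OF G] hopf_hom
  have "beq B [hh, kk, M, V, W] [coev_right B hh, counit H, dual_unt B H, G V W e, G (V*.hh) W (erho V W (triv W) e)]
    (jcd $2 $3 $4 $0 $1 $$4 $$0)
    ($$2##Id $2 ;; Li $2 ;; $$3)"
    by (rule braid_diagram[of "[(Ue, $1**$0), ($0, Ue), (Ue, $1), ($4**$2**$3, $2), ($4**$2**$3**$0, $2)]"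
  "[($$4, $$3 ;; Id $4##Id $2##(Ru $3 ;; Id $3##$$1)), (Id $1##$$1 ;; $$0, $$2##Id Ue ;; Li Ue)]" _ _ "[RF 2 0 0, SR 2, SR 1, SR 0, NB 2 1 True True 1 (Ge 1) True, RF 1 1 1, NB 1 0 True False 2 (Ge 2) False]"],
  code_simp, simp add: hs, simp only: diag_simps, (intro conjI TrueI n coev_dual_unt; simp add: hs))
  then show ?thesis by (simp add: JC_def)
qed

lemma JC_mor:
  assumes F: "pairing_action B N F" and G: "pairing_action B M G" and u: "u \<in> Hom B N M" and V: "V \<in> Ob B" "W \<in> Ob B" "w \<in> Hom B (hh*.W) W" "e \<in> Hom B (V*.W) \<one>"
    and n: "u :. F (V*.hh) W (erho V W w e) = G (V*.hh) W (erho V W w e) :. (Ide B W*:(u*:Ide B (V*.hh)))"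
  shows "(Ide B kk*:u) :. JC N F V W w e = JC M G V W w e :. (Ide B W*:(u*:Ide B V))"
proof -
  note hs = V erho_hom pairing_actionD(1,2)[OF G] hopf_hom u pairing_actionD(1,2)[OF F]
  have "beq B [hh, kk, M, N, V, W] [coev_right B hh, u, F (V*.hh) W (erho V W w e), G (V*.hh) W (erho V W w e)]
    (Id $1##$$1 ;; jcd $3 $4 $5 $0 $1 $$2 $$0)
    (jcd $2 $4 $5 $0 $1 $$3 $$0 ;; Id $5##$$1##Id $4)"
    by (rule braid_diagram[of "[(Ue, $1**$0), ($3, $2), ($5**$3**$4**$0, $3), ($5**$2**$4**$0, $2)]"
  "[($$1 ;; $$2, $$3 ;; Id $5##$$1##Id ($4**$0))]" _ _ "[NB 3 0 False False 1 (Ge 1) True, RF 2 0 0, SR 1, SR 0]"],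
  code_simp, simp add: hs, simp only: diag_simps, (intro conjI TrueI n; simp add: hs))
  then show ?thesis by (simp add: JC_def)
qed

lemma jsec_nat:
  assumes f: "N \<in> Ob B" "M \<in> Ob B" "f \<in> Hom B N M"
  shows "jsec M :. (Ide B kk*:f) = (Ide B hh*:(f*:Ide B ll)) :. jsec N"
proof -
  have "beq B [hh, kk, ll, M, N] [unt H, dual_swap, f]
    (($$0##Id ($3**$2) ;; Li ($3**$2) ;; Id $3##$$1 ;; Br $1 $3) ;; Id $1##$$2)
    (Id $0##$$2##Id $2 ;; $$0##Id ($4**$2) ;; Li ($4**$2) ;; Id $4##$$1 ;; Br $1 $4)"
    by (rule braid_diagram[of "[(Ue, $0), ($1, $2), ($4, $3)]"
  "[]" _ _ "[SR 2, SR 1, SR 0, NB 1 1 True True 1 (Ge 2) False, SL 0, SL 2, SL 1]"],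
  code_simp, simp add: f dual_swap_hom hopf_hom, simp)
  then show ?thesis by (simp add: jsec_def)
qed

text \<open>Putting the unit of \<open>H\<close> into the argument \<open>w\<close> reduces
  \<open>e(v, h w)\<close> to the evaluation of \<open>H\<close>. The action of \<open>G\<close>
  then becomes trivial by its normalisation, and the two dualisations cancel by triangle
  identities.\<close>

lemma JC_jsec:
  assumes G: "pairing_action B M G"
  shows "JC M G ll hh (mul H) (ev_left B hh) :. jsec M = Ide B (kk*.M)"
proof -
  let ?e = "erho ll hh (mul H) (ev_left B hh)"
  have "beq B [hh, ll] [mul H, unt H, ev_left B hh]
    (($$2 ;; Id $1##$$0 ;; As $1 $0 $0) ;; Id ($1**$0)##$$1)
    (Lu Ue ;; $$2##Id Ue)"
    by (rule braid_diagram[of "[($0**$0, $0), (Ue, $0), ($1**$0, Ue)]"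
  "[($$0 ;; Id $0##$$1, Ru $0)]" _ _ "[RF 0 1 0]"],
  code_simp, simp add: hopf_hom, simp only: diag_simps, (intro conjI TrueI hopf_rel; simp add: hopf_hom))
  then have e: "?e :. (Ide B (ll*.hh)*:unt H) = Lun B \<one> :. (ev_left B hh*:Ide B \<one>)" by (simp add: erho_def)
  have n: "G (ll*.hh) hh ?e :. (unt H*:(Ide B M*:Ide B (ll*.hh)))
      = G \<one> \<one> (Lun B \<one>) :. (Ide B \<one>*:(Ide B M*:ev_left B hh))"
    by (rule pairing_action_eq[OF G, where X' = "ll*.hh" and Y' = "\<one>"]) (simp_all add: e erho_hom Lun_hom ide_hom hopf_hom)
  note hs = erho_hom Lun_hom pairing_actionD(1,2)[OF G] hopf_hom
  have "beq B [hh, kk, ll, M] [ev_right B hh, coev_right B hh, ev_left B hh, coev_left B hh, unt H, G (ll*.hh) hh (erho ll hh (mul H) (ev_left B hh)), G \<one> \<one> (Lun B \<one>)]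
    (jcd $3 $2 $0 $0 $1 $$5 $$1 ;; $$4##Id ($3**$2) ;; Li ($3**$2) ;; Id $3##(Lu $2 ;; ($$0 ;; Bi $1 $0)##Id $2 ;; Ai $1 $0 $2 ;; Id $1##$$3 ;; Ri $1) ;; Br $1 $3)
    (Id ($1**$3))"
    by (rule braid_diagram[of "[($0**$1, Ue), (Ue, $1**$0), ($2**$0, Ue), (Ue, $0**$2), (Ue, $0), ($0**$3**$2**$0, $3), (Ue**$3**Ue, $3)]"
  "[zr $1 $0 $$0 $$1, zr $0 $2 $$2 $$3, ($$5 ;; $$4##Id $3##Id ($2**$0), $$6 ;; Id Ue##Id $3##$$2), ($$6, Lu $3 ;; Id Ue##Ru $3)]" _ _ "[SL 4, SL 3, SL 2, SL 1, SL 5, SL 4, SL 3, SL 2, RF 6 0 2, SR 6, SR 5, SR 4, SR 3, SR 2, SR 1, SL 6, SL 5, RF 4 2 1, RF 1 0 3, NB 1 1 False True 1 (Ge 1) True, NB 2 1 True True 1 (Cr True 0 1) False, XX 4 1 True 0 1 True, NB 2 1 True True 1 (Ge 0) True, RF 1 1 0, XX 0 0 True 1 3 True]"],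
  code_simp, simp add: hs, simp only: diag_simps, (intro conjI TrueI n zigzags pairing_actionD(4)[OF G]; simp add: hs))
  then show ?thesis by (simp add: JC_def jsec_def dual_swap_def lcurry_def)
qed

lemma dual_swap_coev: "(Ide B hh*:dual_swap) :. Braid B kk hh :. coev_right B hh = coev_left B hh"
proof -
  have "beq B [hh, kk, ll] [ev_right B hh, coev_right B hh, coev_left B hh]
    (Id $0##(Lu $2 ;; ($$0 ;; Bi $1 $0)##Id $2 ;; Ai $1 $0 $2 ;; Id $1##$$2 ;; Ri $1) ;; Br $1 $0 ;; $$1)
    ($$2)"
    by (rule braid_diagram[of "[($0**$1, Ue), (Ue, $1**$0), (Ue, $0**$2)]"
  "[zl $0 $1 $$0 $$1]" _ _ "[NB 4 0 True False 0 (Ge 0) False, NB 3 0 False False 0 (Cr False 0 1) True, SR 2, XX 1 0 True 1 0 True, SL 0, NB 1 0 False False 0 (Ge 1) False, NB 2 0 False True 0 (Ge 0) False, NB 2 0 False True 0 (Ge 0) True, RF 1 0 0]"],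
  code_simp, simp add: hopf_hom, simp only: diag_simps, (intro conjI TrueI zigzags; simp add: hopf_hom))
  then show ?thesis by (simp add: dual_swap_def lcurry_def)
qed

text \<open>The other composite. By \<open>dual_swap_coev\<close> the functional produced by
  \<open>JC\<close> becomes an element of the left dual, ready to be fed to the action of the
  regular module.\<close>

lemma jsec_JC:
  assumes G: "pairing_action B M G" and V: "V \<in> Ob B" "W \<in> Ob B" "w \<in> Hom B (hh*.W) W" "e \<in> Hom B (V*.W) \<one>"
  shows "jsec M :. JC M G V W w e = unt H*:Ide B (M*.ll) :. LunInv B (M*.ll) :. G (V*.hh) W (erho V W w e)*:Ide B ll :. AscInv B W (M*.(V*.hh)) ll :. Ide B W*:AscInv B M (V*.hh) ll :. Ide B W*:Ide B M*:AscInv B V hh ll :. Ide B W*:Asc B M V (hh*.ll) :. Asc B W (M*.V) (hh*.ll) :. Ide B (W*.(M*.V))*:coev_left B hh :. RunInv B (W*.(M*.V))"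
proof -
  note hs = V erho_hom pairing_actionD(1,2)[OF G] hopf_hom dual_swap_hom
  have "beq B [hh, kk, ll, M, V, W] [coev_right B hh, coev_left B hh, unt H, dual_swap, G (V*.hh) W (erho V W w e)]
    (($$2##Id ($3**$2) ;; Li ($3**$2) ;; Id $3##$$3 ;; Br $1 $3) ;; jcd $3 $4 $5 $0 $1 $$4 $$0)
    ($$2##Id ($3**$2) ;; Li ($3**$2) ;; $$4##Id $2 ;; Ai $5 ($3**$4**$0) $2 ;; Id $5##Ai $3 ($4**$0) $2 ;; Id $5##Id $3##Ai $4 $0 $2 ;; Id $5##As $3 $4 ($0**$2) ;; As $5 ($3**$4) ($0**$2) ;; Id ($5**$3**$4)##$$1 ;; Ri ($5**$3**$4))"
    by (rule braid_diagram[of "[(Ue, $1**$0), (Ue, $0**$2), (Ue, $0), ($1, $2), ($5**$3**$4**$0, $3)]"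
  "[(Id $0##$$3 ;; Br $1 $0 ;; $$0, $$1)]" _ _ "[SR 5, SR 4, SR 3, SR 2, SR 1, SR 0, XX 4 1 False 3 1 True, SL 3, RF 1 4 0, SL 0, SL 1]"],
  code_simp, simp add: hs, simp only: diag_simps, (intro conjI TrueI dual_swap_coev; simp add: hs))
  then show ?thesis by (simp add: JC_def jsec_def)
qed

lemma tensor_action_triv: "\<lbrakk>V \<in> Ob B; W \<in> Ob B\<rbrakk> \<Longrightarrow> tensor_action B H V (triv V) W (triv W) = triv (V*.W)"
proof -
  assume V: "V \<in> Ob B" "W \<in> Ob B"
  have "beq B [hh, V, W] [comul H, counit H]
    ((Lu $1 ;; $$1##Id $1)##(Lu $2 ;; $$1##Id $2) ;; msd $0 $0 $1 $2 ;; $$0##Id ($1**$2))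
    (Lu ($1**$2) ;; $$1##Id ($1**$2))"
    by (rule braid_diagram[of "[($0, $0**$0), ($0, Ue)]"
  "[(Lu $0 ;; $$1##Id $0 ;; $$0, Id $0)]" _ _ "[SR 1, RF 0 0 0, NB 0 0 False True 1 (Ge 1) True]"],
  code_simp, simp add: V hopf_hom, simp only: diag_simps, (intro conjI TrueI hopf_rel; simp add: V hopf_hom))
  then show ?thesis by (simp add: tensor_action_def middle_swap_def)
qed

text \<open>The comultiplication that distributes \<open>h\<close> over
  \<open>W' \<otimes> W\<close> is dual to the multiplication of functionals. When the second
  pairing acts, the first functional is already attached to \<open>M\<close>; hence
  \<open>gact\<close> with \<open>kk\<close>.\<close>

lemma JC_mult:
  assumes G: "pairing_action B M G" and V: "V \<in> Ob B" "W \<in> Ob B" "w \<in> Hom B (hh*.W) W" "e \<in> Hom B (V*.W) \<one>"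
    and V': "V' \<in> Ob B" "W' \<in> Ob B" "w' \<in> Hom B (hh*.W') W'" "e' \<in> Hom B (V'*.W') \<one>"
  shows "JC M G (V*.V') (W'*.W) (tensor_action B H W' w' W w) (nest B V V' W' W e e')
    = (dual_mul B H*:Ide B M) :. AscInv B kk kk M
      :. JC (kk*.M) (gact kk M G) V' W' w' e' :. (Ide B W'*:(JC M G V W w e*:Ide B V')) :. (Ide B W'*:AscInv B W (M*.V) V') :. (Ide B W'*:(Ide B W*:AscInv B M V V')) :. Asc B W' W (M*.(V*.V'))"
proof -
  \<comment> \<open>\<open>?th\<close> sends the second leg of the comultiplication back past
    \<open>V'\<close> to \<open>V\<close>, along the inverse crossing; the first leg stays with
    \<open>V'\<close>.\<close>
  let ?th = "AscInv B V hh (V'*.hh) :. Ide B V*:BraidInv B (V'*.hh) hh :. Ide B V*:AscInv B V' hh hh :. Asc B V V' (hh*.hh) :. Ide B (V*.V')*:comul H"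
  have nh: "nest B V V' W' W e e' \<in> Hom B ((V*.V')*.(W'*.W)) \<one>" using V V' by (intro nest_hom)
  have "beq B [hh, V, W, V', W'] [comul H, w, w', e, e']
    (ned $1 $3 $4 $2 $$3 $$4 ;; Id ($1**$3)##($$2##$$1 ;; msd $0 $0 $4 $2 ;; $$0##Id ($4**$2)) ;; As ($1**$3) $0 ($4**$2))
    (ned ($1**$0) ($3**$0) $4 $2 ($$3 ;; Id $1##$$1 ;; As $1 $0 $2) ($$4 ;; Id $3##$$2 ;; As $3 $0 $4) ;; (Ai $1 $0 ($3**$0) ;; Id $1##Bi ($3**$0) $0 ;; Id $1##Ai $3 $0 $0 ;; As $1 $3 ($0**$0) ;; Id ($1**$3)##$$0)##Id ($4**$2))"
    by (rule braid_diagram[of "[($0, $0**$0), ($0**$2, $2), ($0**$4, $4), ($1**$2, Ue), ($3**$4, Ue)]"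
  "[]" _ _ "[SR 3, XX 1 2 False 0 0 False, NB 2 2 True True 0 (Ge 2) True, XX 2 1 False 3 0 False, SL 3, NB 4 1 True True 0 (Ge 4) True]"],
  code_simp, simp add: V V' hopf_hom, simp)
  then have e: "erho (V*.V') (W'*.W) (tensor_action B H W' w' W w) (nest B V V' W' W e e')
    = nest B (V*.hh) (V'*.hh) W' W (erho V W w e) (erho V' W' w' e') :. (?th*:Ide B (W'*.W))"
    by (simp add: erho_def nest_def tensor_action_def middle_swap_def)
  have "bhom B [hh, V, V'] [comul H]
    (Ai $1 $0 ($2**$0) ;; Id $1##Bi ($2**$0) $0 ;; Id $1##Ai $2 $0 $0 ;; As $1 $2 ($0**$0) ;; Id ($1**$2)##$$0) (($1**$2)**$0) (($1**$0)**$2**$0)"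
    by (rule braid_diagram_hom[of "[($0, $0**$0)]"], code_simp, simp add: V V' hopf_hom)
  then have th: "?th \<in> Hom B ((V*.V')*.hh) ((V*.hh)*.(V'*.hh))" by simp
  have "G ((V*.V')*.hh) (W'*.W) (erho (V*.V') (W'*.W) (tensor_action B H W' w' W w) (nest B V V' W' W e e'))
    = G ((V*.hh)*.(V'*.hh)) (W'*.W) (nest B (V*.hh) (V'*.hh) W' W (erho V W w e) (erho V' W' w' e'))
      :. (Ide B (W'*.W)*:(Ide B M*:?th))"
    unfolding e by (rule pairing_actionD(3)[OF G]) (simp_all add: V V' th erho_hom nest_hom ide_hom hopf_hom)
  then have n: "G ((V*.V')*.hh) (W'*.W) (erho (V*.V') (W'*.W) (tensor_action B H W' w' W w) (nest B V V' W' W e e')) = (G (V'*.hh) W' (erho V' W' w' e') :. Ide B W'*:G (V*.hh) W (erho V W w e)*:Ide B (V'*.hh) :. Ide B W'*:AscInv B W (M*.(V*.hh)) (V'*.hh) :. Ide B W'*:Ide B W*:AscInv B M (V*.hh) (V'*.hh) :. Asc B W' W (M*.((V*.hh)*.(V'*.hh)))) :. Ide B (W'*.W)*:Ide B M*:(AscInv B V hh (V'*.hh) :. Ide B V*:BraidInv B (V'*.hh) hh :. Ide B V*:AscInv B V' hh hh :. Asc B V V' (hh*.hh) :. Ide B (V*.V')*:comul H)"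
    using pairing_actionD(5)[OF G, of "V*.hh" W "V'*.hh" W' "erho V W w e" "erho V' W' w' e'"] V V'
    by (simp add: erho_hom hopf_hom)
  note hs = V V' nh th erho_hom dual_mul_hom nest_hom tensor_action_hom pairing_actionD(1,2)[OF G] hopf_hom
  have "beq B [hh, kk, M, V, W, V', W'] [comul H, coev_right B hh, dual_mul B H, G (V*.hh) W (erho V W w e), G (V'*.hh) W' (erho V' W' w' e'), G ((V*.V')*.hh) (W'*.W) (erho (V*.V') (W'*.W) (tensor_action B H W' w' W w) (nest B V V' W' W e e'))]
    (jcd $2 ($3**$5) ($6**$4) $0 $1 $$5 $$1)
    ($$2##Id $2 ;; Ai $1 $1 $2 ;; mud $2 $3 $4 $5 $6 (jcd $2 $3 $4 $0 $1 $$3 $$1) (jcd ($1**$2) $5 $6 $0 $1 (gad $1 $2 ($5**$0) $6 $$4) $$1))"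
    by (rule braid_diagram[of "[($0, $0**$0), (Ue, $1**$0), ($1**$1, $1), ($4**$2**$3**$0, $2), ($6**$2**$5**$0, $2), (($6**$4)**$2**($3**$5)**$0, $2)]"
  "[($$5, mud $2 ($3**$0) $4 ($5**$0) $6 $$3 $$4 ;; Id ($6**$4)##Id $2##(Ai $3 $0 ($5**$0) ;; Id $3##Bi ($5**$0) $0 ;; Id $3##Ai $5 $0 $0 ;; As $3 $5 ($0**$0) ;; Id ($3**$5)##$$0)), (Id $1##$$0 ;; $$1, $$2##Br $0 $0 ;; Ai $1 $1 ($0**$0) ;; Id $1##As $1 $0 $0 ;; Id $1##$$1##Id $0 ;; Id $1##Li $0 ;; $$1)]" _ _ "[RF 2 0 0, NB 1 5 True True 1 (Ge 0) True, RF 0 5 1, SL 2, NB 3 5 False True 0 (Ge 2) False, NB 5 6 False True 0 (Ge 2) False, SR 7, SR 8, SR 9, SR 10, NB 11 0 True False 2 (Ge 2) False, NB 10 0 False False 1 (Ge 4) False, NB 14 1 False False 1 (Ge 4) False, SL 9, SL 10, SR 18, NB 11 1 False False 1 (Ge 3) False, SR 15, SL 16, SL 17, NB 18 2 False False 1 (Ge 3) False, SL 4, SL 15, SL 14, SL 13, SL 12, SL 11, SL 10, SL 16, SL 15, SL 14, SL 13, SL 12, SL 17, SL 16, SL 15, SL 14, SL 18, SL 17, SL 16, SL 19, SL 18, SL 20, SR 22, SR 23, SR 4, SR 10, SR 12, SR 11, SR 14, SR 13, SR 12, SR 16, SR 15, SR 14, SR 13, SR 18, SR 17, SR 16, SR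 15, SR 14, SR 20, SR 19, SR 18, SR 17, SR 16, SR 15, SL 23, SL 22, NB 18 2 False False 1 (Ge 3) True, SR 17, SR 16, SL 15, NB 11 1 False False 1 (Ge 3) True, SR 10, SR 9, SL 18, NB 14 1 False False 1 (Ge 4) True, NB 10 0 False False 1 (Ge 4) True, NB 11 0 True False 2 (Ge 2) True, SL 10, SL 9, SL 8, SL 7, NB 5 6 False True 0 (Ge 2) True, NB 3 5 False True 0 (Ge 2) True, SR 2, NB 3 5 False True 0 (Cr True 1 0) True, XX 5 5 True 0 0 True, SR 4, SR 5, NB 7 0 False False 1 (Ge 4) False, XX 6 3 True 1 0 True, SL 5, NB 3 4 True False 5 (Cr True 1 0) False, NB 2 4 True False 5 (Ge 2) False, SR 1, SL 4, NB 2 5 True False 5 (Ge 1) False, NB 5 1 False False 1 (Ge 3) False, SR 9, XX 4 4 True 1 0 True, NB 2 4 False False 1 (Ge 1) True, SR 1, SR 0, XX 1 4 True 1 0 False, SL 2, SL 3, NB 4 4 True False 0 (Cr False 1 1) True, NB 5 4 True False 0 (Ge 2) True, SL 10, NB 6 1 False False 1 (Ge 3) True, SR 5, SR 4, SR 3, SR 2, NB 6 1 True False 2 (Ge 2) False, NB 5 1 False False 1 (Cr False 2 1) True, SR 4, SR 3, NB 8 0 True False 6 (Ge 2) False, NB 7 0 False False 1 (Cr False 6 1) True, SR 6, SR 5, SR 4, XX 6 4 True 1 0 False, NB 2 1 False False 1 (Ge 3) False, SR 6, SL 7, SL 8, SL 9, SL 10, NB 11 2 False False 1 (Ge 3) False,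 SR 15, SR 16, SR 17, SL 17, SL 16, SL 15, NB 11 2 False False 1 (Ge 3) True, SR 10, SR 9, SR 8, SR 7, SL 6, NB 2 1 False False 1 (Ge 3) True, SL 12, SL 11, NB 7 1 False False 1 (Ge 4) True, SL 4, SL 5]"],
  code_simp, simp add: hs, simp only: diag_simps, (intro conjI TrueI n coev_dual_mul; simp add: hs))
  then show ?thesis by (simp add: JC_def gact_def)
qed

text \<open>Letting \<open>h'\<close> act on \<open>w\<close> amounts to using the pairing
  \<open>E\<close> of \<open>V \<otimes> H\<close> with \<open>H \<otimes> W\<close>, because
  \<open>e(v, h (h' w)) = e(v, (h h') w)\<close>. Splitting \<open>E\<close> at \<open>H\<close>
  multiplies \<open>h'\<close> onto \<open>h\<close> from the right, at the price of an action of
  \<open>ev_left H\<close>.\<close>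

lemma erho_factor:
  assumes G: "pairing_action B M G" and V: "V \<in> Ob B" "W \<in> Ob B" "w \<in> Hom B (hh*.W) W" "e \<in> Hom B (V*.W) \<one>" and w: "w :. (mul H*:Ide B W) = w :. (Ide B hh*:w) :. Asc B hh hh W"
  shows "G ll hh (ev_left B hh) :. Ide B hh*:G (V*.hh) W (erho V W w e)*:Ide B ll :. Ide B hh*:AscInv B W (M*.(V*.hh)) ll :. Ide B hh*:Ide B W*:AscInv B M (V*.hh) ll :. Ide B hh*:Ide B W*:Ide B M*:AscInv B V hh ll :. Ide B hh*:Ide B W*:Asc B M V (hh*.ll) :. Ide B hh*:Asc B W (M*.V) (hh*.ll) :. Asc B hh (W*.(M*.V)) (hh*.ll) :. Ide B (hh*.(W*.(M*.V)))*:mul H*:Ide B ll :. Ide B (hh*.(W*.(M*.V)))*:AscInv B hh hh ll :. AscInv B hh (W*.(M*.V)) (hh*.(hh*.ll)) :. Ide B hh*:AscInv B W (M*.V) (hh*.(hh*.ll)) :. Ide B hh*:Ide B W*:AscInv B M V (hh*.(hh*.ll)) :. Ide B hh*:Ide B W*:Ide B M*:Asc B V hh (hh*.ll) :. Ide B hh*:Ide B W*:Asc B M (V*.hh) (hh*.ll) :. Ide B hh*:Asc B W (M*.(V*.hh)) (hh*.ll) :. Asc B hh (W*.(M*.(V*.hh))) (hh*.ll) :. Ide B (hh*.(W*.(M*.(V*.hh))))*:coev_left B hh :. RunInv B (hh*.(W*.(M*.(V*.hh)))) = G (V*.hh) W (erho V W w e) :. w*:Ide B (M*.(V*.hh)) :.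 AscInv B hh W (M*.(V*.hh))"
proof -
  define E where "E = erho V W w e :. (Ide B (V*.hh)*:w)"
  have "beq B [hh, V, W] [mul H, w, e]
    ((($$2 ;; Id $1##$$1 ;; As $1 $0 $2) ;; Id ($1**$0)##$$1) ;; As ($1**$0) $0 $2)
    (($$2 ;; Id $1##$$1 ;; As $1 $0 $2) ;; (Id $1##$$0 ;; As $1 $0 $0)##Id $2)"
    by (rule braid_diagram[of "[($0**$0, $0), ($0**$2, $2), ($1**$2, Ue)]"
  "[($$1 ;; $$0##Id $2, $$1 ;; Id $0##$$1 ;; As $0 $0 $2)]" _ _ "[RB 0 1 0]"],
  code_simp, simp add: V hopf_hom, simp only: diag_simps, (intro conjI TrueI w; simp add: V hopf_hom))
  then have e: "E :. Asc B (V*.hh) hh W = erho V W w e :. ((Ide B V*:mul H :. Asc B V hh hh)*:Ide B W)" by (simp add: erho_def E_def)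
  have "bhom B [hh, V] [mul H]
    (Id $1##$$0 ;; As $1 $0 $0) (($1**$0)**$0) ($1**$0)"
    by (rule braid_diagram_hom[of "[($0**$0, $0)]"], code_simp, simp add: V hopf_hom)
  then have k: "Ide B V*:mul H :. Asc B V hh hh \<in> Hom B ((V*.hh)*.hh) (V*.hh)" by simp
  have E: "E \<in> Hom B ((V*.hh)*.(hh*.W)) \<one>"
    unfolding E_def by (rule cmp_hom[of _ "(V*.hh)*.W"]) (simp_all add: V erho_hom hopf_hom tar_hom_ide)
  have EA: "E :. Asc B (V*.hh) hh W \<in> Hom B (((V*.hh)*.hh)*.W) \<one>"
    by (rule cmp_hom[OF _ _ _ str_hom(1) E]) (simp_all add: V hopf_hom)
  have a: "G (V*.hh) (hh*.W) E = G (V*.hh) W (erho V W w e) :. (w*:(Ide B M*:Ide B (V*.hh)))"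
    unfolding E_def by (rule pairing_actionD(3)[OF G]) (simp_all add: V erho_hom ide_hom hopf_hom)
  have b: "G ((V*.hh)*.hh) W (E :. Asc B (V*.hh) hh W) = G (V*.hh) W (erho V W w e) :. (Ide B W*:(Ide B M*:(Ide B V*:mul H :. Asc B V hh hh)))"
    unfolding e by (rule pairing_actionD(3)[OF G]) (simp_all add: V k erho_hom ide_hom hopf_hom)
  have c: "G (V*.hh) (hh*.W) E = G ll hh (ev_left B hh) :. Ide B hh*:(G ((V*.hh)*.hh) W (E :. Asc B (V*.hh) hh W))*:Ide B ll :. Ide B hh*:AscInv B W (M*.((V*.hh)*.hh)) ll :. Ide B hh*:Ide B W*:Asc B M (V*.hh) hh*:Ide B ll :. Ide B hh*:Ide B W*:AscInv B (M*.(V*.hh)) hh ll :. Asc B hh W ((M*.(V*.hh))*.(hh*.ll)) :. Asc B (hh*.W) (M*.(V*.hh)) (hh*.ll) :. Ide B ((hh*.W)*.(M*.(V*.hh)))*:coev_left B hh :. RunInv B ((hh*.W)*.(M*.(V*.hh)))"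
    by (rule pairing_action_factor[OF G]) (simp_all add: V E hopf_hom)
  note hs = V(1-4) E EA erho_hom pairing_actionD(1,2)[OF G] hopf_hom
  have "beq B [hh, ll, M, V, W] [coev_left B hh, w, mul H, G (V*.hh) W (erho V W w e), G ll hh (ev_left B hh), G (V*.hh) (hh*.W) E, G ((V*.hh)*.hh) W (E :. Asc B (V*.hh) hh W)]
    ($$4 ;; Id $0##$$3##Id $1 ;; Id $0##Ai $4 ($2**$3**$0) $1 ;; Id $0##Id $4##Ai $2 ($3**$0) $1 ;; Id $0##Id $4##Id $2##Ai $3 $0 $1 ;; Id $0##Id $4##As $2 $3 ($0**$1) ;; Id $0##As $4 ($2**$3) ($0**$1) ;; As $0 ($4**$2**$3) ($0**$1) ;; Id ($0**$4**$2**$3)##$$2##Id $1 ;; Id ($0**$4**$2**$3)##Ai $0 $0 $1 ;; Ai $0 ($4**$2**$3) ($0**$0**$1) ;; Id $0##Ai $4 ($2**$3) ($0**$0**$1) ;; Id $0##Id $4##Ai $2 $3 ($0**$0**$1) ;; Id $0##Id $4##Id $2##As $3 $0 ($0**$1) ;; Id $0##Id $4##As $2 ($3**$0) ($0**$1) ;; Id $0##As $4 ($2**$3**$0) ($0**$1) ;; As $0 ($4**$2**$3**$0) ($0**$1) ;; Id ($0**$4**$2**$3**$0)##$$0 ;; Ri ($0**$4**$2**$3**$0))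
    ($$3 ;; $$1##Id ($2**$3**$0) ;; Ai $0 $4 ($2**$3**$0))"
    by (rule braid_diagram[of "[(Ue, $0**$1), ($0**$4, $4), ($0**$0, $0), ($4**$2**$3**$0, $2), ($0**$2**$1, $2), (($0**$4)**$2**$3**$0, $2), ($4**$2**($3**$0)**$0, $2)]"
  "[($$5, $$3 ;; $$1##Id $2##Id ($3**$0)), ($$6, $$3 ;; Id $4##Id $2##(Id $3##$$2 ;; As $3 $0 $0)), ($$5, fad ($3**$0) $0 $4 $1 $2 $$4 $$6 $$0)]" _ _ "[RB 1 1 1, RB 0 0 2, RF 0 0 0]"],
  code_simp, simp add: hs, simp only: diag_simps, (intro conjI TrueI a b c; simp add: hs))
  then show ?thesis by simp
qed

text \<open>For linear \<open>e\<close> one has \<open>e(h' v, w) = e(v, S(h') w)\<close>; under the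
  action on \<open>W\<close> this moves the action on \<open>v\<close> to an antipode factor left of
  \<open>h\<close>.\<close>

lemma erho_linear:
  assumes V: "V \<in> Ob B" "v \<in> Hom B (hh*.V) V" and W: "is_hopf_module B H W w" and e: "e \<in> Hom B (V*.W) \<one>"
    and l: "e :. tensor_action B H V v W w = triv \<one> :. (Ide B hh*:e)"
  shows "erho V W w e :. ((v*:Ide B hh)*:Ide B W) = erho V W w e :. ((Ide B V*:(mul H :. antipode H*:Ide B hh) :. Asc B V hh hh :. Braid B hh V*:Ide B hh)*:Ide B W)"
    "Ide B V*:(mul H :. antipode H*:Ide B hh) :. Asc B V hh hh :. Braid B hh V*:Ide B hh \<in> Hom B ((hh*.V)*.hh) (V*.hh)"
proof -
  have "beq B [hh, V, W] [mul H, unt H, comul H, counit H, antipode H, w, v, e]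
    (($$7 ;; Id $1##$$5 ;; As $1 $0 $2) ;; ($$6##Id $0)##Id $2)
    (($$7 ;; Id $1##$$5 ;; As $1 $0 $2) ;; (Id $1##($$0 ;; $$4##Id $0) ;; As $1 $0 $0 ;; Br $0 $1##Id $0)##Id $2)"
    by (rule braid_diagram[of "[($0**$0, $0), (Ue, $0), ($0, $0**$0), ($0, Ue), ($0, $0), ($0**$2, $2), ($0**$1, $1), ($1**$2, Ue)]"
  "[(As $0 $0 $0 ;; $$2##Id $0 ;; $$2, Id $0##$$2 ;; $$2), (Lu $0 ;; $$3##Id $0 ;; $$2, Id $0), (Ru $0 ;; Id $0##$$3 ;; $$2, Id $0), ($$0 ;; Id $0##$$4 ;; $$2, $$1 ;; $$3), ($$5 ;; $$0##Id $2, $$5 ;; Id $0##$$5 ;; As $0 $0 $2), ($$5 ;; $$1##Id $2, Lu $2), ($$7 ;; $$6##$$5 ;; msd $0 $0 $1 $2 ;; $$2##Id ($1**$2), (Lu Ue ;; $$3##Id Ue) ;; Id $0##$$7)]" _ _ "[RB 0 0 2, NB 1 1 False True 1 (Ge 3) False, SR 2, RB 5 1 5, SR 4, RB 3 1 3, SL 5, RF 6 1 4, RB 5 2 4, SL 2, NB 1 1 False True 1 (Ge 2) True, SL 4, SL 3, SL 5, SL 4, SL 6, SL 5, SR 5, SR 4, SR 3, SR 6, SR 5, SR 4, RB 0 0 0, SL 1, SL 4, SL 3, SL 2, SL 5, SL 4, SL 3, SL 6, SL 5, SL 4, RF 5 0 6, SR 5, SR 4, SR 3, SR 2, SR 1,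 RF 0 0 1]"],
  code_simp, simp add: V e hmodD(1,2)[OF W] hopf_hom, simp only: diag_simps, (intro conjI TrueI l[unfolded tensor_action_def middle_swap_def] hmodD(3,4)[OF W] hopf_rel; simp add: V e hmodD(1,2)[OF W] hopf_hom))
  then show "erho V W w e :. ((v*:Ide B hh)*:Ide B W) = erho V W w e :. ((Ide B V*:(mul H :. antipode H*:Ide B hh) :. Asc B V hh hh :. Braid B hh V*:Ide B hh)*:Ide B W)" by (simp add: erho_def)
  have "bhom B [hh, V] [mul H, antipode H]
    (Id $1##($$0 ;; $$1##Id $0) ;; As $1 $0 $0 ;; Br $0 $1##Id $0) (($0**$1)**$0) ($1**$0)"
    by (rule braid_diagram_hom[of "[($0**$0, $0), ($0, $0)]"], code_simp, simp add: V hopf_hom)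
  then show "Ide B V*:(mul H :. antipode H*:Ide B hh) :. Asc B V hh hh :. Braid B hh V*:Ide B hh \<in> Hom B ((hh*.V)*.hh) (V*.hh)" by simp
qed

section \<open>The anti-Yetter-Drinfeld action in \<open>B\<close>, and linearity of
  \<open>JC\<close>\<close>

definition aev :: "'o \<Rightarrow> 'a" where
  "aev M = Lun B M :. ev_right B hh*:Ide B M :. AscInv B hh kk M"

definition acur :: "'o \<Rightarrow> 'a \<Rightarrow> 'a" where
  "acur N f = Ide B kk*:f :. Asc B kk hh N :. coev_right B hh*:Ide B N :. LunInv B N"

definition rr1 :: "'o \<Rightarrow> 'a" where
  "rr1 M = acur (hh*.(kk*.M)) (aev M :. mul H*:Ide B (kk*.M) :. AscInv B hh hh (kk*.M))"

definition rr0 :: "'o \<Rightarrow> 'a \<Rightarrow> 'a" where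
  "rr0 M r = acur (hh*.(kk*.M)) (r :. Ide B hh*:aev M :. Asc B hh hh (kk*.M) :. (Ide B hh*:mul H)*:Ide B (kk*.M) :. (Ide B hh*:antipode H*:Ide B hh)*:Ide B (kk*.M) :. Asc B hh hh hh*:Ide B (kk*.M) :. (comul H*:Ide B hh)*:Ide B (kk*.M) :. Braid B hh hh*:Ide B (kk*.M) :. AscInv B hh hh (kk*.M))"

text \<open>\<open>aYD_act\<close> for \<open>HH_module\<close> in terms of morphisms of
  \<open>B\<close>, just as \<open>aev\<close>, \<open>acur\<close>, \<open>rr1\<close> and
  \<open>rr0\<close> restate its ingredients; in this form diagrams apply. The agreement is
  \<open>aYD_act_HH_module\<close>.\<close>

definition aact :: "'o \<Rightarrow> ('o \<Rightarrow> 'o \<Rightarrow> 'a \<Rightarrow> 'a) \<Rightarrow> 'a \<Rightarrow> 'a" where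
  "aact M G r = rr1 M :. ebr hh (kk*.M) (gact kk M G) :. Ide B hh*:rr0 M r :. Asc B hh hh (kk*.M) :. comul H*:Ide B (kk*.M)"

lemma aev_hom: "M \<in> Ob B \<Longrightarrow> aev M \<in> Hom B (hh*.(kk*.M)) M"
proof -
  assume M: "M \<in> Ob B"
  have "bhom B [hh, kk, M] [ev_right B hh]
    (Lu $2 ;; $$0##Id $2 ;; Ai $0 $1 $2) ($0**$1**$2) ($2)"
    by (rule braid_diagram_hom[of "[($0**$1, Ue)]"], code_simp, simp add: M hopf_hom)
  then show ?thesis by (simp add: aev_def)
qed

lemma acur:
  assumes a: "M \<in> Ob B" "N \<in> Ob B" "f \<in> Hom B (hh*.N) M"
  shows "acur N f \<in> Hom B N (kk*.M)" "aev M :. (Ide B hh*:acur N f) = f"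
proof -
  have "bhom B [hh, kk, M, N] [coev_right B hh, f]
    (Id $1##$$1 ;; As $1 $0 $3 ;; $$0##Id $3 ;; Li $3) ($3) ($1**$2)"
    by (rule braid_diagram_hom[of "[(Ue, $1**$0), ($0**$3, $2)]"], code_simp, simp add: a hopf_hom)
  then show "acur N f \<in> Hom B N (kk*.M)" by (simp add: acur_def)
  have "beq B [hh, kk, M, N] [ev_right B hh, coev_right B hh, f]
    ((Lu $2 ;; $$0##Id $2 ;; Ai $0 $1 $2) ;; Id $0##(Id $1##$$2 ;; As $1 $0 $3 ;; $$1##Id $3 ;; Li $3))
    ($$2)"
    by (rule braid_diagram[of "[($0**$1, Ue), (Ue, $1**$0), ($0**$3, $2)]"
  "[zl $0 $1 $$0 $$1]" _ _ "[SR 1, RF 0 0 0]"],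
  code_simp, simp add: a hopf_hom, simp only: diag_simps, (intro conjI TrueI zigzags; simp add: a hopf_hom))
  then show "aev M :. (Ide B hh*:acur N f) = f" by (simp add: acur_def aev_def)
qed

text \<open>An arrow into \<open>kk \<otimes> M\<close> is determined by its evaluation on
  \<open>H\<close>, being recovered from it by \<open>acur\<close>. This removes dual legs from
  equations.\<close>

lemma aev_inj:
  assumes a: "M \<in> Ob B" "N \<in> Ob B" and g: "g \<in> Hom B N (kk*.M)" "k \<in> Hom B N (kk*.M)"
    and eq: "aev M :. (Ide B hh*:g) = aev M :. (Ide B hh*:k)"
  shows "g = k"
proof -
  have "acur N (aev M :. (Ide B hh*:g)) = g" if g: "g \<in> Hom B N (kk*.M)" for g
  proof -
  have "beq B [hh, kk, M, N] [ev_right B hh, coev_right B hh, g]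
    (Id $1##((Lu $2 ;; $$0##Id $2 ;; Ai $0 $1 $2) ;; Id $0##$$2) ;; As $1 $0 $3 ;; $$1##Id $3 ;; Li $3)
    ($$2)"
    by (rule braid_diagram[of "[($0**$1, Ue), (Ue, $1**$0), ($3, $1**$2)]"
  "[zr $1 $0 $$0 $$1]" _ _ "[SL 0, RF 1 0 0]"],
  code_simp, simp add: a g hopf_hom, simp only: diag_simps, (intro conjI TrueI zigzags; simp add: a g hopf_hom))
    then show ?thesis by (simp add: acur_def aev_def)
  qed
  then show ?thesis using g eq by metis
qed

lemma rr_hom:
  assumes M: "M \<in> Ob B" and r: "r \<in> Hom B (hh*.M) M"
  shows "rr0 M r \<in> Hom B (hh*.(kk*.M)) (kk*.M)"
    "rr1 M \<in> Hom B (hh*.(kk*.M)) (kk*.M)"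
    "aev M :. (Ide B hh*:rr0 M r) = r :. Ide B hh*:aev M :. Asc B hh hh (kk*.M) :. (Ide B hh*:mul H)*:Ide B (kk*.M) :. (Ide B hh*:antipode H*:Ide B hh)*:Ide B (kk*.M) :. Asc B hh hh hh*:Ide B (kk*.M) :. (comul H*:Ide B hh)*:Ide B (kk*.M) :. Braid B hh hh*:Ide B (kk*.M) :. AscInv B hh hh (kk*.M)"
    "aev M :. (Ide B hh*:rr1 M) = aev M :. mul H*:Ide B (kk*.M) :. AscInv B hh hh (kk*.M)"
proof -
  have "bhom B [hh, kk, M] [aev M, r, mul H, comul H, antipode H]
    ($$1 ;; Id $0##$$0 ;; As $0 $0 ($1**$2) ;; (Id $0##$$2)##Id ($1**$2) ;; (Id $0##$$4##Id $0)##Id ($1**$2) ;; As $0 $0 $0##Id ($1**$2) ;; ($$3##Id $0)##Id ($1**$2) ;; Br $0 $0##Id ($1**$2) ;; Ai $0 $0 ($1**$2)) ($0**$0**$1**$2) ($2)"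
    by (rule braid_diagram_hom[of "[($0**$1**$2, $2), ($0**$2, $2), ($0**$0, $0), ($0, $0**$0), ($0, $0)]"], code_simp, simp add: M r aev_hom hopf_hom)
  note a = acur[OF M _ this[simplified]]
  show "rr0 M r \<in> Hom B (hh*.(kk*.M)) (kk*.M)"
    "aev M :. (Ide B hh*:rr0 M r) = r :. Ide B hh*:aev M :. Asc B hh hh (kk*.M) :. (Ide B hh*:mul H)*:Ide B (kk*.M) :. (Ide B hh*:antipode H*:Ide B hh)*:Ide B (kk*.M) :. Asc B hh hh hh*:Ide B (kk*.M) :. (comul H*:Ide B hh)*:Ide B (kk*.M) :. Braid B hh hh*:Ide B (kk*.M) :. AscInv B hh hh (kk*.M)"
    unfolding rr0_def by (rule a; simp add: M hopf_hom)+
  have "bhom B [hh, kk, M] [aev M, mul H]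
    ($$0 ;; $$1##Id ($1**$2) ;; Ai $0 $0 ($1**$2)) ($0**$0**$1**$2) ($2)"
    by (rule braid_diagram_hom[of "[($0**$1**$2, $2), ($0**$0, $0)]"], code_simp, simp add: M aev_hom hopf_hom)
  note a = acur[OF M _ this[simplified]]
  show "rr1 M \<in> Hom B (hh*.(kk*.M)) (kk*.M)"
    "aev M :. (Ide B hh*:rr1 M) = aev M :. mul H*:Ide B (kk*.M) :. AscInv B hh hh (kk*.M)"
    unfolding rr1_def by (rule a; simp add: M hopf_hom)+
qed

lemma aev_JC:
  assumes G: "pairing_action B M G" and V: "V \<in> Ob B" "W \<in> Ob B" "w \<in> Hom B (hh*.W) W" "e \<in> Hom B (V*.W) \<one>"
  shows "aev M :. (Ide B hh*:JC M G V W w e) = G (V*.hh) W (erho V W w e) :. Ide B W*:Asc B M V hh :. Asc B W (M*.V) hh :. Braid B hh (W*.(M*.V))"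
proof -
  note hs = V erho_hom pairing_actionD(1,2)[OF G] hopf_hom
  have "beq B [hh, kk, M, V, W] [ev_right B hh, coev_right B hh, G (V*.hh) W (erho V W w e)]
    ((Lu $2 ;; $$0##Id $2 ;; Ai $0 $1 $2) ;; Id $0##jcd $2 $3 $4 $0 $1 $$2 $$1)
    ($$2 ;; Id $4##As $2 $3 $0 ;; As $4 ($2**$3) $0 ;; Br $0 ($4**$2**$3))"
    by (rule braid_diagram[of "[($0**$1, Ue), (Ue, $1**$0), ($4**$2**$3**$0, $2)]"
  "[zl $0 $1 $$0 $$1]" _ _ "[NB 4 0 False True 2 (Ge 0) False, XX 3 1 False 2 1 True, NB 2 0 True True 0 (Ge 2) False, SR 1, SR 0, SR 2, SR 1, SR 3, SR 2, SL 6, NB 4 3 False True 0 (Ge 0) True, RF 3 3 0]"],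
  code_simp, simp add: hs, simp only: diag_simps, (intro conjI TrueI zigzags; simp add: hs))
  then show ?thesis by (simp add: aev_def JC_def)
qed

lemma aev_rr0_JC:
  assumes G: "pairing_action B M G" and V: "V \<in> Ob B" "W \<in> Ob B" "w \<in> Hom B (hh*.W) W" "e \<in> Hom B (V*.W) \<one>" and r: "r \<in> Hom B (hh*.M) M"
  shows "aev M :. (Ide B hh*:(rr0 M r :. (Ide B hh*:JC M G V W w e))) = r :. Ide B hh*:G (V*.hh) W (erho V W w e) :. Ide B hh*:Ide B W*:Asc B M V hh :. Ide B hh*:Asc B W (M*.V) hh :. Ide B hh*:Braid B hh (W*.(M*.V)) :. Ide B hh*:(mul H :. antipode H*:Ide B hh)*:Ide B (W*.(M*.V)) :. Asc B hh (hh*.hh) (W*.(M*.V)) :. Asc B hh hh hh*:Ide B (W*.(M*.V)) :. (comul H*:Ide B hh)*:Ide B (W*.(M*.V)) :. Braid B hh hh*:Ide B (W*.(M*.V)) :. AscInv B hh hh (W*.(M*.V))"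
proof -
  note M = pairing_actionD(1)[OF G]
  note hs = V r M aev_hom rr_hom(1,2)[OF M r] JC_hom[OF G V] erho_hom pairing_actionD(2)[OF G] hopf_hom
  have "beq B [hh, kk, M, V, W] [aev M, r, G (V*.hh) W (erho V W w e), JC M G V W w e, rr0 M r, mul H, comul H, antipode H]
    ($$0 ;; Id $0##($$4 ;; Id $0##$$3))
    ($$1 ;; Id $0##$$2 ;; Id $0##Id $4##As $2 $3 $0 ;; Id $0##As $4 ($2**$3) $0 ;; Id $0##Br $0 ($4**$2**$3) ;; Id $0##($$5 ;; $$7##Id $0)##Id ($4**$2**$3) ;; As $0 ($0**$0) ($4**$2**$3) ;; As $0 $0 $0##Id ($4**$2**$3) ;; ($$6##Id $0)##Id ($4**$2**$3) ;; Br $0 $0##Id ($4**$2**$3) ;; Ai $0 $0 ($4**$2**$3))"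
    by (rule braid_diagram[of "[($0**$1**$2, $2), ($0**$2, $2), ($4**$2**$3**$0, $2), ($4**$2**$3, $1**$2), ($0**$1**$2, $1**$2), ($0**$0, $0), ($0, $0**$0), ($0, $0)]"
  "[($$0 ;; Id $0##$$3, $$2 ;; Id $4##As $2 $3 $0 ;; As $4 ($2**$3) $0 ;; Br $0 ($4**$2**$3)), ($$0 ;; Id $0##$$4, $$1 ;; Id $0##$$0 ;; As $0 $0 ($1**$2) ;; (Id $0##$$5)##Id ($1**$2) ;; (Id $0##$$7##Id $0)##Id ($1**$2) ;; As $0 $0 $0##Id ($1**$2) ;; ($$6##Id $0)##Id ($1**$2) ;; Br $0 $0##Id ($1**$2) ;; Ai $0 $0 ($1**$2))]" _ _ "[RF 1 0 1, SR 0, SR 1, SR 2, SR 3, RF 4 1 0]"],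
  code_simp, simp add: hs, simp only: diag_simps, (intro conjI TrueI aev_JC[OF G V] rr_hom(3)[OF M r]; simp add: hs))
  then show ?thesis by simp
qed

text \<open>\<open>rr1\<close> multiplies the argument of the functional by the strand that leaves
  the loop of \<open>ebr\<close>. After evaluation the loop survives only as an outer action of
  \<open>ev_left H\<close>.\<close>

lemma aev_ebr:
  assumes G: "pairing_action B M G" and A: "A \<in> Ob B" "n \<in> Hom B A (kk*.M)" and r: "r \<in> Hom B (hh*.M) M"
  shows "aev M :. (Ide B hh*:(rr1 M :. ebr hh (kk*.M) (gact kk M G) :. (Ide B hh*:n)))
    = G ll hh (ev_left B hh) :. Ide B hh*:(aev M :. (Ide B hh*:n))*:Ide B ll :. Ide B hh*:(mul H*:Ide B A :. AscInv B hh hh A :. Ide B hh*:BraidInv B A hh)*:Ide B ll :. Ide B hh*:AscInv B hh (A*.hh) ll :. Ide B hh*:Ide B hh*:AscInv B A hh ll :. Asc B hh hh (A*.(hh*.ll)) :. Braid B hh hh*:Ide B A*:coev_left B hh :. Ide B (hh*.hh)*:RunInv B A :. AscInv B hh hh A"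
proof -
  note M = pairing_actionD(1)[OF G] and rr1 = rr_hom(2)[OF pairing_actionD(1)[OF G] r]
  note rr_1 = rr_hom(4)[OF M r, unfolded aev_def]
  have n2: "aev M :. (Ide B hh*:n) \<in> Hom B (hh*.A) M"
    by (rule cmp_hom[OF _ _ _ _ aev_hom[OF M]]) (use A M in \<open>simp_all add: hopf_hom tar_hom_ide\<close>)
  have n2e: "(Lun B M :. ev_right B hh*:Ide B M :. AscInv B hh kk M) :. Ide B hh*:n = aev M :. (Ide B hh*:n)" by (simp add: aev_def)
  note hs = A M n2 rr1 pairing_actionD(2)[OF G] hopf_hom
  have "beq B [hh, kk, ll, M, A] [coev_left B hh, ev_right B hh, G ll hh (ev_left B hh), mul H, n, aev M :. (Ide B hh*:n), rr1 M]
    ((Lu $3 ;; $$1##Id $3 ;; Ai $0 $1 $3) ;; Id $0##($$6 ;; (Id $0##gad $1 $3 $2 $0 $$2 ;; Id $0##As $0 ($1**$3) $2 ;; As $0 ($0**$1**$3) $2 ;; Bi ($0**$1**$3) $0##Id $2 ;; Ai ($0**$1**$3) $0 $2 ;; Id ($0**$1**$3)##$$0 ;; Ri ($0**$1**$3)) ;; Id $0##$$4))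
    ($$2 ;; Id $0##$$5##Id $2 ;; Id $0##($$3##Id $4 ;; Ai $0 $0 $4 ;; Id $0##Bi $4 $0)##Id $2 ;; Id $0##Ai $0 ($4**$0) $2 ;; Id $0##Id $0##Ai $4 $0 $2 ;; As $0 $0 ($4**$0**$2) ;; Br $0 $0##Id $4##$$0 ;; Id ($0**$0)##Ri $4 ;; Ai $0 $0 $4)"
    by (rule braid_diagram[of "[(Ue, $0**$2), ($0**$1, Ue), ($0**$3**$2, $3), ($0**$0, $0), ($4, $1**$3), ($0**$4, $3), ($0**$1**$3, $1**$3)]"
  "[((Lu $3 ;; $$1##Id $3 ;; Ai $0 $1 $3) ;; Id $0##$$6, (Lu $3 ;; $$1##Id $3 ;; Ai $0 $1 $3) ;; $$3##Id ($1**$3) ;; Ai $0 $0 ($1**$3)), ((Lu $3 ;; $$1##Id $3 ;; Ai $0 $1 $3) ;; Id $0##$$4, $$5)]" _ _ "[RF 7 0 0, SL 0, SR 6, SR 5, SR 7, NB 1 2 False False 0 (Ge 4) False, SR 2, SR 3, NB 6 0 False True 0 (Ge 1) False, XX 5 1 False 0 1 True, SR 4, RF 5 1 1, NB 3 0 False True 0 (Ge 3) False, XX 2 1 False 0 0 True, SR 1, SR 0]"],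
  code_simp, simp add: hs, simp only: diag_simps, (intro conjI TrueI rr_1 n2e zigzags; simp add: hs))
  then show ?thesis by (simp add: aev_def ebr_def gact_def)
qed

lemma aact_hom:
  assumes G: "pairing_action B M G" and r: "r \<in> Hom B (hh*.M) M"
  shows "aact M G r \<in> Hom B (hh*.(kk*.M)) (kk*.M)"
proof -
  note M = pairing_actionD(1)[OF G]
  have K: "kk \<in> Ob B" by (simp add: hopf_hom)
  have "bhom B [hh, kk, M] [rr0 M r, rr1 M, ebr hh (kk*.M) (gact kk M G), comul H]
    ($$1 ;; $$2 ;; Id $0##$$0 ;; As $0 $0 ($1**$2) ;; $$3##Id ($1**$2)) ($0**$1**$2) ($1**$2)"
    by (rule braid_diagram_hom[of "[($0**$1**$2, $1**$2), ($0**$1**$2, $1**$2), ($0**$1**$2, $0**$1**$2), ($0, $0**$0)]"], code_simp, simp add: M rr_hom[OF M r] ebr_hom[OF pairing_action_gact[OF G K] carr_ob] hopf_hom)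
  then show ?thesis by (simp add: aact_def)
qed

text \<open>Both sides are compared after evaluation on some \<open>h'\<close>. In the diagonal
  action \<open>h_1\<close>, \<open>h_2\<close>, \<open>h_3\<close> act on \<open>w\<close>,
  \<open>m\<close>, \<open>v\<close>; \<open>K1\<close> and \<open>K2\<close> collect the first and
  the last of them into \<open>S(h_3) h' h_1\<close> inside the pairing, and \<open>K3\<close> takes
  \<open>h_2\<close> out of \<open>G\<close>. This is what the definition of \<open>aact\<close>
  produces.\<close>

lemma JC_linear:
  assumes G: "pairing_action B M G" and v: "is_hopf_module B H V v" and w: "is_hopf_module B H W w" and e: "e \<in> Hom B (V*.W) \<one>"
    and l: "e :. tensor_action B H V v W w = triv \<one> :. (Ide B hh*:e)" and r: "is_hopf_module B H M r"
    and rG: "\<And>X Y e. \<lbrakk>X \<in> Ob B; Y \<in> Ob B; e \<in> Hom B (X*.Y) \<one>\<rbrakk>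
      \<Longrightarrow> r :. gact hh M G X Y e = G X Y e :. (Ide B Y*:(r*:Ide B X))"
  shows "aact M G r :. (Ide B hh*:JC M G V W w e) = JC M G V W w e :. tensor_action B H W w (M*.V) (tensor_action B H M r V v)"
proof -
  note mo = hmodD(1)[OF v] hmodD(1)[OF w] hmodD(1)[OF r] and v1 = hmodD(2)[OF v] and w1 = hmodD(2)[OF w] and r1 = hmodD(2)[OF r]
  note V = mo(1,2) w1 e
  have o: "hh*.(W*.(M*.V)) \<in> Ob B" "kk*.M \<in> Ob B" "hh*.(kk*.M) \<in> Ob B" "W*.(M*.V) \<in> Ob B" by (simp_all add: mo hopf_hom)
  note J = JC_hom[OF G V] and K1 = erho_factor[OF G V hmodD(3)[OF w]]
  have K2: "G (V*.hh) W (erho V W w e) :. Ide B W*:Ide B M*:v*:Ide B hh = G (V*.hh) W (erho V W w e) :. Ide B W*:Ide B M*:(Ide B V*:(mul H :. antipode H*:Ide B hh) :. Asc B V hh hh :. Braid B hh V*:Ide B hh)"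
    by (rule pairing_action_eq[OF G, where X' = "(hh*.V)*.hh" and Y' = W])
      (simp_all add: erho_linear[OF mo(1) v1 w e l] V v1 erho_hom ide_hom tar_hom_ide hopf_hom)
  have k3: "r :. gact hh M G (V*.hh) W (erho V W w e) = G (V*.hh) W (erho V W w e) :. (Ide B W*:(r*:Ide B (V*.hh)))"
    by (rule rG) (simp_all add: V erho_hom hopf_hom)
  note hs = mo e r1 v1 w1 erho_hom pairing_actionD(2)[OF G] hopf_hom
  have "beq B [hh, W, V, M] [r, G (V*.hh) W (erho V W w e)]
    ($$0 ;; Id $0##$$1)
    ($$1 ;; Id $1##$$0##Id ($2**$0) ;; Id $1##Ai $0 $3 ($2**$0) ;; As $1 $0 ($3**$2**$0) ;; Br $0 $1##Id ($3**$2**$0) ;; Ai $0 $1 ($3**$2**$0))"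
    by (rule braid_diagram[of "[($0**$3, $3), ($1**$3**$2**$0, $3)]"
  "[($$0 ;; gad $0 $3 ($2**$0) $1 $$1, $$1 ;; Id $1##$$0##Id ($2**$0))]" _ _ "[XX 0 0 True 0 1 False, RF 1 0 0]"],
  code_simp, simp add: hs, simp only: diag_simps, (intro conjI TrueI k3[unfolded gact_def]; simp add: hs))
  then have K3: "r :. Ide B hh*:G (V*.hh) W (erho V W w e) = G (V*.hh) W (erho V W w e) :. Ide B W*:r*:Ide B (V*.hh) :. Ide B W*:AscInv B hh M (V*.hh) :. Asc B W hh (M*.(V*.hh)) :. Braid B hh W*:Ide B (M*.(V*.hh)) :. AscInv B hh W (M*.(V*.hh))" by simp
  have k4: "r :. gact hh M G ll hh (ev_left B hh) = G ll hh (ev_left B hh) :. (Ide B hh*:(r*:Ide B ll))"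
    by (rule rG) (simp_all add: hopf_hom)
  note hs = mo e r1 v1 w1 erho_hom pairing_actionD(2)[OF G] hopf_hom
  have "beq B [hh, ll, M] [r, G ll hh (ev_left B hh)]
    ($$0 ;; Id $0##$$1)
    ($$1 ;; Id $0##$$0##Id $1 ;; Id $0##Ai $0 $2 $1 ;; As $0 $0 ($2**$1) ;; Br $0 $0##Id ($2**$1) ;; Ai $0 $0 ($2**$1))"
    by (rule braid_diagram[of "[($0**$2, $2), ($0**$2**$1, $2)]"
  "[($$0 ;; gad $0 $2 $1 $0 $$1, $$1 ;; Id $0##$$0##Id $1)]" _ _ "[XX 0 0 True 0 0 False, RF 1 0 0]"],
  code_simp, simp add: hs, simp only: diag_simps, (intro conjI TrueI k4[unfolded gact_def]; simp add: hs))
  then have K4: "r :. Ide B hh*:G ll hh (ev_left B hh) = G ll hh (ev_left B hh) :. Ide B hh*:r*:Ide B ll :. Ide B hh*:AscInv B hh M ll :. Asc B hh hh (M*.ll) :. Braid B hh hh*:Ide B (M*.ll) :. AscInv B hh hh (M*.ll)" by simp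
  \<comment> \<open>The two sides after evaluation, with \<open>JC\<close>, \<open>rr0\<close>,
    \<open>rr1\<close> and \<open>ebr\<close> eliminated: \<open>?FL\<close> comes from the diagonal
    action, \<open>?FR\<close> from \<open>aact\<close>.\<close>
  let ?FL = "(G (V*.hh) W (erho V W w e) :. Ide B W*:Asc B M V hh :. Asc B W (M*.V) hh :. Braid B hh (W*.(M*.V))) :. Ide B hh*:(w*:(r*:v :. (AscInv B hh M (hh*.V) :. Ide B hh*:(Asc B M hh V :. Braid B hh M*:Ide B V :. AscInv B hh M V) :. Asc B hh hh (M*.V)) :. comul H*:Ide B (M*.V)) :. (AscInv B hh W (hh*.(M*.V)) :. Ide B hh*:(Asc B W hh (M*.V) :. Braid B hh W*:Ide B (M*.V) :. AscInv B hh W (M*.V)) :. Asc B hh hh (W*.(M*.V))) :. comul H*:Ide B (W*.(M*.V)))" and ?FR = "(G ll hh (ev_left B hh) :. Ide B hh*:(r :. Ide B hh*:G (V*.hh) W (erho V W w e) :. Ide B hh*:Ide B W*:Asc B M V hh :. Ide B hh*:Asc B W (M*.V) hh :. Ide B hh*:Braid B hh (W*.(M*.V)) :. Ide B hh*:(mul H :. antipode H*:Ide B hh)*:Ide B (W*.(M*.V)) :. Asc B hh (hh*.hh) (W*.(M*.V)) :. Asc B hh hh hh*:Ide B (W*.(M*.V)) :. (comul H*:Ide B hh)*:Ide B (W*.(M*.V)) :. Braid B hh hh*:Ide B (W*.(M*.V)) :. AscInv B hh hh (W*.(M*.V)))*:Ide B ll :. Ide B hh*:(mul H*:Ide B (hh*.(W*.(M*.V)))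 :. AscInv B hh hh (hh*.(W*.(M*.V))) :. Ide B hh*:BraidInv B (hh*.(W*.(M*.V))) hh)*:Ide B ll :. Ide B hh*:(Ide B hh*:AscInv B hh (W*.(M*.V)) hh)*:Ide B ll :. Ide B hh*:(Ide B hh*:Ide B hh*:AscInv B W (M*.V) hh)*:Ide B ll :. Ide B hh*:(Ide B hh*:Ide B hh*:Ide B W*:AscInv B M V hh)*:Ide B ll :. Ide B hh*:AscInv B hh (hh*.(W*.(M*.(V*.hh)))) ll :. Ide B hh*:Ide B hh*:AscInv B hh (W*.(M*.(V*.hh))) ll :. Ide B hh*:Ide B hh*:Ide B hh*:AscInv B W (M*.(V*.hh)) ll :. Ide B hh*:Ide B hh*:Ide B hh*:Ide B W*:AscInv B M (V*.hh) ll :. Ide B hh*:Ide B hh*:Ide B hh*:Ide B W*:Ide B M*:AscInv B V hh ll :. Asc B hh hh (hh*.(W*.(M*.(V*.(hh*.ll))))) :. Ide B (hh*.hh)*:Ide B hh*:Ide B W*:Asc B M V (hh*.ll) :. Ide B (hh*.hh)*:Ide B hh*:Asc B W (M*.V) (hh*.ll) :. Ide B (hh*.hh)*:Asc B hh (W*.(M*.V)) (hh*.ll) :. Braid B hh hh*:Ide B (hh*.(W*.(M*.V)))*:coev_left B hh :. Ide B (hh*.hh)*:RunInv B (hh*.(W*.(M*.V))) :. AscInv B hh hh (hh*.(W*.(M*.V)))) :. Ide B hh*:(Asc B hh hh (W*.(M*.V)) :. comul H*:Ide B (W*.(M*.V)))"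
  note jr = aev_JC[OF G V]
  note hs = J aev_hom mo e r1 v1 w1 erho_hom pairing_actionD(2)[OF G] hopf_hom
  have "beq B [hh, kk, W, V, M] [w, v, r, aev M, G (V*.hh) W (erho V W w e), JC M G V W w e, comul H]
    ($$3 ;; Id $0##($$5 ;; $$0##($$2##$$1 ;; msd $0 $0 $4 $3 ;; $$6##Id ($4**$3)) ;; msd $0 $0 $2 ($4**$3) ;; $$6##Id ($2**$4**$3)))
    (($$4 ;; Id $2##As $4 $3 $0 ;; As $2 ($4**$3) $0 ;; Br $0 ($2**$4**$3)) ;; Id $0##($$0##($$2##$$1 ;; msd $0 $0 $4 $3 ;; $$6##Id ($4**$3)) ;; msd $0 $0 $2 ($4**$3) ;; $$6##Id ($2**$4**$3)))"
    by (rule braid_diagram[of "[($0**$2, $2), ($0**$3, $3), ($0**$4, $4), ($0**$1**$4, $4), ($2**$4**$3**$0, $4), ($2**$4**$3, $1**$4), ($0, $0**$0)]"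
  "[($$3 ;; Id $0##$$5, $$4 ;; Id $2##As $4 $3 $0 ;; As $2 ($4**$3) $0 ;; Br $0 ($2**$4**$3))]" _ _ "[RF 7 0 0]"],
  code_simp, simp add: hs, simp only: diag_simps, (intro conjI TrueI jr; simp add: hs))
  then have L: "aev M :. (Ide B hh*:(JC M G V W w e :. tensor_action B H W w (M*.V) (tensor_action B H M r V v))) = ?FL"
    by (simp add: tensor_action_def middle_swap_def)
  let ?A = "kk" and ?n = "rr0 M r :. (Ide B hh*:JC M G V W w e)"
  have n: "?n \<in> Hom B (hh*.(W*.(M*.V))) (?A*.M)"
    by (rule cmp_hom[OF _ _ _ _ rr_hom(1)[OF mo(3) r1]]) (simp_all add: o J tar_hom_ide hopf_hom)
  note eb = aev_ebr[OF G o(1) n r1]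
  have eh: "ebr hh (?A*.M) (gact ?A M G) \<in> Hom B (hh*.(?A*.M)) (hh*.(?A*.M))"
    by (rule ebr_hom[OF pairing_action_gact[OF G]]) (simp_all add: hopf_hom)
  note hs = rr_hom(1,2)[OF mo(3) r1] eh J aev_hom mo e r1 v1 w1 erho_hom pairing_actionD(2)[OF G] hopf_hom
  have "beq B [hh, kk, ll, W, V, M] [rr0 M r, rr1 M, ebr hh (kk*.M) (gact kk M G), r, aev M, G (V*.hh) W (erho V W w e), G ll hh (ev_left B hh), JC M G V W w e, mul H, comul H, antipode H, coev_left B hh]
    ($$4 ;; Id $0##(($$1 ;; $$2 ;; Id $0##$$0 ;; As $0 $0 ($1**$5) ;; $$9##Id ($1**$5)) ;; Id $0##$$7))
    (($$6 ;; Id $0##($$3 ;; Id $0##$$5 ;; Id $0##Id $3##As $5 $4 $0 ;; Id $0##As $3 ($5**$4) $0 ;; Id $0##Br $0 ($3**$5**$4) ;; Id $0##($$8 ;; $$10##Id $0)##Id ($3**$5**$4) ;; As $0 ($0**$0) ($3**$5**$4) ;; As $0 $0 $0##Id ($3**$5**$4) ;; ($$9##Id $0)##Id ($3**$5**$4) ;; Br $0 $0##Id ($3**$5**$4) ;; Ai $0 $0 ($3**$5**$4))##Id $2 ;; Id $0##($$8##Id ($0**$3**$5**$4) ;; Ai $0 $0 ($0**$3**$5**$4) ;; Id $0##Bi ($0**$3**$5**$4) $0)##Id $2 ;; Id $0##(Id $0##Ai $0 ($3**$5**$4) $0)##Id $2 ;; Id $0##(Id $0##Id $0##Ai $3 ($5**$4)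 $0)##Id $2 ;; Id $0##(Id $0##Id $0##Id $3##Ai $5 $4 $0)##Id $2 ;; Id $0##Ai $0 ($0**$3**$5**$4**$0) $2 ;; Id $0##Id $0##Ai $0 ($3**$5**$4**$0) $2 ;; Id $0##Id $0##Id $0##Ai $3 ($5**$4**$0) $2 ;; Id $0##Id $0##Id $0##Id $3##Ai $5 ($4**$0) $2 ;; Id $0##Id $0##Id $0##Id $3##Id $5##Ai $4 $0 $2 ;; As $0 $0 ($0**$3**$5**$4**$0**$2) ;; Id ($0**$0)##Id $0##Id $3##As $5 $4 ($0**$2) ;; Id ($0**$0)##Id $0##As $3 ($5**$4) ($0**$2) ;; Id ($0**$0)##As $0 ($3**$5**$4) ($0**$2) ;; Br $0 $0##Id ($0**$3**$5**$4)##$$11 ;; Id ($0**$0)##Ri ($0**$3**$5**$4) ;; Ai $0 $0 ($0**$3**$5**$4)) ;; Id $0##(As $0 $0 ($3**$5**$4) ;; $$9##Id ($3**$5**$4)))"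
    by (rule braid_diagram[of "[($0**$1**$5, $1**$5), ($0**$1**$5, $1**$5), ($0**$1**$5, $0**$1**$5), ($0**$5, $5), ($0**$1**$5, $5), ($3**$5**$4**$0, $5), ($0**$5**$2, $5), ($3**$5**$4, $1**$5), ($0**$0, $0), ($0, $0**$0), ($0, $0), (Ue, $0**$2)]"
  "[($$4 ;; Id $0##($$0 ;; Id $0##$$7), $$3 ;; Id $0##$$5 ;; Id $0##Id $3##As $5 $4 $0 ;; Id $0##As $3 ($5**$4) $0 ;; Id $0##Br $0 ($3**$5**$4) ;; Id $0##($$8 ;; $$10##Id $0)##Id ($3**$5**$4) ;; As $0 ($0**$0) ($3**$5**$4) ;; As $0 $0 $0##Id ($3**$5**$4) ;; ($$9##Id $0)##Id ($3**$5**$4) ;; Br $0 $0##Id ($3**$5**$4) ;; Ai $0 $0 ($3**$5**$4)), ($$4 ;; Id $0##($$1 ;; $$2 ;; Id $0##($$0 ;; Id $0##$$7)), $$6 ;; Id $0##($$4 ;; Id $0##($$0 ;; Id $0##$$7))##Id $2 ;; Id $0##($$8##Id ($0**$3**$5**$4) ;; Ai $0 $0 ($0**$3**$5**$4) ;; Id $0##Bi ($0**$3**$5**$4) $0)##Id $2 ;; Id $0##Ai $0 (($0**$3**$5**$4)**$0) $2 ;; Id $0##Id $0##Ai ($0**$3**$5**$4) $0 $2 ;; As $0 $0 (($0**$3**$5**$4)**$0**$2) ;; Br $0 $0##Id ($0**$3**$5**$4)##$$11 ;; Id ($0**$0)##Ri ($0**$3**$5**$4) ;; Ai $0 $0 ($0**$3**$5**$4))]"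 _ _ "[SR 0, RF 1 0 1, RF 8 1 0]"],
  code_simp, simp add: hs, simp only: diag_simps, (intro conjI TrueI aev_rr0_JC[OF G V r1] eb; simp add: hs))
  then have R: "aev M :. (Ide B hh*:(aact M G r :. (Ide B hh*:JC M G V W w e))) = ?FR"
    by (simp add: aact_def)
  note hs = mo e r1 v1 w1 erho_hom pairing_actionD(2)[OF G] hopf_hom
  \<comment> \<open>The core computation. Besides naturality of crossings its relations are
    associativity, coassociativity, \<open>K1\<close>, \<open>K2\<close> and
    \<open>K3\<close>.\<close>
  have "beq B [hh, ll, W, V, M] [mul H, comul H, antipode H, coev_left B hh, w, v, r, G (V*.hh) W (erho V W w e), G ll hh (ev_left B hh)]
    (($$7 ;; Id $2##As $4 $3 $0 ;; As $2 ($4**$3) $0 ;; Br $0 ($2**$4**$3)) ;; Id $0##($$4##($$6##$$5 ;; msd $0 $0 $4 $3 ;; $$1##Id ($4**$3)) ;; msd $0 $0 $2 ($4**$3) ;; $$1##Id ($2**$4**$3)))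
    (($$8 ;; Id $0##($$6 ;; Id $0##$$7 ;; Id $0##Id $2##As $4 $3 $0 ;; Id $0##As $2 ($4**$3) $0 ;; Id $0##Br $0 ($2**$4**$3) ;; Id $0##($$0 ;; $$2##Id $0)##Id ($2**$4**$3) ;; As $0 ($0**$0) ($2**$4**$3) ;; As $0 $0 $0##Id ($2**$4**$3) ;; ($$1##Id $0)##Id ($2**$4**$3) ;; Br $0 $0##Id ($2**$4**$3) ;; Ai $0 $0 ($2**$4**$3))##Id $1 ;; Id $0##($$0##Id ($0**$2**$4**$3) ;; Ai $0 $0 ($0**$2**$4**$3) ;; Id $0##Bi ($0**$2**$4**$3) $0)##Id $1 ;; Id $0##(Id $0##Ai $0 ($2**$4**$3) $0)##Id $1 ;; Id $0##(Id $0##Id $0##Ai $2 ($4**$3) $0)##Id $1 ;; Id $0##(Id $0##Id $0##Id $2##Ai $4 $3 $0)##Id $1 ;; Id $0##Ai $0 ($0**$2**$4**$3**$0) $1 ;; Id $0##Id $0##Ai $0 ($2**$4**$3**$0) $1 ;; Id $0##Id $0##Id $0##Ai $2 ($4**$3**$0) $1 ;; Id $0##Id $0##Id $0##Id $2##Ai $4 ($3**$0) $1 ;; Id $0##Id $0##Id $0##Id $2##Id $4##Ai $3 $0 $1 ;; As $0 $0 ($0**$2**$4**$3**$0**$1) ;; Id ($0**$0)##Id $0##Id $2##As $4 $3 ($0**$1) ;; Id ($0**$0)##Id $0##As $2 ($4**$3) ($0**$1) ;; Id ($0**$0)##As $0 ($2**$4**$3) ($0**$1) ;; Br $0 $0##Id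 ($0**$2**$4**$3)##$$3 ;; Id ($0**$0)##Ri ($0**$2**$4**$3) ;; Ai $0 $0 ($0**$2**$4**$3)) ;; Id $0##(As $0 $0 ($2**$4**$3) ;; $$1##Id ($2**$4**$3)))"
    by (rule braid_diagram[of "[($0**$0, $0), ($0, $0**$0), ($0, $0), (Ue, $0**$1), ($0**$2, $2), ($0**$3, $3), ($0**$4, $4), ($2**$4**$3**$0, $4), ($0**$4**$1, $4)]"
  "[($$0 ;; $$0##Id $0, $$0 ;; Id $0##$$0 ;; As $0 $0 $0), (As $0 $0 $0 ;; $$1##Id $0 ;; $$1, Id $0##$$1 ;; $$1), ($$8 ;; Id $0##$$7##Id $1 ;; Id $0##Ai $2 ($4**$3**$0) $1 ;; Id $0##Id $2##Ai $4 ($3**$0) $1 ;; Id $0##Id $2##Id $4##Ai $3 $0 $1 ;; Id $0##Id $2##As $4 $3 ($0**$1) ;; Id $0##As $2 ($4**$3) ($0**$1) ;; As $0 ($2**$4**$3) ($0**$1) ;; Id ($0**$2**$4**$3)##$$0##Id $1 ;; Id ($0**$2**$4**$3)##Ai $0 $0 $1 ;; Ai $0 ($2**$4**$3) ($0**$0**$1) ;; Id $0##Ai $2 ($4**$3) ($0**$0**$1) ;; Id $0##Id $2##Ai $4 $3 ($0**$0**$1) ;; Id $0##Id $2##Id $4##As $3 $0 ($0**$1) ;; Id $0##Id $2##As $4 ($3**$0) ($0**$1) ;; Id $0##As $2 ($4**$3**$0) ($0**$1) ;; As $0 ($2**$4**$3**$0) ($0**$1) ;; Id ($0**$2**$4**$3**$0)##$$3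 ;; Ri ($0**$2**$4**$3**$0), $$7 ;; $$4##Id ($4**$3**$0) ;; Ai $0 $2 ($4**$3**$0)), ($$7 ;; Id $2##Id $4##$$5##Id $0, $$7 ;; Id $2##Id $4##(Id $3##($$0 ;; $$2##Id $0) ;; As $3 $0 $0 ;; Br $0 $3##Id $0)), ($$6 ;; Id $0##$$7, $$7 ;; Id $2##$$6##Id ($3**$0) ;; Id $2##Ai $0 $4 ($3**$0) ;; As $2 $0 ($4**$3**$0) ;; Br $0 $2##Id ($4**$3**$0) ;; Ai $0 $2 ($4**$3**$0))]" _ _ "[SR 6, SR 5, SR 4, SR 3, SR 7, NB 8 2 True True 0 (Ge 5) False, NB 6 1 True True 0 (Ge 6) False, SR 5, SL 8, NB 6 2 True True 0 (Cr True 0 4) False, NB 4 1 True True 0 (Ge 1) False, NB 2 0 True True 0 (Ge 4) False, SR 1, SL 4, NB 2 1 True True 0 (Cr True 0 2) False, NB 0 0 True True 0 (Ge 1) False, SL 4, NB 3 1 False True 2 (Ge 1) True, SR 2, RB 1 0 1, RF 11 0 3, SL 2, SL 1, SL 6, SL 5, SL 4, SL 3, SL 2, SL 9, SL 8, SL 7, SL 6, SL 5, SL 4, SL 3, SL 8, SL 7, SL 10, SL 9, SR 3, SR 2, SR 1, SR 4, SR 3, SR 2, SR 5, SR 4, SR 7, SR 6, SR 5, SR 9, SR 8, SR 7, SR 6, SR 8, SR 10, SR 9, RB 11 0 3, SL 6, SL 7, SL 8, SL 9, SL 10, RB 11 0 2, SL 5, SL 6, SL 8, SL 7, SL 9, SL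 8, SL 10, SL 9, SL 11, SL 10, RB 11 1 4, SL 8, SL 9, RF 10 2 3, SL 2, SL 1, SL 4, SL 3, SL 2, SL 6, SL 5, SL 4, SL 3, SR 9, SR 8, SR 10, SR 3, SR 2, SR 1, SR 4, SR 3, SR 2, SR 5, SR 4, SR 6, SL 8, SL 10, SL 9, RB 10 2 3, SR 9, SR 8, RF 11 1 4, SR 10, SR 9, SR 8, SR 7, SR 6, SR 5, SR 11, SR 10, SR 9, SR 8, RF 11 0 2, SR 10, SR 9, SR 8, SR 7, SR 6, RF 1 0 1, SL 2, NB 3 1 False True 2 (Ge 1) False, SR 4, RF 10 0 3, NB 10 2 False True 3 (Ge 2) True, SR 9, NB 10 2 False True 3 (Ge 0) True, SL 8, NB 7 2 False True 4 (Ge 2) True, SR 6, SL 9, NB 7 2 False True 4 (Ge 0) True, SL 4, NB 3 1 False True 2 (Ge 1) True, SR 2, SL 6, SL 5, NB 4 2 False True 2 (Ge 2) True, SR 3, SL 7, SL 6, NB 4 2 False True 2 (Ge 0) True, SL 7, SL 8, SL 9, RB 10 0 2, SL 6, SL 8, SL 7, SL 9, SL 8, SL 10, SL 9, RB 10 1 4, SL 7, XX 8 5 False 3 0 False, NB 9 4 False True 3 (Ge 0) True, SL 6, SL 7, XX 8 4 False 4 0 False, NB 9 3 False True 4 (Ge 0) True, SL 5, SL 6, SL 7, XX 8 3 False 2 0 False, NB 9 2 False True 2 (Ge 0) True, SL 4, SL 5, SL 6, SL 7, RF 8 2 0, NB 0 0 True True 0 (Ge 1) True, SL 4, SL 3,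 SL 2, SL 5, SL 4, SL 3, SL 6, SL 5, SL 4, SL 7, SL 6, SL 5, XX 6 2 False 0 0 False, SL 10, SL 9, NB 7 1 False True 0 (Ge 0) True]"],
  code_simp, simp add: hs, simp only: diag_simps, (intro conjI TrueI K1 K2 K3 K4 mul_assoc comul_coassoc; simp add: hs))
  then have "?FL = ?FR" by simp
  then have q: "aev M :. (Ide B hh*:(aact M G r :. (Ide B hh*:JC M G V W w e)))
    = aev M :. (Ide B hh*:(JC M G V W w e :. tensor_action B H W w (M*.V) (tensor_action B H M r V v)))"
    unfolding L R by (rule sym)
  show ?thesis
  proof (rule aev_inj[OF mo(3) o(1) _ _ q])
    show "aact M G r :. (Ide B hh*:JC M G V W w e) \<in> Hom B (hh*.(W*.(M*.V))) (?A*.M)"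
      by (rule cmp_hom[OF o(1) o(3) o(2)]) (simp_all add: aact_hom[OF G r1] J tar_hom_ide o hopf_hom)
    show "JC M G V W w e :. tensor_action B H W w (M*.V) (tensor_action B H M r V v) \<in> Hom B (hh*.(W*.(M*.V))) (?A*.M)"
      by (rule cmp_hom[OF o(1) o(4) o(2)]) (simp_all add: J V v1 r1 mo tensor_action_hom hopf_hom)
  qed
qed

end

context rigid_monoidal_category
begin

lemma ev_left_factor:
  assumes a: "X \<in> Ob D" "Y \<in> Ob D" "e \<in> Hom D (X*.Y) \<one>"
  shows "lcurry D Y X e \<in> Hom D X (ldual D Y)" "ev_left D Y :. (lcurry D Y X e*:Ide D Y) = e"
    "\<lbrakk>k \<in> Hom D X (ldual D Y); ev_left D Y :. (k*:Ide D Y) = e\<rbrakk> \<Longrightarrow> k = lcurry D Y X e"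
proof -
  have "dhom D [X, Y, ldual D Y] [e, coev_left D Y]
    (Lu $2 ;; $$0##Id $2 ;; Ai $0 $1 $2 ;; Id $0##$$1 ;; Ri $0) ($0) ($2)"
    by (rule diagram_hom[of "[($0**$1, Ue), (Ue, $1**$2)]"], code_simp, simp add: a rigid_homs)
  then show "lcurry D Y X e \<in> Hom D X (ldual D Y)" by (simp add: lcurry_def)
  have "deq D [X, Y, ldual D Y] [e, ev_left D Y, coev_left D Y]
    ($$1 ;; (Lu $2 ;; $$0##Id $2 ;; Ai $0 $1 $2 ;; Id $0##$$2 ;; Ri $0)##Id $1)
    ($$0)"
    by (rule diagram[of "[($0**$1, Ue), ($2**$1, Ue), (Ue, $1**$2)]"
  "[zr $1 $2 $$1 $$2]" _ _ "[SL 1, RF 0 1 0]"],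
  code_simp, simp add: a rigid_homs, simp only: diag_simps, (intro conjI TrueI zigzags; simp add: a rigid_homs))
  then show "ev_left D Y :. (lcurry D Y X e*:Ide D Y) = e" by (simp add: lcurry_def)
  show "k = lcurry D Y X e" if k: "k \<in> Hom D X (ldual D Y)" "ev_left D Y :. (k*:Ide D Y) = e"
  proof -
    have "deq D [X, Y, ldual D Y] [ev_left D Y, coev_left D Y, k]
      (Lu $2 ;; ($$0 ;; $$2##Id $1)##Id $2 ;; Ai $0 $1 $2 ;; Id $0##$$1 ;; Ri $0)
      ($$2)"
      by (rule diagram[of "[($2**$1, Ue), (Ue, $1**$2), ($0, $2)]"
  "[zl $2 $1 $$0 $$1]" _ _ "[SR 0, RF 1 0 0]"],
  code_simp, simp add: a k(1) rigid_homs, simp only: diag_simps, (intro conjI TrueI zigzags; simp add: a k(1) rigid_homs))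
    then show ?thesis by (simp add: lcurry_def k(2))
  qed
qed

end

section \<open>From anti-Yetter-Drinfeld modules to pairing actions over modules\<close>

context hopf_algebra
begin

text \<open>In \<open>HH_module\<close> the structure morphisms and their inverses are those of
  \<open>B\<close>, and \<open>ebr\<close> depends on the half braiding of
  \<open>kk \<otimes> M\<close> only through its pairing action.\<close>

lemma aYD_act_HH_module:
  assumes t: "half_braiding B M t"
  shows "aYD_act MM B H (M, t) r = aact M (pairact B (M, t)) r"
proof -
  let ?K = "kk" and ?h = "hh"
  have K: "?K \<in> Ob B" by (simp add: hopf_hom)
  note tK = HH_act_half_braiding[OF t K] and tH = HH_act_half_braiding[OF HH_act_half_braiding(1)[OF t K] carr_ob]
  have b: "Bra MM ?h (?K*.M, hact ?K M t) = ebr ?h (?K*.M) (gact ?K M (pairact B (M, t)))"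
    by (simp add: HH_module_Bra(4)[OF tK(1) carr_ob] ebr_def tK(2) hopf_hom)
  show ?thesis
    by (simp add: aYD_act_def r1_def r0_def act_curry_def act_coev_def act_ev_def aact_def rr1_def rr0_def acur_def aev_def HH_module_simps
      tK(3) tH(3) b HH_module_inverses[OF t] HH_module_inverses[OF tK(1)] HH_module_inverses[OF tH(1)] hopf_hom)
qed

definition ayd :: "'o \<Rightarrow> ('o \<Rightarrow> 'a) \<Rightarrow> 'a \<Rightarrow> 'a \<Rightarrow> bool" where
  "ayd M t r q \<longleftrightarrow> half_braiding B M t \<and> r \<in> Hom (HH B) (HH_act B hh (M, t)) (M, t) \<and> is_hopf_module B H M r \<and>
    q \<in> Hom (HH B) (HH_act B kk (M, t)) (M, t) \<and>
    q :. (dual_mul B H*:Ide B M) = q :. (Ide B kk*:q) :. Asc B kk kk M \<and>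
    q :. (dual_unt B H*:Ide B M) = Lun B M \<and> r :. (Ide B hh*:q) = q :. aact M (pairact B (M, t)) r"

lemma aYD_simps:
  "((M, t), r, q) \<in> Ob (aYD MM B H) \<longleftrightarrow> ayd M t r q"
  "f \<in> Hom (aYD MM B H) ((M, t), r, q) ((M', t'), r', q') \<longleftrightarrow> f \<in> Hom (HH B) (M, t) (M', t') \<and>
    f :. r = r' :. (Ide B hh*:f) \<and> f :. q = q' :. (Ide B kk*:f)"
  "Ide (aYD MM B H) ((M, t), r, q) = Ide B M" "Cmp (aYD MM B H) = Cmp B"
  "Zer (aYD MM B H) ((M, t), r, q) ((M', t'), r', q') = Zer B M M'"
  "Add (aYD MM B H) = Add B" "Smul (aYD MM B H) = Smul B"
proof -
  show "((M, t), r, q) \<in> Ob (aYD MM B H) \<longleftrightarrow> ayd M t r q"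
  proof (cases "half_braiding B M t")
    case True
    then show ?thesis
      using HH_HomD[of r "hh*.M" "hact hh M t" M t] HH_act_half_braiding(3)[OF True carr_ob] half_braidingD(1)[OF True]
      by (auto simp: aYD_def is_module_over_def ayd_def is_hopf_module_def HH_module_simps aYD_act_HH_module[OF True])
  qed (simp add: aYD_def is_module_over_def ayd_def HH_module_simps)
qed (simp_all add: aYD_def HH_module_simps HH_simps(5))

lemma aydD:
  assumes a: "ayd M t r q"
  shows "half_braiding B M t" "is_hopf_module B H M r" "M \<in> Ob B" "r \<in> Hom B (hh*.M) M" "q \<in> Hom B (kk*.M) M"
    "\<lbrakk>X \<in> Ob B; Y \<in> Ob B; e \<in> Hom B (X*.Y) \<one>\<rbrakk> \<Longrightarrow> r :. gact hh M (pairact B (M, t)) X Y e = pairact B (M, t) X Y e :. (Ide B Y*:(r*:Ide B X))"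
    "\<lbrakk>X \<in> Ob B; Y \<in> Ob B; e \<in> Hom B (X*.Y) \<one>\<rbrakk> \<Longrightarrow> q :. gact kk M (pairact B (M, t)) X Y e = pairact B (M, t) X Y e :. (Ide B Y*:(q*:Ide B X))"
    "q :. (dual_mul B H*:Ide B M) = q :. (Ide B kk*:q) :. Asc B kk kk M"
    "q :. (dual_unt B H*:Ide B M) = Lun B M" "r :. (Ide B hh*:q) = q :. aact M (pairact B (M, t)) r"
proof -
  have K: "kk \<in> Ob B" by (simp add: hopf_hom)
  show t: "half_braiding B M t" and m: "is_hopf_module B H M r" using a by (simp_all add: ayd_def)
  note hK = HH_act_half_braiding[OF t K] and hH = HH_act_half_braiding[OF t carr_ob]
  have r: "r \<in> Hom (HH B) (hh*.M, hact hh M t) (M, t)" and q: "q \<in> Hom (HH B) (kk*.M, hact kk M t) (M, t)"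
    using a by (simp_all add: ayd_def hK(3) hH(3))
  show "M \<in> Ob B" "r \<in> Hom B (hh*.M) M" "q \<in> Hom B (kk*.M) M"
    using hmodD[OF m] HH_HomD[OF q] by simp_all
  show "\<lbrakk>X \<in> Ob B; Y \<in> Ob B; e \<in> Hom B (X*.Y) \<one>\<rbrakk> \<Longrightarrow> r :. gact hh M (pairact B (M, t)) X Y e = pairact B (M, t) X Y e :. (Ide B Y*:(r*:Ide B X))"
    using HH_Hom_pairact[OF hH(1) t r] by (simp add: hH(2))
  show "\<lbrakk>X \<in> Ob B; Y \<in> Ob B; e \<in> Hom B (X*.Y) \<one>\<rbrakk> \<Longrightarrow> q :. gact kk M (pairact B (M, t)) X Y e = pairact B (M, t) X Y e :. (Ide B Y*:(q*:Ide B X))"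
    using HH_Hom_pairact[OF hK(1) t q] by (simp add: hK(2))
qed (use a in \<open>simp_all add: ayd_def\<close>)

definition GC :: "'o \<Rightarrow> ('o \<Rightarrow> 'o \<Rightarrow> 'a \<Rightarrow> 'a) \<Rightarrow> 'a \<Rightarrow> 'o \<times> 'a \<Rightarrow> 'o \<times> 'a \<Rightarrow> 'a \<Rightarrow> 'a" where
  "GC M G q = (\<lambda>(V, v) (W, w) e. q :. JC M G V W w e)"

lemma nest_Hmod: "\<lbrakk>is_hopf_module B H V v; is_hopf_module B H V' v'; is_hopf_module B H W' w'; is_hopf_module B H W w\<rbrakk>
    \<Longrightarrow> nest HM (V, v) (V', v') (W', w') (W, w) e e' = nest B V V' W' W e e'"
  using Hmod_str_inv(4)[of V' v' W' w' W w] by (simp add: nest_def Hmod_simps)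

text \<open>Linearity over \<open>H\<close> is \<open>JC_linear\<close> followed by the
  compatibility of \<open>r\<close> with \<open>q\<close>. The unit law is that of \<open>q\<close>,
  through \<open>JC_triv\<close>. Multiplicativity is associativity of \<open>q\<close> for
  \<open>dual_mul\<close>, through \<open>JC_mult\<close>, with \<open>JC_mor\<close> moving the
  inner \<open>q\<close> past the second pairing.\<close>

lemma pairing_action_GC:
  assumes a: "ayd M t r q"
  shows "pairing_action HM (M, r) (GC M (pairact B (M, t)) q)"
proof -
  note d = aydD[OF a]
  note G = pairing_action_pairact[OF d(1)] and K = rdual_ob[OF carr_ob]
  let ?G = "pairact B (M, t)" and ?K = "kk" and ?P = "GC M (pairact B (M, t)) q"
  note gK = pairing_action_gact[OF G K]
  have e: "v \<in> Hom B (hh*.V) V" "e \<in> Hom B (V*.W) \<one>" "e :. tensor_action B H V v W w = triv \<one> :. (Ide B hh*:e)" "w \<in> Hom B (hh*.W) W" "V \<in> Ob B" "W \<in> Ob B"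
    if "is_hopf_module B H V v" "is_hopf_module B H W w" "e \<in> Hom HM ((V, v) *C (W, w)) oneC" for V v W w e
    using that hmodD(1,2) by (auto simp: Hmod_simps)
  have hom: "?P X Y e \<in> Hom HM (Y *C ((M, r) *C X)) (M, r)"
    if "X \<in> Ob HM" "Y \<in> Ob HM" "e \<in> Hom HM (X *C Y) oneC" for X Y e
  proof -
    obtain V v W w where [simp]: "X = (V, v)" "Y = (W, w)" by (cases X, cases Y)
    have m: "is_hopf_module B H V v" "is_hopf_module B H W w" using that by (simp_all add: Hmod_simps)
    note e = e[OF m that(3)[simplified]]
    note j = JC_hom[OF G e(5,6,4,2)]
    let ?J = "JC M ?G V W w e" and ?A = "tensor_action B H W w (M*.V) (tensor_action B H M r V v)"
    have l: "aact M ?G r :. (Ide B hh*:?J) = ?J :. ?A" by (rule JC_linear[OF G m e(2,3) d(2)]) (rule d(6))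
    have o: "W*.(M*.V) \<in> Ob B" "hh*.(W*.(M*.V)) \<in> Ob B" "?K*.M \<in> Ob B" "hh*.(?K*.M) \<in> Ob B" "hh*.M \<in> Ob B" using e(5,6) d(3) by (simp_all add: hopf_hom)
    have A: "?A \<in> Hom B (hh*.(W*.(M*.V))) (W*.(M*.V))" using e d by (intro tensor_action_hom ten_ob)
    have hJ: "Ide B hh*:?J \<in> Hom B (hh*.(W*.(M*.V))) (hh*.(?K*.M))" by (rule tar_hom_ide(2)[OF o(1,3) carr_ob j])
    have "(q :. ?J) :. ?A = q :. (aact M ?G r :. (Ide B hh*:?J))" unfolding l by (rule cmp_assoc[OF o(2,1,3) d(3) A j d(5)])
    also have "\<dots> = (r :. (Ide B hh*:q)) :. (Ide B hh*:?J)"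
      unfolding d(10) by (rule cmp_assoc[OF o(2,4,3) d(3) hJ aact_hom[OF G d(4)] d(5), symmetric])
    also have "\<dots> = r :. ((Ide B hh*:q) :. (Ide B hh*:?J))"
      by (rule cmp_assoc[OF o(2,4,5) d(3) hJ tar_hom_ide(2)[OF o(3) d(3) carr_ob d(5)] d(4)])
    also have "(Ide B hh*:q) :. (Ide B hh*:?J) = Ide B hh*:(q :. ?J)"
      using tar_cmp[OF carr_ob carr_ob carr_ob o(1,3) d(3) ide_hom ide_hom j d(5)] by (simp add: carr_ob ide_left[OF carr_ob carr_ob] ide_hom)
    finally show ?thesis using cmp_hom[OF o(1,3) d(3) j d(5)] by (simp add: GC_def Hmod_simps)
  qed
  show ?thesis unfolding pairing_action_def
  proof (intro conjI ballI)
    show "(M, r) \<in> Ob HM" by (simp add: Hmod_simps d(2))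
    note p = JC_triv[OF G uni_ob uni_ob Lun_hom(1)[OF uni_ob]]
    note hs = d(3,5) dual_unt_hom Lun_hom pairing_actionD(2)[OF G] hopf_hom
    have "beq B [kk, M] [q, dual_unt B H, pairact B (M, t) \<one> \<one> (Lun B \<one>)]
      ($$0 ;; $$1##Id $1 ;; Li $1 ;; $$2)
      (Lu $1 ;; Id Ue##Ru $1)"
      by (rule braid_diagram[of "[($0**$1, $1), (Ue, $0), (Ue**$1**Ue, $1)]"
  "[($$0 ;; $$1##Id $1, Lu $1), ($$2, Lu $1 ;; Id Ue##Ru $1)]" _ _ "[RF 1 0 0, RF 0 0 1]"],
  code_simp, simp add: hs, simp only: diag_simps, (intro conjI TrueI d(9) pairing_actionD(4)[OF G]; simp add: hs))
    then show "?P oneC oneC (Lun HM oneC) = Lun HM (M, r) :C (Ide HM oneC **C Run HM (M, r))"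
      by (simp add: GC_def Hmod_simps p)
  next
    fix X Y X' Y' e f k
    assume "X \<in> Ob HM" "Y \<in> Ob HM" "X' \<in> Ob HM" "Y' \<in> Ob HM"
      and e': "e \<in> Hom HM (X *C Y) oneC" and f: "f \<in> Hom HM X' X" and k: "k \<in> Hom HM Y' Y"
    then obtain V v W w V' v' W' w' where [simp]: "X = (V, v)" "Y = (W, w)" "X' = (V', v')" "Y' = (W', w')"
      and m: "is_hopf_module B H V v" "is_hopf_module B H W w" "is_hopf_module B H V' v'" "is_hopf_module B H W' w'"
      by (cases X; cases Y; cases X'; cases Y') (simp add: Hmod_simps)
    note e = e[OF m(1,2) e'[simplified]] and o = hmodD(1)[OF m(3)] hmodD(1,2)[OF m(4)]
    have f: "f \<in> Hom B V' V" and k: "k \<in> Hom B W' W" "k :. w' = w :. (Ide B hh*:k)" using f k by (simp_all add: Hmod_simps)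
    have "q :. (JC M ?G V W w e :. (k*:(Ide B M*:f))) = (q :. JC M ?G V W w e) :. (k*:(Ide B M*:f))"
      by (rule cmp_assoc[of "W'*.(M*.V')" "W*.(M*.V)" "?K*.M" M, symmetric])
        (use e o f k d(3,5) in \<open>simp_all add: JC_hom[OF G e(5,6,4,2)] hopf_hom tar_hom ide_hom\<close>)
    then show "?P X' Y' (e :C (f **C k)) = ?P X Y e :C (k **C (Ide HM (M, r) **C f))"
      by (simp add: GC_def Hmod_simps JC_nat[OF G e(5,6,4,2) o f k])
  next
    fix X Y X' Y' e e'
    assume "X \<in> Ob HM" "Y \<in> Ob HM" "X' \<in> Ob HM" "Y' \<in> Ob HM"
      and e1: "e \<in> Hom HM (X *C Y) oneC" and e2: "e' \<in> Hom HM (X' *C Y') oneC"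
    then obtain V v W w V' v' W' w' where [simp]: "X = (V, v)" "Y = (W, w)" "X' = (V', v')" "Y' = (W', w')"
      and m: "is_hopf_module B H V v" "is_hopf_module B H W w" "is_hopf_module B H V' v'" "is_hopf_module B H W' w'"
      by (cases X; cases Y; cases X'; cases Y') (simp add: Hmod_simps)
    note e1 = e[OF m(1,2) e1[simplified]] and e2 = e[OF m(3,4) e2[simplified]]
    note V = e1(5,6,4,2) and V' = e2(5,6,4,2) and mo = e1(5,6) and mo' = e2(5,6)
    note b = JC_mult[OF G V V'] and j = JC_hom[OF G V] and jj = JC_hom[OF G V'] and jk = JC_hom[OF gK V']
    have jm: "JC M ?G (V*.V') (W'*.W) (tensor_action B H W' w' W w) (nest B V V' W' W e e') \<in> Hom B ((W'*.W)*.(M*.(V*.V'))) (?K*.M)"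
      "JC (?K*.M) (gact ?K M ?G) V' W' w' e' \<in> Hom B (W'*.((?K*.M)*.V')) (?K*.(?K*.M))"
      using V V' jk by (auto intro!: JC_hom[OF G] tensor_action_hom nest_hom ten_ob)
    have c: "(Ide B ?K*:q) :. JC (?K*.M) (gact ?K M ?G) V' W' w' e' = JC M ?G V' W' w' e' :. (Ide B W'*:(q*:Ide B V'))"
      by (rule JC_mor[OF gK G d(5) V']) (rule d(7), use V' in \<open>simp_all add: erho_hom hopf_hom\<close>)
    note hs = mo mo' d(3,5) j jj jm dual_mul_hom hopf_hom
    have "beq B [kk, M, V, W, V', W'] [q, dual_mul B H, JC M ?G V W w e, JC M ?G V' W' w' e', JC (?K*.M) (gact ?K M ?G) V' W' w' e', JC M ?G (V*.V') (W'*.W) (tensor_action B H W' w' W w) (nest B V V' W' W e e')]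
      ($$0 ;; $$5)
      (mud $1 $2 $3 $4 $5 ($$0 ;; $$2) ($$0 ;; $$3))"
      by (rule braid_diagram[of "[($0**$1, $1), ($0**$0, $0), ($3**$1**$2, $0**$1), ($5**$1**$4, $0**$1), ($5**($0**$1)**$4, $0**$0**$1), (($5**$3)**$1**$2**$4, $0**$1)]"
  "[($$0 ;; $$1##Id $1, $$0 ;; Id $0##$$0 ;; As $0 $0 $1), ($$5, $$1##Id $1 ;; Ai $0 $0 $1 ;; mud $1 $2 $3 $4 $5 $$2 $$4), (Id $0##$$0 ;; $$4, $$3 ;; Id $5##$$0##Id $4)]" _ _ "[RF 0 0 1, RF 2 0 0, RF 1 0 2]"],
  code_simp, simp add: hs, simp only: diag_simps, (intro conjI TrueI d(8) b c; simp add: hs))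
    then show "?P (X *C X') (Y' *C Y) (nest HM X X' Y' Y e e') = ?P X' Y' e' :C (Ide HM Y' **C (?P X Y e **C Ide HM X'))
        :C (Ide HM Y' **C AscInv HM Y ((M, r) *C X) X')
        :C (Ide HM Y' **C (Ide HM Y **C AscInv HM (M, r) X X')) :C Asc HM Y' Y ((M, r) *C (X *C X'))"
      using Hmod_str_inv(4)[OF m(2) tensor_module[OF d(2) m(1)] m(3)] Hmod_str_inv(4)[OF d(2) m(1) m(3)] Hmod_str_inv(4)[OF m(3,4) m(2)] Hmod_str_inv(4)[OF m(3) m(4) m(2)]
      by (simp add: GC_def Hmod_simps nest_Hmod[OF m(1,3,4,2)])
  qed (use hom in auto)
qed

section \<open>Restriction to trivial modules and recovery of the action of the dual algebra\<close>

definition ptriv :: "('o \<times> 'a \<Rightarrow> 'o \<times> 'a \<Rightarrow> 'a \<Rightarrow> 'a) \<Rightarrow> 'o \<Rightarrow> 'o \<Rightarrow> 'a \<Rightarrow> 'a" where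
  "ptriv P X Y e = P (X, triv X) (Y, triv Y) e"

lemma triv_linear:
  assumes a: "X \<in> Ob B" "Y \<in> Ob B" "f \<in> Hom B X Y"
  shows "f \<in> Hom HM (X, triv X) (Y, triv Y)"
proof -
  have "beq B [hh, X, Y] [counit H, f]
    ($$1 ;; Lu $1 ;; $$0##Id $1)
    ((Lu $2 ;; $$0##Id $2) ;; Id $0##$$1)"
    by (rule braid_diagram[of "[($0, Ue), ($1, $2)]"
  "[]" _ _ "[SL 0]"],
  code_simp, simp add: a hopf_hom, simp)
  then show ?thesis by (simp add: Hmod_simps a)
qed

lemma triv_pairing:
  assumes a: "X \<in> Ob B" "Y \<in> Ob B" "e \<in> Hom B (X*.Y) \<one>"
  shows "e \<in> Hom HM ((X, triv X) *C (Y, triv Y)) oneC"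
  using triv_linear[of "X*.Y" \<one> e] a by (simp add: Hmod_simps(8,10) tensor_action_triv ten_ob uni_ob)

lemma regular_module: "is_hopf_module B H hh (mul H)"
  by (simp add: is_hopf_module_def mul_assoc mul_unt_left hopf_hom)

text \<open>The counit absorbs the leg that acts on the trivial module, and associativity of
  \<open>w\<close> remains. The source is regular in \<open>H\<close> and trivial in
  \<open>W\<close>.\<close>

lemma action_linear:
  assumes w: "is_hopf_module B H W w"
  shows "w \<in> Hom HM ((hh, mul H) *C (W, triv W)) (W, w)"
proof -
  have "beq B [hh, W] [mul H, comul H, counit H, w]
    ($$3 ;; $$0##(Lu $1 ;; $$2##Id $1) ;; msd $0 $0 $0 $1 ;; $$1##Id ($0**$1))
    ($$3 ;; Id $0##$$3)"
    by (rule braid_diagram[of "[($0**$0, $0), ($0, $0**$0), ($0, Ue), ($0**$1, $1)]"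
  "[(Ru $0 ;; Id $0##$$2 ;; $$1, Id $0), ($$3 ;; $$0##Id $1, $$3 ;; Id $0##$$3 ;; As $0 $0 $1)]" _ _ "[SL 2, NB 1 1 False True 0 (Ge 2) True, RF 0 0 0, RF 0 0 1]"],
  code_simp, simp add: hmodD(1,2)[OF w] hopf_hom, simp only: diag_simps, (intro conjI TrueI hmodD(3)[OF w] counit_left counit_right; simp add: hmodD(1,2)[OF w] hopf_hom))
  then show ?thesis using hmodD(2)[OF w] by (simp add: Hmod_simps tensor_action_def middle_swap_def)
qed

text \<open>A substitute for a braiding of \<open>Hmod\<close>: against a trivial module one leg of
  the comultiplication dies in the counit, on the right or on the left of the other, so both sides
  carry the same action on \<open>A\<close>.\<close>

lemma braid_triv_linear:
  assumes X: "X \<in> Ob B" and A: "A \<in> Ob B" "a \<in> Hom B (hh*.A) A"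
  shows "Braid B A X \<in> Hom HM ((A, a) *C (X, triv X)) ((X, triv X) *C (A, a))"
proof -
  have "beq B [hh, X, A] [comul H, counit H, a]
    (Br $2 $1 ;; $$2##(Lu $1 ;; $$1##Id $1) ;; msd $0 $0 $2 $1 ;; $$0##Id ($2**$1))
    (((Lu $1 ;; $$1##Id $1)##$$2 ;; msd $0 $0 $1 $2 ;; $$0##Id ($1**$2)) ;; Id $0##Br $2 $1)"
    by (rule braid_diagram[of "[($0, $0**$0), ($0, Ue), ($0**$2, $2)]"
  "[(Lu $0 ;; $$1##Id $0 ;; $$0, Id $0), (Ru $0 ;; Id $0##$$1 ;; $$0, Id $0)]" _ _ "[SL 2, NB 1 1 False True 2 (Ge 1) True, RF 0 0 1, NB 0 0 False True 1 (Ge 2) False, RB 0 0 0, SL 1, SL 0, SL 2]"],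
  code_simp, simp add: X A hopf_hom, simp only: diag_simps, (intro conjI TrueI hopf_rel; simp add: X A hopf_hom))
  then have l: "Braid B A X :. tensor_action B H A a X (triv X) = tensor_action B H X (triv X) A a :. (Ide B hh*:Braid B A X)"
    by (simp add: tensor_action_def middle_swap_def)
  have "bhom B [X, A] []
    (Br $1 $0) ($1**$0) ($0**$1)"
    by (rule braid_diagram_hom[of "[]"], code_simp, simp add: X A hopf_hom)
  then show ?thesis by (simp add: Hmod_simps l)
qed

text \<open>All arrows of \<open>B\<close> are linear between trivial modules, and trivial modules
  are closed under tensor products, so the laws of \<open>P\<close> restrict.\<close>

lemma pairing_action_ptriv:
  assumes P: "pairing_action HM (M, r) P"
  shows "pairing_action B M (ptriv P)"
proof -
  note d = rigid_monoidal_category.pairing_actionD[OF rigid_monoidal_category_Hmod P]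
  have m: "is_hopf_module B H M r" using d(1) by (simp add: Hmod_simps)
  note tm = triv_module and tp = triv_pairing and tl = triv_linear
  show ?thesis unfolding pairing_action_def
  proof (intro conjI ballI)
    show "M \<in> Ob B" by (rule hmodD(1)[OF m])
    show "ptriv P \<one> \<one> (Lun B \<one>) = Lun B M :. (Ide B \<one>*:Run B M)" using d(4) by (simp add: ptriv_def Hmod_simps)
  next
    fix X Y e assume a: "X \<in> Ob B" "Y \<in> Ob B" "e \<in> Hom B (X*.Y) \<one>"
    show "ptriv P X Y e \<in> Hom B (Y*.(M*.X)) M"
      using d(2)[OF _ _ tp[OF a]] tm a by (simp add: ptriv_def Hmod_simps)
    show "ptriv P X' Y' (e :. (f*:k)) = ptriv P X Y e :. (k*:(Ide B M*:f))"
      if b: "X' \<in> Ob B" "Y' \<in> Ob B" "f \<in> Hom B X' X" "k \<in> Hom B Y' Y" for X' Y' f k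
      using d(3)[OF _ _ _ _ tp[OF a] tl[OF b(1) a(1) b(3)] tl[OF b(2) a(2) b(4)]] tm a b by (simp add: ptriv_def Hmod_simps)
    show "ptriv P (X*.X') (Y'*.Y) (nest B X X' Y' Y e e') = ptriv P X' Y' e' :. (Ide B Y'*:(ptriv P X Y e*:Ide B X'))
        :. (Ide B Y'*:AscInv B Y (M*.X) X') :. (Ide B Y'*:(Ide B Y*:AscInv B M X X')) :. Asc B Y' Y (M*.(X*.X'))"
      if b: "X' \<in> Ob B" "Y' \<in> Ob B" "e' \<in> Hom B (X'*.Y') \<one>" for X' Y' e'
      using d(5)[OF _ _ _ _ tp[OF a] tp[OF b]] tm[OF a(1)] tm[OF a(2)] tm[OF b(1)] tm[OF b(2)] a b
        Hmod_str_inv(4)[OF tm[OF a(2)] tensor_module[OF m tm[OF a(1)]] tm[OF b(1)]] Hmod_str_inv(4)[OF m tm[OF a(1)] tm[OF b(1)]]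
      by (simp add: ptriv_def Hmod_simps nest_Hmod tensor_action_triv)
  qed
qed

text \<open>Against a trivial module \<open>Y\<close> the module structure on \<open>X\<close> is irrelevant, since \<open>e\<close> factors through \<open>Y\<^sup>*\<close>.\<close>

lemma pairing_action_triv_right:
  assumes P: "pairing_action HM (M, r) P" and x: "is_hopf_module B H X x" and Y: "Y \<in> Ob B"
    and e: "e \<in> Hom HM ((X, x) *C (Y, triv Y)) oneC"
  shows "P (X, x) (Y, triv Y) e = ptriv P X Y e"
proof -
  interpret C: rigid_monoidal_category "HM" by (rule rigid_monoidal_category_Hmod)
  note X = hmodD(1)[OF x] and m = triv_module[OF Y]
  have eB: "e \<in> Hom B (X*.Y) \<one>" using e by (simp add: Hmod_simps)
  let ?L = "ldual HM (Y, triv Y)" and ?k = "lcurry B Y X e"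
  \<comment> \<open>The expression for \<open>P\<close> obtained here is free of \<open>z\<close>;
    the claim is applied both to \<open>x\<close> and to the trivial action.\<close>
  have *: "?k \<in> Hom HM (X, z) ?L \<and> P (X, z) (Y, triv Y) e = P ?L (Y, triv Y) (ev_left B Y) :. (Ide B Y*:(Ide B M*:?k))"
    if z: "is_hopf_module B H X z" and ez: "e \<in> Hom HM ((X, z) *C (Y, triv Y)) oneC" for z
  proof -
    have o: "(X, z) \<in> Ob HM" "(Y, triv Y) \<in> Ob HM" using z m by (simp_all add: Hmod_simps)
    note c = C.ev_left_factor(1,2)[OF o ez]
    have "lcurry HM (Y, triv Y) (X, z) e = ?k"
      using c by (intro ev_left_factor(3)[OF X Y eB]) (simp_all add: Hmod_simps)
    then have k: "?k \<in> Hom HM (X, z) ?L" "ev_left B Y :. (?k*:Ide B Y) = e" using c by (simp_all add: Hmod_simps)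
    show ?thesis
      using C.pairing_actionD(3)[OF P C.ldual_ob[OF o(2)] o(2) o C.lev_hom[OF o(2)] k(1) C.ide_hom[OF o(2)]] k by (simp add: Hmod_simps)
  qed
  show ?thesis using *[OF x e] *[OF triv_module[OF X] triv_pairing[OF X Y eB]] by (simp add: ptriv_def)
qed

text \<open>Precomposing \<open>e\<close> with \<open>w\<close> gives a pairing with the product of
  the regular module and a trivial one; \<open>pairing_action_factor\<close> separates the two. The
  unit of \<open>H\<close> splits \<open>w\<close>, so inserting it recovers the action of
  \<open>e\<close>, and \<open>jsec_JC\<close> recognises the result.\<close>

lemma pairing_action_regular:
  assumes P: "pairing_action HM (M, r) P" and v: "is_hopf_module B H V v" and w: "is_hopf_module B H W w"
    and e: "e \<in> Hom HM ((V, v) *C (W, w)) oneC"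
  shows "P (V, v) (W, w) e = P (ldual HM (hh, mul H)) (hh, mul H) (ev_left B hh) :. jsec M :. JC M (ptriv P) V W w e"
proof -
  interpret C: rigid_monoidal_category "HM" by (rule rigid_monoidal_category_Hmod)
  let ?h = "(hh, mul H)" and ?t = "(W, triv W)"
  let ?Q = "P (ldual HM ?h) ?h (ev_left B hh)"
  note G = pairing_action_ptriv[OF P]
  have pm: "is_hopf_module B H M r" using C.pairing_actionD(1)[OF P] by (simp add: Hmod_simps)
  note M = pairing_actionD(1)[OF G] and W = hmodD(1,2)[OF w] and V1 = hmodD(1)[OF v] and tm = triv_module[OF W(1)]
  have eB: "e \<in> Hom B (V*.W) \<one>" using e by (simp add: Hmod_simps)
  note V = V1 W eB and mo = M V1 W(1)
  have o: "(V, v) \<in> Ob HM" "(W, w) \<in> Ob HM" "?h \<in> Ob HM" "?t \<in> Ob HM"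
    using v w regular_module tm by (simp_all add: Hmod_simps)
  note wl = action_linear[OF w] and i = C.ide_hom[OF o(1)]
  let ?E = "e :. (Ide B V*:w)"
  have E: "?E \<in> Hom HM ((V, v) *C (?h *C ?t)) oneC"
    using C.cmp_hom[OF _ _ _ C.tar_hom[OF o(1,1) _ o(2) i wl] e] o C.ten_ob C.uni_ob by (simp add: Hmod_simps(3,4,9))
  have "P (V, v) (?h *C ?t) ?E = P (V, v) (W, w) e :. (w*:(Ide B M*:Ide B V))"
    using C.pairing_actionD(3)[OF P o(1,2,1) _ e i wl] o C.ten_ob by (simp add: Hmod_simps(3,4,9))
  moreover have "?E :. Asc B V hh W = erho V W w e"
    unfolding erho_def using V by (intro cmp_assoc[of "(V*.hh)*.W" "V*.(hh*.W)" "V*.W" \<one>]) (simp_all add: hopf_hom str_hom tar_hom_ide)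
  moreover have "P ((V, v) *C ?h) ?t (?E :. Asc B V hh W) = ptriv P (V*.hh) W (?E :. Asc B V hh W)"
  proof -
    have "?E :. Asc B V hh W \<in> Hom HM (((V, v) *C ?h) *C ?t) oneC"
      using C.cmp_hom[OF C.ten_ob[OF C.ten_ob[OF o(1,3)] o(4)] C.ten_ob[OF o(1) C.ten_ob[OF o(3,4)]] C.uni_ob _ E]
        Hmod_str(1)[OF v regular_module tm] by (simp add: Hmod_simps(4,8))
    then show ?thesis using pairing_action_triv_right[OF P tensor_module[OF v regular_module] W(1)] by (simp add: Hmod_simps(8))
  qed
  ultimately have a: "P (V, v) (W, w) e :. w*:Ide B M*:Ide B V = ?Q :. Ide B hh*:ptriv P (V*.hh) W (erho V W w e)*:Ide B ll :. Ide B hh*:AscInv B W (M*.(V*.hh)) ll :. Ide B hh*:Ide B W*:Asc B M V hh*:Ide B ll :. Ide B hh*:Ide B W*:AscInv B (M*.V) hh ll :. Asc B hh W ((M*.V)*.(hh*.ll)) :. Asc B (hh*.W) (M*.V) (hh*.ll) :. Ide B ((hh*.W)*.(M*.V))*:coev_left B hh :. RunInv B ((hh*.W)*.(M*.V))"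
    using C.pairing_action_factor[OF P o(1,4,3) E] Hmod_str_inv(4)[OF tm tensor_module[OF pm tensor_module[OF v regular_module]] ldual_module[OF regular_module]]
      Hmod_str_inv(4)[OF tensor_module[OF pm v] regular_module ldual_module[OF regular_module]] Hmod_unit_inv(4)[OF tensor_module[OF tensor_module[OF regular_module tm] tensor_module[OF pm v]]]
    by (simp add: Hmod_simps)
  have Pe: "P (V, v) (W, w) e \<in> Hom B (W*.(M*.V)) M" using C.pairing_actionD(2)[OF P o(1,2) e] by (simp add: Hmod_simps)
  have Q: "?Q \<in> Hom B (hh*.(M*.ll)) M"
    using C.pairing_actionD(2)[OF P C.ldual_ob[OF o(3)] o(3)] C.lev_hom[OF o(3)] by (simp add: Hmod_simps)
  note b = jsec_JC[OF G V]
  note hs = V mo Pe Q jsec_hom JC_hom[OF G V] erho_hom pairing_actionD(2)[OF G] hopf_hom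
  have "beq B [hh, kk, ll, M, V, W] [unt H, coev_left B hh, w, P (V, v) (W, w) e, ?Q, ptriv P (V*.hh) W (erho V W w e), jsec M, JC M (ptriv P) V W w e]
    ($$3)
    ($$4 ;; $$6 ;; $$7)"
    by (rule braid_diagram[of "[(Ue, $0), (Ue, $0**$2), ($0**$5, $5), ($5**$3**$4, $3), ($0**$3**$2, $3), ($5**$3**$4**$0, $3), ($1**$3, $0**$3**$2), ($5**$3**$4, $1**$3)]"
  "[($$3 ;; $$2##Id $3##Id $4, fad $4 $0 $5 $2 $3 $$4 $$5 $$1), ($$2 ;; $$0##Id $5, Lu $5), ($$6 ;; $$7, $$0##Id ($3**$2) ;; Li ($3**$2) ;; $$5##Id $2 ;; Ai $5 ($3**$4**$0) $2 ;; Id $5##Ai $3 ($4**$0) $2 ;; Id $5##Id $3##Ai $4 $0 $2 ;; Id $5##As $3 $4 ($0**$2) ;; As $5 ($3**$4) ($0**$2) ;; Id ($5**$3**$4)##$$1 ;; Ri ($5**$3**$4))]" _ _ "[RB 0 0 1, RF 1 0 0, SL 0, SL 1, RB 0 0 2]"],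
  code_simp, simp add: hs, simp only: diag_simps, (intro conjI TrueI a b hmodD(4)[OF w]; simp add: hs))
  then show ?thesis by simp
qed

text \<open>On an action of the form \<open>q\<close> after \<open>JC\<close> this returns
  \<open>q\<close>, by \<open>JC_jsec\<close>.\<close>

definition qof :: "'o \<Rightarrow> ('o \<times> 'a \<Rightarrow> 'o \<times> 'a \<Rightarrow> 'a \<Rightarrow> 'a) \<Rightarrow> 'a" where
  "qof M P = P (ldual HM (hh, mul H)) (hh, mul H) (ev_left B hh) :. jsec M"

lemma ayd_ptriv:
  assumes P: "pairing_action HM (M, r) P"
  shows "ayd M (acthalf B M (ptriv P)) r (qof M P)"
proof -
  interpret C: rigid_monoidal_category "HM" by (rule rigid_monoidal_category_Hmod)
  let ?h = "(hh, mul H)" and ?K = "kk" and ?s = "ll"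
  let ?l = "ldual_action B H hh (mul H)"
  let ?Q = "P (?s, ?l) ?h (ev_left B hh)" and ?t = "acthalf B M (ptriv P)"
  let ?J = "JC M (ptriv P) ?s hh (mul H) (ev_left B hh)"
    and ?JK = "JC (?K*.M) (gact ?K M (ptriv P)) ?s hh (mul H) (ev_left B hh)"
    and ?T = "tensor_action B H hh (mul H) (M*.?s) (tensor_action B H M r ?s ?l)"
  note G = pairing_action_ptriv[OF P]
  have m: "is_hopf_module B H M r" using C.pairing_actionD(1)[OF P] by (simp add: Hmod_simps)
  note pm = hmodD(1,2)[OF m] and K = rdual_ob[OF carr_ob]
  note gK = pairing_action_gact[OF G K] and lm = ldual_module[OF regular_module]
  have o: "?h \<in> Ob HM" "(?s, ?l) \<in> Ob HM" using lm regular_module by (simp_all add: Hmod_simps)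
  have ev: "ev_left B hh \<in> Hom HM ((?s, ?l) *C ?h) oneC" using C.lev_hom[OF o(1)] by (simp add: Hmod_simps)
  have Q: "?Q \<in> Hom B (hh*.(M*.?s)) M" and l: "?Q :. ?T = r :. (Ide B hh*:?Q)"
    using C.pairing_actionD(2)[OF P o(2,1) ev] by (simp_all add: Hmod_simps)
  have qof: "qof M P = ?Q :. jsec M" by (simp add: qof_def Hmod_simps)
  have V: "?s \<in> Ob B" "hh \<in> Ob B" "mul H \<in> Hom B (hh*.hh) hh" "ev_left B hh \<in> Hom B (?s*.hh) \<one>" by (simp_all add: hopf_hom)
  note J = JC_hom[OF G V] and JK = JC_hom[OF gK V] and j = JC_jsec[OF G] and j2 = JC_jsec[OF gK]
  \<comment> \<open>The action of the regular pairing factors through its own \<open>JC\<close>;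
    with \<open>JC_jsec\<close> this makes \<open>?Q\<close> and \<open>qof M P\<close>
    interchangeable.\<close>
  have F: "?Q = ?Q :. jsec M :. ?J" using pairing_action_regular[OF P lm regular_module ev] by (simp add: Hmod_simps)
  have T: "?T \<in> Hom B (hh*.(hh*.(M*.?s))) (hh*.(M*.?s))"
    by (intro tensor_action_hom ten_ob V(1-3) pm hmodD(2)[OF lm])
  \<comment> \<open>Linearity of \<open>P X Y e\<close> for trivial \<open>X\<close> and
    \<open>Y\<close>: the counit removes two of the three copies of \<open>h\<close>, and the
    remaining one says that \<open>r\<close> commutes with the restricted action.\<close>
  have rG: "r :. gact hh M (ptriv P) X Y e = ptriv P X Y e :. (Ide B Y*:(r*:Ide B X))"
    if a: "X \<in> Ob B" "Y \<in> Ob B" "e \<in> Hom B (X*.Y) \<one>" for X Y e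
  proof -
    have l: "ptriv P X Y e :. tensor_action B H Y (triv Y) (M*.X) (tensor_action B H M r X (triv X)) = r :. (Ide B hh*:ptriv P X Y e)"
      using C.pairing_actionD(2)[OF P _ _ triv_pairing[OF a]] triv_module a by (simp add: Hmod_simps ptriv_def)
  note hs = a pm(1,2) pairing_actionD(2)[OF G] hopf_hom
  have "beq B [hh, M, X, Y] [comul H, counit H, r, ptriv P X Y e]
    ($$2 ;; gad $0 $1 $2 $3 $$3)
    ($$3 ;; Id $3##$$2##Id $2)"
    by (rule braid_diagram[of "[($0, $0**$0), ($0, Ue), ($0**$1, $1), ($3**$1**$2, $1)]"
  "[($$3 ;; (Lu $3 ;; $$1##Id $3)##($$2##(Lu $2 ;; $$1##Id $2) ;; msd $0 $0 $1 $2 ;; $$0##Id ($1**$2)) ;; msd $0 $0 $3 ($1**$2) ;; $$0##Id ($3**$1**$2), $$2 ;; Id $0##$$3), (Lu $0 ;; $$1##Id $0 ;; $$0, Id $0), (Ru $0 ;; Id $0##$$1 ;; $$0, Id $0)]" _ _ "[RB 1 0 0, SR 2, RF 1 0 1, XX 0 0 False 3 0 True, SL 2, NB 1 2 False True 1 (Ge 1) True, RF 0 1 2]"],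
  code_simp, simp add: hs, simp only: diag_simps, (intro conjI TrueI l[unfolded tensor_action_def middle_swap_def] counit_left counit_right; simp add: hs))
    then show ?thesis by (simp add: gact_def)
  qed
  \<comment> \<open>The regular pairing and a trivial one are nested in both orders. By
    \<open>braid_triv_linear\<close> the crossings that exchange them are arrows of
    \<open>Hmod\<close>, so naturality of \<open>P\<close> relates the two multiplicativity
    laws.\<close>
  have qG: "qof M P :. gact ?K M (ptriv P) X Y e = ptriv P X Y e :. (Ide B Y*:(qof M P*:Ide B X))"
    if a: "X \<in> Ob B" "Y \<in> Ob B" "e \<in> Hom B (X*.Y) \<one>" for X Y e
  proof -
    let ?X = "(X, triv X)" and ?Y = "(Y, triv Y)"
    note x = triv_module[OF a(1)] and y = triv_module[OF a(2)]
    have oo: "?X \<in> Ob HM" "?Y \<in> Ob HM" using x y by (simp_all add: Hmod_simps)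
    note e = triv_pairing[OF a]
  have "beq B [hh, ll, X, Y] [e, ev_left B hh]
    (ned $2 $1 $0 $3 $$0 $$1 ;; Br $1 $2##Id ($0**$3))
    (ned $1 $2 $3 $0 $$1 $$0 ;; Id ($1**$2)##Br $0 $3)"
    by (rule braid_diagram[of "[($2**$3, Ue), ($1**$0, Ue)]"
  "[]" _ _ "[NB 1 1 False True 3 (Ge 1) False, SL 0, SR 3, NB 1 0 True True 1 (Ge 0) True]"],
  code_simp, simp add: a hopf_hom, simp)
    then have eq: "nest B X ?s hh Y e (ev_left B hh) :. (Braid B ?s X*:Ide B (hh*.Y)) = nest B ?s X Y hh (ev_left B hh) e :. (Ide B (?s*.X)*:Braid B hh Y)"
      by (simp add: nest_def)
    have "P (?X *C (?s, ?l)) (?h *C ?Y) (nest HM ?X (?s, ?l) ?h ?Y e (ev_left B hh)) :C (Ide HM (?h *C ?Y) **C (Ide HM (M, r) **C Braid B ?s X))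
      = P ((?s, ?l) *C ?X) (?Y *C ?h) (nest HM (?s, ?l) ?X ?Y ?h (ev_left B hh) e) :C (Braid B hh Y **C (Ide HM (M, r) **C Ide HM ((?s, ?l) *C ?X)))"
    proof (rule C.pairing_action_eq[OF P])
      show "nest HM ?X (?s, ?l) ?h ?Y e (ev_left B hh) \<in> Hom HM ((?X *C (?s, ?l)) *C (?h *C ?Y)) oneC"
        by (rule C.nest_hom[OF oo o(2,1) e ev])
      show "nest HM (?s, ?l) ?X ?Y ?h (ev_left B hh) e \<in> Hom HM (((?s, ?l) *C ?X) *C (?Y *C ?h)) oneC"
        by (rule C.nest_hom[OF o(2,1) oo ev e])
      show "Braid B ?s X \<in> Hom HM ((?s, ?l) *C ?X) (?X *C (?s, ?l))" by (rule braid_triv_linear[OF a(1) hmodD(1,2)[OF lm]])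
      show "Braid B hh Y \<in> Hom HM (?h *C ?Y) (?Y *C ?h)" by (rule braid_triv_linear[OF a(2) V(2,3)])
      show "nest HM ?X (?s, ?l) ?h ?Y e (ev_left B hh) :C (Braid B ?s X **C Ide HM (?h *C ?Y))
        = nest HM (?s, ?l) ?X ?Y ?h (ev_left B hh) e :C (Ide HM ((?s, ?l) *C ?X) **C Braid B hh Y)"
        using eq by (simp add: nest_Hmod[OF x lm regular_module y] nest_Hmod[OF lm x y regular_module] Hmod_simps(3,4,8,9))
    qed (intro C.ten_ob C.ide_hom o oo)+
    then have n: "(?Q :. Ide B hh*:ptriv P X Y e*:Ide B ll :. Ide B hh*:AscInv B Y (M*.X) ll :. Ide B hh*:Ide B Y*:AscInv B M X ll :. Asc B hh Y (M*.(X*.ll))) :. Ide B (hh*.Y)*:Ide B M*:Braid B ll X = (ptriv P X Y e :. Ide B Y*:?Q*:Ide B X :. Ide B Y*:AscInv B hh (M*.ll) X :. Ide B Y*:Ide B hh*:AscInv B M ll X :. Asc B Y hh (M*.(ll*.X))) :. Braid B hh Y*:Ide B M*:Ide B (ll*.X)"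
      using C.pairing_actionD(5)[OF P oo o(2,1) e ev] C.pairing_actionD(5)[OF P o(2,1) oo ev e]
        Hmod_str_inv(4)[OF y tensor_module[OF m x] lm] Hmod_str_inv(4)[OF m x lm] Hmod_str_inv(4)[OF regular_module tensor_module[OF m lm] x] Hmod_str_inv(4)[OF m lm x]
      by (simp add: Hmod_simps ptriv_def)
  note hs = a pm(1) Q dual_swap_hom pairing_actionD(2)[OF G] hopf_hom
  have "beq B [hh, kk, ll, M, X, Y] [unt H, dual_swap, ?Q, ptriv P X Y e]
    (($$2 ;; $$0##Id ($3**$2) ;; Li ($3**$2) ;; Id $3##$$1 ;; Br $1 $3) ;; gad $1 $3 $4 $5 $$3)
    ($$3 ;; Id $5##($$2 ;; $$0##Id ($3**$2) ;; Li ($3**$2) ;; Id $3##$$1 ;; Br $1 $3)##Id $4)"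
    by (rule braid_diagram[of "[(Ue, $0), ($1, $2), ($0**$3**$2, $3), ($5**$3**$4, $3)]"
  "[(mud $3 $4 $5 $2 $0 $$3 $$2 ;; Id ($0**$5)##Id $3##Br $2 $4, mud $3 $2 $0 $4 $5 $$2 $$3 ;; Br $0 $5##Id $3##Id ($2**$4))]" _ _ "[SR 3, SR 2, SR 1, NB 2 1 True True 1 (Ge 3) False, SL 1, XX 0 0 False 5 1 True, SL 3, NB 2 3 False True 4 (Ge 1) True, SL 0, SL 1, SR 1, SR 0, RF 3 0 0, SL 0, SL 1, SR 1, SR 0, SR 2, SR 1, NB 0 0 False True 5 (Ge 0) False, SL 0, SL 1]"],
  code_simp, simp add: hs, simp only: diag_simps, (intro conjI TrueI n; simp add: hs))
    then show ?thesis by (simp add: gact_def qof jsec_def)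
  qed
  \<comment> \<open>\<open>pairing_action_regular\<close> on the unit pairing, where
    \<open>JC_triv\<close> yields the unit of the dual algebra.\<close>
  have u0: "?Q :. jsec M :. dual_unt B H*:Ide B M :. LunInv B M :. Lun B M :. Ide B \<one>*:Run B M = Lun B M :. Ide B \<one>*:Run B M"
    using pairing_action_regular[OF P triv_module[OF uni_ob] triv_module[OF uni_ob], where e = "Lun B \<one>"] C.pairing_actionD(4)[OF P] C.Lun_hom(1)[OF C.uni_ob]
      JC_triv[OF G uni_ob uni_ob Lun_hom(1)[OF uni_ob]] pairing_actionD(4)[OF G]
    by (simp add: Hmod_simps)
  note hs = pm(1) Q jsec_hom dual_unt_hom hopf_hom
  have "beq B [hh, kk, ll, M] [?Q, jsec M, dual_unt B H]
    (($$0 ;; $$1) ;; $$2##Id $3)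
    (Lu $3)"
    by (rule braid_diagram[of "[($0**$3**$2, $3), ($1**$3, $0**$3**$2), (Ue, $1)]"
  "[($$0 ;; $$1 ;; $$2##Id $3 ;; Li $3 ;; Lu $3 ;; Id Ue##Ru $3, Lu $3 ;; Id Ue##Ru $3)]" _ _ "[RF 0 0 0]"],
  code_simp, simp add: hs, simp only: diag_simps, (intro conjI TrueI u0; simp add: hs))
  then have q1: "qof M P :. (dual_unt B H*:Ide B M) = Lun B M" by (simp add: qof)
  have nh: "nest HM (?s, ?l) (?s, ?l) ?h ?h (ev_left B hh) (ev_left B hh) \<in> Hom HM (((?s, ?l) *C (?s, ?l)) *C (?h *C ?h)) oneC"
    by (rule C.nest_hom[OF o(2,1) o(2,1) ev ev])
  \<comment> \<open>The regular pairing nested in itself, computed once by multiplicativity and once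
    by \<open>pairing_action_regular\<close> with \<open>JC_mult\<close>. The sections
    \<open>j\<close> and \<open>j2\<close> afterwards remove both copies of
    \<open>JC\<close>.\<close>
  have m0: "?Q :. Ide B hh*:?Q*:Ide B ll :. Ide B hh*:AscInv B hh (M*.ll) ll :. Ide B hh*:Ide B hh*:AscInv B M ll ll :. Asc B hh hh (M*.(ll*.ll)) = ?Q :. jsec M :. dual_mul B H*:Ide B M :. AscInv B kk kk M :. ?JK :. Ide B hh*:?J*:Ide B ll :. Ide B hh*:AscInv B hh (M*.ll) ll :. Ide B hh*:Ide B hh*:AscInv B M ll ll :. Asc B hh hh (M*.(ll*.ll))"
    using C.pairing_actionD(5)[OF P o(2,1) o(2,1) ev ev] pairing_action_regular[OF P tensor_module[OF lm lm] tensor_module[OF regular_module regular_module]] nh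
      Hmod_str_inv(4)[OF regular_module tensor_module[OF m lm] lm] Hmod_str_inv(4)[OF m lm lm] JC_mult[OF G V V]
    by (simp add: Hmod_simps nest_Hmod[OF lm lm regular_module regular_module])
  have qh: "?Q :. jsec M \<in> Hom B (?K*.M) M" by (rule cmp_hom[OF _ _ _ jsec_hom[OF pm(1)] Q]) (simp_all add: pm hopf_hom)
  note jn = jsec_nat[OF ten_ob[OF K pm(1)] pm(1) qh]
  note hs = pm(1) Q jsec_hom J JK dual_mul_hom hopf_hom
  have "beq B [hh, kk, ll, M] [?Q, jsec M, dual_mul B H, jsec (?K*.M), ?J, ?JK]
    (($$0 ;; $$1) ;; $$2##Id $3)
    (($$0 ;; $$1) ;; Id $1##($$0 ;; $$1) ;; As $1 $1 $3)"
    by (rule braid_diagram[of "[($0**$3**$2, $3), ($1**$3, $0**$3**$2), ($1**$1, $1), ($1**$1**$3, $0**($1**$3)**$2), ($0**$3**$2, $1**$3), ($0**($1**$3)**$2, $1**$1**$3)]"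
  "[(mud $3 $2 $0 $2 $0 $$0 $$0, $$0 ;; $$1 ;; $$2##Id $3 ;; Ai $1 $1 $3 ;; mud $3 $2 $0 $2 $0 $$4 $$5), ($$4 ;; $$1, Id ($1**$3)), ($$5 ;; $$3, Id ($1**$1**$3)), ($$1 ;; Id $1##($$0 ;; $$1), Id $0##($$0 ;; $$1)##Id $2 ;; $$3)]" _ _ "[RB 0 0 2, RB 1 1 1, RB 2 0 0, RB 0 0 3]"],
  code_simp, simp add: hs, simp only: diag_simps, (intro conjI TrueI m0 j j2 jn; simp add: hs))
  then have q2: "qof M P :. (dual_mul B H*:Ide B M) = qof M P :. (Ide B ?K*:qof M P) :. Asc B ?K ?K M" by (simp add: qof)
  \<comment> \<open>This transports linearity of \<open>?Q\<close> through \<open>JC\<close>; since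
    \<open>jsec\<close> is a section of \<open>JC\<close>, it becomes the compatibility of
    \<open>r\<close> with \<open>qof M P\<close>.\<close>
  have c: "aact M (ptriv P) r :. (Ide B hh*:?J) = ?J :. ?T"
    by (rule JC_linear[OF G lm regular_module V(4) ev_left_linear[OF regular_module] m]) (rule rG)
  note hs = pm(1,2) Q T jsec_hom J aact_hom[OF G pm(2)] hopf_hom
  have "beq B [hh, kk, ll, M] [?Q, jsec M, ?J, ?T, r, aact M (ptriv P) r]
    ($$4 ;; Id $0##($$0 ;; $$1))
    (($$0 ;; $$1) ;; $$5)"
    by (rule braid_diagram[of "[($0**$3**$2, $3), ($1**$3, $0**$3**$2), ($0**$3**$2, $1**$3), ($0**$0**$3**$2, $0**$3**$2), ($0**$3, $3), ($0**$1**$3, $1**$3)]"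
  "[($$0 ;; $$3, $$4 ;; Id $0##$$0), ($$0, $$0 ;; $$1 ;; $$2), ($$5 ;; Id $0##$$2, $$2 ;; $$3), ($$2 ;; $$1, Id ($1**$3))]" _ _ "[RB 1 0 0, RF 2 0 1, RB 1 0 2, RF 0 1 3]"],
  code_simp, simp add: hs, simp only: diag_simps, (intro conjI TrueI l F c j; simp add: hs))
  then have q3: "r :. (Ide B hh*:qof M P) = qof M P :. aact M (ptriv P) r" by (simp add: qof)
  have t: "half_braiding B M ?t" by (rule half_braiding_acthalf[OF G])
  have p: "pairact B (M, ?t) X Y e = ptriv P X Y e" if "X \<in> Ob B" "Y \<in> Ob B" "e \<in> Hom B (X*.Y) \<one>" for X Y e
    by (rule pairact_acthalf[OF G that])
  have H: "f \<in> Hom (HH B) (HH_act B A (M, ?t)) (M, ?t)"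
    if A: "A \<in> Ob B" and f: "f \<in> Hom B (A*.M) M"
      and g: "\<And>X Y e. \<lbrakk>X \<in> Ob B; Y \<in> Ob B; e \<in> Hom B (X*.Y) \<one>\<rbrakk> \<Longrightarrow> f :. gact A M (ptriv P) X Y e = ptriv P X Y e :. (Ide B Y*:(f*:Ide B X))" for A f
    unfolding HH_act_half_braiding(3)[OF t A]
    using g by (intro HH_HomI[OF HH_act_half_braiding(1)[OF t A] t f]) (simp add: HH_act_half_braiding(2)[OF t A] gact_def p rdual_ob rev_hom)
  have "aact M (pairact B (M, ?t)) r = aact M (ptriv P) r" by (simp add: aact_def ebr_def gact_def p hopf_hom)
  then show ?thesis unfolding ayd_def
    using t m q1 q2 q3 H[OF carr_ob pm(2) rG] H[OF K _ qG] qh by (simp add: qof)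
qed

section \<open>The mutually inverse functors and the comparison of twists\<close>

definition Fo :: "('o \<times> ('o \<Rightarrow> 'a)) \<times> 'a \<times> 'a \<Rightarrow> ('o \<times> 'a) \<times> ('o \<times> 'a \<Rightarrow> 'a)" where
  "Fo = (\<lambda>((M, t), r, q). ((M, r), acthalf HM (M, r) (GC M (pairact B (M, t)) q)))"

definition Go :: "('o \<times> 'a) \<times> ('o \<times> 'a \<Rightarrow> 'a) \<Rightarrow> ('o \<times> ('o \<Rightarrow> 'a)) \<times> 'a \<times> 'a" where
  "Go = (\<lambda>((M, r), T). ((M, acthalf B M (ptriv (pairact HM ((M, r), T)))), r, qof M (pairact HM ((M, r), T))))"

lemma acthalf_cong: "(\<And>X. X \<in> Ob D \<Longrightarrow> G X (rdual D X) (ev_right D X) = G' X (rdual D X) (ev_right D X)) \<Longrightarrow> acthalf D M G = acthalf D M G'"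
  by (auto simp: acthalf_def)

text \<open>On trivial modules \<open>JC_triv\<close> and the unit law of \<open>q\<close> return
  the original action; on the regular module \<open>JC_jsec\<close> returns
  \<open>q\<close>.\<close>

lemma Fo_facts:
  assumes a: "ayd M t r q"
  shows "Fo ((M, t), r, q) = ((M, r), acthalf HM (M, r) (GC M (pairact B (M, t)) q))"
    "half_braiding HM (M, r) (acthalf HM (M, r) (GC M (pairact B (M, t)) q))"
    "\<lbrakk>X \<in> Ob HM; Y \<in> Ob HM; e \<in> Hom HM (X *C Y) oneC\<rbrakk>
      \<Longrightarrow> pairact HM (Fo ((M, t), r, q)) X Y e = GC M (pairact B (M, t)) q X Y e"
    "\<lbrakk>V \<in> Ob B; W \<in> Ob B; e \<in> Hom B (V*.W) \<one>\<rbrakk> \<Longrightarrow> ptriv (pairact HM (Fo ((M, t), r, q))) V W e = pairact B (M, t) V W e"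
    "qof M (pairact HM (Fo ((M, t), r, q))) = q"
proof -
  interpret C: rigid_monoidal_category "HM" by (rule rigid_monoidal_category_Hmod)
  note d = aydD[OF a]
  note G = pairing_action_pairact[OF d(1)] and P = pairing_action_GC[OF a]
  let ?h = "(hh, mul H)"
  show 1: "Fo ((M, t), r, q) = ((M, r), acthalf HM (M, r) (GC M (pairact B (M, t)) q))" by (simp add: Fo_def)
  show "half_braiding HM (M, r) (acthalf HM (M, r) (GC M (pairact B (M, t)) q))" by (rule C.half_braiding_acthalf[OF P])
  show p: "pairact HM (Fo ((M, t), r, q)) X Y e = GC M (pairact B (M, t)) q X Y e"
    if "X \<in> Ob HM" "Y \<in> Ob HM" "e \<in> Hom HM (X *C Y) oneC" for X Y e
    unfolding 1 by (rule C.pairact_acthalf[OF P that])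
  show "ptriv (pairact HM (Fo ((M, t), r, q))) X Y e = pairact B (M, t) X Y e"
    if a: "X \<in> Ob B" "Y \<in> Ob B" "e \<in> Hom B (X*.Y) \<one>" for X Y e
  proof -
  note hs = a d(3,5) dual_unt_hom pairing_actionD(2)[OF G] hopf_hom
    have "beq B [kk, M, X, Y] [q, dual_unt B H, pairact B (M, t) X Y e]
      ($$0 ;; $$1##Id $1 ;; Li $1 ;; $$2)
      ($$2)"
      by (rule braid_diagram[of "[($0**$1, $1), (Ue, $0), ($3**$1**$2, $1)]"
  "[($$0 ;; $$1##Id $1, Lu $1)]" _ _ "[RF 1 0 0]"],
  code_simp, simp add: hs, simp only: diag_simps, (intro conjI TrueI d(9); simp add: hs))
    then show ?thesis using p[OF _ _ triv_pairing[OF a]] triv_module a by (simp add: ptriv_def GC_def Hmod_simps(1) JC_triv[OF G a])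
  qed
  have o: "?h \<in> Ob HM" using regular_module by (simp add: Hmod_simps)
  have V: "ll \<in> Ob B" "hh \<in> Ob B" "mul H \<in> Hom B (hh*.hh) hh" "ev_left B hh \<in> Hom B (ll*.hh) \<one>" by (simp_all add: hopf_hom)
  have "(q :. JC M (pairact B (M, t)) ll hh (mul H) (ev_left B hh)) :. jsec M
    = q :. (JC M (pairact B (M, t)) ll hh (mul H) (ev_left B hh) :. jsec M)"
    by (rule cmp_assoc[OF _ _ _ d(3) jsec_hom[OF d(3)] JC_hom[OF G V] d(5)]) (simp_all add: d hopf_hom)
  then show "qof M (pairact HM (Fo ((M, t), r, q))) = q"
    using p[OF C.ldual_ob[OF o] o C.lev_hom[OF o]] d(3,5) by (simp add: qof_def Hmod_simps GC_def JC_jsec[OF G] ide_right[of "kk*.M" M] hopf_hom)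
qed

lemma Go_Fo: "ayd M t r q \<Longrightarrow> Go (Fo ((M, t), r, q)) = ((M, t), r, q)"
proof -
  assume a: "ayd M t r q"
  note f = Fo_facts[OF a]
  have "acthalf B M (ptriv (pairact HM (Fo ((M, t), r, q)))) = acthalf B M (pairact B (M, t))"
    by (rule acthalf_cong) (simp add: f(4) rdual_ob rev_hom)
  then have "acthalf B M (ptriv (pairact HM (Fo ((M, t), r, q)))) = t" by (simp add: acthalf_pairact[OF aydD(1)[OF a]])
  then show ?thesis using f(5) by (simp add: Go_def f(1))
qed

text \<open>\<open>pairing_action_regular\<close> says precisely that the action rebuilt from its
  restriction to trivial modules and from \<open>qof\<close> is the given one.\<close>

lemma Go_facts:
  assumes T: "half_braiding HM (M, r) T"
  shows "\<exists>t q. Go ((M, r), T) = ((M, t), r, q) \<and> ayd M t r q" "Fo (Go ((M, r), T)) = ((M, r), T)"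
proof -
  interpret C: rigid_monoidal_category "HM" by (rule rigid_monoidal_category_Hmod)
  let ?P = "pairact HM ((M, r), T)"
  note P = C.pairing_action_pairact[OF T]
  note G = pairing_action_ptriv[OF P] and a = ayd_ptriv[OF P]
  show "\<exists>t q. Go ((M, r), T) = ((M, t), r, q) \<and> ayd M t r q" using a by (auto simp: Go_def)
  let ?h = "(hh, mul H)"
  have o: "?h \<in> Ob HM" using regular_module by (simp add: Hmod_simps)
  note M = pairing_actionD(1)[OF G]
  have Q: "?P (ldual HM ?h) ?h (ev_left B hh) \<in> Hom B (hh*.(M*.ll)) M"
    using C.pairing_actionD(2)[OF P C.ldual_ob[OF o] o] C.lev_hom[OF o] by (simp add: Hmod_simps)
  have "acthalf HM (M, r) (GC M (pairact B (M, acthalf B M (ptriv ?P))) (qof M ?P)) = acthalf HM (M, r) ?P"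
  proof (rule acthalf_cong)
    fix X assume X: "X \<in> Ob HM"
    obtain V v where [simp]: "X = (V, v)" by (cases X)
    obtain W w where [simp]: "rdual HM (V, v) = (W, w)" by (cases "rdual HM (V, v)")
    have m: "is_hopf_module B H V v" "is_hopf_module B H W w" using X C.rdual_ob[OF X] by (simp_all add: Hmod_simps(1))
    let ?e = "ev_right HM (V, v)"
    have e: "?e \<in> Hom HM ((V, v) *C (W, w)) oneC" using C.rev_hom[OF X] by simp
    note V = hmodD(1)[OF m(1)] hmodD(1,2)[OF m(2)]
    have eB: "?e \<in> Hom B (V*.W) \<one>" using e by (simp add: Hmod_simps)
    have "JC M (pairact B (M, acthalf B M (ptriv ?P))) V W w ?e = JC M (ptriv ?P) V W w ?e"
      by (simp add: JC_def pairact_acthalf[OF G] erho_hom V eB hopf_hom)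
    moreover have "(?P (ldual HM ?h) ?h (ev_left B hh) :. jsec M) :. JC M (ptriv ?P) V W w ?e
      = ?P (ldual HM ?h) ?h (ev_left B hh) :. (jsec M :. JC M (ptriv ?P) V W w ?e)"
      by (rule cmp_assoc[OF _ _ _ M JC_hom[OF G V eB] jsec_hom[OF M] Q]) (simp_all add: V M hopf_hom)
    ultimately show "GC M (pairact B (M, acthalf B M (ptriv ?P))) (qof M ?P) X (rdual HM X) (ev_right HM X) = ?P X (rdual HM X) (ev_right HM X)"
      by (simp add: GC_def qof_def pairing_action_regular[OF P m e])
  qed
  then show "Fo (Go ((M, r), T)) = ((M, r), T)" by (simp add: Go_def Fo_def C.acthalf_pairact[OF T])
qed

text \<open>Both hom-sets consist of arrows of \<open>B\<close>. Forwards, \<open>f\<close> passes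
  \<open>JC\<close> by \<open>JC_mor\<close> and then \<open>q\<close>. Backwards, trivial modules
  show that \<open>f\<close> is a morphism of \<open>HH B\<close>, and the regular module gives
  compatibility with \<open>q\<close>, as \<open>jsec\<close> is natural.\<close>

lemma Fo_Hom:
  assumes a: "ayd M t r q" and a': "ayd M' t' r' q'"
  shows "Hom (aYD MM B H) ((M, t), r, q) ((M', t'), r', q') = Hom (HH HM) (Fo ((M, t), r, q)) (Fo ((M', t'), r', q'))"
proof (intro set_eqI iffI)
  interpret C: rigid_monoidal_category "HM" by (rule rigid_monoidal_category_Hmod)
  note d = aydD[OF a] and d' = aydD[OF a'] and F = Fo_facts[OF a] and F' = Fo_facts[OF a'] and K = rdual_ob[OF carr_ob]
  note G = pairing_action_pairact[OF d(1)] and G' = pairing_action_pairact[OF d'(1)]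
  fix f
  {
    assume "f \<in> Hom (aYD MM B H) ((M, t), r, q) ((M', t'), r', q')"
    then have f: "f \<in> Hom (HH B) (M, t) (M', t')" "f \<in> Hom B M M'" "f :. r = r' :. (Ide B hh*:f)" "f :. q = q' :. (Ide B kk*:f)"
      using HH_HomD by (auto simp: aYD_simps)
    have fC: "f \<in> Hom HM (M, r) (M', r')" using f by (simp add: Hmod_simps)
    show "f \<in> Hom (HH HM) (Fo ((M, t), r, q)) (Fo ((M', t'), r', q'))"
      unfolding F(1) F'(1)
    proof (rule C.HH_HomI[OF F(2) F'(2) fC])
      fix X assume X: "X \<in> Ob HM"
      obtain V v where [simp]: "X = (V, v)" by (cases X)
    obtain W w where [simp]: "rdual HM (V, v) = (W, w)" by (cases "rdual HM (V, v)")
      have m: "is_hopf_module B H V v" "is_hopf_module B H W w" using X C.rdual_ob[OF X] by (simp_all add: Hmod_simps(1))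
      let ?e = "ev_right HM (V, v)"
      have "?e \<in> Hom HM ((V, v) *C (W, w)) oneC" using C.rev_hom[OF X] by simp
      then have "?e \<in> Hom B (V*.W) \<one>" by (simp add: Hmod_simps)
      note V = hmodD(1)[OF m(1)] hmodD(1,2)[OF m(2)] this
      let ?J = "JC M (pairact B (M, t)) V W w ?e" and ?J' = "JC M' (pairact B (M', t')) V W w ?e"
      note j = JC_hom[OF G V] and j' = JC_hom[OF G' V]
      have o: "W*.(M*.V) \<in> Ob B" "W*.(M'*.V) \<in> Ob B" "kk*.M \<in> Ob B" "kk*.M' \<in> Ob B" using V d d' by (simp_all add: hopf_hom)
      have "f :. (q :. ?J) = (f :. q) :. ?J" by (rule cmp_assoc[OF o(1,3) d(3) d'(3) j d(5) f(2), symmetric])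
      also have "\<dots> = q' :. ((Ide B kk*:f) :. ?J)"
        unfolding f(4) by (rule cmp_assoc[OF o(1,3,4) d'(3) j tar_hom_ide(2)[OF d(3) d'(3) K f(2)] d'(5)])
      also have "(Ide B kk*:f) :. ?J = ?J' :. (Ide B W*:(f*:Ide B V))"
        by (rule JC_mor[OF G G' f(2) V], rule HH_Hom_pairact[OF d(1) d'(1) f(1)]) (simp_all add: V erho_hom hopf_hom)
      also have "q' :. (?J' :. (Ide B W*:(f*:Ide B V))) = (q' :. ?J') :. (Ide B W*:(f*:Ide B V))"
        by (rule cmp_assoc[OF o(1,2,4) d'(3) _ j' d'(5), symmetric]) (use V d d' f in \<open>simp add: tar_hom_ide hopf_hom\<close>)
      finally show "f :C pairact HM ((M, r), acthalf HM (M, r) (GC M (pairact B (M, t)) q)) X (rdual HM X) (ev_right HM X)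
        = pairact HM ((M', r'), acthalf HM (M', r') (GC M' (pairact B (M', t')) q')) X (rdual HM X) (ev_right HM X)
          :C (Ide HM (rdual HM X) **C (f **C Ide HM X))"
        using F(3)[OF X C.rdual_ob[OF X] C.rev_hom[OF X]] F'(3)[OF X C.rdual_ob[OF X] C.rev_hom[OF X]]
        by (simp add: F(1) F'(1) GC_def Hmod_simps(3,4,9))
    qed
  next
    assume f: "f \<in> Hom (HH HM) (Fo ((M, t), r, q)) (Fo ((M', t'), r', q'))"
    note n = C.HH_Hom_pairact[OF F(2) F'(2) f[unfolded F(1) F'(1)], folded F(1) F'(1)]
    have fC: "f \<in> Hom B M M'" "f :. r = r' :. (Ide B hh*:f)" using f by (simp_all add: F(1) F'(1) C.HH_simps Hmod_simps)
    have 1: "f \<in> Hom (HH B) (M, t) (M', t')"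
    proof (rule HH_HomI[OF d(1) d'(1) fC(1)])
      fix X assume X: "X \<in> Ob B"
      note x = X rdual_ob[OF X] rev_hom[OF X]
      show "f :. pairact B (M, t) X (rdual B X) (ev_right B X) = pairact B (M', t') X (rdual B X) (ev_right B X) :. (Ide B (rdual B X)*:(f*:Ide B X))"
        using n[OF _ _ triv_pairing[OF x]] triv_module x by (simp add: F(4)[OF x, symmetric] F'(4)[OF x, symmetric] ptriv_def Hmod_simps(1,3,4,9))
    qed
    let ?h = "(hh, mul H)" and ?s = "ll"
    have o: "?h \<in> Ob HM" using regular_module by (simp add: Hmod_simps)
    define Q where "Q = pairact HM (Fo ((M, t), r, q)) (ldual HM ?h) ?h (ev_left B hh)"
    define Q' where "Q' = pairact HM (Fo ((M', t'), r', q')) (ldual HM ?h) ?h (ev_left B hh)"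
    have n: "f :. Q = Q' :. (Ide B hh*:(f*:Ide B ?s))"
      using n[OF C.ldual_ob[OF o] o C.lev_hom[OF o]] by (simp add: Q_def Q'_def Hmod_simps)
    have Q: "Q \<in> Hom B (hh*.(M*.?s)) M" "Q' \<in> Hom B (hh*.(M'*.?s)) M'"
      using C.pairing_actionD(2)[OF C.pairing_action_pairact[OF F(2)] C.ldual_ob[OF o] o C.lev_hom[OF o]]
        C.pairing_actionD(2)[OF C.pairing_action_pairact[OF F'(2)] C.ldual_ob[OF o] o C.lev_hom[OF o]] by (simp_all add: Q_def Q'_def F(1) F'(1) Hmod_simps)
    have q: "q = Q :. jsec M" "q' = Q' :. jsec M'" using F(5) F'(5) by (simp_all add: qof_def Q_def Q'_def)
    have s: "hh*.(M*.?s) \<in> Ob B" "hh*.(M'*.?s) \<in> Ob B" "kk*.M \<in> Ob B" "kk*.M' \<in> Ob B" using d d' by (simp_all add: hopf_hom)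
    have fs: "Ide B hh*:(f*:Ide B ?s) \<in> Hom B (hh*.(M*.?s)) (hh*.(M'*.?s))" using d d' fC by (simp add: tar_hom_ide hopf_hom)
    have "f :. q = (f :. Q) :. jsec M" unfolding q by (rule cmp_assoc[OF s(3,1) d(3) d'(3) jsec_hom[OF d(3)] Q(1) fC(1), symmetric])
    also have "\<dots> = Q' :. ((Ide B hh*:(f*:Ide B ?s)) :. jsec M)" unfolding n by (rule cmp_assoc[OF s(3,1,2) d'(3) jsec_hom[OF d(3)] fs Q(2)])
    also have "\<dots> = Q' :. (jsec M' :. (Ide B kk*:f))" by (simp add: jsec_nat[OF d(3) d'(3) fC(1)])
    also have "\<dots> = q' :. (Ide B kk*:f)"
      unfolding q by (rule cmp_assoc[OF s(3,4,2) d'(3) tar_hom_ide(2)[OF d(3) d'(3) K fC(1)] jsec_hom[OF d'(3)] Q(2), symmetric])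
    finally show "f \<in> Hom (aYD MM B H) ((M, t), r, q) ((M', t'), r', q')" using 1 fC(2) by (simp add: aYD_simps)
  }
qed

text \<open>The twist over modules is \<open>q\<close> after \<open>JC\<close> of
  \<open>ev_left M\<close>, closed by \<open>coev_left M\<close>. Moving \<open>h\<close> from the
  pairing through this coevaluation makes it act on \<open>M\<close>, and \<open>r\<close> then
  leaves \<open>G\<close>; this is the factor \<open>r\<close> of \<open>aYD_twist\<close>, next to
  the twist of \<open>HH B\<close>.\<close>

lemma Fo_twist:
  assumes a: "ayd M t r q"
  shows "HH_twist HM (Fo ((M, t), r, q)) = aYD_twist MM B H ((M, t), r, q)"
proof -
  interpret C: rigid_monoidal_category "HM" by (rule rigid_monoidal_category_Hmod)
  note d = aydD[OF a] and F = Fo_facts[OF a]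
  note G = pairing_action_pairact[OF d(1)]
  let ?G = "pairact B (M, t)"
  have o: "(M, r) \<in> Ob HM" using d(2) by (simp add: Hmod_simps)
  note V = ldual_ob[OF d(3)] d(3,4) lev_hom[OF d(3)]
  note e = erho_hom[OF V]
  have Vh: "ldual B M*.hh \<in> Ob B" by (simp add: V hopf_hom)
  \<comment> \<open>\<open>dd\<close> sends a functional \<open>f\<close> and \<open>h\<close> to
    the functional \<open>m |-> f(h m)\<close>.\<close>
  obtain dd where k: "dd \<in> Hom B (ldual B M*.hh) (ldual B M)"
      "ev_left B M :. (dd*:Ide B M) = erho (ldual B M) M r (ev_left B M)"
    using ev_left_factor(1,2)[OF Vh d(3) e] by blast
  have n: "?G (ldual B M*.hh) M (erho (ldual B M) M r (ev_left B M)) = ?G (ldual B M) M (ev_left B M) :. Ide B M*:Ide B M*:dd"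
    using pairing_actionD(3)[OF G V(1,2) Vh d(3) V(4) k(1) ide_hom[OF d(3)]] by (simp add: k(2))
  have "beq B [hh, M, ldual B M] [r, ev_left B M, coev_left B M, dd]
    (Id $1##$$3 ;; As $1 $2 $0 ;; $$2##Id $0 ;; Li $0)
    ($$0##Id $2 ;; Ai $0 $1 $2 ;; Id $0##$$2 ;; Ri $0)"
    by (rule braid_diagram[of "[($0**$1, $1), ($2**$1, Ue), (Ue, $1**$2), ($2**$0, $2)]"
  "[zr $1 $2 $$1 $$2, zl $2 $1 $$1 $$2, ($$1 ;; $$3##Id $1, $$1 ;; Id $2##$$0 ;; As $2 $0 $1)]" _ _ "[RB 2 1 1, SL 1, RF 2 1 2, SL 0, SL 1, RF 2 0 0]"],
  code_simp, simp add: d(3,4) e k(1) hopf_hom, simp only: diag_simps, (intro conjI TrueI k(2)[unfolded erho_def] zigzags; simp add: d(3,4) e k(1) hopf_hom))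
  then have rd: "Ide B M*:dd :. Asc B M (ldual B M) hh :. coev_left B M*:Ide B hh :. LunInv B hh = r*:Ide B (ldual B M) :. AscInv B hh M (ldual B M) :. Ide B hh*:coev_left B M :. RunInv B hh" by simp
  \<comment> \<open>\<open>r\<close> is a morphism of \<open>HH B\<close>, so it commutes with the
    action of \<open>ev_left M\<close>.\<close>
  note rm = d(6)[OF V(1,2,4), unfolded gact_def]
  note hs = d(3,4) e k(1) erho_hom pairing_actionD(2)[OF G] hopf_hom
  have "beq B [hh, kk, M, ldual B M] [r, coev_right B hh, coev_left B M, dd, ?G (ldual B M) M (ev_left B M), ?G (ldual B M*.hh) M (erho (ldual B M) M r (ev_left B M))]
    (jcd $2 $3 $2 $0 $1 $$5 $$1 ;; Id $2##$$2 ;; Ri $2)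
    (Id $1##$$0 ;; (As $1 $0 $2 ;; $$1##Id $2 ;; Li $2) ;; $$4 ;; Id $2##$$2 ;; Ri $2)"
    by (rule braid_diagram[of "[($0**$2, $2), (Ue, $1**$0), (Ue, $2**$3), ($3**$0, $3), ($2**$2**$3, $2), ($2**$2**$3**$0, $2)]"
  "[($$5, $$4 ;; Id $2##Id $2##$$3), (Id $2##$$3 ;; As $2 $3 $0 ;; $$2##Id $0 ;; Li $0, $$0##Id $3 ;; Ai $0 $2 $3 ;; Id $0##$$2 ;; Ri $0), ($$0 ;; gad $0 $2 $3 $2 $$4, $$4 ;; Id $2##$$0##Id $3)]" _ _ "[RF 3 0 0, SL 0, SL 1, RF 2 1 1, RB 3 0 2, RF 3 0 2, RB 2 1 1, SR 1, SR 0, RB 3 0 0, NB 3 0 False False 1 (Ge 5) False, SL 0, SL 1, SL 2, NB 3 1 False False 1 (Ge 2) False, SR 3, XX 1 1 True 1 0 True, RF 3 1 0, RF 2 2 1, SL 1, SL 0, RB 3 1 2, SR 0, SR 1, SR 2, NB 0 0 True False 2 (Ge 1) False, SL 0, SL 1]"],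
  code_simp, simp add: hs, simp only: diag_simps, (intro conjI TrueI n rd rm; simp add: hs))
  then have tw: "JC M ?G (ldual B M) M r (ev_left B M) :. Ide B M*:coev_left B M :. RunInv B M = (Ide B kk*:r) :. (Asc B kk hh M :. (coev_right B hh*:Ide B M) :. LunInv B M) :. HH_twist B (M, t)"
    by (simp add: JC_def HH_twist_acttwist[OF d(1)] acttwist_def)
  have co: "(Ide B M*:coev_left B M) :. RunInv B M \<in> Hom B M (M*.(M*.ldual B M))"
    using is_isoD[OF run_iso[OF d(3)] ten_ob[OF d(3) uni_ob] d(3)] d(3)
    by (intro cmp_hom[of _ "M*.\<one>"]) (simp_all add: RunInv_def tar_hom_ide hopf_hom)
  have "HH_twist HM (Fo ((M, t), r, q)) = (q :. JC M ?G (ldual B M) M r (ev_left B M)) :. ((Ide B M*:coev_left B M) :. RunInv B M)"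
    using C.HH_twist_acttwist[OF F(2)] F(3)[OF C.ldual_ob[OF o] o C.lev_hom[OF o]] Hmod_unit_inv(4)[OF d(2)]
    by (simp add: C.acttwist_def F(1) GC_def Hmod_simps)
  also have "\<dots> = q :. (JC M ?G (ldual B M) M r (ev_left B M) :. ((Ide B M*:coev_left B M) :. RunInv B M))"
    by (rule cmp_assoc[OF _ _ _ d(3) co JC_hom[OF G V] d(5)]) (use d in \<open>simp_all add: hopf_hom\<close>)
  also have "\<dots> = aYD_twist MM B H ((M, t), r, q)"
    by (simp add: tw aYD_twist_def act_coev_def HH_module_simps HH_module_inverses[OF d(1)])
  finally show ?thesis .
qed

end

text \<open>With a bijection on objects, equal hom-sets and equal operations, the axioms for
  \<open>C\<close> are pulled back from \<open>D\<close>, and so are invertibility and naturality of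
  an automorphism of the identity.\<close>

lemma category_isomorphism_transport:
  assumes D: "linear_category D" and ob: "\<And>X. X \<in> Ob C \<Longrightarrow> F X \<in> Ob D" "\<And>U. U \<in> Ob D \<Longrightarrow> G U \<in> Ob C"
    and GF: "\<And>X. X \<in> Ob C \<Longrightarrow> G (F X) = X" and FG: "\<And>U. U \<in> Ob D \<Longrightarrow> F (G U) = U"
    and hom: "\<And>X Y. \<lbrakk>X \<in> Ob C; Y \<in> Ob C\<rbrakk> \<Longrightarrow> Hom C X Y = Hom D (F X) (F Y)"
    and eqs: "\<And>X. X \<in> Ob C \<Longrightarrow> Ide C X = Ide D (F X)" "\<And>X Y. \<lbrakk>X \<in> Ob C; Y \<in> Ob C\<rbrakk> \<Longrightarrow> Zer C X Y = Zer D (F X) (F Y)"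
      "Cmp C = Cmp D" "Add C = Add D" "Smul C = Smul D"
  shows "category_isomorphism C D F (\<lambda>X Y f. f)"
    "\<lbrakk>identity_automorphism D s; \<And>X. X \<in> Ob C \<Longrightarrow> s' X = s (F X)\<rbrakk> \<Longrightarrow> identity_automorphism C s'"
proof -
  interpret D: linear_category D by (rule D)
  have C: "linear_category C"
  proof (rule linear_category_over[where V = F, OF D])
    show "g \<cdot>\<^bsub>D\<^esub> f \<in> Hom C X Z" if "X \<in> Ob C" "Y \<in> Ob C" "Z \<in> Ob C" "f \<in> Hom C X Y" "g \<in> Hom C Y Z" for X Y Z f g
      using that D.cmp_hom[of "F X" "F Y" "F Z" f g] by (simp add: hom ob)
  qed (simp_all add: hom eqs ob D.ide_hom D.zer_hom D.add_hom D.smul_hom)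
  have "linear_functor C D F (\<lambda>X Y f. f)" by (simp add: linear_functor_def hom eqs ob)
  moreover have "linear_functor D C G (\<lambda>X Y f. f)" by (simp add: linear_functor_def hom eqs ob FG)
  ultimately show "category_isomorphism C D F (\<lambda>X Y f. f)" using C D GF FG unfolding category_isomorphism_def by blast
  have i: "is_iso C X X f \<longleftrightarrow> is_iso D (F X) (F X) f" if "X \<in> Ob C" for X f
    using that by (simp add: is_iso_def inverse_pair_def hom eqs)
  show "identity_automorphism C s'" if "identity_automorphism D s" "\<And>X. X \<in> Ob C \<Longrightarrow> s' X = s (F X)"
    using that i ob by (simp add: identity_automorphism_def hom eqs)
qed

theorem theorem1p2:
  fixes B :: "('o, 'a, 'k::{alg_closed_field, field_char_0}) braided"
    and H :: "('o, 'a) hopf"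
  assumes "rigid_braided_category B"
    and "hopf_algebra B H"
  shows "rigid_monoidal_category (Hmod B H) \<and>
    stable_braided_module_category (HH_module B) B \<and>
    identity_automorphism (aYD (HH_module B) B H) (aYD_twist (HH_module B) B H) \<and>
    identity_automorphism (HH (Hmod B H)) (HH_twist (Hmod B H)) \<and>
    (\<exists>Fo Fa.
      category_isomorphism (aYD (HH_module B) B H) (HH (Hmod B H)) Fo Fa \<and>
      (\<forall>M \<in> Ob (aYD (HH_module B) B H).
        Fa M M (aYD_twist (HH_module B) B H M) = HH_twist (Hmod B H) (Fo M)))"
proof -
  interpret hopf_algebra B H by (rule assms(2))
  interpret C: rigid_monoidal_category "Hmod B H" by (rule rigid_monoidal_category_Hmod)
  let ?A = "aYD (HH_module B) B H" and ?D = "HH (Hmod B H)"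
  have split: "\<exists>M t r q. Z = ((M, t), r, q) \<and> ayd M t r q" if "Z \<in> Ob ?A" for Z
    using that aYD_simps(1) by (cases Z) auto
  have 1: "Fo Z \<in> Ob ?D" "Go (Fo Z) = Z" "Ide ?A Z = Ide ?D (Fo Z)" "HH_twist (Hmod B H) (Fo Z) = aYD_twist (HH_module B) B H Z" if "Z \<in> Ob ?A" for Z
  proof -
    obtain M t r q where Z: "Z = ((M, t), r, q)" "ayd M t r q" using split[OF \<open>Z \<in> Ob ?A\<close>] by blast
    note a = Z(2)
    show "Fo Z \<in> Ob ?D" "Ide ?A Z = Ide ?D (Fo Z)" using Fo_facts(1,2)[OF a] by (simp_all add: Z(1) C.HH_simps aYD_simps Hmod_simps)
    show "Go (Fo Z) = Z" "HH_twist (Hmod B H) (Fo Z) = aYD_twist (HH_module B) B H Z" unfolding Z(1) by (rule Go_Fo[OF a], rule Fo_twist[OF a])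
  qed
  have 2: "Hom ?A Z Z' = Hom ?D (Fo Z) (Fo Z')" "Zer ?A Z Z' = Zer ?D (Fo Z) (Fo Z')" if Z: "Z \<in> Ob ?A" "Z' \<in> Ob ?A" for Z Z'
    using split[OF Z(1)] split[OF Z(2)] by (auto simp: Fo_Hom, auto simp: Fo_facts(1) C.HH_simps aYD_simps Hmod_simps)
  have 3: "Go U \<in> Ob ?A \<and> Fo (Go U) = U" if U: "U \<in> Ob ?D" for U
  proof -
    obtain M r T where [simp]: "U = ((M, r), T)" by (metis surj_pair)
    have "half_braiding (Hmod B H) (M, r) T" using U by (simp add: C.HH_simps)
    from Go_facts[OF this] show ?thesis by (auto simp: aYD_simps)
  qed
  have 4: "Cmp ?A = Cmp ?D" "Add ?A = Add ?D" "Smul ?A = Smul ?D" by (simp_all add: aYD_simps C.HH_simps Hmod_simps)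
  \<comment> \<open>By \<open>Fo_Hom\<close> the hom-sets coincide, so arrows are sent to themselves
    and the twists correspond literally.\<close>
  have "category_isomorphism ?A ?D Fo (\<lambda>X Y f. f)"
    by (rule category_isomorphism_transport(1)[where G = Go, OF C.linear_category_HH]) (simp_all add: 1 2 3 4)
  moreover have "identity_automorphism ?A (aYD_twist (HH_module B) B H)"
    by (rule category_isomorphism_transport(2)[where F = Fo and G = Go, OF C.linear_category_HH _ _ _ _ _ _ _ _ _ _ C.identity_automorphism_HH_twist])
      (simp_all add: 1 2 3 4)
  ultimately show ?thesis
    using rigid_monoidal_category_Hmod stable_braided_HH_module C.identity_automorphism_HH_twist 1(4)
    by (intro conjI exI[of _ Fo] exI[of _ "\<lambda>X Y f. f"]) simp_all
qed

end
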